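(* Let $d\ge 2$, $N>0$, $R^*>0$ and $R_*>1$ with $R_*>R^*$, and let $f_0$ be a measurable function on $\mathbb{R}^d$ with $f_0\ge 0$, $R^*<\|f_0\|_{L^1_{N+3}}<R_*$ and $\|f_0\|_{L^1}\ge R^*/2$ (that is, $f_0\in\mathcal S_0\cap B_*(O,R_* )\setminus\overline{B_*(O,R^* )}$, where $B_*(O,r)$ is the ball of radius $r$ centered at the origin $O$ of $L^1_{N+3}(\mathbb{R}^d)$). Then there are a constant $C_0(\lambda_1,\lambda_2)>0$ and, for the given initial datum $f_0$ (satisfying $f_0\ge 0$, $R^*<\|f_0\|_{L^1_{N+3}}<R_*$ and $\|f_0\|_{L^1}\ge R^*/2$), a radius $R_0>0$ with $\|f_0\chi_{R_0}\|_{L^1}>0$, such that for every $T>0$ the following holds, with $\mathcal S_T$ the set defined in the context. The equation $$\partial_t f(t,k)+2\nu|k|^2 f(t,k)=Q[f](t,k),\qquad f(0,k)=f_0(k),$$ has a unique strong solution $f$ such that $$0\le f(t,k)\in C\big([0,T);L^1_N(\mathbb{R}^d)\big)\cap C^1\big((0,T);L^1_N(\mathbb{R}^d)\big).$$ Moreover $f(t,\cdot)\in\mathcal S_T$ for all $t\in[0,T)$. Since $T$ can be chosen arbitrarily large, the equation has a unique global solution for all time $t>0$.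
   Context: Fixed parameters: dimension $d\ge2$, $\nu>0$ (viscosity), $\lambda_1\ge0$, $\lambda_2>0$, and a constant $\mathfrak C>0$. Dispersion relation: $\omega_k=\sqrt{\lambda_1+\lambda_2|k|^2}$, $k\in\mathbb{R}^d$. Spaces: $L^1_n(\mathbb{R}^d)=\{g\in L^1(\mathbb{R}^d):\|g\|_{L^1_n}:=\int_{\mathbb{R}^d}\omega_k^n|g(k)|\,dk<\infty\}$. Collision operator: writing $f=f(t,k)$, $f_j=f(t,k_j)$, $$Q[f](k)=\iint_{\mathbb{R}^{2d}}\big[R_{k,k_1,k_2}[f]-R_{k_1,k,k_2}[f]-R_{k_2,k,k_1}[f]\big]dk_1dk_2,$$ $$R_{k,k_1,k_2}[f]=|V_{k,k_1,k_2}|^2\,\delta(k-k_1-k_2)\,\mathcal L_f(\omega_k-\omega_{k_1}-\omega_{k_2})\,(f_1f_2-ff_1-ff_2),$$ where $R_{k_1,k,k_2}$ and $R_{k_2,k,k_1}$ are obtained by permuting the roles of the wave vectors (e.g. $R_{k_1,k,k_2}[f]=|V_{k_1,k,k_2}|^2\delta(k_1-k-k_2)\mathcal L_f(\omega_{k_1}-\omega_k-\omega_{k_2})(ff_2-f_1f-f_1f_2)$). The Dirac delta restricts integration to its support, e.g. $\iint\phi(k,k_1,k_2)\delta(k-k_1-k_2)dk_1dk_2=\int_{\mathbb{R}^d}\phi(k,k_1,k-k_1)dk_1$. Further $$V_{k,k_1,k_2}=\mathfrak C(|k||k_1||k_2|)^{1/2},\qquad \mathcal L_f(\zeta)=\frac{\Gamma_{k,k_1,k_2}}{\zeta^2+\Gamma_{k,k_1,k_2}^2},\qquad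 \Gamma_{k,k_1,k_2}=(|k|^2+|k_1|^2+|k_2|^2)\int_{\mathbb{R}^d}f(t,p)\,dp.$$ A strong solution on $[0,T)$ is a function in $C([0,T);L^1_N)\cap C^1((0,T);L^1_N)$ satisfying the equation and the initial condition. The sets $\mathcal S_t$: $\chi_{R_0}$ is the characteristic function of the ball $B(O,R_0)\subset\mathbb{R}^d$ of radius $R_0$ centered at the origin. Given $T>0$ and $R_0$, put $$C_*=\frac{C_0(\lambda_1,\lambda_2)\left(1+e^{(4\nu R_0^2+8R_0)T}\right)}{\|f_0\chi_{R_0}\|_{L^1}},\qquad C^*=4\nu R_0^2+8R_0 .$$ For $t\in[0,T]$, $$\mathcal S_t=\Big\{f\in L^1_{N+3}(\mathbb{R}^d):\ f\ge0,\ \ \|f\|_{L^1_{N+3}}\le(2R_*+1)e^{C_*t},\ \ \|f\|_{L^1}\ge\tfrac12R^*e^{-C^*t}\Big\}.$$ The bounds are monotone in $t$, so $\mathcal S_t\subset\mathcal S_{t'}$ for $0\le t\le t'\le T$; $\mathcal S_T$ is the case $t=T$. *)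

theory Defs
  imports "HOL-Analysis.Analysis"
begin

definition omega :: "real \<Rightarrow> real \<Rightarrow> real^'n \<Rightarrow> real" where
  "omega lam1 lam2 k = sqrt (lam1 + lam2 * (norm k)\<^sup>2)"

text \<open>
  Elements of the Lebesgue spaces are represented by Borel functions; identities and signs are
  understood almost everywhere. The Bochner integrals defining the norms have their usual meaning
  only for members of the respective space, so membership is always stated along with them.
\<close>

definition L1_norm :: "(real^'n \<Rightarrow> real) \<Rightarrow> real" where
  "L1_norm g = (\<integral>k. \<bar>g k\<bar> \<partial>lborel)"

definition L1w_space :: "real \<Rightarrow> real \<Rightarrow> real \<Rightarrow> (real^'n \<Rightarrow> real) set" where
  "L1w_space lam1 lam2 n =
     {g. integrable lborel g \<and> integrable lborel (\<lambda>k. omega lam1 lam2 k powr n * \<bar>g k\<bar>)}"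

definition L1w_norm :: "real \<Rightarrow> real \<Rightarrow> real \<Rightarrow> (real^'n \<Rightarrow> real) \<Rightarrow> real" where
  "L1w_norm lam1 lam2 n g = (\<integral>k. omega lam1 lam2 k powr n * \<bar>g k\<bar> \<partial>lborel)"

definition L1w_continuous_on ::
  "real \<Rightarrow> real \<Rightarrow> real \<Rightarrow> real set \<Rightarrow> (real \<Rightarrow> real^'n \<Rightarrow> real) \<Rightarrow> bool" where
  "L1w_continuous_on lam1 lam2 n J f \<longleftrightarrow>
     (\<forall>t\<in>J. f t \<in> L1w_space lam1 lam2 n \<and>
        ((\<lambda>s. L1w_norm lam1 lam2 n (\<lambda>k. f s k - f t k)) \<longlongrightarrow> 0) (at t within J))"

definition L1w_has_derivative ::
  "real \<Rightarrow> real \<Rightarrow> real \<Rightarrow> (real \<Rightarrow> real^'n \<Rightarrow> real) \<Rightarrow> (real^'n \<Rightarrow> real) \<Rightarrow> real \<Rightarrow> bool" where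
  "L1w_has_derivative lam1 lam2 n f g t \<longleftrightarrow>
     g \<in> L1w_space lam1 lam2 n \<and>
     ((\<lambda>s. L1w_norm lam1 lam2 n (\<lambda>k. (f s k - f t k) / (s - t) - g k)) \<longlongrightarrow> 0) (at t)"

definition interaction :: "real \<Rightarrow> real^'n \<Rightarrow> real^'n \<Rightarrow> real^'n \<Rightarrow> real" where
  "interaction \<CC> k k1 k2 = \<CC> * sqrt (norm k * norm k1 * norm k2)"

definition Gamma_coeff :: "(real^'n \<Rightarrow> real) \<Rightarrow> real^'n \<Rightarrow> real^'n \<Rightarrow> real^'n \<Rightarrow> real" where
  "Gamma_coeff f k k1 k2 = ((norm k)\<^sup>2 + (norm k1)\<^sup>2 + (norm k2)\<^sup>2) * (\<integral>p. f p \<partial>lborel)"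

definition lorentzian ::
  "(real^'n \<Rightarrow> real) \<Rightarrow> real^'n \<Rightarrow> real^'n \<Rightarrow> real^'n \<Rightarrow> real \<Rightarrow> real" where
  "lorentzian f k k1 k2 \<zeta> = Gamma_coeff f k k1 k2 / (\<zeta>\<^sup>2 + (Gamma_coeff f k k1 k2)\<^sup>2)"

text \<open>
  The density multiplying \<open>\<delta>(k - k1 - k2)\<close> in \<open>R\<close> with indices \<open>k, k1, k2\<close>.
\<close>

definition R_density ::
  "real \<Rightarrow> real \<Rightarrow> real \<Rightarrow> (real^'n \<Rightarrow> real) \<Rightarrow> real^'n \<Rightarrow> real^'n \<Rightarrow> real^'n \<Rightarrow> real" where
  "R_density lam1 lam2 \<CC> f k k1 k2 =
     \<bar>interaction \<CC> k k1 k2\<bar>\<^sup>2 *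
     lorentzian f k k1 k2 (omega lam1 lam2 k - omega lam1 lam2 k1 - omega lam1 lam2 k2) *
     (f k1 * f k2 - f k * f k1 - f k * f k2)"

text \<open>
  The Dirac masses are resolved term by term:
  \<open>\<delta>(k - k1 - k2)\<close> sets \<open>k2 = k - k1\<close>, \<open>\<delta>(k1 - k - k2)\<close> sets \<open>k1 = k + k2\<close>,
  and \<open>\<delta>(k2 - k - k1)\<close> sets \<open>k2 = k + k1\<close>. For integrable \<open>f \<ge> 0\<close> the three integrals converge
  absolutely for almost every \<open>k\<close>, because \<open>\<bar>V\<bar>\<^sup>2 L\<^sub>f\<close> is then bounded in \<open>k1, k2\<close> for fixed \<open>k\<close>.
\<close>

definition collision ::
  "real \<Rightarrow> real \<Rightarrow> real \<Rightarrow> (real^'n \<Rightarrow> real) \<Rightarrow> real^'n \<Rightarrow> real" where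
  "collision lam1 lam2 \<CC> f k =
     (\<integral>k1. R_density lam1 lam2 \<CC> f k k1 (k - k1) \<partial>lborel)
     - (\<integral>k2. R_density lam1 lam2 \<CC> f (k + k2) k k2 \<partial>lborel)
     - (\<integral>k1. R_density lam1 lam2 \<CC> f (k + k1) k k1 \<partial>lborel)"

text \<open>
  \<open>J\<close> is the time interval, either \<open>{0..<T}\<close> or \<open>{0..}\<close>.
\<close>

definition strong_solution ::
  "real \<Rightarrow> real \<Rightarrow> real \<Rightarrow> real \<Rightarrow> real \<Rightarrow> real set \<Rightarrow> (real^'n \<Rightarrow> real) \<Rightarrow>
   (real \<Rightarrow> real^'n \<Rightarrow> real) \<Rightarrow> bool" where
  "strong_solution lam1 lam2 \<CC> \<nu> N J f0 f \<longleftrightarrow>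
     L1w_continuous_on lam1 lam2 N J f \<and>
     (AE k in lborel. f 0 k = f0 k) \<and>
     (\<exists>f'. L1w_continuous_on lam1 lam2 N (interior J) f' \<and>
        (\<forall>t\<in>interior J. L1w_has_derivative lam1 lam2 N f (f' t) t \<and>
           (AE k in lborel.
              f' t k + 2 * \<nu> * (norm k)\<^sup>2 * f t k = collision lam1 lam2 \<CC> (f t) k)))"

definition nonneg_strong_solution ::
  "real \<Rightarrow> real \<Rightarrow> real \<Rightarrow> real \<Rightarrow> real \<Rightarrow> real set \<Rightarrow> (real^'n \<Rightarrow> real) \<Rightarrow>
   (real \<Rightarrow> real^'n \<Rightarrow> real) \<Rightarrow> bool" where
  "nonneg_strong_solution lam1 lam2 \<CC> \<nu> N J f0 f \<longleftrightarrow>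
     strong_solution lam1 lam2 \<CC> \<nu> N J f0 f \<and> (\<forall>t\<in>J. AE k in lborel. 0 \<le> f t k)"

definition C_lower :: "real \<Rightarrow> real \<Rightarrow> real \<Rightarrow> real \<Rightarrow> (real^'n \<Rightarrow> real) \<Rightarrow> real" where
  "C_lower C0 \<nu> R0 T f0 =
     C0 * (1 + exp ((4 * \<nu> * R0\<^sup>2 + 8 * R0) * T)) / L1_norm (\<lambda>k. f0 k * indicator (ball 0 R0) k)"

definition C_upper :: "real \<Rightarrow> real \<Rightarrow> real" where
  "C_upper \<nu> R0 = 4 * \<nu> * R0\<^sup>2 + 8 * R0"

text \<open>
  Lower and upper stars are written \<open>lower\<close> and \<open>upper\<close>: \<open>C_lower\<close> and \<open>R_lower\<close> (lower star, the
  larger radius) control the weighted norm from above, whereas \<open>C_upper\<close> and \<open>R_upper\<close> (upper star,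
  the smaller radius) control the mass from below.
\<close>

definition S_set ::
  "real \<Rightarrow> real \<Rightarrow> real \<Rightarrow> real \<Rightarrow> real \<Rightarrow> real \<Rightarrow> real \<Rightarrow> real \<Rightarrow> (real^'n \<Rightarrow> real) \<Rightarrow>
   real \<Rightarrow> real \<Rightarrow> (real^'n \<Rightarrow> real) set" where
  "S_set lam1 lam2 \<nu> N R_upper R_lower C0 R0 f0 T t =
     {f \<in> L1w_space lam1 lam2 (N + 3).
        (AE k in lborel. 0 \<le> f k) \<and>
        L1w_norm lam1 lam2 (N + 3) f \<le> (2 * R_lower + 1) * exp (C_lower C0 \<nu> R0 T f0 * t) \<and>
        L1_norm f \<ge> 1 / 2 * R_upper * exp (- C_upper \<nu> R0 * t)}"

end

theory Submission imports Defs begin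

text \<open>
  Write \<open>m = \<integral> f\<close> and \<open>\<Sigma> = |k|\<^sup>2 + |k\<^sub>1|\<^sup>2 + |k\<^sub>2|\<^sup>2\<close>. Everything rests on one property of the kernel
  \<open>|V|\<^sup>2 L\<^sub>f\<close>. Since \<open>L\<^sub>f \<le> 1 / (\<Sigma> m)\<close> and \<open>2 |k\<^sub>1| |k\<^sub>2| \<le> \<Sigma>\<close>, the kernel is at most
  \<open>\<CC>\<^sup>2 |k| / (2 m)\<close>, where \<open>k\<close> may be any of the three wave vectors. Hence \<open>Q[f] / |k|\<close> is a sum of
  integrals of products of two values of \<open>f\<close> against bounded kernels of size \<open>1 / m\<close>. The factor
  \<open>1 / m\<close> cancels one factor \<open>f\<close>: changing the other factor by \<open>h\<close> costs \<open>\<integral> |h|\<close>, and changing the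
  mass inside the kernel costs \<open>|m - m'| / (m m')\<close> times \<open>m m'\<close>. So \<open>f \<mapsto> Q[f] / |k|\<close> is globally
  Lipschitz on the nonnegative cone of \<open>L\<^sup>1\<close>, with no lower bound on the mass (\<open>collision_Lipschitz\<close>),
  and it is linearly bounded in every space with a doubling weight (\<open>collision_le\<close>).

  Existence. The loss part of \<open>Q[f]\<close> is at most \<open>2 \<CC>\<^sup>2 |k| f\<close>. Adding this term to both sides turns
  the right-hand side into a nonnegative source and the damping into
  \<open>a = 2 \<nu> |k|\<^sup>2 + 2 \<CC>\<^sup>2 |k|\<close>, so that the Duhamel map preserves positivity. In
  \<open>L\<^sup>1(e\<^sup>-\<^sup>\<kappa>\<^sup>t dt dk)\<close> the convolution in time with \<open>e\<^sup>-\<^sup>a\<^sup>t\<close> is bounded, for fixed \<open>k\<close>, by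
  \<open>1 / (a + \<kappa>)\<close>, and \<open>|k| / (a + \<kappa>)\<close> is uniformly small for large \<open>\<kappa>\<close> because \<open>a\<close> grows
  quadratically. This compensates the factor \<open>|k|\<close> in \<open>Q\<close>: the Duhamel map is a contraction
  (\<open>gap_step_le\<close>), its fixed point exists for all times, and the same computation with a weight
  bounds the moments (\<open>mild_solution_exists\<close>). The \<open>N + 3\<close> moments exceed the \<open>N + 2\<close> moments that
  the viscous term needs, and this surplus gives continuity in time by interpolation
  (\<open>flow_strong_solution\<close>).

  Uniqueness. A competitor is only continuous in the norm with weight \<open>\<omega>\<^sup>N\<close>, which degenerates at
  the origin if \<open>\<lambda>\<^sub>1 = 0\<close>, and it has no further moments. Therefore one works on shells
  \<open>1/n \<le> |k| \<le> n\<close>. For the difference \<open>h\<close> of two solutions, the integral of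
  \<open>|h| / (2 \<nu> |k|\<^sup>2 + \<kappa>)\<close> over a shell satisfies a differential inequality
  (\<open>energy_inequality\<close>) in which the collision term is at most \<open>1/2 \<integral> |h|\<close>. Integrating it
  against \<open>e\<^sup>-\<^sup>\<kappa>\<^sup>t\<close> and exhausting by shells gives \<open>\<integral>\<integral> e\<^sup>-\<^sup>\<kappa>\<^sup>t |h| \<le> 1/2 \<integral>\<integral> e\<^sup>-\<^sup>\<kappa>\<^sup>t |h|\<close>, hence
  \<open>h = 0\<close>. The double integral is finite because the mass of a solution is locally bounded in time
  (\<open>mass_locally_bounded\<close>).

  The sets \<open>S\<^sub>T\<close>. The moment of order \<open>N + 3\<close> grows at most like \<open>2 e\<^sup>\<kappa>\<^sup>t\<close>, and by Jensen's
  inequality applied to \<open>f \<ge> e\<^sup>-\<^sup>a\<^sup>t f\<^sub>0\<close> the mass decays at most exponentially. The radius \<open>R\<^sub>0\<close>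
  is chosen after \<open>\<nu>\<close>, \<open>\<CC>\<close>, \<open>N\<close> and \<open>f\<^sub>0\<close>, and both exponents in \<open>S\<^sub>T\<close> tend to infinity with it; a large
  \<open>R\<^sub>0\<close> therefore absorbs all constants, and \<open>C\<^sub>0 = 1\<close> suffices.
\<close>

section \<open>Doubling weights and the dispersion relation\<close>

text \<open>
  The three wave vectors of an interaction satisfy \<open>|k| \<le> |k\<^sub>1| + |k\<^sub>2|\<close> in every order. A weight
  of this kind can therefore be moved from the outgoing wave vector to the two arguments of \<open>f\<close>.
\<close>

definition doubling :: "real \<Rightarrow> ('a::euclidean_space \<Rightarrow> real) \<Rightarrow> bool" where
  "doubling D W \<longleftrightarrow> W \<in> borel_measurable borel \<and> (\<forall>x. 0 \<le> W x) \<and>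
     (\<forall>x y z. norm x \<le> norm y + norm z \<longrightarrow> W x \<le> D * (W y + W z))"

lemma doubling_nonneg: "doubling D W \<Longrightarrow> 0 \<le> W x"
  and doubling_measurable: "doubling D W \<Longrightarrow> W \<in> borel_measurable borel"
  and doubling_le: "doubling D W \<Longrightarrow> norm x \<le> norm y + norm z \<Longrightarrow> W x \<le> D * (W y + W z)"
  by (auto simp: doubling_def)

lemma doubling_mono:
  assumes "doubling D W" "D \<le> D'" shows "doubling D' W"
proof -
  have "D * (W y + W z) \<le> D' * (W y + W z)" for y z
    using assms by (intro mult_right_mono) (auto simp: doubling_def)
  then show ?thesis using assms unfolding doubling_def by (meson order_trans)
qed

lemma doubling_const: "0 \<le> c \<Longrightarrow> doubling 1 (\<lambda>_::'a::euclidean_space. c)"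
  by (auto simp: doubling_def)

text \<open>
  The longer of \<open>y\<close> and \<open>z\<close> has at least half the length of \<open>x\<close>, and taking both of them equal to
  it shows that \<open>W x\<close> is bounded by \<open>2 D\<close> times the value of \<open>W\<close> there.
\<close>

lemma doubling_norm_mult:
  assumes W: "doubling D W"
  shows "doubling (4 * D) (\<lambda>x. norm x * W x)"
proof -
  have aux: "norm x * W x \<le> 4 * D * (norm y * W y)" if "norm x \<le> 2 * norm y" for x y
  proof -
    have "W x \<le> D * (W y + W y)" using that by (intro doubling_le[OF W]) auto
    then have "norm x * W x \<le> (2 * norm y) * (D * (W y + W y))"
      using that doubling_nonneg[OF W] by (intro mult_mono) auto
    then show ?thesis by (simp add: algebra_simps)
  qed
  have "norm x * W x \<le> 4 * D * (norm y * W y + norm z * W z)"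
    if "norm x \<le> norm y + norm z" for x y z
  proof -
    have nn: "0 \<le> 4 * D * (norm v * W v)" for v
      using order_trans[OF _ aux[of v v]] doubling_nonneg[OF W, of v] by simp
    show ?thesis
    proof (cases "norm y \<le> norm z")
      case True
      then have "norm x * W x \<le> 4 * D * (norm z * W z)" using that by (intro aux) simp
      then show ?thesis using nn[of y] by (simp add: algebra_simps)
    next
      case False
      then have "norm x * W x \<le> 4 * D * (norm y * W y)" using that by (intro aux) simp
      then show ?thesis using nn[of z] by (simp add: algebra_simps)
    qed
  qed
  moreover have "(\<lambda>x. norm x * W x) \<in> borel_measurable borel"
    using doubling_measurable[OF W] by simp
  ultimately show ?thesis using doubling_nonneg[OF W] unfolding doubling_def by auto
qed

lemma doubling_powr:
  assumes m: "\<phi> \<in> borel_measurable borel" and nn: "\<And>x. 0 \<le> \<phi> x"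
    and sub: "\<And>x y z. norm x \<le> norm y + norm z \<Longrightarrow> \<phi> x \<le> \<phi> y + \<phi> z" and p: "0 \<le> p"
  shows "doubling (2 powr p) (\<lambda>x. \<phi> x powr p)"
proof -
  have "\<phi> x powr p \<le> 2 powr p * (\<phi> y powr p + \<phi> z powr p)"
    if "norm x \<le> norm y + norm z" for x y z
  proof -
    have "\<phi> x \<le> 2 * max (\<phi> y) (\<phi> z)" using sub[OF that] by auto
    then have "\<phi> x powr p \<le> (2 * max (\<phi> y) (\<phi> z)) powr p" using nn p by (intro powr_mono2) auto
    also have "\<dots> = 2 powr p * (max (\<phi> y) (\<phi> z)) powr p" using nn by (simp add: powr_mult le_max_iff_disj)
    also have "\<dots> \<le> 2 powr p * (\<phi> y powr p + \<phi> z powr p)" by (intro mult_left_mono) (auto simp: max_def)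
    finally show ?thesis .
  qed
  then show ?thesis using m by (auto simp: doubling_def)
qed

lemma doubling_power:
  assumes m: "\<phi> \<in> borel_measurable borel" and nn: "\<And>x. 0 \<le> \<phi> x"
    and sub: "\<And>x y z. norm x \<le> norm y + norm z \<Longrightarrow> \<phi> x \<le> \<phi> y + \<phi> z"
  shows "doubling (2 ^ p) (\<lambda>x. \<phi> x ^ p)"
proof -
  have "\<phi> x ^ p \<le> 2 ^ p * (\<phi> y ^ p + \<phi> z ^ p)"
    if "norm x \<le> norm y + norm z" for x y z
  proof -
    have "\<phi> x \<le> 2 * max (\<phi> y) (\<phi> z)" using sub[OF that] by auto
    then have "\<phi> x ^ p \<le> (2 * max (\<phi> y) (\<phi> z)) ^ p" using nn by (intro power_mono) auto
    also have "\<dots> = 2 ^ p * (max (\<phi> y) (\<phi> z)) ^ p" by (simp add: power_mult_distrib)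
    also have "\<dots> \<le> 2 ^ p * (\<phi> y ^ p + \<phi> z ^ p)" using nn by (intro mult_left_mono) (auto simp: max_def)
    finally show ?thesis .
  qed
  then show ?thesis using m nn by (auto simp: doubling_def)
qed

lemma omega_nonneg: "0 \<le> omega lam1 lam2 k" if "0 \<le> lam1" "0 \<le> lam2"
  using that by (simp add: omega_def)

lemma omega_measurable [measurable]:
  "omega lam1 lam2 \<in> borel_measurable (borel :: (real^'n) measure)"
  unfolding omega_def[abs_def] by measurable

text \<open>
  \<open>\<omega>\<close> is the Euclidean norm of the vector \<open>(\<surd>\<lambda>\<^sub>1, \<surd>\<lambda>\<^sub>2 k)\<close>, whose first component does not change.
\<close>

lemma omega_subadditive:
  fixes x y z :: "real^'n"
  assumes "0 \<le> lam1" "0 \<le> lam2" "norm x \<le> norm y + norm z"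
  shows "omega lam1 lam2 x \<le> omega lam1 lam2 y + omega lam1 lam2 z"
proof -
  have sq: "omega lam1 lam2 k ^ 2 = lam1 + lam2 * (norm k)\<^sup>2" for k :: "real^'n"
    using assms by (simp add: omega_def)
  have nn: "0 \<le> omega lam1 lam2 k" for k :: "real^'n" using assms omega_nonneg by blast
  have lo: "sqrt lam2 * norm k \<le> omega lam1 lam2 k" for k :: "real^'n"
    using assms by (intro power2_le_imp_le[OF _ nn]) (simp add: sq power_mult_distrib)
  have "(sqrt lam2 * norm y) * (sqrt lam2 * norm z) \<le> omega lam1 lam2 y * omega lam1 lam2 z"
    using lo nn assms by (intro mult_mono) auto
  moreover have "(sqrt lam2 * norm y) * (sqrt lam2 * norm z) = (sqrt lam2)\<^sup>2 * (norm y * norm z)"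
    unfolding power2_eq_square by (simp only: mult_ac)
  ultimately have "lam2 * (norm y * norm z) \<le> omega lam1 lam2 y * omega lam1 lam2 z"
    using assms by simp
  moreover have "lam2 * (norm x)\<^sup>2 \<le> lam2 * (norm y + norm z)\<^sup>2"
    using assms by (intro mult_left_mono power_mono) auto
  ultimately have "omega lam1 lam2 x ^ 2 \<le> (omega lam1 lam2 y + omega lam1 lam2 z)^2"
    using assms by (simp add: sq power2_sum algebra_simps)
  then show ?thesis by (rule power2_le_imp_le) (intro add_nonneg_nonneg nn)
qed

lemma omega_ge_norm: "0 \<le> lam1 \<Longrightarrow> 0 \<le> lam2 \<Longrightarrow> sqrt lam2 * norm k \<le> omega lam1 lam2 k"
  by (auto simp: omega_def intro!: real_le_rsqrt simp: power_mult_distrib)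

text \<open>
  The factor \<open>|V|\<^sup>2 L\<^sub>f\<close>, which depends on \<open>f\<close> only through its mass \<open>m\<close>.
\<close>

definition coll_kernel :: "real \<Rightarrow> real \<Rightarrow> real \<Rightarrow> real \<Rightarrow> real^'n \<Rightarrow> real^'n \<Rightarrow> real^'n \<Rightarrow> real" where
  "coll_kernel lam1 lam2 \<CC> m k k1 k2 =
     (let \<Sigma> = (norm k)\<^sup>2 + (norm k1)\<^sup>2 + (norm k2)\<^sup>2;
          \<zeta> = omega lam1 lam2 k - omega lam1 lam2 k1 - omega lam1 lam2 k2
      in \<bar>interaction \<CC> k k1 k2\<bar>\<^sup>2 * (\<Sigma> * m / (\<zeta>\<^sup>2 + (\<Sigma> * m)\<^sup>2)))"

lemma R_density_eq_coll_kernel: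
  "R_density lam1 lam2 \<CC> f k k1 k2 =
     coll_kernel lam1 lam2 \<CC> (\<integral>p. f p \<partial>lborel) k k1 k2 * (f k1 * f k2 - f k * f k1 - f k * f k2)"
  by (simp add: R_density_def coll_kernel_def lorentzian_def Gamma_coeff_def Let_def)

lemma coll_kernel_0 [simp]: "coll_kernel lam1 lam2 \<CC> 0 k k1 k2 = 0"
  by (simp add: coll_kernel_def)

lemma coll_kernel_nonneg: "0 \<le> m \<Longrightarrow> 0 \<le> coll_kernel lam1 lam2 \<CC> m k k1 k2"
  by (auto simp: coll_kernel_def Let_def intro!: mult_nonneg_nonneg divide_nonneg_nonneg add_nonneg_nonneg)

lemma lorentz_le:
  fixes S z m :: real assumes "0 \<le> S" "0 < m"
  shows "S * (S * m / (z\<^sup>2 + (S * m)\<^sup>2)) \<le> 1 / m"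
proof (cases "S = 0")
  case False
  then have S: "S > 0" using assms by simp
  then have d: "0 < z\<^sup>2 + (S * m)\<^sup>2" using assms by (intro add_nonneg_pos) auto
  have "S * (S * m) * m \<le> z\<^sup>2 + (S * m)\<^sup>2" by (simp add: power2_eq_square algebra_simps)
  then show ?thesis using d assms by (simp add: field_simps)
qed (use assms in auto)

text \<open>
  The factor \<open>S\<close> on the left is what the interaction coefficient supplies. The point is the
  homogeneity of the right-hand side, which is the reason why the collision operator is Lipschitz
  without a lower bound on the mass.
\<close>

lemma lorentz_diff_le:
  fixes S z m m' :: real assumes "0 \<le> S" "0 < m" "0 < m'"
  shows "S * \<bar>S * m / (z\<^sup>2 + (S * m)\<^sup>2) - S * m' / (z\<^sup>2 + (S * m')\<^sup>2)\<bar> \<le> \<bar>m - m'\<bar> / (m * m')"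
proof (cases "S = 0")
  case False
  then have S: "S > 0" using assms by simp
  define A B where "A = z\<^sup>2 + (S * m)\<^sup>2" and "B = z\<^sup>2 + (S * m')\<^sup>2"
  have A: "A > 0" and B: "B > 0" unfolding A_def B_def using S assms by (auto intro!: add_nonneg_pos)
  have eq: "S * m / A - S * m' / B = S * (m - m') * (z\<^sup>2 - S\<^sup>2 * m * m') / (A * B)"
  proof -
    have "S * m / A - S * m' / B = (S * m * B - S * m' * A) / (A * B)" using A B by (simp add: field_simps)
    also have "S * m * B - S * m' * A = S * (m - m') * (z\<^sup>2 - S\<^sup>2 * m * m')"
      unfolding A_def B_def by (simp add: algebra_simps power2_eq_square)
    finally show ?thesis .
  qed
  \<comment> \<open>The Cauchy-Schwarz inequality: the denominators dominate the square of the mixed term.\<close>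
  have AB: "(z\<^sup>2 + S\<^sup>2 * m * m')\<^sup>2 \<le> A * B"
  proof -
    have "A * B - (z\<^sup>2 + S\<^sup>2 * m * m')\<^sup>2 = (z * S * (m - m'))\<^sup>2"
      unfolding A_def B_def by (simp add: algebra_simps power2_eq_square)
    then show ?thesis using zero_le_power2[of "z * S * (m - m')"] by linarith
  qed
  have "S\<^sup>2 * m * m' * \<bar>z\<^sup>2 - S\<^sup>2 * m * m'\<bar> \<le> (z\<^sup>2 + S\<^sup>2 * m * m') * (z\<^sup>2 + S\<^sup>2 * m * m')"
  proof -
    have "0 \<le> S\<^sup>2 * m * m'" using assms by simp
    moreover have "0 \<le> z\<^sup>2" by simp
    ultimately show ?thesis by (intro mult_mono) linarith+
  qed
  with AB have *: "S\<^sup>2 * m * m' * \<bar>z\<^sup>2 - S\<^sup>2 * m * m'\<bar> \<le> A * B" by (simp add: power2_eq_square)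
  have "S * \<bar>S * m / A - S * m' / B\<bar> = S\<^sup>2 * \<bar>m - m'\<bar> * \<bar>z\<^sup>2 - S\<^sup>2 * m * m'\<bar> / (A * B)"
    unfolding eq using A B S by (simp add: abs_mult power2_eq_square)
  also have "\<dots> = \<bar>m - m'\<bar> * (S\<^sup>2 * m * m' * \<bar>z\<^sup>2 - S\<^sup>2 * m * m'\<bar>) / (A * B) / (m * m')"
    using assms by (simp add: field_simps)
  also have "\<dots> \<le> \<bar>m - m'\<bar> * (A * B) / (A * B) / (m * m')"
    using * assms A B by (intro divide_right_mono mult_left_mono) auto
  also have "\<dots> = \<bar>m - m'\<bar> / (m * m')" using A B by simp
  finally show ?thesis unfolding A_def B_def .
qed (use assms in auto)

text \<open>
  Whichever wave vector \<open>s\<close> is singled out, the product of the other two lengths is at most half the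
  sum of the squares.
\<close>

lemma interaction_le:
  fixes k k1 k2 :: "real^'n"
  assumes "s \<in> {k, k1, k2}"
  shows "\<bar>interaction \<CC> k k1 k2\<bar>\<^sup>2 \<le> \<CC>\<^sup>2 / 2 * norm s * ((norm k)\<^sup>2 + (norm k1)\<^sup>2 + (norm k2)\<^sup>2)"
proof -
  define a b c where "a = norm k" and "b = norm k1" and "c = norm k2"
  have nn: "a \<ge> 0" "b \<ge> 0" "c \<ge> 0" unfolding a_def b_def c_def by auto
  have ab: "2 * (b * c) \<le> a\<^sup>2 + b\<^sup>2 + c\<^sup>2" "2 * (a * c) \<le> a\<^sup>2 + b\<^sup>2 + c\<^sup>2" "2 * (a * b) \<le> a\<^sup>2 + b\<^sup>2 + c\<^sup>2"
    using zero_le_power2[of "b - c"] zero_le_power2[of "a - c"] zero_le_power2[of "a - b"]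
      zero_le_power2[of a] zero_le_power2[of b] zero_le_power2[of c]
    unfolding power2_diff by linarith+
  have "2 * (a * b * c) \<le> norm s * (a\<^sup>2 + b\<^sup>2 + c\<^sup>2)"
    using assms mult_left_mono[OF ab(1) nn(1)] mult_left_mono[OF ab(2) nn(2)] mult_left_mono[OF ab(3) nn(3)]
    by (auto simp flip: a_def b_def c_def simp: algebra_simps)
  then have "\<CC>\<^sup>2 / 2 * (2 * (a * b * c)) \<le> \<CC>\<^sup>2 / 2 * (norm s * (a\<^sup>2 + b\<^sup>2 + c\<^sup>2))"
    by (intro mult_left_mono) auto
  moreover have "\<bar>interaction \<CC> k k1 k2\<bar>\<^sup>2 = \<CC>\<^sup>2 * (a * b * c)"
    using nn by (simp add: interaction_def power_mult_distrib a_def b_def c_def)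
  ultimately show ?thesis by (simp add: a_def b_def c_def mult.assoc)
qed

lemma coll_kernel_le:
  fixes k k1 k2 :: "real^'n"
  assumes "0 < m" "s \<in> {k, k1, k2}"
  shows "coll_kernel lam1 lam2 \<CC> m k k1 k2 \<le> \<CC>\<^sup>2 / 2 * norm s * (1 / m)"
proof -
  define S where "S = (norm k)\<^sup>2 + (norm k1)\<^sup>2 + (norm k2)\<^sup>2"
  define z where "z = omega lam1 lam2 k - omega lam1 lam2 k1 - omega lam1 lam2 k2"
  have S: "S \<ge> 0" unfolding S_def by simp
  have "coll_kernel lam1 lam2 \<CC> m k k1 k2 = \<bar>interaction \<CC> k k1 k2\<bar>\<^sup>2 * (S * m / (z\<^sup>2 + (S * m)\<^sup>2))"
    by (simp add: coll_kernel_def S_def z_def Let_def)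
  also have "\<dots> \<le> (\<CC>\<^sup>2 / 2 * norm s * S) * (S * m / (z\<^sup>2 + (S * m)\<^sup>2))"
    using interaction_le[OF assms(2)] S assms unfolding S_def
    by (intro mult_right_mono divide_nonneg_nonneg add_nonneg_nonneg mult_nonneg_nonneg) auto
  also have "\<dots> = (\<CC>\<^sup>2 / 2 * norm s) * (S * (S * m / (z\<^sup>2 + (S * m)\<^sup>2)))" by simp
  also have "\<dots> \<le> (\<CC>\<^sup>2 / 2 * norm s) * (1 / m)"
    using lorentz_le[OF S assms(1)] by (intro mult_left_mono) auto
  finally show ?thesis .
qed

lemma coll_kernel_diff_le:
  fixes k k1 k2 :: "real^'n"
  assumes "0 < m" "0 < m'" "s \<in> {k, k1, k2}"
  shows "\<bar>coll_kernel lam1 lam2 \<CC> m k k1 k2 - coll_kernel lam1 lam2 \<CC> m' k k1 k2\<bar>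
           \<le> \<CC>\<^sup>2 / 2 * norm s * (\<bar>m - m'\<bar> / (m * m'))"
proof -
  define S where "S = (norm k)\<^sup>2 + (norm k1)\<^sup>2 + (norm k2)\<^sup>2"
  define z where "z = omega lam1 lam2 k - omega lam1 lam2 k1 - omega lam1 lam2 k2"
  define L where "L x = S * x / (z\<^sup>2 + (S * x)\<^sup>2)" for x
  have S: "S \<ge> 0" unfolding S_def by simp
  have kL: "coll_kernel lam1 lam2 \<CC> x k k1 k2 = \<bar>interaction \<CC> k k1 k2\<bar>\<^sup>2 * L x" for x
    by (simp add: coll_kernel_def S_def z_def Let_def L_def)
  have "\<bar>coll_kernel lam1 lam2 \<CC> m k k1 k2 - coll_kernel lam1 lam2 \<CC> m' k k1 k2\<bar> = \<bar>interaction \<CC> k k1 k2\<bar>\<^sup>2 * \<bar>L m - L m'\<bar>"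
    unfolding kL by (simp add: abs_mult flip: right_diff_distrib)
  also have "\<dots> \<le> (\<CC>\<^sup>2 / 2 * norm s * S) * \<bar>L m - L m'\<bar>"
    using interaction_le[OF assms(3)] unfolding S_def by (intro mult_right_mono) auto
  also have "\<dots> = (\<CC>\<^sup>2 / 2 * norm s) * (S * \<bar>L m - L m'\<bar>)" by simp
  also have "\<dots> \<le> (\<CC>\<^sup>2 / 2 * norm s) * (\<bar>m - m'\<bar> / (m * m'))"
    using lorentz_diff_le[OF S assms(1,2), of z] unfolding L_def by (intro mult_left_mono) auto
  finally show ?thesis .
qed

text \<open>
  The three terms come from changing one factor at a time: the second value of \<open>f\<close>, the first one,
  and the mass. After integration each of them is linear in the perturbation.
\<close>

lemma coll_kernel_product_diff_le:
  fixes k k1 k2 :: "real^'n"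
  assumes "0 < m" "0 < m'" "s \<in> {k, k1, k2}" "0 \<le> u" "0 \<le> v'"
  shows "\<bar>coll_kernel lam1 lam2 \<CC> m k k1 k2 * (u * v) - coll_kernel lam1 lam2 \<CC> m' k k1 k2 * (u' * v')\<bar>
     \<le> \<CC>\<^sup>2 / 2 * norm s * (u * \<bar>v - v'\<bar> / m + \<bar>u - u'\<bar> * v' / m' + \<bar>m - m'\<bar> * (u * v') / (m * m'))"
proof -
  let ?a = "coll_kernel lam1 lam2 \<CC> m k k1 k2" and ?b = "coll_kernel lam1 lam2 \<CC> m' k k1 k2"
  have "?a * (u * v) - ?b * (u' * v') = ?a * (u * (v - v')) + ?b * ((u - u') * v') + (?a - ?b) * (u * v')"
    by (simp add: algebra_simps)
  then have "\<bar>?a * (u * v) - ?b * (u' * v')\<bar>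
      \<le> \<bar>?a * (u * (v - v'))\<bar> + \<bar>?b * ((u - u') * v')\<bar> + \<bar>(?a - ?b) * (u * v')\<bar>" by linarith
  also have "\<dots> = ?a * (u * \<bar>v - v'\<bar>) + ?b * (\<bar>u - u'\<bar> * v') + \<bar>?a - ?b\<bar> * (u * v')"
    using assms by (simp add: abs_mult abs_of_nonneg[OF coll_kernel_nonneg])
  also have "\<dots> \<le> (\<CC>\<^sup>2 / 2 * norm s * (1 / m)) * (u * \<bar>v - v'\<bar>) + (\<CC>\<^sup>2 / 2 * norm s * (1 / m')) * (\<bar>u - u'\<bar> * v')
      + (\<CC>\<^sup>2 / 2 * norm s * (\<bar>m - m'\<bar> / (m * m'))) * (u * v')"
    using assms by (intro add_mono mult_right_mono coll_kernel_le coll_kernel_diff_le) auto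
  also have "\<dots> = \<CC>\<^sup>2 / 2 * norm s * (u * \<bar>v - v'\<bar> / m + \<bar>u - u'\<bar> * v' / m' + \<bar>m - m'\<bar> * (u * v') / (m * m'))"
    by (simp add: distrib_left)
  finally show ?thesis .
qed

section \<open>Changes of variables and measurability\<close>

lemma nn_integral_translate:
  fixes F :: "'a::euclidean_space \<Rightarrow> ennreal"
  assumes [measurable]: "F \<in> borel_measurable borel"
  shows "(\<integral>\<^sup>+x. F (x + c) \<partial>lborel) = (\<integral>\<^sup>+x. F x \<partial>lborel)"
    and "(\<integral>\<^sup>+x. F (c + x) \<partial>lborel) = (\<integral>\<^sup>+x. F x \<partial>lborel)"
    and "(\<integral>\<^sup>+x. F (x - c) \<partial>lborel) = (\<integral>\<^sup>+x. F x \<partial>lborel)"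
    and "(\<integral>\<^sup>+x. F (c - x) \<partial>lborel) = (\<integral>\<^sup>+x. F x \<partial>lborel)"
proof -
  have gen: "(\<integral>\<^sup>+x. F (t + s *\<^sub>R x) \<partial>lborel) = (\<integral>\<^sup>+x. F x \<partial>lborel)" if "\<bar>s\<bar> = 1" for t s
  proof -
    have "lborel = distr lborel borel (\<lambda>x::'a. t + s *\<^sub>R x)"
      using that lborel_affine[of s t] by (simp add: density_1)
    then have "(\<integral>\<^sup>+x. F x \<partial>lborel) = (\<integral>\<^sup>+x. F x \<partial>distr lborel borel (\<lambda>x::'a. t + s *\<^sub>R x))" by simp
    also have "\<dots> = (\<integral>\<^sup>+x. F (t + s *\<^sub>R x) \<partial>lborel)" by (subst nn_integral_distr) auto
    finally show ?thesis by simp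
  qed
  show "(\<integral>\<^sup>+x. F (x + c) \<partial>lborel) = (\<integral>\<^sup>+x. F x \<partial>lborel)"
    using gen[of 1 c] by (simp add: add.commute)
  show "(\<integral>\<^sup>+x. F (c + x) \<partial>lborel) = (\<integral>\<^sup>+x. F x \<partial>lborel)"
    using gen[of 1 c] by simp
  show "(\<integral>\<^sup>+x. F (x - c) \<partial>lborel) = (\<integral>\<^sup>+x. F x \<partial>lborel)"
    using gen[of 1 "- c"] by simp
  show "(\<integral>\<^sup>+x. F (c - x) \<partial>lborel) = (\<integral>\<^sup>+x. F x \<partial>lborel)"
    using gen[of "-1" c] by simp
qed

lemma measurable_pairI:
  assumes "case_prod F \<in> borel_measurable (M \<Otimes>\<^sub>M L)" "g \<in> measurable N M" "h \<in> measurable N L"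
  shows "(\<lambda>x. F (g x) (h x)) \<in> borel_measurable N"
  using measurable_compose[OF measurable_Pair[OF assms(2,3)] assms(1)] by simp

lemma lborel_swap:
  fixes F :: "'a::euclidean_space \<Rightarrow> 'b::euclidean_space \<Rightarrow> ennreal"
  assumes "case_prod F \<in> borel_measurable (lborel \<Otimes>\<^sub>M lborel)"
  shows "(\<integral>\<^sup>+y. (\<integral>\<^sup>+x. F x y \<partial>lborel) \<partial>lborel) = (\<integral>\<^sup>+x. (\<integral>\<^sup>+y. F x y \<partial>lborel) \<partial>lborel)"
  using assms by (rule lborel_pair.Fubini')

text \<open>
  The arguments of \<open>f\<close> in the collision integrals depend on the outgoing \<open>k\<close> and the integration
  variable \<open>q\<close> through linear maps of determinant \<open>\<plusminus>1\<close>; all of them lead to the same double integral.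
\<close>

lemma nn_integral_pair_maps:
  fixes F :: "'a::euclidean_space \<Rightarrow> 'a \<Rightarrow> ennreal"
  assumes F: "case_prod F \<in> borel_measurable (lborel \<Otimes>\<^sub>M lborel)"
  defines "I \<equiv> (\<integral>\<^sup>+x. \<integral>\<^sup>+y. F x y \<partial>lborel \<partial>lborel)"
  shows "(\<integral>\<^sup>+k. \<integral>\<^sup>+q. F q (k - q) \<partial>lborel \<partial>lborel) = I"
    and "(\<integral>\<^sup>+k. \<integral>\<^sup>+q. F k (k - q) \<partial>lborel \<partial>lborel) = I"
    and "(\<integral>\<^sup>+k. \<integral>\<^sup>+q. F (k + q) k \<partial>lborel \<partial>lborel) = I"
    and "(\<integral>\<^sup>+k. \<integral>\<^sup>+q. F (k + q) q \<partial>lborel \<partial>lborel) = I"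
proof -
  note mp = measurable_pairI[OF F]
  have m1: "F x \<in> borel_measurable borel" for x
    using mp[of "\<lambda>_. x" lborel "\<lambda>y. y"] by simp
  have m2: "(\<lambda>x. F x y) \<in> borel_measurable borel" for y
    using mp[of "\<lambda>x. x" lborel "\<lambda>_. y"] by simp
  have sw: "(\<integral>\<^sup>+y. \<integral>\<^sup>+x. F x y \<partial>lborel \<partial>lborel) = I"
    unfolding I_def by (rule lborel_swap[OF F])
  have "(\<integral>\<^sup>+k. \<integral>\<^sup>+q. F q (k - q) \<partial>lborel \<partial>lborel) = (\<integral>\<^sup>+q. \<integral>\<^sup>+k. F q (k - q) \<partial>lborel \<partial>lborel)"
    by (rule lborel_swap, unfold case_prod_beta, rule mp) measurable
  then show "(\<integral>\<^sup>+k. \<integral>\<^sup>+q. F q (k - q) \<partial>lborel \<partial>lborel) = I"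
    using nn_integral_translate(3)[OF m1] by (simp add: I_def)
  show "(\<integral>\<^sup>+k. \<integral>\<^sup>+q. F k (k - q) \<partial>lborel \<partial>lborel) = I"
    using nn_integral_translate(4)[OF m1] by (simp add: I_def)
  show "(\<integral>\<^sup>+k. \<integral>\<^sup>+q. F (k + q) k \<partial>lborel \<partial>lborel) = I"
    using nn_integral_translate(2)[OF m2] sw by simp
  have "(\<integral>\<^sup>+k. \<integral>\<^sup>+q. F (k + q) q \<partial>lborel \<partial>lborel) = (\<integral>\<^sup>+q. \<integral>\<^sup>+k. F (k + q) q \<partial>lborel \<partial>lborel)"
    by (rule lborel_swap, unfold case_prod_beta, rule mp) measurable
  then show "(\<integral>\<^sup>+k. \<integral>\<^sup>+q. F (k + q) q \<partial>lborel \<partial>lborel) = I"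
    using nn_integral_translate(1)[OF m2] sw by simp
qed

lemma coll_kernel_measurable [measurable (raw)]:
  fixes k k1 k2 :: "'b \<Rightarrow> real^'n"
  assumes [measurable]: "m \<in> borel_measurable M" "k \<in> borel_measurable M" "k1 \<in> borel_measurable M" "k2 \<in> borel_measurable M"
  shows "(\<lambda>x. coll_kernel lam1 lam2 \<CC> (m x) (k x) (k1 x) (k2 x)) \<in> borel_measurable M"
  unfolding coll_kernel_def interaction_def omega_def Let_def by measurable

lemma R_density_measurable_aux:
  fixes k k1 k2 :: "'b \<Rightarrow> real^'n"
  assumes F: "case_prod F \<in> borel_measurable (M \<Otimes>\<^sub>M lborel)" and s: "s \<in> measurable N M"
    and k [measurable]: "k \<in> borel_measurable N" "k1 \<in> borel_measurable N" "k2 \<in> borel_measurable N"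
  shows "(\<lambda>x. R_density lam1 lam2 \<CC> (F (s x)) (k x) (k1 x) (k2 x)) \<in> borel_measurable N"
proof -
  have [measurable]: "(\<lambda>s. \<integral>p. F s p \<partial>lborel) \<in> borel_measurable M"
    by (rule lborel.borel_measurable_lebesgue_integral[OF F])
  have m [measurable]: "(\<lambda>x. \<integral>p. F (s x) p \<partial>lborel) \<in> borel_measurable N"
    using s by measurable
  have [measurable]: "(\<lambda>x. F (s x) (k x)) \<in> borel_measurable N" "(\<lambda>x. F (s x) (k1 x)) \<in> borel_measurable N"
     "(\<lambda>x. F (s x) (k2 x)) \<in> borel_measurable N"
    using measurable_pairI[OF F s] k by simp_all
  show ?thesis unfolding R_density_eq_coll_kernel by measurable
qed

lemma collision_measurable_pair:
  fixes F :: "'b \<Rightarrow> real^'n \<Rightarrow> real"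
  assumes F: "case_prod F \<in> borel_measurable (M \<Otimes>\<^sub>M lborel)"
  shows "(\<lambda>(s,k). collision lam1 lam2 \<CC> (F s) k) \<in> borel_measurable (M \<Otimes>\<^sub>M lborel)"
proof -
  have "(\<lambda>x. (\<integral>q. R_density lam1 lam2 \<CC> (F (fst x)) (snd x) q (snd x - q) \<partial>lborel)) \<in> borel_measurable (M \<Otimes>\<^sub>M lborel)"
    and "(\<lambda>x. (\<integral>q. R_density lam1 lam2 \<CC> (F (fst x)) (snd x + q) (snd x) q \<partial>lborel)) \<in> borel_measurable (M \<Otimes>\<^sub>M lborel)"
    by (rule lborel.borel_measurable_lebesgue_integral, unfold case_prod_beta,
        rule R_density_measurable_aux[OF F]; measurable)+
  then show ?thesis unfolding collision_def case_prod_beta by measurable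
qed

lemma collision_measurable:
  fixes f :: "real^'n \<Rightarrow> real"
  assumes "f \<in> borel_measurable borel"
  shows "collision lam1 lam2 \<CC> f \<in> borel_measurable borel"
proof -
  have "(\<lambda>(s::unit,k). f k) \<in> borel_measurable (count_space UNIV \<Otimes>\<^sub>M lborel)"
    using assms by (simp add: case_prod_beta)
  from measurable_pairI[OF collision_measurable_pair[OF this], of "\<lambda>_. ()" lborel "\<lambda>x. x"]
  show ?thesis by simp
qed

lemma convolution_integrable_AE:
  fixes f g :: "'a::euclidean_space \<Rightarrow> real"
  assumes f: "integrable lborel f" and g: "integrable lborel g"
  shows "AE k in lborel. integrable lborel (\<lambda>q. f q * g (k - q))"
    and "AE k in lborel. integrable lborel (\<lambda>q. f (k + q) * g q)"
proof -
  have [measurable]: "f \<in> borel_measurable borel" "g \<in> borel_measurable borel" using f g by auto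
  define F where "F x y = ennreal \<bar>f x * g y\<bar>" for x y
  have mF [measurable]: "case_prod F \<in> borel_measurable (lborel \<Otimes>\<^sub>M lborel)"
    unfolding F_def by measurable
  have "(\<integral>\<^sup>+x. \<integral>\<^sup>+y. F x y \<partial>lborel \<partial>lborel) = (\<integral>\<^sup>+x. ennreal \<bar>f x\<bar> \<partial>lborel) * (\<integral>\<^sup>+x. ennreal \<bar>g x\<bar> \<partial>lborel)"
    by (simp add: F_def abs_mult ennreal_mult nn_integral_cmult nn_integral_multc)
  also have "\<dots> < \<infinity>" using f g by (auto simp: integrable_iff_bounded ennreal_mult_less_top)
  finally have fin: "(\<integral>\<^sup>+x. \<integral>\<^sup>+y. F x y \<partial>lborel \<partial>lborel) \<noteq> \<infinity>" by simp
  have "AE k in lborel. (\<integral>\<^sup>+q. F q (k - q) \<partial>lborel) \<noteq> \<infinity>"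
    using fin nn_integral_pair_maps(1)[OF mF] unfolding F_def by (intro nn_integral_PInf_AE) auto
  then show "AE k in lborel. integrable lborel (\<lambda>q. f q * g (k - q))"
    unfolding F_def by eventually_elim (auto simp: integrable_iff_bounded less_top)
  have "AE k in lborel. (\<integral>\<^sup>+q. F (k + q) q \<partial>lborel) \<noteq> \<infinity>"
    using fin nn_integral_pair_maps(4)[OF mF] unfolding F_def by (intro nn_integral_PInf_AE) auto
  then show "AE k in lborel. integrable lborel (\<lambda>q. f (k + q) * g q)"
    unfolding F_def by eventually_elim (auto simp: integrable_iff_bounded less_top)
qed

lemma integrable_translate:
  fixes f :: "'a::euclidean_space \<Rightarrow> real"
  assumes "integrable lborel f"
  shows "integrable lborel (\<lambda>q. f (k + q))" "integrable lborel (\<lambda>q. f (k - q))"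
    "(\<integral>q. f (k - q) \<partial>lborel) = (\<integral>q. f q \<partial>lborel)"
proof -
  have "distr lborel borel (\<lambda>x::'a. k + s *\<^sub>R x) = lborel" if "\<bar>s\<bar> = 1" for s
    using that lborel_affine[of s k] by (simp add: density_1)
  from this[of "-1"] this[of 1] have d: "distr lborel borel (\<lambda>x::'a. k - x) = lborel" "distr lborel borel (\<lambda>x::'a. k + x) = lborel" by simp_all
  have [measurable]: "f \<in> borel_measurable borel" using assms by auto
  show "integrable lborel (\<lambda>q. f (k + q))"
    using integrable_distr[of "\<lambda>x. k + x" lborel borel f] assms d by simp
  show "integrable lborel (\<lambda>q. f (k - q))"
    using integrable_distr[of "\<lambda>x. k - x" lborel borel f] assms d by simp
  show "(\<integral>q. f (k - q) \<partial>lborel) = (\<integral>q. f q \<partial>lborel)"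
    using integral_distr[of "\<lambda>x. k - x" lborel borel f] d by simp
qed

text \<open>
  The products that occur are convolutions of integrable functions, which are finite only almost
  everywhere. This is needed before differences of collision integrals can be estimated under the
  integral sign.
\<close>

lemma R_density_integrable_AE:
  fixes f :: "real^'n \<Rightarrow> real"
  assumes f: "integrable lborel f" and nn: "\<And>x. 0 \<le> f x"
  shows "AE k in lborel. integrable lborel (\<lambda>q. R_density lam1 lam2 \<CC> f k q (k - q))
       \<and> integrable lborel (\<lambda>q. R_density lam1 lam2 \<CC> f (k + q) k q)"
proof -
  define m where "m = (\<integral>p. f p \<partial>lborel)"
  have [measurable]: "f \<in> borel_measurable borel" using f by auto
  have m0: "0 \<le> m" unfolding m_def using nn by simp
  show ?thesis
  proof (cases "m = 0")
    case True
    then show ?thesis unfolding R_density_eq_coll_kernel m_def[symmetric] by simp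
  next
    case False
    with m0 have m: "0 < m" by simp
    have b: "norm (coll_kernel lam1 lam2 \<CC> m p q r * (a - b - c)) \<le> norm (\<CC>\<^sup>2 / 2 * norm s * (1 / m) * (a + b + c))"
      if "s \<in> {p, q, r}" "0 \<le> a" "0 \<le> b" "0 \<le> c" for p q r s :: "real^'n" and a b c
    proof -
      have "norm (coll_kernel lam1 lam2 \<CC> m p q r * (a - b - c)) = coll_kernel lam1 lam2 \<CC> m p q r * \<bar>a - b - c\<bar>"
        by (simp add: abs_mult abs_of_nonneg[OF coll_kernel_nonneg[OF m0]])
      also have "\<dots> \<le> (\<CC>\<^sup>2 / 2 * norm s * (1 / m)) * (a + b + c)"
        using that m by (intro mult_mono coll_kernel_le) auto
      finally show ?thesis using that m by simp
    qed
    show ?thesis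
      using convolution_integrable_AE[OF f f]
    proof eventually_elim
      case (elim k)
      have 1: "integrable lborel (\<lambda>q. \<CC>\<^sup>2 / 2 * norm k * (1 / m) * (f q * f (k - q) + f k * f q + f k * f (k - q)))"
        using elim integrable_translate[OF f, of k] f by (intro integrable_mult_right integrable_add) auto
      have 2: "integrable lborel (\<lambda>q. \<CC>\<^sup>2 / 2 * norm k * (1 / m) * (f k * f q + f (k + q) * f k + f (k + q) * f q))"
        using elim integrable_translate[OF f, of k] f by (intro integrable_mult_right integrable_add) auto
      show ?case unfolding R_density_eq_coll_kernel m_def[symmetric]
        by (intro conjI Bochner_Integration.integrable_bound[OF 1] Bochner_Integration.integrable_bound[OF 2] AE_I2 b)
           (auto intro: nn mult_nonneg_nonneg)
    qed
  qed
qed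

lemma ennreal_abs_integral_diff_le:
  fixes u v :: "'b \<Rightarrow> real"
  assumes "integrable M u" "integrable M v" "\<And>x. \<bar>u x - v x\<bar> \<le> w x" "w \<in> borel_measurable M"
  shows "ennreal \<bar>(\<integral>x. u x \<partial>M) - (\<integral>x. v x \<partial>M)\<bar> \<le> (\<integral>\<^sup>+x. ennreal (w x) \<partial>M)"
proof -
  have "ennreal \<bar>(\<integral>x. u x \<partial>M) - (\<integral>x. v x \<partial>M)\<bar> = ennreal (norm (\<integral>x. u x - v x \<partial>M))"
    using assms by simp
  also have "\<dots> \<le> (\<integral>\<^sup>+x. norm (u x - v x) \<partial>M)"
    using assms by (intro integral_norm_bound_ennreal) auto
  also have "\<dots> \<le> (\<integral>\<^sup>+x. ennreal (w x) \<partial>M)"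
    using assms(3) by (intro nn_integral_mono) (auto intro: ennreal_leI)
  finally show ?thesis .
qed

section \<open>Estimates for the collision operator\<close>

text \<open>
  The common bound for all contributions to a weighted norm of \<open>Q\<close>, once the outgoing weight has been
  moved to the arguments.
\<close>

definition pair_moment :: "('a::euclidean_space \<Rightarrow> real) \<Rightarrow> ('a \<Rightarrow> 'a \<Rightarrow> real) \<Rightarrow> ennreal" where
  "pair_moment W \<Psi> = (\<integral>\<^sup>+x. \<integral>\<^sup>+y. ennreal ((W x + W y) * \<Psi> x y) \<partial>lborel \<partial>lborel)"

text \<open>
  This reduces every estimate of \<open>Q\<close> to a pointwise bound of single products. The constant \<open>9\<close>
  counts products: three in the first collision integral and three in each of the two others. The
  weight \<open>W\<close> on the outgoing side gains one power of \<open>|k|\<close> from the kernel.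
\<close>

lemma collision_diff_le_pair_moment:
  fixes f g :: "real^'n \<Rightarrow> real" and \<Psi> :: "real^'n \<Rightarrow> real^'n \<Rightarrow> real"
  assumes f: "integrable lborel f" "\<And>x. 0 \<le> f x" and g: "integrable lborel g" "\<And>x. 0 \<le> g x"
    and \<Psi>m: "case_prod \<Psi> \<in> borel_measurable (lborel \<Otimes>\<^sub>M lborel)" and \<Psi>0: "\<And>x y. 0 \<le> \<Psi> x y" and B: "0 \<le> B"
    and point: "\<And>(p::real^'n) q r s x y. s \<in> {p, q, r} \<Longrightarrow>
       \<bar>coll_kernel lam1 lam2 \<CC> (\<integral>p. f p \<partial>lborel) p q r * (f x * f y) - coll_kernel lam1 lam2 \<CC> (\<integral>p. g p \<partial>lborel) p q r * (g x * g y)\<bar>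
         \<le> B * norm s * \<Psi> x y"
    and W: "W \<in> borel_measurable borel" "\<And>x. 0 \<le> W x" and V: "doubling D V" "0 \<le> D" and WV: "\<And>k. norm k * W k \<le> V k"
  shows "(\<integral>\<^sup>+k. ennreal (W k * \<bar>collision lam1 lam2 \<CC> f k - collision lam1 lam2 \<CC> g k\<bar>) \<partial>lborel)
           \<le> ennreal (9 * B * D) * pair_moment V \<Psi>"
proof -
  define S where "S k q = (\<Psi> q (k - q) + \<Psi> k q + \<Psi> k (k - q)) + 2 * (\<Psi> k q + \<Psi> (k + q) k + \<Psi> (k + q) q)" for k q
  note [measurable] = W(1) doubling_measurable[OF V(1)]
  note \<Psi>mp = measurable_pairI[OF \<Psi>m]
  have S0: "0 \<le> S k q" for k q unfolding S_def using \<Psi>0 by simp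
  have \<Psi>s [measurable]: "(\<lambda>z. \<Psi> (snd z) (fst z - snd z)) \<in> borel_measurable (lborel \<Otimes>\<^sub>M lborel)"
    "(\<lambda>z. \<Psi> (fst z) (snd z)) \<in> borel_measurable (lborel \<Otimes>\<^sub>M lborel)"
    "(\<lambda>z. \<Psi> (fst z) (fst z - snd z)) \<in> borel_measurable (lborel \<Otimes>\<^sub>M lborel)"
    "(\<lambda>z. \<Psi> (fst z + snd z) (fst z)) \<in> borel_measurable (lborel \<Otimes>\<^sub>M lborel)"
    "(\<lambda>z. \<Psi> (fst z + snd z) (snd z)) \<in> borel_measurable (lborel \<Otimes>\<^sub>M lborel)"
    by (rule \<Psi>mp; measurable)+
  have Sm: "case_prod S \<in> borel_measurable (lborel \<Otimes>\<^sub>M lborel)"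
    unfolding S_def case_prod_beta by measurable
  have Sk: "S k \<in> borel_measurable borel" for k
    using measurable_pairI[OF Sm, of "\<lambda>_. k" lborel "\<lambda>x. x"] by simp
  let ?Q = "collision lam1 lam2 \<CC>" and ?R = "R_density lam1 lam2 \<CC>"
  have R: "\<bar>?R f p q r - ?R g p q r\<bar> \<le> B * norm s * (\<Psi> q r + \<Psi> p q + \<Psi> p r)" if "s \<in> {p, q, r}" for p q r s
  proof -
    let ?a = "coll_kernel lam1 lam2 \<CC> (\<integral>p. f p \<partial>lborel) p q r" and ?b = "coll_kernel lam1 lam2 \<CC> (\<integral>p. g p \<partial>lborel) p q r"
    have "?R f p q r - ?R g p q r = (?a * (f q * f r) - ?b * (g q * g r)) - (?a * (f p * f q) - ?b * (g p * g q))
      - (?a * (f p * f r) - ?b * (g p * g r))"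
      unfolding R_density_eq_coll_kernel by (simp add: algebra_simps)
    then show ?thesis
      using point[OF that, of q r] point[OF that, of p q] point[OF that, of p r]
      by (simp only: distrib_left)
  qed
  have Qle: "AE k in lborel. ennreal \<bar>?Q f k - ?Q g k\<bar> \<le> (\<integral>\<^sup>+q. ennreal (B * norm k * S k q) \<partial>lborel)"
    using R_density_integrable_AE[OF f, of lam1 lam2 \<CC>] R_density_integrable_AE[OF g, of lam1 lam2 \<CC>]
  proof eventually_elim
    case (elim k)
    let ?u = "\<lambda>h q. ?R h k q (k - q) - 2 * ?R h (k + q) k q"
    have Qu: "?Q h k = (\<integral>q. ?u h q \<partial>lborel)"
      if "integrable lborel (\<lambda>q. ?R h k q (k - q)) \<and> integrable lborel (\<lambda>q. ?R h (k + q) k q)" for h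
      using that by (simp add: collision_def)
    have "\<bar>?u f q - ?u g q\<bar> \<le> B * norm k * S k q" for q
      using R[of k k q "k - q"] R[of k "k + q" k q] unfolding S_def distrib_left by simp
    then show ?case unfolding Qu[OF elim(1)] Qu[OF elim(2)]
      using elim Sk by (intro ennreal_abs_integral_diff_le) auto
  qed
  have Wk: "W k * (B * norm k * S k q) \<le> B * V k * S k q" for k q
  proof -
    have "B * S k q * (norm k * W k) \<le> B * S k q * V k"
      using WV[of k] B S0 by (intro mult_left_mono) auto
    then show ?thesis by (simp add: mult_ac)
  qed
  have "(\<integral>\<^sup>+k. ennreal (W k * \<bar>?Q f k - ?Q g k\<bar>) \<partial>lborel)
      \<le> (\<integral>\<^sup>+k. \<integral>\<^sup>+q. ennreal (W k) * ennreal (B * norm k * S k q) \<partial>lborel \<partial>lborel)"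
  proof (rule nn_integral_mono_AE, use Qle in eventually_elim)
    case (elim k)
    have "ennreal (W k * \<bar>?Q f k - ?Q g k\<bar>) \<le> ennreal (W k) * (\<integral>\<^sup>+q. ennreal (B * norm k * S k q) \<partial>lborel)"
      using elim W by (simp add: ennreal_mult mult_left_mono)
    also have "\<dots> = (\<integral>\<^sup>+q. ennreal (W k) * ennreal (B * norm k * S k q) \<partial>lborel)"
      using Sk by (intro nn_integral_cmult[symmetric]) auto
    finally show ?case .
  qed
  also have "\<dots> \<le> (\<integral>\<^sup>+k. \<integral>\<^sup>+q. ennreal (B * V k * S k q) \<partial>lborel \<partial>lborel)"
    using W B S0 Wk by (intro nn_integral_mono) (auto simp flip: ennreal_mult intro!: ennreal_leI)
  finally have 1: "(\<integral>\<^sup>+k. ennreal (W k * \<bar>?Q f k - ?Q g k\<bar>) \<partial>lborel)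
      \<le> (\<integral>\<^sup>+k. \<integral>\<^sup>+q. ennreal (B * V k * S k q) \<partial>lborel \<partial>lborel)" .
  define F where "F x y = ennreal (B * D * ((V x + V y) * \<Psi> x y))" for x y
  have BD: "0 \<le> D * (V x + V y)" for x y
    using doubling_le[OF V(1), of 0 x y] doubling_nonneg[OF V(1), of 0] by simp
  have Fm: "case_prod F \<in> borel_measurable (lborel \<Otimes>\<^sub>M lborel)"
    unfolding F_def case_prod_beta by measurable
  have VF: "ennreal (B * V k * \<Psi> x y) \<le> F x y" if "norm k \<le> norm x + norm y" for k x y
  proof -
    have "B * V k * \<Psi> x y \<le> B * (D * (V x + V y)) * \<Psi> x y"
      using doubling_le[OF V(1) that] B \<Psi>0 by (intro mult_right_mono mult_left_mono) auto
    then show ?thesis unfolding F_def by (intro ennreal_leI) (simp add: mult_ac)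
  qed
  have S_le: "ennreal (B * V k * S k q) \<le> F q (k - q) + F k q + F k (k - q) + (F k q + F k q)
       + (F (k + q) k + F (k + q) k) + (F (k + q) q + F (k + q) q)" for k q
  proof -
    have nn: "0 \<le> B * V k * \<Psi> x y" for x y using B doubling_nonneg[OF V(1)] \<Psi>0 by simp
    have "ennreal (B * V k * S k q) = ennreal (B * V k * \<Psi> q (k - q)) + ennreal (B * V k * \<Psi> k q) + ennreal (B * V k * \<Psi> k (k - q))
      + (ennreal (B * V k * \<Psi> k q) + ennreal (B * V k * \<Psi> k q)) + (ennreal (B * V k * \<Psi> (k + q) k) + ennreal (B * V k * \<Psi> (k + q) k))
      + (ennreal (B * V k * \<Psi> (k + q) q) + ennreal (B * V k * \<Psi> (k + q) q))"
      using nn by (simp add: S_def algebra_simps flip: ennreal_plus)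
    moreover have "norm k \<le> norm q + norm (k - q)" "norm k \<le> norm (k + q) + norm q"
      using norm_triangle_ineq[of q "k - q"] norm_triangle_ineq4[of "k + q" q] by simp_all
    ultimately show ?thesis by (auto intro!: add_mono VF)
  qed
  have Fi: "(\<lambda>q. F q (k - q)) \<in> borel_measurable lborel" "F k \<in> borel_measurable lborel"
     "(\<lambda>q. F k (k - q)) \<in> borel_measurable lborel" "(\<lambda>q. F (k + q) k) \<in> borel_measurable lborel"
     "(\<lambda>q. F (k + q) q) \<in> borel_measurable lborel" for k
    by (rule measurable_pairI[OF Fm]; measurable)+
  have Fo: "(\<lambda>k. \<integral>\<^sup>+q. F q (k - q) \<partial>lborel) \<in> borel_measurable lborel" "(\<lambda>k. \<integral>\<^sup>+q. F k q \<partial>lborel) \<in> borel_measurable lborel"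
     "(\<lambda>k. \<integral>\<^sup>+q. F k (k - q) \<partial>lborel) \<in> borel_measurable lborel" "(\<lambda>k. \<integral>\<^sup>+q. F (k + q) k \<partial>lborel) \<in> borel_measurable lborel"
     "(\<lambda>k. \<integral>\<^sup>+q. F (k + q) q \<partial>lborel) \<in> borel_measurable lborel"
    by (rule lborel.borel_measurable_nn_integral, unfold case_prod_beta, rule measurable_pairI[OF Fm]; measurable)+
  have "(\<integral>\<^sup>+k. \<integral>\<^sup>+q. ennreal (B * V k * S k q) \<partial>lborel \<partial>lborel)
     \<le> (\<integral>\<^sup>+k. \<integral>\<^sup>+q. F q (k - q) + F k q + F k (k - q) + (F k q + F k q)
       + (F (k + q) k + F (k + q) k) + (F (k + q) q + F (k + q) q) \<partial>lborel \<partial>lborel)"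
    by (intro nn_integral_mono S_le)
  also have "\<dots> = 9 * (\<integral>\<^sup>+x. \<integral>\<^sup>+y. F x y \<partial>lborel \<partial>lborel)"
  proof -
    let ?I = "\<integral>\<^sup>+x. \<integral>\<^sup>+y. F x y \<partial>lborel \<partial>lborel"
    have "(\<integral>\<^sup>+k. \<integral>\<^sup>+q. F q (k - q) + F k q + F k (k - q) + (F k q + F k q)
       + (F (k + q) k + F (k + q) k) + (F (k + q) q + F (k + q) q) \<partial>lborel \<partial>lborel)
       = ?I + ?I + ?I + (?I + ?I) + (?I + ?I) + (?I + ?I)"
      using Fi Fo by (simp add: nn_integral_add nn_integral_pair_maps[OF Fm])
    also have "\<dots> = (1 + 1 + 1 + (1 + 1) + (1 + 1) + (1 + 1)) * ?I" by (simp only: distrib_right mult_1_left)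
    also have "\<dots> = 9 * ?I" by simp
    finally show ?thesis .
  qed
  also have "\<dots> = ennreal (9 * B * D) * pair_moment V \<Psi>"
  proof -
    have "(\<integral>\<^sup>+x. \<integral>\<^sup>+y. F x y \<partial>lborel \<partial>lborel)
        = (\<integral>\<^sup>+x. ennreal (B * D) * \<integral>\<^sup>+y. ennreal ((V x + V y) * \<Psi> x y) \<partial>lborel \<partial>lborel)"
    proof (rule nn_integral_cong)
      fix x
      have [measurable]: "\<Psi> x \<in> borel_measurable lborel" by (rule \<Psi>mp) measurable
      show "(\<integral>\<^sup>+y. F x y \<partial>lborel) = ennreal (B * D) * (\<integral>\<^sup>+y. ennreal ((V x + V y) * \<Psi> x y) \<partial>lborel)"
        unfolding F_def using B V(2) \<Psi>0 doubling_nonneg[OF V(1)]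
        by (simp add: ennreal_mult nn_integral_cmult)
    qed
    also have "\<dots> = ennreal (B * D) * pair_moment V \<Psi>"
      unfolding pair_moment_def by (rule nn_integral_cmult) measurable
    finally show ?thesis using B V(2) by (simp add: ennreal_mult mult.assoc)
  qed
  finally show ?thesis using 1 by simp
qed


lemma collision_eq_0:
  assumes "(\<integral>p. f p \<partial>lborel) = 0"
  shows "collision lam1 lam2 \<CC> f k = 0"
  unfolding collision_def R_density_eq_coll_kernel assms by simp

lemma pair_moment_product:
  fixes u v V :: "'a::euclidean_space \<Rightarrow> real"
  assumes u: "integrable lborel u" "\<And>x. 0 \<le> u x" and v: "integrable lborel v" "\<And>x. 0 \<le> v x"
    and V: "\<And>x. 0 \<le> V x" and Vu: "integrable lborel (\<lambda>x. V x * u x)" and Vv: "integrable lborel (\<lambda>x. V x * v x)"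
    and Vm: "V \<in> borel_measurable borel"
  shows "pair_moment V (\<lambda>x y. u x * v y) =
     ennreal ((\<integral>x. V x * u x \<partial>lborel) * (\<integral>x. v x \<partial>lborel) + (\<integral>x. u x \<partial>lborel) * (\<integral>x. V x * v x \<partial>lborel))"
proof -
  note [measurable] = borel_measurable_integrable[OF u(1)] borel_measurable_integrable[OF v(1)] Vm
  have "(\<integral>\<^sup>+y. ennreal ((V x + V y) * (u x * v y)) \<partial>lborel)
     = ennreal (V x * u x) * ennreal (\<integral>x. v x \<partial>lborel) + ennreal (u x) * ennreal (\<integral>x. V x * v x \<partial>lborel)" for x
  proof -
    have "(\<integral>\<^sup>+y. ennreal ((V x + V y) * (u x * v y)) \<partial>lborel)
        = (\<integral>\<^sup>+y. ennreal (V x * u x) * ennreal (v y) + ennreal (u x) * ennreal (V y * v y) \<partial>lborel)"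
      using u v V by (intro nn_integral_cong) (simp add: algebra_simps flip: ennreal_plus ennreal_mult)
    also have "\<dots> = ennreal (V x * u x) * (\<integral>\<^sup>+y. ennreal (v y) \<partial>lborel) + ennreal (u x) * (\<integral>\<^sup>+y. ennreal (V y * v y) \<partial>lborel)"
      by (simp add: nn_integral_add nn_integral_cmult)
    finally show ?thesis
      using nn_integral_eq_integral[OF v(1)] nn_integral_eq_integral[OF Vv] v V by simp
  qed
  then have "pair_moment V (\<lambda>x y. u x * v y) = (\<integral>\<^sup>+x. ennreal (V x * u x) * ennreal (\<integral>x. v x \<partial>lborel) + ennreal (u x) * ennreal (\<integral>x. V x * v x \<partial>lborel) \<partial>lborel)"
    unfolding pair_moment_def by simp
  also have "\<dots> = (\<integral>\<^sup>+x. ennreal (V x * u x) \<partial>lborel) * ennreal (\<integral>x. v x \<partial>lborel) + (\<integral>\<^sup>+x. ennreal (u x) \<partial>lborel) * ennreal (\<integral>x. V x * v x \<partial>lborel)"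
    by (simp add: nn_integral_add nn_integral_multc)
  also have "\<dots> = ennreal (\<integral>x. V x * u x \<partial>lborel) * ennreal (\<integral>x. v x \<partial>lborel) + ennreal (\<integral>x. u x \<partial>lborel) * ennreal (\<integral>x. V x * v x \<partial>lborel)"
    using nn_integral_eq_integral[OF u(1)] nn_integral_eq_integral[OF Vu] u V by simp
  finally show ?thesis using u v V by (simp flip: ennreal_plus ennreal_mult)
qed

text \<open>
  The bound is linear in \<open>f\<close>, although \<open>Q\<close> is quadratic: one of the two masses cancels the \<open>1 / m\<close>
  of the kernel. It is the case of the previous estimate in which the second function vanishes.
\<close>

lemma collision_le:
  fixes f :: "real^'n \<Rightarrow> real"
  assumes f: "integrable lborel f" "\<And>x. 0 \<le> f x"
    and W: "W \<in> borel_measurable borel" "\<And>x. 0 \<le> W x" and V: "doubling D V" "0 \<le> D" and WV: "\<And>k. norm k * W k \<le> V k"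
    and Vf: "integrable lborel (\<lambda>k. V k * f k)"
  shows "(\<integral>\<^sup>+k. ennreal (W k * \<bar>collision lam1 lam2 \<CC> f k\<bar>) \<partial>lborel) \<le> ennreal (9 * \<CC>\<^sup>2 * D * (\<integral>k. V k * f k \<partial>lborel))"
proof -
  define m where "m = (\<integral>p. f p \<partial>lborel)"
  have m0: "0 \<le> m" unfolding m_def using f by simp
  note [measurable] = borel_measurable_integrable[OF f(1)]
  show ?thesis
  proof (cases "m = 0")
    case True
    then show ?thesis unfolding m_def by (simp add: collision_eq_0)
  next
    case False
    with m0 have m: "0 < m" by simp
    have "(\<integral>\<^sup>+k. ennreal (W k * \<bar>collision lam1 lam2 \<CC> f k - collision lam1 lam2 \<CC> (\<lambda>_. 0) k\<bar>) \<partial>lborel)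
        \<le> ennreal (9 * (\<CC>\<^sup>2 / 2) * D) * pair_moment V (\<lambda>x y. (f x / m) * f y)"
    proof (rule collision_diff_le_pair_moment)
      fix p q r s :: "real^'n" and x y :: "real^'n" assume s: "s \<in> {p, q, r}"
      have "coll_kernel lam1 lam2 \<CC> m p q r * (f x * f y) \<le> (\<CC>\<^sup>2 / 2 * norm s * (1 / m)) * (f x * f y)"
        using f by (intro mult_right_mono coll_kernel_le m s) auto
      then show "\<bar>coll_kernel lam1 lam2 \<CC> (\<integral>p. f p \<partial>lborel) p q r * (f x * f y) - coll_kernel lam1 lam2 \<CC> (\<integral>p. 0 \<partial>lborel) p q r * (0 * 0)\<bar>
         \<le> \<CC>\<^sup>2 / 2 * norm s * (f x / m * f y)"
        using f coll_kernel_nonneg[OF m0, of lam1 lam2 \<CC> p q r] by (simp flip: m_def)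
    qed (use f W V WV m in auto)
    also have "pair_moment V (\<lambda>x y. (f x / m) * f y) = ennreal ((\<integral>x. V x * (f x / m) \<partial>lborel) * m + (\<integral>x. f x / m \<partial>lborel) * (\<integral>x. V x * f x \<partial>lborel))"
      unfolding m_def using f m V Vf doubling_nonneg[OF V(1)] doubling_measurable[OF V(1)]
      by (intro pair_moment_product) (auto simp: m_def)
    also have "(\<integral>x. V x * (f x / m) \<partial>lborel) * m + (\<integral>x. f x / m \<partial>lborel) * (\<integral>x. V x * f x \<partial>lborel) = 2 * (\<integral>x. V x * f x \<partial>lborel)"
      using m by (simp flip: m_def)
    also have "ennreal (9 * (\<CC>\<^sup>2 / 2) * D) * ennreal (2 * (\<integral>x. V x * f x \<partial>lborel)) = ennreal (9 * \<CC>\<^sup>2 * D * (\<integral>k. V k * f k \<partial>lborel))"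
      using V(2) f doubling_nonneg[OF V(1)] by (simp flip: ennreal_mult)
    finally show ?thesis by (simp add: collision_eq_0)
  qed
qed

text \<open>
  With a weight the Lipschitz constant involves the ratio of moment and mass. For a constant weight
  this ratio is a constant, which gives the global Lipschitz bound below.
\<close>

lemma collision_diff_le:
  fixes f g :: "real^'n \<Rightarrow> real"
  assumes f: "integrable lborel f" "\<And>x. 0 \<le> f x" and g: "integrable lborel g" "\<And>x. 0 \<le> g x"
    and mf: "0 < (\<integral>x. f x \<partial>lborel)" and mg: "0 < (\<integral>x. g x \<partial>lborel)"
    and W: "W \<in> borel_measurable borel" "\<And>x. 0 \<le> W x" and V: "doubling D V" "0 \<le> D" and WV: "\<And>k. norm k * W k \<le> V k"
    and Vf: "integrable lborel (\<lambda>k. V k * f k)" and Vg: "integrable lborel (\<lambda>k. V k * g k)"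
  shows "(\<integral>\<^sup>+k. ennreal (W k * \<bar>collision lam1 lam2 \<CC> f k - collision lam1 lam2 \<CC> g k\<bar>) \<partial>lborel)
    \<le> ennreal (9 * \<CC>\<^sup>2 * D * ((\<integral>k. V k * \<bar>f k - g k\<bar> \<partial>lborel) + (\<integral>k. \<bar>f k - g k\<bar> \<partial>lborel) *
          ((\<integral>k. V k * f k \<partial>lborel) / (\<integral>k. f k \<partial>lborel) + (\<integral>k. V k * g k \<partial>lborel) / (\<integral>k. g k \<partial>lborel))))"
proof -
  define a b where "a = (\<integral>p. f p \<partial>lborel)" and "b = (\<integral>p. g p \<partial>lborel)"
  define h where "h x = \<bar>f x - g x\<bar>" for x
  define c where "c = \<bar>a - b\<bar> / (a * b)"
  define \<Psi> where "\<Psi> x y = f x * (h y / a) + h x * (g y / b) + f x * (c * g y)" for x y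
  define Vf' Vg' Vh H where "Vf' = (\<integral>k. V k * f k \<partial>lborel)" and "Vg' = (\<integral>k. V k * g k \<partial>lborel)"
    and "Vh = (\<integral>k. V k * h k \<partial>lborel)" and "H = (\<integral>k. h k \<partial>lborel)"
  have a: "0 < a" and b: "0 < b" using mf mg by (auto simp: a_def b_def)
  have c: "0 \<le> c" using a b by (simp add: c_def)
  have V0: "0 \<le> V x" for x by (rule doubling_nonneg[OF V(1)])
  have h: "integrable lborel h" "0 \<le> h x" for x using f g by (auto simp: h_def[abs_def])
  note [measurable] = borel_measurable_integrable[OF f(1)] borel_measurable_integrable[OF g(1)]
     borel_measurable_integrable[OF h(1)] doubling_measurable[OF V(1)]
  have Vhi: "integrable lborel (\<lambda>k. V k * h k)"
  proof (rule Bochner_Integration.integrable_bound[OF Bochner_Integration.integrable_add[OF Vf Vg]])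
    have "V x * h x \<le> V x * (f x + g x)" for x
      using f(2)[of x] g(2)[of x] V0 by (intro mult_left_mono) (auto simp: h_def)
    then show "AE x in lborel. norm (V x * h x) \<le> norm (V x * f x + V x * g x)"
      using f g h V0 by (simp add: distrib_left)
  qed measurable
  have "(\<integral>\<^sup>+k. ennreal (W k * \<bar>collision lam1 lam2 \<CC> f k - collision lam1 lam2 \<CC> g k\<bar>) \<partial>lborel)
      \<le> ennreal (9 * (\<CC>\<^sup>2 / 2) * D) * pair_moment V \<Psi>"
  proof (rule collision_diff_le_pair_moment[OF f g])
    show "case_prod \<Psi> \<in> borel_measurable (lborel \<Otimes>\<^sub>M lborel)"
      unfolding \<Psi>_def case_prod_beta by measurable
    show "0 \<le> \<Psi> x y" for x y using f g h a b c by (simp add: \<Psi>_def)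
    fix p q r s :: "real^'n" and x y :: "real^'n" assume s: "s \<in> {p, q, r}"
    have "\<Psi> x y = f x * \<bar>f y - g y\<bar> / a + \<bar>f x - g x\<bar> * g y / b + \<bar>a - b\<bar> * (f x * g y) / (a * b)"
      by (simp add: \<Psi>_def h_def c_def)
    then show "\<bar>coll_kernel lam1 lam2 \<CC> (\<integral>p. f p \<partial>lborel) p q r * (f x * f y) - coll_kernel lam1 lam2 \<CC> (\<integral>p. g p \<partial>lborel) p q r * (g x * g y)\<bar>
       \<le> \<CC>\<^sup>2 / 2 * norm s * \<Psi> x y"
      using coll_kernel_product_diff_le[OF a b s f(2)[of x] g(2)[of y], of lam1 lam2 \<CC> "f y" "g x"]
      by (simp only: a_def b_def)
  qed (use W V WV in auto)
  also have "pair_moment V \<Psi> = pair_moment V (\<lambda>x y. f x * (h y / a)) + pair_moment V (\<lambda>x y. h x * (g y / b))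
        + pair_moment V (\<lambda>x y. f x * (c * g y))"
  proof -
    have "ennreal ((V x + V y) * \<Psi> x y) = ennreal ((V x + V y) * (f x * (h y / a))) + ennreal ((V x + V y) * (h x * (g y / b)))
        + ennreal ((V x + V y) * (f x * (c * g y)))" for x y
      using f g h a b c V0 by (simp add: \<Psi>_def distrib_left flip: ennreal_plus)
    then show ?thesis unfolding pair_moment_def by (simp add: nn_integral_add)
  qed
  also have "pair_moment V (\<lambda>x y. f x * (h y / a)) = ennreal (Vf' * (H / a) + a * (Vh / a))"
    using f h a V Vf Vhi V0 by (subst pair_moment_product) (auto simp: Vf'_def H_def a_def Vh_def)
  also have "pair_moment V (\<lambda>x y. h x * (g y / b)) = ennreal (Vh * (b / b) + H * (Vg' / b))"
    using g h b V Vg Vhi V0 by (subst pair_moment_product) (auto simp: Vg'_def H_def b_def Vh_def)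
  also have "pair_moment V (\<lambda>x y. f x * (c * g y)) = ennreal (Vf' * (c * b) + a * (c * Vg'))"
    using f g h b c V Vf Vg V0 by (subst pair_moment_product) (auto simp: Vg'_def Vf'_def H_def b_def a_def mult.left_commute[of _ c])
  also have "ennreal (9 * (\<CC>\<^sup>2 / 2) * D) * (ennreal (Vf' * (H / a) + a * (Vh / a)) + ennreal (Vh * (b / b) + H * (Vg' / b))
      + ennreal (Vf' * (c * b) + a * (c * Vg'))) \<le> ennreal (9 * \<CC>\<^sup>2 * D * (Vh + H * (Vf' / a + Vg' / b)))"
  proof -
    have nn: "0 \<le> Vf'" "0 \<le> Vg'" "0 \<le> Vh" "0 \<le> H" using f g h V0 by (auto simp: Vf'_def Vg'_def Vh_def H_def)
    have "a - b = (\<integral>x. f x - g x \<partial>lborel)" using f g by (simp add: a_def b_def)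
    then have abH: "\<bar>a - b\<bar> \<le> H"
      unfolding H_def h_def using integral_norm_bound[of lborel "\<lambda>x. f x - g x"] by simp
    have "Vf' * (c * b) + a * (c * Vg') = \<bar>a - b\<bar> * (Vf' / a + Vg' / b)" using a b by (simp add: c_def field_simps)
    also have "\<dots> \<le> H * (Vf' / a + Vg' / b)" using abH nn a b by (intro mult_right_mono) auto
    moreover have "(Vf' * (H / a) + a * (Vh / a)) + (Vh * (b / b) + H * (Vg' / b)) = 2 * Vh + H * (Vf' / a + Vg' / b)"
      using a b by (simp add: distrib_left)
    ultimately have "(Vf' * (H / a) + a * (Vh / a)) + (Vh * (b / b) + H * (Vg' / b)) + (Vf' * (c * b) + a * (c * Vg'))
       \<le> 2 * (Vh + H * (Vf' / a + Vg' / b))" by (simp add: distrib_left)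
    moreover have "9 * (\<CC>\<^sup>2 / 2) * D * (2 * Y) = 9 * \<CC>\<^sup>2 * D * Y" "0 \<le> 9 * (\<CC>\<^sup>2 / 2) * D" for Y using V(2) by simp_all
    ultimately
    have "9 * (\<CC>\<^sup>2 / 2) * D * ((Vf' * (H / a) + a * (Vh / a)) + (Vh * (b / b) + H * (Vg' / b)) + (Vf' * (c * b) + a * (c * Vg')))
       \<le> 9 * \<CC>\<^sup>2 * D * (Vh + H * (Vf' / a + Vg' / b))" by (metis mult_left_mono)
    then show ?thesis using nn a b c V(2) by (auto simp flip: ennreal_plus ennreal_mult intro!: ennreal_leI)
  qed
  finally show ?thesis unfolding Vh_def H_def h_def a_def b_def Vf'_def Vg'_def by simp
qed

text \<open>
  If one of the masses vanishes, so does its collision term, and the distance of the two functions is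
  the mass of the other one; then the linear bound takes the place of the difference estimate.
\<close>

lemma collision_Lipschitz:
  fixes f g :: "real^'n \<Rightarrow> real"
  assumes f: "integrable lborel f" "\<And>x. 0 \<le> f x" and g: "integrable lborel g" "\<And>x. 0 \<le> g x"
    and W: "W \<in> borel_measurable borel" "\<And>x. 0 \<le> W x" and e: "\<And>k. norm k * W k \<le> e" and "0 \<le> e"
  shows "(\<integral>\<^sup>+k. ennreal (W k * \<bar>collision lam1 lam2 \<CC> f k - collision lam1 lam2 \<CC> g k\<bar>) \<partial>lborel)
    \<le> ennreal (27 * \<CC>\<^sup>2 * e * (\<integral>k. \<bar>f k - g k\<bar> \<partial>lborel))"
proof -
  have w: "doubling 1 (\<lambda>_::real^'n. e)" using \<open>0 \<le> e\<close> by (rule doubling_const)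
  have zero: "(\<integral>\<^sup>+k. ennreal (W k * \<bar>collision lam1 lam2 \<CC> u k - collision lam1 lam2 \<CC> v k\<bar>) \<partial>lborel)
    \<le> ennreal (27 * \<CC>\<^sup>2 * e * (\<integral>k. \<bar>u k - v k\<bar> \<partial>lborel))"
    if u: "integrable lborel u" "\<And>x. 0 \<le> u x" and v: "integrable lborel v" "\<And>x. 0 \<le> v x"
      and v0: "(\<integral>x. v x \<partial>lborel) = 0" for u v :: "real^'n \<Rightarrow> real"
  proof -
    have ae: "AE x in lborel. v x = 0" using v v0 by (subst (asm) integral_nonneg_eq_0_iff_AE) auto
    have "(\<integral>k. \<bar>u k - v k\<bar> \<partial>lborel) = (\<integral>k. u k \<partial>lborel)"
      using u v by (intro integral_cong_AE) (use ae in \<open>auto elim!: eventually_mono\<close>)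
    moreover have "(\<integral>\<^sup>+k. ennreal (W k * \<bar>collision lam1 lam2 \<CC> u k\<bar>) \<partial>lborel) \<le> ennreal (9 * \<CC>\<^sup>2 * 1 * (\<integral>k. e * u k \<partial>lborel))"
      using u W w e by (intro collision_le) auto
    moreover have "9 * \<CC>\<^sup>2 * 1 * (\<integral>k. e * u k \<partial>lborel) \<le> 27 * \<CC>\<^sup>2 * e * (\<integral>k. u k \<partial>lborel)"
      using u \<open>0 \<le> e\<close> by (simp add: mult_right_mono)
    ultimately show ?thesis using collision_eq_0[OF v0] by (auto intro: order_trans ennreal_leI)
  qed
  have "0 \<le> (\<integral>x. f x \<partial>lborel)" "0 \<le> (\<integral>x. g x \<partial>lborel)" using f g by simp_all
  then consider "(\<integral>x. g x \<partial>lborel) = 0" | "(\<integral>x. f x \<partial>lborel) = 0" | "0 < (\<integral>x. f x \<partial>lborel)" "0 < (\<integral>x. g x \<partial>lborel)"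
    by linarith
  then show ?thesis
  proof cases
    case 1 then show ?thesis by (intro zero f g)
  next
    case 2 then show ?thesis using zero[OF g f] by (simp add: abs_minus_commute)
  next
    case 3
    have "(\<integral>\<^sup>+k. ennreal (W k * \<bar>collision lam1 lam2 \<CC> f k - collision lam1 lam2 \<CC> g k\<bar>) \<partial>lborel)
      \<le> ennreal (9 * \<CC>\<^sup>2 * 1 * ((\<integral>k. e * \<bar>f k - g k\<bar> \<partial>lborel) + (\<integral>k. \<bar>f k - g k\<bar> \<partial>lborel) *
          ((\<integral>k. e * f k \<partial>lborel) / (\<integral>k. f k \<partial>lborel) + (\<integral>k. e * g k \<partial>lborel) / (\<integral>k. g k \<partial>lborel))))"
      using f g w W e 3 by (intro collision_diff_le) auto
    also have "\<dots> = ennreal (27 * \<CC>\<^sup>2 * e * (\<integral>k. \<bar>f k - g k\<bar> \<partial>lborel))"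
      using 3 by (simp add: algebra_simps)
    finally show ?thesis .
  qed
qed

text \<open>
  Only the products in which \<open>f k\<close> enters with a negative sign are kept; integrating the kernel bound
  against \<open>f\<close> cancels the mass. If a collision integral does not converge, its value is \<open>0\<close> and the
  bound holds trivially.
\<close>

lemma collision_loss_bound:
  fixes f :: "real^'n \<Rightarrow> real"
  assumes nn: "\<And>x. 0 \<le> f x"
  shows "- (2 * \<CC>\<^sup>2 * norm k * f k) \<le> collision lam1 lam2 \<CC> f k"
proof -
  define m where "m = (\<integral>p. f p \<partial>lborel)"
  have m0: "0 \<le> m" unfolding m_def using nn by simp
  show ?thesis
  proof (cases "m = 0")
    case True
    then show ?thesis using nn by (simp add: collision_eq_0 m_def)
  next
    case False
    with m0 have m: "0 < m" by simp
    have f: "integrable lborel f" using False not_integrable_integral_eq m_def by blast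
    let ?B = "\<CC>\<^sup>2 / 2 * norm k * (1 / m)"
    have ge: "- (?B * a) \<le> coll_kernel lam1 lam2 \<CC> m p q r * (b - a)"
      if "k \<in> {p, q, r}" "0 \<le> a" "0 \<le> b" for p q r a b
    proof -
      have "coll_kernel lam1 lam2 \<CC> m p q r * a \<le> ?B * a" using that m by (intro mult_right_mono coll_kernel_le) auto
      moreover have "0 \<le> coll_kernel lam1 lam2 \<CC> m p q r * b" using that by (intro mult_nonneg_nonneg coll_kernel_nonneg m0)
      ultimately show ?thesis by (simp add: algebra_simps)
    qed
    have lower: "- c \<le> (\<integral>q. u q \<partial>lborel)" if "integrable lborel v" "(\<integral>q. v q \<partial>lborel) = c" "0 \<le> c" "\<And>q. - v q \<le> u q"
      for u v :: "real^'n \<Rightarrow> real" and c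
    proof (cases "integrable lborel u")
      case True
      then have "(\<integral>q. - v q \<partial>lborel) \<le> (\<integral>q. u q \<partial>lborel)" using that by (intro integral_mono) auto
      then show ?thesis using that by simp
    qed (use that in \<open>simp add: not_integrable_integral_eq\<close>)
    have upper: "(\<integral>q. u q \<partial>lborel) \<le> c" if "integrable lborel v" "(\<integral>q. v q \<partial>lborel) = c" "0 \<le> c" "\<And>q. - v q \<le> - u q"
      for u v :: "real^'n \<Rightarrow> real" and c
      using lower[OF that] by simp
    have 1: "- (\<CC>\<^sup>2 * norm k * f k) \<le> (\<integral>q. R_density lam1 lam2 \<CC> f k q (k - q) \<partial>lborel)"
    proof (rule lower)
      show "integrable lborel (\<lambda>q. ?B * (f k * f q + f k * f (k - q)))"
        using f integrable_translate[OF f, of k] by simp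
      show "(\<integral>q. ?B * (f k * f q + f k * f (k - q)) \<partial>lborel) = \<CC>\<^sup>2 * norm k * f k"
        using f integrable_translate[OF f, of k] m by (simp flip: m_def) 
      show "- (?B * (f k * f q + f k * f (k - q))) \<le> R_density lam1 lam2 \<CC> f k q (k - q)" for q
        using ge[of k q "k - q" "f k * f q + f k * f (k - q)" "f q * f (k - q)"] nn
        by (simp add: R_density_eq_coll_kernel m_def diff_diff_eq)
    qed (use nn in simp)
    have 2: "(\<integral>q. R_density lam1 lam2 \<CC> f (k + q) k q \<partial>lborel) \<le> \<CC>\<^sup>2 / 2 * norm k * f k"
    proof (rule upper)
      show "integrable lborel (\<lambda>q. ?B * (f k * f q))"
        using f by simp
      show "(\<integral>q. ?B * (f k * f q) \<partial>lborel) = \<CC>\<^sup>2 / 2 * norm k * f k"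
        using f m by (simp flip: m_def) 
      show "- (?B * (f k * f q)) \<le> - R_density lam1 lam2 \<CC> f (k + q) k q" for q
        using ge[of "k + q" k q "f k * f q" "f (k + q) * f k + f (k + q) * f q"] nn
        by (simp add: R_density_eq_coll_kernel m_def algebra_simps)
    qed (use nn in simp)
    show ?thesis using 1 2 unfolding collision_def by simp
  qed
qed

lemma collision_cong_AE:
  fixes f g :: "real^'n \<Rightarrow> real"
  assumes [measurable]: "f \<in> borel_measurable borel" "g \<in> borel_measurable borel" and ae: "AE x in lborel. f x = g x"
  shows "AE k in lborel. collision lam1 lam2 \<CC> f k = collision lam1 lam2 \<CC> g k"
proof -
  have m: "(\<integral>p. f p \<partial>lborel) = (\<integral>p. g p \<partial>lborel)" using ae by (intro integral_cong_AE) auto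
  have sh: "AE q in lborel. f (k + s *\<^sub>R q) = g (k + s *\<^sub>R q)" if "\<bar>s\<bar> = 1" for k s
  proof -
    have d: "distr lborel borel (\<lambda>x::real^'n. k + s *\<^sub>R x) = lborel"
      using that lborel_affine[of s k] by (simp add: density_1)
    have "AE x in distr lborel borel (\<lambda>x::real^'n. k + s *\<^sub>R x). f x = g x" unfolding d by (rule ae)
    then show ?thesis by (subst (asm) AE_distr_iff) auto
  qed
  show ?thesis using ae
  proof eventually_elim
    case (elim k)
    have a: "AE q in lborel. f (k - q) = g (k - q)" and b: "AE q in lborel. f (k + q) = g (k + q)"
      using sh[of "-1" k] sh[of 1 k] by simp_all
    have "(\<integral>q. R_density lam1 lam2 \<CC> f k q (k - q) \<partial>lborel) = (\<integral>q. R_density lam1 lam2 \<CC> g k q (k - q) \<partial>lborel)"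
      unfolding R_density_eq_coll_kernel m by (intro integral_cong_AE) (use a ae elim in \<open>measurable, auto elim: eventually_elim2\<close>)
    moreover have "(\<integral>q. R_density lam1 lam2 \<CC> f (k + q) k q \<partial>lborel) = (\<integral>q. R_density lam1 lam2 \<CC> g (k + q) k q \<partial>lborel)"
      unfolding R_density_eq_coll_kernel m by (intro integral_cong_AE) (use b ae elim in \<open>measurable, auto elim: eventually_elim2\<close>)
    ultimately show ?case unfolding collision_def by simp
  qed
qed

section \<open>The Laplace weight in time and Duhamel's formula\<close>

text \<open>
  The measure \<open>e\<^sup>-\<^sup>\<kappa>\<^sup>t dt\<close> on \<open>[0, \<infinity>)\<close>. Integrals against it are Laplace transforms at \<open>\<kappa>\<close>, which
  turn convolution in time into multiplication.
\<close>

definition laplace :: "real \<Rightarrow> real measure" where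
  "laplace \<kappa> = density lborel (\<lambda>t. ennreal (indicator {0..} t * exp (- (\<kappa> * t))))"

lemma sets_laplace [measurable_cong, simp]: "sets (laplace \<kappa>) = sets borel"
  and space_laplace [simp]: "space (laplace \<kappa>) = UNIV"
  by (simp_all add: laplace_def)

lemma nn_integral_laplace:
  "\<phi> \<in> borel_measurable borel \<Longrightarrow>
   (\<integral>\<^sup>+t. \<phi> t \<partial>laplace \<kappa>) = (\<integral>\<^sup>+t. ennreal (indicator {0..} t * exp (- (\<kappa> * t))) * \<phi> t \<partial>lborel)"
  unfolding laplace_def by (subst nn_integral_density) auto

lemma AE_laplace: "(AE t in laplace \<kappa>. Q t) \<longleftrightarrow> (AE t in lborel. 0 \<le> t \<longrightarrow> Q t)"
  unfolding laplace_def by (subst AE_density) (auto simp: indicator_def)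

lemma nn_integral_exp_tail:
  assumes "0 < (b::real)"
  shows "(\<integral>\<^sup>+t. ennreal (exp (- (b * t))) * indicator {s..} t \<partial>lborel) = ennreal (exp (- (b * s)) / b)"
proof -
  have "(\<integral>\<^sup>+t. ennreal (exp (- (b * t))) * indicator {s..} t \<partial>lborel) = ennreal (0 - (- exp (- (b * s)) / b))"
  proof (rule nn_integral_FTC_atLeast)
    show "((\<lambda>t. - exp (- (b * t)) / b) \<longlongrightarrow> 0) at_top"
    proof -
      have "filterlim (\<lambda>t. - (b * t)) at_bot at_top"
        unfolding filterlim_uminus_at_bot using assms
        by (auto intro!: filterlim_tendsto_pos_mult_at_top[OF tendsto_const] filterlim_ident)
      then have "((\<lambda>t. exp (- (b * t))) \<longlongrightarrow> 0) at_top" by (rule filterlim_compose[OF exp_at_bot])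
      from tendsto_mult_left[OF this, of "- 1 / b"] show ?thesis by simp
    qed
  qed (use assms in \<open>auto intro!: derivative_eq_intros\<close>)
  then show ?thesis by simp
qed

lemma finite_measure_laplace: "0 < \<kappa> \<Longrightarrow> finite_measure (laplace \<kappa>)"
proof (rule finite_measureI)
  assume l: "0 < \<kappa>"
  have "emeasure (laplace \<kappa>) UNIV = (\<integral>\<^sup>+t. 1 \<partial>laplace \<kappa>)" by (subst nn_integral_const) simp
  also have "\<dots> = (\<integral>\<^sup>+t. ennreal (exp (- (\<kappa> * t))) * indicator {0..} t \<partial>lborel)"
    by (subst nn_integral_laplace) (auto intro!: nn_integral_cong simp: indicator_def)
  finally show "emeasure (laplace \<kappa>) (space (laplace \<kappa>)) \<noteq> \<infinity>"
    using nn_integral_exp_tail[OF l] by simp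
qed

text \<open>
  The Laplace transform of \<open>e\<^sup>-\<^sup>a\<^sup>t\<close> is \<open>1 / (a + \<kappa>)\<close>.
\<close>

lemma laplace_Duhamel:
  assumes [measurable]: "\<phi> \<in> borel_measurable borel" and a: "0 \<le> a" and l: "0 < \<kappa>"
  shows "(\<integral>\<^sup>+t. (\<integral>\<^sup>+s. ennreal (indicator {0..t} s * exp (- (a * (t - s)))) * \<phi> s \<partial>lborel) \<partial>laplace \<kappa>)
       = ennreal (1 / (a + \<kappa>)) * (\<integral>\<^sup>+s. \<phi> s \<partial>laplace \<kappa>)"
proof -
  have ind: "indicator {0..t} s = (if 0 \<le> s \<and> s \<le> t then 1 else (0::real))" for s t :: real by auto
  have m [measurable]: "(\<lambda>(t,s). ennreal (indicator {0..t} s * exp (- (a * (t - s)))) * \<phi> s) \<in> borel_measurable (lborel \<Otimes>\<^sub>M lborel)"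
    unfolding ind by measurable
  have [measurable]: "(\<lambda>t. \<integral>\<^sup>+s. ennreal (indicator {0..t} s * exp (- (a * (t - s)))) * \<phi> s \<partial>lborel) \<in> borel_measurable borel"
    using lborel.borel_measurable_nn_integral[OF m] by simp
  let ?w = "\<lambda>t. ennreal (indicator {0..} t * exp (- (\<kappa> * t)))"
  have "(\<integral>\<^sup>+t. (\<integral>\<^sup>+s. ennreal (indicator {0..t} s * exp (- (a * (t - s)))) * \<phi> s \<partial>lborel) \<partial>laplace \<kappa>)
      = (\<integral>\<^sup>+t. (\<integral>\<^sup>+s. ?w t * (ennreal (indicator {0..t} s * exp (- (a * (t - s)))) * \<phi> s) \<partial>lborel) \<partial>lborel)"
    by (subst nn_integral_laplace) (auto intro!: nn_integral_cong simp: ind nn_integral_cmult)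
  also have "\<dots> = (\<integral>\<^sup>+s. (\<integral>\<^sup>+t. ?w t * (ennreal (indicator {0..t} s * exp (- (a * (t - s)))) * \<phi> s) \<partial>lborel) \<partial>lborel)"
    by (rule lborel_swap[symmetric]) (unfold ind, measurable)
  also have "\<dots> = (\<integral>\<^sup>+s. ennreal (1 / (a + \<kappa>)) * (?w s * \<phi> s) \<partial>lborel)"
  proof (rule nn_integral_cong)
    fix s :: real
    have "(\<integral>\<^sup>+t. ?w t * (ennreal (indicator {0..t} s * exp (- (a * (t - s)))) * \<phi> s) \<partial>lborel)
        = (\<integral>\<^sup>+t. (ennreal (indicator {0..} s * exp (a * s)) * \<phi> s) * (ennreal (exp (- ((a + \<kappa>) * t))) * indicator {s..} t) \<partial>lborel)"
    proof (rule nn_integral_cong)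
      fix t :: real
      have e: "exp (- (\<kappa> * t)) * exp (- (a * (t - s))) = exp (a * s) * exp (- ((a + \<kappa>) * t))"
        by (simp add: algebra_simps flip: exp_add)
      show "?w t * (ennreal (indicator {0..t} s * exp (- (a * (t - s)))) * \<phi> s)
        = (ennreal (indicator {0..} s * exp (a * s)) * \<phi> s) * (ennreal (exp (- ((a + \<kappa>) * t))) * indicator {s..} t)"
      proof (cases "0 \<le> s \<and> s \<le> t")
        case True
        then show ?thesis using arg_cong[OF e, of ennreal] by (simp add: ennreal_mult mult_ac)
      qed (auto simp: indicator_def)
    qed
    also have "\<dots> = (ennreal (indicator {0..} s * exp (a * s)) * \<phi> s) * ennreal (exp (- ((a + \<kappa>) * s)) / (a + \<kappa>))"
      using a l by (subst nn_integral_cmult) (auto simp: nn_integral_exp_tail)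
    also have "\<dots> = ennreal (1 / (a + \<kappa>)) * (?w s * \<phi> s)"
    proof -
      have "indicator {0..} s * exp (a * s) * (exp (- ((a + \<kappa>) * s)) / (a + \<kappa>)) = 1 / (a + \<kappa>) * (indicator {0..} s * exp (- (\<kappa> * s)))"
        by (simp add: algebra_simps flip: exp_add)
      then have eqn: "ennreal (indicator {0..} s * exp (a * s)) * ennreal (exp (- ((a + \<kappa>) * s)) / (a + \<kappa>)) = ennreal (1 / (a + \<kappa>)) * ?w s"
        using a l by (simp flip: ennreal_mult)
      have arr: "A * \<phi> s * B = (A * B) * \<phi> s" for A B by (simp only: mult_ac)
      show ?thesis by (subst arr, subst eqn, rule mult.assoc)
    qed
    finally show "(\<integral>\<^sup>+t. ?w t * (ennreal (indicator {0..t} s * exp (- (a * (t - s)))) * \<phi> s) \<partial>lborel)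
      = ennreal (1 / (a + \<kappa>)) * (?w s * \<phi> s)" .
  qed
  also have "\<dots> = ennreal (1 / (a + \<kappa>)) * (\<integral>\<^sup>+s. \<phi> s \<partial>laplace \<kappa>)"
    by (subst nn_integral_cmult) (auto simp: nn_integral_laplace)
  finally show ?thesis .
qed

definition duhamel :: "real \<Rightarrow> real \<Rightarrow> (real \<Rightarrow> real) \<Rightarrow> real \<Rightarrow> real" where
  "duhamel a u p t = exp (- (a * t)) * u + (\<integral>s. indicator {0..t} s * exp (- (a * (t - s))) * p s \<partial>lborel)"

lemma duhamel_nonneg: "0 \<le> u \<Longrightarrow> (\<And>s. 0 \<le> p s) \<Longrightarrow> 0 \<le> duhamel a u p t"
  unfolding duhamel_def by simp

lemma duhamel_ge: "(\<And>s. 0 \<le> p s) \<Longrightarrow> exp (- (a * t)) * u \<le> duhamel a u p t"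
  unfolding duhamel_def by simp

lemma ennreal_integral_le_nn_integral:
  fixes f :: "'a \<Rightarrow> real"
  assumes "\<And>x. 0 \<le> f x"
  shows "ennreal (\<integral>x. f x \<partial>M) \<le> (\<integral>\<^sup>+x. ennreal (f x) \<partial>M)"
proof (cases "integrable M f")
  case True then show ?thesis using nn_integral_eq_integral[OF True] assms by simp
qed (simp add: not_integrable_integral_eq)

lemma duhamel_le:
  assumes u: "0 \<le> u" and p: "\<And>s. 0 \<le> p s"
  shows "ennreal (duhamel a u p t) \<le> ennreal (exp (- (a * t)) * u)
      + (\<integral>\<^sup>+s. ennreal (indicator {0..t} s * exp (- (a * (t - s)))) * ennreal (p s) \<partial>lborel)"
  unfolding duhamel_def using u p
  by (subst ennreal_plus) (auto intro!: add_left_mono order_trans[OF ennreal_integral_le_nn_integral] simp: ennreal_mult simp flip: mult.assoc)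

lemma duhamel_laplace_le:
  assumes u: "0 \<le> u" and p: "\<And>s. 0 \<le> p s" and pm [measurable]: "p \<in> borel_measurable borel" and a: "0 \<le> a" and l: "0 < \<kappa>"
  shows "(\<integral>\<^sup>+t. ennreal (duhamel a u p t) \<partial>laplace \<kappa>) \<le> ennreal (1 / (a + \<kappa>)) * (ennreal u + (\<integral>\<^sup>+s. ennreal (p s) \<partial>laplace \<kappa>))"
proof -
  have ind: "indicator {0..t} s = (if 0 \<le> s \<and> s \<le> t then 1 else (0::real))" for s t :: real by auto
  have m: "(\<lambda>(t,s). ennreal (indicator {0..t} s * exp (- (a * (t - s)))) * ennreal (p s)) \<in> borel_measurable (lborel \<Otimes>\<^sub>M lborel)"
    unfolding ind by measurable
  have [measurable]: "(\<lambda>t. \<integral>\<^sup>+s. ennreal (indicator {0..t} s * exp (- (a * (t - s)))) * ennreal (p s) \<partial>lborel) \<in> borel_measurable borel"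
    using lborel.borel_measurable_nn_integral[OF m] by simp
  have "(\<integral>\<^sup>+t. ennreal (duhamel a u p t) \<partial>laplace \<kappa>) \<le> (\<integral>\<^sup>+t. ennreal (exp (- (a * t)) * u) +
      (\<integral>\<^sup>+s. ennreal (indicator {0..t} s * exp (- (a * (t - s)))) * ennreal (p s) \<partial>lborel) \<partial>laplace \<kappa>)"
    by (intro nn_integral_mono duhamel_le u p)
  also have "\<dots> = (\<integral>\<^sup>+t. ennreal (exp (- (a * t)) * u) \<partial>laplace \<kappa>) + ennreal (1 / (a + \<kappa>)) * (\<integral>\<^sup>+s. ennreal (p s) \<partial>laplace \<kappa>)"
    by (subst nn_integral_add) (auto simp: laplace_Duhamel[OF _ a l])
  also have "(\<integral>\<^sup>+t. ennreal (exp (- (a * t)) * u) \<partial>laplace \<kappa>) = ennreal (1 / (a + \<kappa>)) * ennreal u"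
  proof -
    have "(\<integral>\<^sup>+t. ennreal (exp (- (a * t)) * u) \<partial>laplace \<kappa>)
       = (\<integral>\<^sup>+t. ennreal u * (ennreal (exp (- ((a + \<kappa>) * t))) * indicator {0..} t) \<partial>lborel)"
    proof (subst nn_integral_laplace, measurable, rule nn_integral_cong)
      fix t :: real
      have e: "exp (- (\<kappa> * t)) * (exp (- (a * t)) * u) = u * exp (- ((a + \<kappa>) * t))"
        by (simp add: algebra_simps flip: exp_add)
      show "ennreal (indicator {0..} t * exp (- (\<kappa> * t))) * ennreal (exp (- (a * t)) * u)
          = ennreal u * (ennreal (exp (- ((a + \<kappa>) * t))) * indicator {0..} t)"
        using arg_cong[OF e, of ennreal] u by (auto simp: indicator_def ennreal_mult mult_ac)
    qed
    also have "\<dots> = ennreal u * ennreal (1 / (a + \<kappa>))"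
      using a l by (subst nn_integral_cmult) (auto simp: nn_integral_exp_tail)
    finally show ?thesis by (simp add: mult.commute)
  qed
  finally show ?thesis by (simp add: distrib_left)
qed

lemma nn_integral_laplace_window:
  assumes [measurable]: "\<phi> \<in> borel_measurable borel" and l: "0 < \<kappa>"
  shows "(\<integral>\<^sup>+s. indicator {0..t} s * \<phi> s \<partial>lborel) \<le> ennreal (exp (\<kappa> * t)) * (\<integral>\<^sup>+s. \<phi> s \<partial>laplace \<kappa>)"
proof -
  have "(\<integral>\<^sup>+s. indicator {0..t} s * \<phi> s \<partial>lborel)
      \<le> (\<integral>\<^sup>+s. ennreal (exp (\<kappa> * t)) * (ennreal (indicator {0..} s * exp (- (\<kappa> * s))) * \<phi> s) \<partial>lborel)"
  proof (rule nn_integral_mono)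
    fix s :: real
    show "indicator {0..t} s * \<phi> s \<le> ennreal (exp (\<kappa> * t)) * (ennreal (indicator {0..} s * exp (- (\<kappa> * s))) * \<phi> s)"
    proof (cases "0 \<le> s \<and> s \<le> t")
      case True
      then have "1 \<le> exp (\<kappa> * t) * exp (- (\<kappa> * s))" using l by (simp flip: exp_add)
      then have "ennreal 1 * \<phi> s \<le> ennreal (exp (\<kappa> * t) * exp (- (\<kappa> * s))) * \<phi> s" by (intro mult_right_mono ennreal_leI) auto
      then show ?thesis using True by (simp add: ennreal_mult mult.assoc)
    qed (auto simp: indicator_def)
  qed
  then show ?thesis by (simp add: nn_integral_cmult nn_integral_laplace)
qed

lemma duhamel_integrable:
  assumes p: "\<And>s. 0 \<le> p s" and pm [measurable]: "p \<in> borel_measurable borel" and l: "0 < \<kappa>" and a: "0 \<le> a"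
    and fin: "(\<integral>\<^sup>+s. ennreal (p s) \<partial>laplace \<kappa>) < \<infinity>"
  shows "integrable lborel (\<lambda>s. indicator {0..t} s * p s)"
    and "integrable lborel (\<lambda>s. indicator {0..t} s * exp (- (a * (t - s))) * p s)"
proof -
  have "(\<integral>\<^sup>+s. indicator {0..t} s * ennreal (p s) \<partial>lborel) \<le> ennreal (exp (\<kappa> * t)) * (\<integral>\<^sup>+s. ennreal (p s) \<partial>laplace \<kappa>)"
    by (rule nn_integral_laplace_window) (use l in auto)
  also have "\<dots> < \<infinity>" using fin by (simp add: ennreal_mult_less_top)
  finally have "(\<integral>\<^sup>+s. ennreal (norm (indicator {0..t} s * p s)) \<partial>lborel) < \<infinity>"
    using p by (simp add: ennreal_mult ennreal_indicator)
  then show 1: "integrable lborel (\<lambda>s. indicator {0..t} s * p s)"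
    by (intro integrableI_bounded) auto
  show "integrable lborel (\<lambda>s. indicator {0..t} s * exp (- (a * (t - s))) * p s)"
  proof (rule Bochner_Integration.integrable_bound[OF 1])
    show "AE s in lborel. norm (indicator {0..t} s * exp (- (a * (t - s))) * p s) \<le> norm (indicator {0..t} s * p s)"
      using p a by (auto intro!: AE_I2 simp: indicator_def mult_left_le_one_le)
  qed measurable
qed

lemma duhamel_diff_laplace_le:
  assumes p: "\<And>s. 0 \<le> p s" and pm [measurable]: "p \<in> borel_measurable borel" 
    and q: "\<And>s. 0 \<le> q s" and qm [measurable]: "q \<in> borel_measurable borel"
    and l: "0 < \<kappa>" and a: "0 \<le> a"
    and fp: "(\<integral>\<^sup>+s. ennreal (p s) \<partial>laplace \<kappa>) < \<infinity>" and fq: "(\<integral>\<^sup>+s. ennreal (q s) \<partial>laplace \<kappa>) < \<infinity>"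
  shows "(\<integral>\<^sup>+t. ennreal \<bar>duhamel a u p t - duhamel a u q t\<bar> \<partial>laplace \<kappa>)
    \<le> ennreal (1 / (a + \<kappa>)) * (\<integral>\<^sup>+s. ennreal \<bar>p s - q s\<bar> \<partial>laplace \<kappa>)"
proof -
  have "ennreal \<bar>duhamel a u p t - duhamel a u q t\<bar>
      \<le> (\<integral>\<^sup>+s. ennreal (indicator {0..t} s * exp (- (a * (t - s)))) * ennreal \<bar>p s - q s\<bar> \<partial>lborel)" for t
  proof -
    have "ennreal \<bar>duhamel a u p t - duhamel a u q t\<bar>
      \<le> (\<integral>\<^sup>+s. ennreal (indicator {0..t} s * exp (- (a * (t - s))) * \<bar>p s - q s\<bar>) \<partial>lborel)"
      unfolding duhamel_def add_diff_cancel_left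
      using duhamel_integrable[OF p pm l a fp] duhamel_integrable[OF q qm l a fq]
      by (intro ennreal_abs_integral_diff_le) (auto simp: abs_mult indicator_def simp flip: right_diff_distrib)
    then show ?thesis by (simp add: ennreal_mult)
  qed
  then have "(\<integral>\<^sup>+t. ennreal \<bar>duhamel a u p t - duhamel a u q t\<bar> \<partial>laplace \<kappa>)
    \<le> (\<integral>\<^sup>+t. (\<integral>\<^sup>+s. ennreal (indicator {0..t} s * exp (- (a * (t - s)))) * ennreal \<bar>p s - q s\<bar> \<partial>lborel) \<partial>laplace \<kappa>)"
    by (rule nn_integral_mono)
  then show ?thesis using laplace_Duhamel[OF _ a l, of "\<lambda>s. ennreal \<bar>p s - q s\<bar>"] by simp
qed

text \<open>
  Integrating Duhamel's formula and interchanging the order of integration shows that it solves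
  \<open>D' = p - a D\<close> in integrated form. The computation is done with nonnegative integrals, so that
  Tonelli's theorem applies to a source that is merely integrable in time.
\<close>

lemma duhamel_integral_equation:
  assumes u: "0 \<le> u" and p: "\<And>s. 0 \<le> p s" and pm [measurable]: "p \<in> borel_measurable borel" and a: "0 \<le> a"
    and int: "\<And>t. integrable lborel (\<lambda>s. indicator {0..t} s * p s)"
    and t: "0 \<le> t"
    and D: "D \<in> borel_measurable borel" "\<And>t. 0 \<le> t \<Longrightarrow> D t = duhamel a u p t"
  shows "integrable lborel (\<lambda>s. indicator {0..t} s * D s)"
    and "D t + (\<integral>s. indicator {0..t} s * (a * D s) \<partial>lborel) = u + (\<integral>s. indicator {0..t} s * p s \<partial>lborel)"
proof -
  note [measurable] = D(1)
  have ind: "indicator {0..t} s = (if 0 \<le> s \<and> s \<le> t then 1 else (0::real))" for s t :: real by auto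
  have iexp: "integrable lborel (\<lambda>s. indicator {0..t} s * exp (- (a * (t - s))) * p s)" for t
  proof (rule Bochner_Integration.integrable_bound[OF int[of t]])
    show "AE s in lborel. norm (indicator {0..t} s * exp (- (a * (t - s))) * p s) \<le> norm (indicator {0..t} s * p s)"
      using p a by (auto intro!: AE_I2 simp: indicator_def mult_left_le_one_le)
  qed measurable
  have D0: "0 \<le> D t" if "0 \<le> t" for t unfolding D(2)[OF that] using u p by (rule duhamel_nonneg)
  have De: "ennreal (D r) = ennreal (exp (- (a * r)) * u) + (\<integral>\<^sup>+s. ennreal (indicator {0..r} s * exp (- (a * (r - s))) * p s) \<partial>lborel)"
    if "0 \<le> r" for r
    unfolding D(2)[OF that] duhamel_def using u p iexp
    by (subst ennreal_plus) (auto simp: nn_integral_eq_integral)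
  have exp_int: "(\<integral>\<^sup>+r. ennreal (a * exp (- (a * (r - s)))) * indicator {s..t} r \<partial>lborel) = ennreal (1 - exp (- (a * (t - s))))"
    if "s \<le> t" for s
  proof -
    have "(\<integral>\<^sup>+r. ennreal (a * exp (- (a * (r - s)))) * indicator {s..t} r \<partial>lborel)
       = ennreal ((- exp (- (a * (t - s)))) - (- exp (- (a * (s - s)))))"
      using that a by (intro nn_integral_FTC_Icc) (auto intro!: derivative_eq_intros)
    then show ?thesis by simp
  qed
  have m [measurable]: "(\<lambda>(r,s). ennreal (indicator {0..r} s * exp (- (a * (r - s))) * p s)) \<in> borel_measurable (lborel \<Otimes>\<^sub>M lborel)"
    unfolding ind by measurable
  have [measurable]: "(\<lambda>r. \<integral>\<^sup>+s. ennreal (indicator {0..r} s * exp (- (a * (r - s))) * p s) \<partial>lborel) \<in> borel_measurable borel"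
    using lborel.borel_measurable_nn_integral[OF m] by simp
  have "(\<integral>\<^sup>+r. indicator {0..t} r * ennreal (a * D r) \<partial>lborel)
     = (\<integral>\<^sup>+r. ennreal u * (ennreal (a * exp (- (a * (r - 0)))) * indicator {0..t} r)
         + indicator {0..t} r * (ennreal a * (\<integral>\<^sup>+s. ennreal (indicator {0..r} s * exp (- (a * (r - s))) * p s) \<partial>lborel)) \<partial>lborel)"
    using a u D0 by (intro nn_integral_cong) (auto simp: indicator_def ennreal_mult De distrib_left mult_ac)
  also have "\<dots> = ennreal u * ennreal (1 - exp (- (a * t)))
      + (\<integral>\<^sup>+r. indicator {0..t} r * (ennreal a * (\<integral>\<^sup>+s. ennreal (indicator {0..r} s * exp (- (a * (r - s))) * p s) \<partial>lborel)) \<partial>lborel)"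
    using exp_int[OF t] by (subst nn_integral_add) (auto simp: nn_integral_cmult)
  also have "(\<integral>\<^sup>+r. indicator {0..t} r * (ennreal a * (\<integral>\<^sup>+s. ennreal (indicator {0..r} s * exp (- (a * (r - s))) * p s) \<partial>lborel)) \<partial>lborel)
     = (\<integral>\<^sup>+r. \<integral>\<^sup>+s. indicator {0..t} r * (ennreal a * ennreal (indicator {0..r} s * exp (- (a * (r - s))) * p s)) \<partial>lborel \<partial>lborel)"
    by (intro nn_integral_cong) (simp add: nn_integral_cmult ind)
  also have "\<dots> = (\<integral>\<^sup>+s. \<integral>\<^sup>+r. indicator {0..t} r * (ennreal a * ennreal (indicator {0..r} s * exp (- (a * (r - s))) * p s)) \<partial>lborel \<partial>lborel)"
    by (rule lborel_swap[symmetric]) measurable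
  also have "\<dots> = (\<integral>\<^sup>+s. ennreal (indicator {0..t} s * (p s * (1 - exp (- (a * (t - s)))))) \<partial>lborel)"
  proof (rule nn_integral_cong)
    fix s
    have "(\<integral>\<^sup>+r. indicator {0..t} r * (ennreal a * ennreal (indicator {0..r} s * exp (- (a * (r - s))) * p s)) \<partial>lborel)
       = (\<integral>\<^sup>+r. ennreal (indicator {0..t} s * p s) * (ennreal (a * exp (- (a * (r - s)))) * indicator {s..t} r) \<partial>lborel)"
      using a p by (intro nn_integral_cong) (auto simp: indicator_def ennreal_mult mult_ac)
    also have "\<dots> = ennreal (indicator {0..t} s * p s) * (\<integral>\<^sup>+r. ennreal (a * exp (- (a * (r - s)))) * indicator {s..t} r \<partial>lborel)"
      by (rule nn_integral_cmult) measurable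
    also have "\<dots> = ennreal (indicator {0..t} s * (p s * (1 - exp (- (a * (t - s))))))"
      using exp_int[of s] p a by (cases "0 \<le> s \<and> s \<le> t") (auto simp flip: ennreal_mult)
    finally show "(\<integral>\<^sup>+r. indicator {0..t} r * (ennreal a * ennreal (indicator {0..r} s * exp (- (a * (r - s))) * p s)) \<partial>lborel)
      = ennreal (indicator {0..t} s * (p s * (1 - exp (- (a * (t - s))))))" .
  qed
  finally have *: "(\<integral>\<^sup>+r. indicator {0..t} r * ennreal (a * D r) \<partial>lborel)
    = ennreal u * ennreal (1 - exp (- (a * t))) + (\<integral>\<^sup>+s. ennreal (indicator {0..t} s * (p s * (1 - exp (- (a * (t - s)))))) \<partial>lborel)" .
  have sum: "ennreal (D t) + (\<integral>\<^sup>+r. indicator {0..t} r * ennreal (a * D r) \<partial>lborel) = ennreal u + ennreal (\<integral>s. indicator {0..t} s * p s \<partial>lborel)"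
  proof -
    have "(\<integral>\<^sup>+s. ennreal (indicator {0..t} s * exp (- (a * (t - s))) * p s) \<partial>lborel) + (\<integral>\<^sup>+s. ennreal (indicator {0..t} s * (p s * (1 - exp (- (a * (t - s)))))) \<partial>lborel)
      = (\<integral>\<^sup>+s. ennreal (indicator {0..t} s * p s) \<partial>lborel)"
    proof (subst nn_integral_add[symmetric], measurable, rule nn_integral_cong)
      fix s :: real
      define E where "E = exp (- (a * (t - s)))"
      have "ennreal (E * p s) + ennreal (p s * (1 - E)) = ennreal (p s)" if "s \<le> t"
      proof -
        have "0 \<le> E" "E \<le> 1" unfolding E_def using that a by auto
        then have "ennreal (E * p s) + ennreal (p s * (1 - E)) = ennreal (E * p s + p s * (1 - E))"
          using p by (intro ennreal_plus[symmetric]) auto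
        also have "E * p s + p s * (1 - E) = p s" by (simp add: algebra_simps)
        finally show ?thesis .
      qed
      then show "ennreal (indicator {0..t} s * exp (- (a * (t - s))) * p s) + ennreal (indicator {0..t} s * (p s * (1 - exp (- (a * (t - s))))))
         = ennreal (indicator {0..t} s * p s)" by (auto simp: indicator_def E_def)
    qed
    also have "\<dots> = ennreal (\<integral>s. indicator {0..t} s * p s \<partial>lborel)"
      using p int by (intro nn_integral_eq_integral) auto
    finally have IJ: "(\<integral>\<^sup>+s. ennreal (indicator {0..t} s * exp (- (a * (t - s))) * p s) \<partial>lborel) + (\<integral>\<^sup>+s. ennreal (indicator {0..t} s * (p s * (1 - exp (- (a * (t - s)))))) \<partial>lborel)
      = ennreal (\<integral>s. indicator {0..t} s * p s \<partial>lborel)" .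
    have XY: "ennreal (exp (- (a * t)) * u) + ennreal u * ennreal (1 - exp (- (a * t))) = ennreal u"
    proof -
      define E where "E = exp (- (a * t))"
      have "0 \<le> E" "E \<le> 1" unfolding E_def using t a by auto
      then have "ennreal (E * u) + ennreal u * ennreal (1 - E) = ennreal (E * u + u * (1 - E))"
        using u by (simp flip: ennreal_plus ennreal_mult)
      also have "E * u + u * (1 - E) = u" by (simp add: algebra_simps)
      finally show ?thesis unfolding E_def .
    qed
    have swap: "(X + I) + (Y + J) = (X + Y) + (I + J)" for X Y I J :: ennreal by (simp only: add_ac)
    show ?thesis unfolding * De[OF t] by (subst swap) (simp only: XY IJ)
  qed
  have "integrable lborel (\<lambda>s. indicator {0..t} s * (u + (\<integral>s. indicator {0..t} s * p s \<partial>lborel)))"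
    by (intro integrable_mult_left integrable_real_indicator) (auto simp: emeasure_lborel_Icc_eq)
  then show iD: "integrable lborel (\<lambda>s. indicator {0..t} s * D s)"
  proof (rule Bochner_Integration.integrable_bound)
    have "D s \<le> u + (\<integral>s. indicator {0..t} s * p s \<partial>lborel)" if "0 \<le> s" "s \<le> t" for s
    proof -
      have "exp (- (a * s)) * u \<le> u" using u a that by (simp add: mult_left_le_one_le)
      moreover have "(\<integral>r. indicator {0..s} r * exp (- (a * (s - r))) * p r \<partial>lborel) \<le> (\<integral>r. indicator {0..t} r * p r \<partial>lborel)"
        using p a that by (intro integral_mono iexp int) (auto simp: indicator_def mult_left_le_one_le)
      ultimately show ?thesis unfolding D(2)[OF that(1)] duhamel_def by simp
    qed
    then show "AE s in lborel. norm (indicator {0..t} s * D s) \<le> norm (indicator {0..t} s * (u + (\<integral>s. indicator {0..t} s * p s \<partial>lborel)))"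
      using D0 by (force intro!: AE_I2 simp: indicator_def)
  qed measurable
  have "(\<integral>\<^sup>+r. indicator {0..t} r * ennreal (a * D r) \<partial>lborel) = (\<integral>\<^sup>+r. ennreal (indicator {0..t} r * (a * D r)) \<partial>lborel)"
    using a D0 by (intro nn_integral_cong) (auto simp: indicator_def)
  also have "\<dots> = ennreal (\<integral>s. indicator {0..t} s * (a * D s) \<partial>lborel)"
    using integrable_mult_right[OF iD, of a] a D0 by (intro nn_integral_eq_integral) (auto simp: indicator_def mult_ac)
  finally have "ennreal (D t + (\<integral>s. indicator {0..t} s * (a * D s) \<partial>lborel)) = ennreal (u + (\<integral>s. indicator {0..t} s * p s \<partial>lborel))"
    using sum D0 t u p a by (subst (1 2) ennreal_plus) (auto intro!: integral_nonneg_AE AE_I2 simp: indicator_def)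
  then show "D t + (\<integral>s. indicator {0..t} s * (a * D s) \<partial>lborel) = u + (\<integral>s. indicator {0..t} s * p s \<partial>lborel)"
    using D0 t u p a by (subst (asm) ennreal_inj) (auto intro!: integral_nonneg_AE AE_I2 simp: indicator_def add_nonneg_nonneg)
qed

section \<open>The contraction\<close>

locale kinetic =
  fixes lam1 lam2 \<CC> \<nu> :: real
  assumes lam1: "0 \<le> lam1" and lam2: "0 < lam2" and CC: "0 < \<CC>" and nu: "0 < \<nu>"
begin

definition damp :: "real^'n \<Rightarrow> real" where
  "damp k = 2 * \<nu> * (norm k)\<^sup>2 + 2 * \<CC>\<^sup>2 * norm k"

text \<open>
  The collision operator plus the bound of its loss part, which makes it nonnegative.
\<close>

definition source :: "(real^'n \<Rightarrow> real) \<Rightarrow> real^'n \<Rightarrow> real" where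
  "source f k = collision lam1 lam2 \<CC> f k + 2 * \<CC>\<^sup>2 * norm k * f k"

text \<open>
  The factor by which the source enlarges a moment with weight of doubling constant \<open>C\<close>, up to one
  power of \<open>|k|\<close> (\<open>source_le\<close>).
\<close>

definition gain_const :: "real \<Rightarrow> real" where
  "gain_const C = \<CC>\<^sup>2 * (2 + 36 * C)"

text \<open>
  The smallest \<open>\<kappa>\<close> for which \<open>2 gain_const C |k| \<le> 2 \<nu> |k|\<^sup>2 + \<kappa>\<close> for all \<open>k\<close>.
\<close>

definition rate :: "real \<Rightarrow> real" where
  "rate C = (gain_const C)\<^sup>2 / (2 * \<nu>)"

lemma damp_measurable [measurable]: "damp \<in> borel_measurable borel"
  unfolding damp_def[abs_def] by measurable

lemma damp_nonneg: "0 \<le> damp k"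
  unfolding damp_def using nu by simp

lemma gain_const_pos: "1 \<le> C \<Longrightarrow> 0 < gain_const C"
  unfolding gain_const_def using CC by simp

lemma gain_const_ge: "1 \<le> C \<Longrightarrow> 38 * \<CC>\<^sup>2 \<le> gain_const C"
  unfolding gain_const_def using mult_left_mono[of 38 "2 + 36 * C" "\<CC>\<^sup>2"] by (simp add: mult.commute)

lemma rate_pos: "1 \<le> C \<Longrightarrow> 0 < rate C"
  unfolding rate_def using nu gain_const_pos[of C] by simp

lemma norm_le_damp: "1 \<le> C \<Longrightarrow> norm k * (2 * gain_const C) \<le> 2 * \<nu> * (norm k)\<^sup>2 + rate C"
proof -
  have "0 \<le> (2 * \<nu> * norm k - gain_const C)\<^sup>2 / (2 * \<nu>)" using nu by simp
  also have "\<dots> = 2 * \<nu> * (norm k)\<^sup>2 - norm k * (2 * gain_const C) + rate C"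
    using nu by (simp add: rate_def power2_diff field_simps power2_eq_square)
  finally show ?thesis by simp
qed

lemma norm_le_damp': "1 \<le> C \<Longrightarrow> norm k * (2 * gain_const C) \<le> damp k + rate C"
proof -
  assume "1 \<le> C"
  moreover have "0 \<le> 2 * \<CC>\<^sup>2 * norm k" by simp
  ultimately show ?thesis using norm_le_damp[of C k] unfolding damp_def by linarith
qed

lemma source_nonneg: "(\<And>x. 0 \<le> f x) \<Longrightarrow> 0 \<le> source f k"
  using collision_loss_bound[of f \<CC> k lam1 lam2] by (simp add: source_def)

lemma source_measurable_pair:
  assumes "case_prod F \<in> borel_measurable (M \<Otimes>\<^sub>M lborel)"
  shows "(\<lambda>(s,k). source (F s) k) \<in> borel_measurable (M \<Otimes>\<^sub>M lborel)"
  unfolding source_def using assms collision_measurable_pair[OF assms, of lam1 lam2 \<CC>] by measurable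

lemma source_le:
  fixes f :: "real^'n \<Rightarrow> real"
  assumes fm [measurable]: "f \<in> borel_measurable borel" and f0: "\<And>x. 0 \<le> f x" and W: "doubling C W" and C: "1 \<le> C"
  shows "(\<integral>\<^sup>+k. ennreal (W k * source f k) \<partial>lborel) \<le> ennreal (gain_const C) * (\<integral>\<^sup>+k. ennreal (norm k * W k * f k) \<partial>lborel)"
proof -
  note [measurable] = doubling_measurable[OF W] collision_measurable[OF fm]
  have W0: "0 \<le> W x" for x by (rule doubling_nonneg[OF W])
  let ?I = "\<integral>\<^sup>+k. ennreal (norm k * W k * f k) \<partial>lborel"
  \<comment> \<open>The Bochner integral of a function that is not integrable is \<open>0\<close>; in that case the mass in the kernel, and with it the collision term, vanishes.\<close>
  have Q: "(\<integral>\<^sup>+k. ennreal (W k * \<bar>collision lam1 lam2 \<CC> f k\<bar>) \<partial>lborel) \<le> ennreal (36 * \<CC>\<^sup>2 * C) * ?I"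
  proof (cases "integrable lborel f \<and> ?I < \<infinity>")
    case True
    then have int: "integrable lborel (\<lambda>k. norm k * W k * f k)"
      using f0 W0 by (intro integrableI_bounded) auto
    have "(\<integral>\<^sup>+k. ennreal (W k * \<bar>collision lam1 lam2 \<CC> f k\<bar>) \<partial>lborel)
       \<le> ennreal (9 * \<CC>\<^sup>2 * (4 * C) * (\<integral>k. norm k * W k * f k \<partial>lborel))"
      using True f0 W0 C int by (intro collision_le doubling_norm_mult W) auto
    also have "\<dots> = ennreal (36 * \<CC>\<^sup>2 * C) * ?I"
      using int f0 W0 C by (subst nn_integral_eq_integral) (auto simp flip: ennreal_mult)
    finally show ?thesis .
  next
    case False
    show ?thesis
    proof (cases "integrable lborel f")
      case True
      with False have "?I = \<infinity>" by (auto simp: not_less top_unique)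
      then show ?thesis using C CC by (simp add: ennreal_mult_top)
    next
      case False
      then show ?thesis by (simp add: collision_eq_0 not_integrable_integral_eq)
    qed
  qed
  have "(\<integral>\<^sup>+k. ennreal (W k * source f k) \<partial>lborel)
     \<le> (\<integral>\<^sup>+k. ennreal (W k * \<bar>collision lam1 lam2 \<CC> f k\<bar>) + ennreal (2 * \<CC>\<^sup>2) * ennreal (norm k * W k * f k) \<partial>lborel)"
  proof (rule nn_integral_mono)
    fix k
    have "W k * source f k \<le> W k * \<bar>collision lam1 lam2 \<CC> f k\<bar> + (2 * \<CC>\<^sup>2) * (norm k * W k * f k)"
    proof -
      have "W k * collision lam1 lam2 \<CC> f k \<le> W k * \<bar>collision lam1 lam2 \<CC> f k\<bar>" by (intro mult_left_mono W0) auto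
      then show ?thesis by (simp add: source_def distrib_left mult_ac)
    qed
    then show "ennreal (W k * source f k) \<le> ennreal (W k * \<bar>collision lam1 lam2 \<CC> f k\<bar>) + ennreal (2 * \<CC>\<^sup>2) * ennreal (norm k * W k * f k)"
      using W0 f0 by (simp add: ennreal_leI flip: ennreal_plus ennreal_mult)
  qed
  also have "\<dots> = (\<integral>\<^sup>+k. ennreal (W k * \<bar>collision lam1 lam2 \<CC> f k\<bar>) \<partial>lborel) + ennreal (2 * \<CC>\<^sup>2) * ?I"
    by (simp add: nn_integral_add nn_integral_cmult)
  also have "\<dots> \<le> ennreal (36 * \<CC>\<^sup>2 * C) * ?I + ennreal (2 * \<CC>\<^sup>2) * ?I"
    by (intro add_right_mono Q)
  also have "\<dots> = ennreal (gain_const C) * ?I"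
  proof -
    have "gain_const C = 36 * \<CC>\<^sup>2 * C + 2 * \<CC>\<^sup>2" by (simp add: gain_const_def algebra_simps)
    then have "ennreal (gain_const C) = ennreal (36 * \<CC>\<^sup>2 * C) + ennreal (2 * \<CC>\<^sup>2)"
      using C by (simp only:) (rule ennreal_plus, auto)
    then show ?thesis by (simp only: distrib_right)
  qed
  finally show ?thesis .
qed

lemma source_Lipschitz:
  fixes f g :: "real^'n \<Rightarrow> real"
  assumes f: "integrable lborel f" "\<And>x. 0 \<le> f x" and g: "integrable lborel g" "\<And>x. 0 \<le> g x"
    and Wm: "W \<in> borel_measurable borel" and W0: "\<And>x. 0 \<le> W x" and e: "\<And>k. norm k * W k \<le> e" and e0: "0 \<le> e"
  shows "(\<integral>\<^sup>+k. ennreal (W k * \<bar>source f k - source g k\<bar>) \<partial>lborel) \<le> ennreal (29 * \<CC>\<^sup>2 * e) * (\<integral>\<^sup>+k. ennreal \<bar>f k - g k\<bar> \<partial>lborel)"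
proof -
  note [measurable] = borel_measurable_integrable[OF f(1)] borel_measurable_integrable[OF g(1)] Wm
  note [measurable] = collision_measurable[of f lam1 lam2 \<CC>] collision_measurable[of g lam1 lam2 \<CC>]
  let ?Q = "collision lam1 lam2 \<CC>" and ?H = "\<integral>\<^sup>+k. ennreal \<bar>f k - g k\<bar> \<partial>lborel"
  have H: "?H = ennreal (\<integral>k. \<bar>f k - g k\<bar> \<partial>lborel)" using f g by (intro nn_integral_eq_integral) auto
  have "(\<integral>\<^sup>+k. ennreal (W k * \<bar>source f k - source g k\<bar>) \<partial>lborel)
     \<le> (\<integral>\<^sup>+k. ennreal (W k * \<bar>?Q f k - ?Q g k\<bar>) + ennreal (2 * \<CC>\<^sup>2 * e) * ennreal \<bar>f k - g k\<bar> \<partial>lborel)"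
  proof (rule nn_integral_mono)
    fix k
    have eq: "source f k - source g k = (?Q f k - ?Q g k) + 2 * \<CC>\<^sup>2 * norm k * (f k - g k)"
      by (simp add: source_def algebra_simps)
    have "W k * \<bar>source f k - source g k\<bar> \<le> W k * (\<bar>?Q f k - ?Q g k\<bar> + \<bar>2 * \<CC>\<^sup>2 * norm k * (f k - g k)\<bar>)"
      unfolding eq by (intro mult_left_mono abs_triangle_ineq W0)
    also have "\<dots> = W k * \<bar>?Q f k - ?Q g k\<bar> + 2 * \<CC>\<^sup>2 * (norm k * W k) * \<bar>f k - g k\<bar>"
    proof -
      have "\<bar>2 * \<CC>\<^sup>2 * norm k * (f k - g k)\<bar> = 2 * \<CC>\<^sup>2 * norm k * \<bar>f k - g k\<bar>" by (simp add: abs_mult)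
      then show ?thesis by (simp only: distrib_left mult_ac)
    qed
    also have "\<dots> \<le> W k * \<bar>?Q f k - ?Q g k\<bar> + 2 * \<CC>\<^sup>2 * e * \<bar>f k - g k\<bar>"
      using e by (intro add_left_mono mult_right_mono mult_left_mono) auto
    finally show "ennreal (W k * \<bar>source f k - source g k\<bar>) \<le> ennreal (W k * \<bar>?Q f k - ?Q g k\<bar>) + ennreal (2 * \<CC>\<^sup>2 * e) * ennreal \<bar>f k - g k\<bar>"
      using W0 e0 by (simp add: ennreal_leI flip: ennreal_plus ennreal_mult)
  qed
  also have "\<dots> = (\<integral>\<^sup>+k. ennreal (W k * \<bar>?Q f k - ?Q g k\<bar>) \<partial>lborel) + ennreal (2 * \<CC>\<^sup>2 * e) * ?H"
    by (simp add: nn_integral_add nn_integral_cmult)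
  also have "\<dots> \<le> ennreal (27 * \<CC>\<^sup>2 * e * (\<integral>k. \<bar>f k - g k\<bar> \<partial>lborel)) + ennreal (2 * \<CC>\<^sup>2 * e) * ?H"
    using f g e e0 W0 by (intro add_right_mono collision_Lipschitz) auto
  also have "\<dots> = ennreal (29 * \<CC>\<^sup>2 * e) * ?H"
    using e0 unfolding H by (simp add: algebra_simps flip: ennreal_plus ennreal_mult)
  finally show ?thesis .
qed

lemma laplace_swap:
  fixes F :: "real \<Rightarrow> real^'n \<Rightarrow> ennreal"
  assumes k: "0 < \<kappa>" and F: "case_prod F \<in> borel_measurable (lborel \<Otimes>\<^sub>M lborel)"
  shows "(\<integral>\<^sup>+k. \<integral>\<^sup>+t. F t k \<partial>laplace \<kappa> \<partial>lborel) = (\<integral>\<^sup>+t. \<integral>\<^sup>+k. F t k \<partial>lborel \<partial>laplace \<kappa>)"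
proof -
  interpret L: finite_measure "laplace \<kappa>" by (rule finite_measure_laplace[OF k])
  interpret pair_sigma_finite "laplace \<kappa>" "lborel :: (real^'n) measure" by standard
  have "case_prod F \<in> borel_measurable (laplace \<kappa> \<Otimes>\<^sub>M lborel)"
    using F by (subst measurable_cong_sets[OF sets_pair_measure_cong refl]) (auto simp: laplace_def)
  then show ?thesis by (rule Fubini')
qed

definition step :: "(real^'n \<Rightarrow> real) \<Rightarrow> (real \<Rightarrow> real^'n \<Rightarrow> real) \<Rightarrow> real \<Rightarrow> real^'n \<Rightarrow> real" where
  "step u f t k = duhamel (damp k) (u k) (\<lambda>s. source (f s) k) t"

primrec picard :: "(real^'n \<Rightarrow> real) \<Rightarrow> nat \<Rightarrow> real \<Rightarrow> real^'n \<Rightarrow> real" where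
  "picard u 0 = (\<lambda>t k. 0)"
| "picard u (Suc n) = step u (picard u n)"

lemma step_measurable:
  assumes [measurable]: "u \<in> borel_measurable borel" and f: "case_prod f \<in> borel_measurable (lborel \<Otimes>\<^sub>M lborel)"
  shows "case_prod (step u f) \<in> borel_measurable (lborel \<Otimes>\<^sub>M lborel)"
proof -
  have ind: "indicator {0..t} s = (if 0 \<le> s \<and> s \<le> t then 1 else (0::real))" for s t :: real by auto
  have [measurable]: "(\<lambda>z. source (f (snd z)) (snd (fst z))) \<in> borel_measurable ((lborel \<Otimes>\<^sub>M lborel) \<Otimes>\<^sub>M lborel)"
    by (rule measurable_pairI[OF source_measurable_pair[OF f]]) measurable
  have [measurable]: "(\<lambda>x. \<integral>s. indicator {0..fst x} s * exp (- (damp (snd x) * (fst x - s))) * source (f s) (snd x) \<partial>lborel)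
     \<in> borel_measurable (lborel \<Otimes>\<^sub>M lborel)"
    unfolding ind by (rule lborel.borel_measurable_lebesgue_integral, unfold case_prod_beta) measurable
  show ?thesis unfolding step_def duhamel_def case_prod_beta by measurable
qed

lemma step_nonneg: "0 \<le> u k \<Longrightarrow> (\<And>t k. 0 \<le> f t k) \<Longrightarrow> 0 \<le> step u f t k"
  unfolding step_def by (intro duhamel_nonneg source_nonneg)

lemma picard_measurable: "u \<in> borel_measurable borel \<Longrightarrow> case_prod (picard u n) \<in> borel_measurable (lborel \<Otimes>\<^sub>M lborel)"
proof (induction n)
  case 0 show ?case by (simp add: case_prod_beta)
next
  case (Suc n) show ?case unfolding picard.simps(2) by (rule step_measurable[OF Suc.prems Suc.IH[OF Suc.prems]])
qed

lemma picard_nonneg: "(\<And>k. 0 \<le> u k) \<Longrightarrow> 0 \<le> picard u n t k"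
  by (induction n arbitrary: t k) (auto intro: step_nonneg)

text \<open>
  The additional factor \<open>damp k + \<kappa>\<close> is exactly what the Duhamel map gains in Laplace norm. It
  dominates the power of \<open>|k|\<close> that the source loses.
\<close>

definition energy :: "real \<Rightarrow> (real^'n \<Rightarrow> real) \<Rightarrow> (real \<Rightarrow> real^'n \<Rightarrow> real) \<Rightarrow> ennreal" where
  "energy \<kappa> W f = (\<integral>\<^sup>+k. ennreal (W k * (damp k + \<kappa>)) * (\<integral>\<^sup>+t. ennreal (f t k) \<partial>laplace \<kappa>) \<partial>lborel)"

definition gap :: "real \<Rightarrow> (real \<Rightarrow> real^'n \<Rightarrow> real) \<Rightarrow> (real \<Rightarrow> real^'n \<Rightarrow> real) \<Rightarrow> ennreal" where
  "gap \<kappa> f g = (\<integral>\<^sup>+k. \<integral>\<^sup>+t. ennreal \<bar>f t k - g t k\<bar> \<partial>laplace \<kappa> \<partial>lborel)"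

lemma measurable_slices:
  fixes F :: "real \<Rightarrow> real^'n \<Rightarrow> 'b::topological_space"
  assumes "case_prod F \<in> borel_measurable (lborel \<Otimes>\<^sub>M lborel)"
  shows "F t \<in> borel_measurable borel" "(\<lambda>t. F t k) \<in> borel_measurable borel"
  using measurable_compose[OF measurable_Pair[of "\<lambda>_. t" lborel lborel "\<lambda>x. x" lborel] assms]
    measurable_compose[OF measurable_Pair[of "\<lambda>x. x" lborel lborel "\<lambda>_. k" lborel] assms] by simp_all

lemma measurable_laplace_integral:
  fixes F :: "real \<Rightarrow> real^'n \<Rightarrow> ennreal"
  assumes k: "0 < \<kappa>" and F: "case_prod F \<in> borel_measurable (lborel \<Otimes>\<^sub>M lborel)"
  shows "(\<lambda>k. \<integral>\<^sup>+t. F t k \<partial>laplace \<kappa>) \<in> borel_measurable borel"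
    "(\<lambda>t. \<integral>\<^sup>+k. F t k \<partial>lborel) \<in> borel_measurable borel"
proof -
  interpret L: finite_measure "laplace \<kappa>" by (rule finite_measure_laplace[OF k])
  have "case_prod (\<lambda>k t. F t k) \<in> borel_measurable (lborel \<Otimes>\<^sub>M laplace \<kappa>)"
    unfolding case_prod_beta by (rule measurable_pairI[OF F]) (auto simp: laplace_def)
  from L.borel_measurable_nn_integral[OF this]
  show "(\<lambda>k. \<integral>\<^sup>+t. F t k \<partial>laplace \<kappa>) \<in> borel_measurable borel" by simp
  show "(\<lambda>t. \<integral>\<^sup>+k. F t k \<partial>lborel) \<in> borel_measurable borel"
    using lborel.borel_measurable_nn_integral[OF F] by simp
qed

text \<open>
  The factor \<open>1/2\<close> comes from the choice of \<open>rate\<close>.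
\<close>

lemma source_spacetime_le:
  fixes f :: "real \<Rightarrow> real^'n \<Rightarrow> real"
  assumes C: "1 \<le> C" and W: "doubling C W" and f: "case_prod f \<in> borel_measurable (lborel \<Otimes>\<^sub>M lborel)" and f0: "\<And>t k. 0 \<le> f t k"
  shows "(\<integral>\<^sup>+k. ennreal (W k) * (\<integral>\<^sup>+t. ennreal (source (f t) k) \<partial>laplace (rate C)) \<partial>lborel) \<le> ennreal (1 / 2) * energy (rate C) W f"
proof -
  let ?\<kappa> = "rate C"
  note k = rate_pos[OF C]
  note sl = measurable_slices[OF f] and [measurable] = doubling_measurable[OF W] f
  have sm: "case_prod (\<lambda>s k. source (f s) k) \<in> borel_measurable (lborel \<Otimes>\<^sub>M lborel)" using source_measurable_pair[OF f] by simp
  note [measurable] = sm measurable_slices[OF sm]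
  have W0: "0 \<le> W x" for x by (rule doubling_nonneg[OF W])
  have m1: "case_prod (\<lambda>t k. ennreal (W k * source (f t) k)) \<in> borel_measurable (lborel \<Otimes>\<^sub>M lborel)"
    and m2: "case_prod (\<lambda>t k. ennreal (norm k * W k * f t k)) \<in> borel_measurable (lborel \<Otimes>\<^sub>M lborel)"
    and m3: "case_prod (\<lambda>t k. ennreal (f t k)) \<in> borel_measurable (lborel \<Otimes>\<^sub>M lborel)"
    by measurable
  have sn: "0 \<le> source (f t) k" for t k by (rule source_nonneg[OF f0])
  have "(\<integral>\<^sup>+k. ennreal (W k) * (\<integral>\<^sup>+t. ennreal (source (f t) k) \<partial>laplace ?\<kappa>) \<partial>lborel)
     = (\<integral>\<^sup>+k. \<integral>\<^sup>+t. ennreal (W k * source (f t) k) \<partial>laplace ?\<kappa> \<partial>lborel)"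
    using W0 sn by (intro nn_integral_cong) (simp add: ennreal_mult nn_integral_cmult)
  also have "\<dots> = (\<integral>\<^sup>+t. \<integral>\<^sup>+k. ennreal (W k * source (f t) k) \<partial>lborel \<partial>laplace ?\<kappa>)"
    by (rule laplace_swap[OF k m1])
  also have "\<dots> \<le> (\<integral>\<^sup>+t. ennreal (gain_const C) * (\<integral>\<^sup>+k. ennreal (norm k * W k * f t k) \<partial>lborel) \<partial>laplace ?\<kappa>)"
    by (intro nn_integral_mono source_le sl f0 W C)
  also have "\<dots> = ennreal (gain_const C) * (\<integral>\<^sup>+t. \<integral>\<^sup>+k. ennreal (norm k * W k * f t k) \<partial>lborel \<partial>laplace ?\<kappa>)"
    by (rule nn_integral_cmult) (use measurable_laplace_integral(2)[OF k m2] in simp)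
  also have "\<dots> = ennreal (gain_const C) * (\<integral>\<^sup>+k. \<integral>\<^sup>+t. ennreal (norm k * W k * f t k) \<partial>laplace ?\<kappa> \<partial>lborel)"
    by (subst laplace_swap[OF k m2]) simp
  also have "\<dots> = (\<integral>\<^sup>+k. ennreal (gain_const C) * (\<integral>\<^sup>+t. ennreal (norm k * W k * f t k) \<partial>laplace ?\<kappa>) \<partial>lborel)"
    by (rule nn_integral_cmult[symmetric]) (use measurable_laplace_integral(1)[OF k m2] in simp)
  also have "\<dots> \<le> (\<integral>\<^sup>+k. ennreal (1 / 2) * (ennreal (W k * (damp k + ?\<kappa>)) * (\<integral>\<^sup>+t. ennreal (f t k) \<partial>laplace ?\<kappa>)) \<partial>lborel)"
  proof (rule nn_integral_mono)
    fix k
    have "(\<integral>\<^sup>+t. ennreal (norm k * W k * f t k) \<partial>laplace ?\<kappa>) = ennreal (norm k * W k) * (\<integral>\<^sup>+t. ennreal (f t k) \<partial>laplace ?\<kappa>)"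
      using W0 f0 sl by (simp add: ennreal_mult nn_integral_cmult)
    moreover have "gain_const C * (norm k * W k) \<le> 1 / 2 * (W k * (damp k + ?\<kappa>))"
      using mult_left_mono[OF norm_le_damp'[OF C, of k] W0[of k]] by (simp add: mult_ac)
    then have "ennreal (gain_const C) * ennreal (norm k * W k) \<le> ennreal (1 / 2) * ennreal (W k * (damp k + ?\<kappa>))"
      using gain_const_pos[OF C] W0[of k] k damp_nonneg[of k]
      by (subst (1 2) ennreal_mult[symmetric]) (auto simp del: divide_const_simps intro!: ennreal_leI)
    ultimately show "ennreal (gain_const C) * (\<integral>\<^sup>+t. ennreal (norm k * W k * f t k) \<partial>laplace ?\<kappa>)
       \<le> ennreal (1 / 2) * (ennreal (W k * (damp k + ?\<kappa>)) * (\<integral>\<^sup>+t. ennreal (f t k) \<partial>laplace ?\<kappa>))"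
      by (simp add: mult_right_mono flip: mult.assoc)
  qed
  also have "\<dots> = ennreal (1 / 2) * energy ?\<kappa> W f"
    unfolding energy_def using measurable_laplace_integral(1)[OF k m3] by (intro nn_integral_cmult) measurable
  finally show ?thesis .
qed

lemma energy_step_le:
  fixes f :: "real \<Rightarrow> real^'n \<Rightarrow> real"
  assumes C: "1 \<le> C" and W: "doubling C W" and f: "case_prod f \<in> borel_measurable (lborel \<Otimes>\<^sub>M lborel)" and f0: "\<And>t k. 0 \<le> f t k"
    and um [measurable]: "u \<in> borel_measurable borel" and u0: "\<And>k. 0 \<le> u k"
  shows "energy (rate C) W (step u f) \<le> (\<integral>\<^sup>+k. ennreal (W k * u k) \<partial>lborel) + ennreal (1 / 2) * energy (rate C) W f"
proof -
  let ?\<kappa> = "rate C"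
  note k = rate_pos[OF C]
  note [measurable] = doubling_measurable[OF W]
  have sm: "case_prod (\<lambda>s k. source (f s) k) \<in> borel_measurable (lborel \<Otimes>\<^sub>M lborel)" using source_measurable_pair[OF f] by simp
  have W0: "0 \<le> W x" for x by (rule doubling_nonneg[OF W])
  have "energy ?\<kappa> W (step u f) \<le> (\<integral>\<^sup>+k. ennreal (W k * u k) + ennreal (W k) * (\<integral>\<^sup>+t. ennreal (source (f t) k) \<partial>laplace ?\<kappa>) \<partial>lborel)"
    unfolding energy_def
  proof (rule nn_integral_mono)
    fix k
    have "(\<integral>\<^sup>+t. ennreal (step u f t k) \<partial>laplace ?\<kappa>) \<le> ennreal (1 / (damp k + ?\<kappa>)) * (ennreal (u k) + (\<integral>\<^sup>+t. ennreal (source (f t) k) \<partial>laplace ?\<kappa>))"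
      unfolding step_def using k
      by (intro duhamel_laplace_le u0 source_nonneg f0 measurable_slices(2)[OF sm] damp_nonneg) 
    then have "ennreal (W k * (damp k + ?\<kappa>)) * (\<integral>\<^sup>+t. ennreal (step u f t k) \<partial>laplace ?\<kappa>)
        \<le> ennreal (W k * (damp k + ?\<kappa>)) * (ennreal (1 / (damp k + ?\<kappa>)) * (ennreal (u k) + (\<integral>\<^sup>+t. ennreal (source (f t) k) \<partial>laplace ?\<kappa>)))"
      by (rule mult_left_mono) simp
    also have "\<dots> = ennreal (W k) * (ennreal (u k) + (\<integral>\<^sup>+t. ennreal (source (f t) k) \<partial>laplace ?\<kappa>))"
      using k damp_nonneg[of k] W0[of k] by (simp flip: mult.assoc ennreal_mult)
    also have "\<dots> = ennreal (W k * u k) + ennreal (W k) * (\<integral>\<^sup>+t. ennreal (source (f t) k) \<partial>laplace ?\<kappa>)"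
      using u0[of k] W0[of k] by (simp add: distrib_left ennreal_mult)
    finally show "ennreal (W k * (damp k + ?\<kappa>)) * (\<integral>\<^sup>+t. ennreal (step u f t k) \<partial>laplace ?\<kappa>)
       \<le> ennreal (W k * u k) + ennreal (W k) * (\<integral>\<^sup>+t. ennreal (source (f t) k) \<partial>laplace ?\<kappa>)" .
  qed
  also have "\<dots> = (\<integral>\<^sup>+k. ennreal (W k * u k) \<partial>lborel) + (\<integral>\<^sup>+k. ennreal (W k) * (\<integral>\<^sup>+t. ennreal (source (f t) k) \<partial>laplace ?\<kappa>) \<partial>lborel)"
  proof (rule nn_integral_add)
    have "case_prod (\<lambda>t k. ennreal (source (f t) k)) \<in> borel_measurable (lborel \<Otimes>\<^sub>M lborel)" using sm by measurable
    from measurable_laplace_integral(1)[OF k this]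
    show "(\<lambda>k. ennreal (W k) * (\<integral>\<^sup>+t. ennreal (source (f t) k) \<partial>laplace ?\<kappa>)) \<in> borel_measurable lborel" by measurable
  qed measurable
  also have "\<dots> \<le> (\<integral>\<^sup>+k. ennreal (W k * u k) \<partial>lborel) + ennreal (1 / 2) * energy ?\<kappa> W f"
    by (intro add_left_mono source_spacetime_le assms)
  finally show ?thesis .
qed

end

text \<open>
  Used along almost every space-time point, where the increments of the Picard iteration are summable.
\<close>

lemma telescoping_limit:
  fixes x :: "nat \<Rightarrow> real"
  assumes fin: "(\<Sum>i. ennreal \<bar>x (Suc i) - x i\<bar>) \<noteq> \<infinity>"
  shows "x \<longlonglongrightarrow> lim x"
    and "ennreal \<bar>lim x - x n\<bar> \<le> (\<Sum>i. ennreal \<bar>x (Suc (i + n)) - x (i + n)\<bar>)"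
proof -
  have s: "summable (\<lambda>i. \<bar>x (Suc i) - x i\<bar>)" using fin by (intro summable_suminf_not_top) auto
  then have "summable (\<lambda>i. x (Suc i) - x i)" by (rule summable_rabs_cancel)
  then have "convergent (\<lambda>n. \<Sum>i<n. x (Suc i) - x i)" by (simp add: summable_iff_convergent)
  then have "convergent (\<lambda>n. x n - x 0)" by (simp add: sum_lessThan_telescope)
  then have "convergent (\<lambda>n. (x n - x 0) + x 0)" by (intro convergent_add convergent_const)
  then have "convergent x" by simp
  then show lim: "x \<longlonglongrightarrow> lim x" by (simp add: convergent_LIMSEQ_iff)
  have sn: "summable (\<lambda>i. \<bar>x (Suc (i + n)) - x (i + n)\<bar>)" using summable_ignore_initial_segment[OF s, of n] by simp
  have "\<bar>lim x - x n\<bar> \<le> (\<Sum>i. \<bar>x (Suc (i + n)) - x (i + n)\<bar>)"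
  proof (rule LIMSEQ_le_const2)
    show "(\<lambda>m. \<bar>x (m + n) - x n\<bar>) \<longlonglongrightarrow> \<bar>lim x - x n\<bar>"
      using LIMSEQ_ignore_initial_segment[OF lim, of n] by (intro tendsto_intros)
    have "\<bar>x (m + n) - x n\<bar> \<le> (\<Sum>i. \<bar>x (Suc (i + n)) - x (i + n)\<bar>)" for m
    proof -
      have "x (m + n) - x n = (\<Sum>i<m. x (Suc (i + n)) - x (i + n))"
        using sum_lessThan_telescope[of "\<lambda>i. x (i + n)" m] by simp
      also have "\<bar>\<dots>\<bar> \<le> (\<Sum>i<m. \<bar>x (Suc (i + n)) - x (i + n)\<bar>)" by (rule sum_abs)
      also have "\<dots> \<le> (\<Sum>i. \<bar>x (Suc (i + n)) - x (i + n)\<bar>)" by (rule sum_le_suminf[OF sn]) auto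
      finally show ?thesis .
    qed
    then show "\<exists>N. \<forall>m\<ge>N. \<bar>x (m + n) - x n\<bar> \<le> (\<Sum>i. \<bar>x (Suc (i + n)) - x (i + n)\<bar>)" by blast
  qed
  then have "ennreal \<bar>lim x - x n\<bar> \<le> ennreal (\<Sum>i. \<bar>x (Suc (i + n)) - x (i + n)\<bar>)" by (rule ennreal_leI)
  also have "\<dots> = (\<Sum>i. ennreal \<bar>x (Suc (i + n)) - x (i + n)\<bar>)" using sn by (intro suminf_ennreal2[symmetric]) auto
  finally show "ennreal \<bar>lim x - x n\<bar> \<le> (\<Sum>i. ennreal \<bar>x (Suc (i + n)) - x (i + n)\<bar>)" .
qed

context kinetic begin

lemma energy_alt:
  fixes f :: "real \<Rightarrow> real^'n \<Rightarrow> real"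
  assumes f: "case_prod f \<in> borel_measurable (lborel \<Otimes>\<^sub>M lborel)" and W: "\<And>k. 0 \<le> W k" and f0: "\<And>t k. 0 \<le> f t k" and k: "0 < \<kappa>"
  shows "energy \<kappa> W f = (\<integral>\<^sup>+k. \<integral>\<^sup>+t. ennreal (W k * (damp k + \<kappa>) * f t k) \<partial>laplace \<kappa> \<partial>lborel)"
  unfolding energy_def
proof (rule nn_integral_cong)
  fix k :: "real^'n"
  note [measurable] = measurable_slices(2)[OF f, of k]
  have "0 \<le> W k * (damp k + \<kappa>)" using W k damp_nonneg[of k] by simp
  then show "ennreal (W k * (damp k + \<kappa>)) * (\<integral>\<^sup>+t. ennreal (f t k) \<partial>laplace \<kappa>) = (\<integral>\<^sup>+t. ennreal (W k * (damp k + \<kappa>) * f t k) \<partial>laplace \<kappa>)"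
    using f0 by (simp add: ennreal_mult nn_integral_cmult)
qed

lemma energy_mass_le:
  fixes f :: "real \<Rightarrow> real^'n \<Rightarrow> real"
  assumes f: "case_prod f \<in> borel_measurable (lborel \<Otimes>\<^sub>M lborel)" and f0: "\<And>t k. 0 \<le> f t k" and k: "0 < \<kappa>"
  shows "ennreal \<kappa> * (\<integral>\<^sup>+k. \<integral>\<^sup>+t. ennreal (f t k) \<partial>laplace \<kappa> \<partial>lborel) \<le> energy \<kappa> (\<lambda>_. 1) f"
proof -
  have "case_prod (\<lambda>t k. ennreal (f t k)) \<in> borel_measurable (lborel \<Otimes>\<^sub>M lborel)" using f by measurable
  then have "ennreal \<kappa> * (\<integral>\<^sup>+k. \<integral>\<^sup>+t. ennreal (f t k) \<partial>laplace \<kappa> \<partial>lborel) = (\<integral>\<^sup>+k. ennreal \<kappa> * (\<integral>\<^sup>+t. ennreal (f t k) \<partial>laplace \<kappa>) \<partial>lborel)"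
    using measurable_laplace_integral(1)[OF k] by (intro nn_integral_cmult[symmetric]) simp
  also have "\<dots> \<le> energy \<kappa> (\<lambda>_. 1) f"
    unfolding energy_def using damp_nonneg by (intro nn_integral_mono mult_right_mono ennreal_leI) auto
  finally show ?thesis .
qed

lemma mass_finite:
  fixes f :: "real \<Rightarrow> real^'n \<Rightarrow> real"
  assumes f: "case_prod f \<in> borel_measurable (lborel \<Otimes>\<^sub>M lborel)" and f0: "\<And>t k. 0 \<le> f t k" and k: "0 < \<kappa>"
    and e: "energy \<kappa> (\<lambda>_. 1) f < \<infinity>"
  shows "(\<integral>\<^sup>+k. \<integral>\<^sup>+t. ennreal (f t k) \<partial>laplace \<kappa> \<partial>lborel) < \<infinity>"
    and "AE t in laplace \<kappa>. integrable lborel (f t)"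
proof -
  have m: "case_prod (\<lambda>t k. ennreal (f t k)) \<in> borel_measurable (lborel \<Otimes>\<^sub>M lborel)" using f by measurable
  show fin: "(\<integral>\<^sup>+k. \<integral>\<^sup>+t. ennreal (f t k) \<partial>laplace \<kappa> \<partial>lborel) < \<infinity>"
    using le_less_trans[OF energy_mass_le[OF f f0 k] e] k by (auto simp: ennreal_mult_less_top)
  then have "(\<integral>\<^sup>+t. \<integral>\<^sup>+k. ennreal (f t k) \<partial>lborel \<partial>laplace \<kappa>) \<noteq> \<infinity>"
    using laplace_swap[OF k m] by simp
  then have "AE t in laplace \<kappa>. (\<integral>\<^sup>+k. ennreal (f t k) \<partial>lborel) \<noteq> \<infinity>"
    using measurable_laplace_integral(2)[OF k m] by (intro nn_integral_PInf_AE) auto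
  then show "AE t in laplace \<kappa>. integrable lborel (f t)"
    by eventually_elim (use measurable_slices(1)[OF f] f0 in \<open>auto intro!: integrableI_bounded simp: less_top\<close>)
qed

lemma doubling_one: "1 \<le> C \<Longrightarrow> doubling C (\<lambda>_. 1)"
  by (rule doubling_mono[OF doubling_const]) auto

lemma source_finite_AE:
  fixes f :: "real \<Rightarrow> real^'n \<Rightarrow> real"
  assumes C: "1 \<le> C" and f: "case_prod f \<in> borel_measurable (lborel \<Otimes>\<^sub>M lborel)" and f0: "\<And>t k. 0 \<le> f t k"
    and e: "energy (rate C) (\<lambda>_. 1) f < \<infinity>"
  shows "AE k in lborel. (\<integral>\<^sup>+t. ennreal (source (f t) k) \<partial>laplace (rate C)) < \<infinity>"
proof -
  have sm: "case_prod (\<lambda>s k. ennreal (source (f s) k)) \<in> borel_measurable (lborel \<Otimes>\<^sub>M lborel)" using source_measurable_pair[OF f] by measurable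
  have "(\<integral>\<^sup>+k. ennreal 1 * (\<integral>\<^sup>+t. ennreal (source (f t) k) \<partial>laplace (rate C)) \<partial>lborel) \<le> ennreal (1 / 2) * energy (rate C) (\<lambda>_. 1) f"
    by (rule source_spacetime_le[OF C doubling_one[OF C] f f0])
  also have "\<dots> < \<infinity>" using e by (metis ennreal_less_top ennreal_mult_less_top infinity_ennreal_def)
  finally have "(\<integral>\<^sup>+k. ennreal 1 * (\<integral>\<^sup>+t. ennreal (source (f t) k) \<partial>laplace (rate C)) \<partial>lborel) < \<infinity>" .
  then have "AE k in lborel. (\<integral>\<^sup>+t. ennreal (source (f t) k) \<partial>laplace (rate C)) \<noteq> \<infinity>"
    using measurable_laplace_integral(1)[OF rate_pos[OF C] sm] by (intro nn_integral_PInf_AE) auto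
  then show ?thesis by eventually_elim (simp add: less_top)
qed

text \<open>
  For fixed \<open>k\<close> the Duhamel map contributes \<open>1 / (damp k + \<kappa>)\<close>; for fixed \<open>t\<close> the source is Lipschitz
  with respect to the weight \<open>1 / (damp k + \<kappa>)\<close>, because this weight times \<open>|k|\<close> is small.
\<close>

lemma gap_step_le:
  fixes f g :: "real \<Rightarrow> real^'n \<Rightarrow> real"
  assumes C: "1 \<le> C" 
    and f: "case_prod f \<in> borel_measurable (lborel \<Otimes>\<^sub>M lborel)" and f0: "\<And>t k. 0 \<le> f t k" and ef: "energy (rate C) (\<lambda>_. 1) f < \<infinity>"
    and g: "case_prod g \<in> borel_measurable (lborel \<Otimes>\<^sub>M lborel)" and g0: "\<And>t k. 0 \<le> g t k" and eg: "energy (rate C) (\<lambda>_. 1) g < \<infinity>"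
  shows "gap (rate C) (step u f) (step u g) \<le> ennreal (1 / 2) * gap (rate C) f g"
proof -
  let ?\<kappa> = "rate C"
  note k = rate_pos[OF C]
  define e where "e = 1 / (2 * gain_const C)"
  have e0: "0 \<le> e" using gain_const_pos[OF C] by (simp add: e_def)
  have e_le: "29 * \<CC>\<^sup>2 * e \<le> 1 / 2"
    unfolding e_def using gain_const_pos[OF C] gain_const_ge[OF C] zero_le_power2[of \<CC>] by (simp add: field_simps)
  have ke: "norm x * (1 / (damp x + ?\<kappa>)) \<le> e" for x :: "real^'n"
    using norm_le_damp'[OF C, of x] damp_nonneg[of x] k gain_const_pos[OF C] by (simp add: e_def field_simps)
  have sf: "case_prod (\<lambda>s k. source (f s) k) \<in> borel_measurable (lborel \<Otimes>\<^sub>M lborel)" using source_measurable_pair[OF f] by simp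
  have sg: "case_prod (\<lambda>s k. source (g s) k) \<in> borel_measurable (lborel \<Otimes>\<^sub>M lborel)" using source_measurable_pair[OF g] by simp
  note [measurable] = sf sg measurable_slices[OF sf] measurable_slices[OF sg] f g
  have sw: "0 \<le> 1 / (damp x + ?\<kappa>)" for x :: "real^'n" using damp_nonneg[of x] k by simp
  have m1: "case_prod (\<lambda>t k. ennreal (1 / (damp k + ?\<kappa>) * \<bar>source (f t) k - source (g t) k\<bar>)) \<in> borel_measurable (lborel \<Otimes>\<^sub>M lborel)"
    and m2: "case_prod (\<lambda>t k. ennreal \<bar>f t k - g t k\<bar>) \<in> borel_measurable (lborel \<Otimes>\<^sub>M lborel)" by measurable
  have "gap ?\<kappa> (step u f) (step u g) \<le> (\<integral>\<^sup>+k. \<integral>\<^sup>+t. ennreal (1 / (damp k + ?\<kappa>) * \<bar>source (f t) k - source (g t) k\<bar>) \<partial>laplace ?\<kappa> \<partial>lborel)"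
    unfolding gap_def
  proof (rule nn_integral_mono_AE, use source_finite_AE[OF C f f0 ef] source_finite_AE[OF C g g0 eg] in eventually_elim)
    case (elim k)
    have "(\<integral>\<^sup>+t. ennreal \<bar>step u f t k - step u g t k\<bar> \<partial>laplace ?\<kappa>) \<le> ennreal (1 / (damp k + ?\<kappa>)) * (\<integral>\<^sup>+t. ennreal \<bar>source (f t) k - source (g t) k\<bar> \<partial>laplace ?\<kappa>)"
      unfolding step_def using elim k rate_pos[OF C]
      by (intro duhamel_diff_laplace_le source_nonneg f0 g0 damp_nonneg) auto
    also have "\<dots> = (\<integral>\<^sup>+t. ennreal (1 / (damp k + ?\<kappa>) * \<bar>source (f t) k - source (g t) k\<bar>) \<partial>laplace ?\<kappa>)"
    proof (subst nn_integral_cmult[symmetric])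
      show "(\<integral>\<^sup>+t. ennreal (1 / (damp k + ?\<kappa>)) * ennreal \<bar>source (f t) k - source (g t) k\<bar> \<partial>laplace ?\<kappa>)
         = (\<integral>\<^sup>+t. ennreal (1 / (damp k + ?\<kappa>) * \<bar>source (f t) k - source (g t) k\<bar>) \<partial>laplace ?\<kappa>)"
        by (intro nn_integral_cong ennreal_mult'[OF sw, symmetric])
    qed measurable
    finally show ?case .
  qed
  also have "\<dots> = (\<integral>\<^sup>+t. \<integral>\<^sup>+k. ennreal (1 / (damp k + ?\<kappa>) * \<bar>source (f t) k - source (g t) k\<bar>) \<partial>lborel \<partial>laplace ?\<kappa>)"
    by (rule laplace_swap[OF k m1])
  also have "\<dots> \<le> (\<integral>\<^sup>+t. ennreal (1 / 2) * (\<integral>\<^sup>+k. ennreal \<bar>f t k - g t k\<bar> \<partial>lborel) \<partial>laplace ?\<kappa>)"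
  proof (rule nn_integral_mono_AE, use mass_finite(2)[OF f f0 k ef] mass_finite(2)[OF g g0 k eg] in eventually_elim)
    case (elim t)
    have "(\<integral>\<^sup>+k. ennreal (1 / (damp k + ?\<kappa>) * \<bar>source (f t) k - source (g t) k\<bar>) \<partial>lborel)
       \<le> ennreal (29 * \<CC>\<^sup>2 * e) * (\<integral>\<^sup>+k. ennreal \<bar>f t k - g t k\<bar> \<partial>lborel)"
      using elim by (intro source_Lipschitz f0 g0 sw ke e0) auto
    also have "\<dots> \<le> ennreal (1 / 2) * (\<integral>\<^sup>+k. ennreal \<bar>f t k - g t k\<bar> \<partial>lborel)"
      by (intro mult_right_mono ennreal_leI e_le) auto
    finally show ?case .
  qed
  also have "\<dots> = ennreal (1 / 2) * (\<integral>\<^sup>+t. \<integral>\<^sup>+k. ennreal \<bar>f t k - g t k\<bar> \<partial>lborel \<partial>laplace ?\<kappa>)"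
    by (rule nn_integral_cmult) (use measurable_laplace_integral(2)[OF k m2] in simp)
  also have "(\<integral>\<^sup>+t. \<integral>\<^sup>+k. ennreal \<bar>f t k - g t k\<bar> \<partial>lborel \<partial>laplace ?\<kappa>) = gap ?\<kappa> f g"
    unfolding gap_def by (rule laplace_swap[OF k m2, symmetric])
  finally show ?thesis .
qed

lemma gap_triangle:
  assumes k: "0 < \<kappa>" and [measurable]: "case_prod f \<in> borel_measurable (lborel \<Otimes>\<^sub>M lborel)" "case_prod g \<in> borel_measurable (lborel \<Otimes>\<^sub>M lborel)"
    "case_prod h \<in> borel_measurable (lborel \<Otimes>\<^sub>M lborel)"
  shows "gap \<kappa> f h \<le> gap \<kappa> f g + gap \<kappa> g h"
proof -
  have m1: "case_prod (\<lambda>t k. ennreal \<bar>f t k - g t k\<bar>) \<in> borel_measurable (lborel \<Otimes>\<^sub>M lborel)"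
    and m2: "case_prod (\<lambda>t k. ennreal \<bar>g t k - h t k\<bar>) \<in> borel_measurable (lborel \<Otimes>\<^sub>M lborel)" by measurable
  note [measurable] = measurable_slices(2)[OF m1] measurable_slices(2)[OF m2] measurable_laplace_integral(1)[OF k m1] measurable_laplace_integral(1)[OF k m2]
  have "gap \<kappa> f h \<le> (\<integral>\<^sup>+k. \<integral>\<^sup>+t. ennreal \<bar>f t k - g t k\<bar> + ennreal \<bar>g t k - h t k\<bar> \<partial>laplace \<kappa> \<partial>lborel)"
    unfolding gap_def by (intro nn_integral_mono) (auto intro!: ennreal_leI simp flip: ennreal_plus)
  also have "\<dots> = gap \<kappa> f g + gap \<kappa> g h"
    unfolding gap_def by (simp add: nn_integral_add)
  finally show ?thesis .
qed

text \<open>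
  The fixed point of \<open>X = U + X / 2\<close> bounds all iterates at once.
\<close>

lemma picard_energy_le:
  fixes u :: "real^'n \<Rightarrow> real"
  assumes C: "1 \<le> C" and W: "doubling C W" and um: "u \<in> borel_measurable borel" and u0: "\<And>k. 0 \<le> u k"
  shows "energy (rate C) W (picard u n) \<le> 2 * (\<integral>\<^sup>+k. ennreal (W k * u k) \<partial>lborel)"
proof (induction n)
  case 0 show ?case by (simp add: energy_def)
next
  case (Suc n)
  let ?U = "\<integral>\<^sup>+k. ennreal (W k * u k) \<partial>lborel"
  have "energy (rate C) W (picard u (Suc n)) \<le> ?U + ennreal (1 / 2) * energy (rate C) W (picard u n)"
    unfolding picard.simps(2) by (intro energy_step_le C W picard_measurable picard_nonneg um u0)
  also have "\<dots> \<le> ?U + ennreal (1 / 2) * (2 * ?U)" by (intro add_left_mono mult_left_mono Suc) auto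
  also have "ennreal (1 / 2) * (2 * ?U) = ?U"
  proof -
    have "ennreal (1 / 2) * (2 * ?U) = (ennreal (1 / 2) * ennreal 2) * ?U" by (simp only: mult.assoc ennreal_numeral)
    also have "ennreal (1 / 2) * ennreal 2 = 1" by (subst ennreal_mult[symmetric]) auto
    finally show ?thesis by simp
  qed
  finally show ?case by (simp add: mult_2)
qed

text \<open>
  The maximum with \<open>0\<close> makes the function nonnegative also at the points where the iterates diverge.
\<close>

definition picard_limit :: "(real^'n \<Rightarrow> real) \<Rightarrow> real \<Rightarrow> real^'n \<Rightarrow> real" where
  "picard_limit u t k = max 0 (lim (\<lambda>n. picard u n t k))"

lemma picard_limit_measurable:
  assumes u: "u \<in> borel_measurable borel"
  shows "case_prod (picard_limit u) \<in> borel_measurable (lborel \<Otimes>\<^sub>M lborel)"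
proof -
  have "(\<lambda>x. picard u n (fst x) (snd x)) \<in> borel_measurable (lborel \<Otimes>\<^sub>M lborel)" for n
    using picard_measurable[OF u, of n] by (simp add: case_prod_beta)
  then have "(\<lambda>x. lim (\<lambda>n. picard u n (fst x) (snd x))) \<in> borel_measurable (lborel \<Otimes>\<^sub>M lborel)"
    by (rule borel_measurable_lim_metric)
  then show ?thesis unfolding picard_limit_def case_prod_beta by measurable
qed

lemma picard_limit_nonneg: "0 \<le> picard_limit u t k"
  by (simp add: picard_limit_def)


text \<open>
  Picard iteration. The limit of the iterates is determined almost everywhere in space-time; applying
  the Duhamel map once more gives a representative that is defined for every time and satisfies the
  equation outside one null set of wave vectors. The moment bound at a fixed time follows from the
  space-time bound, since the source is integrable in time.
\<close>

lemma mild_solution_exists: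
  fixes u :: "real^'n \<Rightarrow> real"
  assumes C: "1 \<le> C" and ui: "integrable lborel u" and u0: "\<And>k. 0 \<le> u k"
  obtains f where "case_prod f \<in> borel_measurable (lborel \<Otimes>\<^sub>M lborel)" "\<And>t k. 0 \<le> f t k"
    "AE k in lborel. (\<integral>\<^sup>+t. ennreal (source (f t) k) \<partial>laplace (rate C)) < \<infinity> \<and> (\<forall>t. f t k = duhamel (damp k) (u k) (\<lambda>s. source (f s) k) t)"
    "\<And>W t. doubling C W \<Longrightarrow> 0 \<le> t \<Longrightarrow>
        (\<integral>\<^sup>+k. ennreal (W k * f t k) \<partial>lborel) \<le> ennreal (2 * exp (rate C * t)) * (\<integral>\<^sup>+k. ennreal (W k * u k) \<partial>lborel)"
proof
  let ?\<kappa> = "rate C" and ?l = "picard_limit u" and ?p = "picard u"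
  define f where "f = step u ?l"
  note k = rate_pos[OF C]
  have um [measurable]: "u \<in> borel_measurable borel" using ui by auto
  note pm = picard_measurable[OF um] and lm = picard_limit_measurable[OF um]
  have p0: "0 \<le> ?p n t k" for n t k by (intro picard_nonneg u0)
  have l0: "0 \<le> ?l t k" for t k by (rule picard_limit_nonneg)
  have pe: "energy ?\<kappa> W (?p n) \<le> 2 * (\<integral>\<^sup>+k. ennreal (W k * u k) \<partial>lborel)" if "doubling C W" for W n
    by (rule picard_energy_le[OF C that um u0])
  have Ufin: "(\<integral>\<^sup>+k. ennreal (1 * u k) \<partial>lborel) < \<infinity>"
    using nn_integral_eq_integral[OF ui] u0 by simp
  have pfin: "energy ?\<kappa> (\<lambda>_. 1) (?p n) < \<infinity>" for n
    using le_less_trans[OF pe[OF doubling_one[OF C], of n]] Ufin by (simp add: ennreal_mult_less_top)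
  define G where "G = gap ?\<kappa> (?p 1) (?p 0)"
  have Gfin: "G < \<infinity>"
  proof -
    have "(\<integral>\<^sup>+k. \<integral>\<^sup>+t. ennreal (?p 1 t k) \<partial>laplace ?\<kappa> \<partial>lborel) < \<infinity>" by (rule mass_finite(1)[OF pm p0 k pfin])
    moreover have "\<bar>?p 1 t k - ?p 0 t k\<bar> = ?p 1 t k" for t k using p0[of 1 t k] by (simp only: picard.simps(1))
    ultimately show ?thesis unfolding G_def gap_def by (simp only:)
  qed
  have incr: "gap ?\<kappa> (?p (Suc n)) (?p n) \<le> ennreal ((1 / 2) ^ n) * G" for n
  proof (induction n)
    case 0 show ?case by (simp add: G_def)
  next
    case (Suc n)
    have "gap ?\<kappa> (?p (Suc (Suc n))) (?p (Suc n)) \<le> ennreal (1 / 2) * gap ?\<kappa> (?p (Suc n)) (?p n)"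
      unfolding picard.simps(2)[of u "Suc n"] unfolding picard.simps(2)[of u n]
      using gap_step_le[OF C pm p0 pfin pm p0 pfin, of u "Suc n" n] by simp
    also have "\<dots> \<le> ennreal (1 / 2) * (ennreal ((1 / 2) ^ n) * G)" by (intro mult_left_mono Suc) auto
    also have "\<dots> = ennreal ((1 / 2) ^ Suc n) * G"
      unfolding power_Suc by (subst ennreal_mult) (auto simp: mult.assoc)
    finally show ?case .
  qed
  \<comment> \<open>The sum of the increments from the \<open>n\<close>-th iterate on; it bounds the distance of that iterate from the limit.\<close>
  define S where "S n t k = (\<Sum>i. ennreal \<bar>?p (Suc (i + n)) t k - ?p (i + n) t k\<bar>)" for n t k
  have dm: "case_prod (\<lambda>t k. ennreal \<bar>?p (Suc i) t k - ?p i t k\<bar>) \<in> borel_measurable (lborel \<Otimes>\<^sub>M lborel)" for i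
    using pm[of "Suc i"] pm[of i] by (simp del: picard.simps) 
  have Sm: "case_prod (S n) \<in> borel_measurable (lborel \<Otimes>\<^sub>M lborel)" for n
    unfolding S_def case_prod_beta using dm unfolding case_prod_beta by (intro borel_measurable_suminf_order) simp
  have Sint: "(\<integral>\<^sup>+k. \<integral>\<^sup>+t. S n t k \<partial>laplace ?\<kappa> \<partial>lborel) \<le> ennreal (2 * (1 / 2) ^ n) * G" for n
  proof -
    have "(\<integral>\<^sup>+k. \<integral>\<^sup>+t. S n t k \<partial>laplace ?\<kappa> \<partial>lborel) = (\<Sum>i. gap ?\<kappa> (?p (Suc (i + n))) (?p (i + n)))"
    proof -
      have "(\<integral>\<^sup>+t. S n t k \<partial>laplace ?\<kappa>) = (\<Sum>i. \<integral>\<^sup>+t. ennreal \<bar>?p (Suc (i + n)) t k - ?p (i + n) t k\<bar> \<partial>laplace ?\<kappa>)" for k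
        unfolding S_def using measurable_slices(2)[OF dm] by (intro nn_integral_suminf) simp
      then show ?thesis unfolding gap_def using measurable_laplace_integral(1)[OF k dm]
        by (simp only:) (intro nn_integral_suminf, simp)
    qed
    also have "\<dots> \<le> (\<Sum>i. ennreal ((1 / 2) ^ (i + n)) * G)" by (intro suminf_le incr) auto
    also have "\<dots> = (\<Sum>i. ennreal ((1 / 2) ^ (i + n))) * G" by (rule ennreal_suminf_multc)
    also have "(\<Sum>i. ennreal ((1 / 2) ^ (i + n))) = ennreal (2 * (1 / 2) ^ n)"
    proof -
      have "(\<lambda>i. (1 / 2 :: real) ^ i) sums 2" using geometric_sums[of "1 / 2 :: real"] by simp
      then have "(\<lambda>i. (1 / 2 :: real) ^ i * (1 / 2) ^ n) sums (2 * (1 / 2) ^ n)" by (rule sums_mult2)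
      then show ?thesis by (intro suminf_ennreal_eq) (auto simp: power_add)
    qed
    finally show ?thesis .
  qed
  have "(\<integral>\<^sup>+k. \<integral>\<^sup>+t. S 0 t k \<partial>laplace ?\<kappa> \<partial>lborel) \<noteq> \<infinity>"
    using le_less_trans[OF Sint[of 0]] Gfin by (simp add: ennreal_mult_less_top less_top)
  then have "AE k in lborel. (\<integral>\<^sup>+t. S 0 t k \<partial>laplace ?\<kappa>) \<noteq> \<infinity>"
    using measurable_laplace_integral(1)[OF k Sm] by (intro nn_integral_PInf_AE) auto
  then have S0: "AE k in lborel. AE t in laplace ?\<kappa>. S 0 t k \<noteq> \<infinity>"
    by eventually_elim (intro nn_integral_PInf_AE, use measurable_slices(2)[OF Sm] in auto)
  have lim: "AE k in lborel. AE t in laplace ?\<kappa>. (\<lambda>n. ?p n t k) \<longlonglongrightarrow> ?l t k \<and> (\<forall>n. ennreal \<bar>?l t k - ?p n t k\<bar> \<le> S n t k)"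
    using S0
  proof eventually_elim
    case (elim k)
    then show ?case
    proof eventually_elim
      case (elim t)
      then have fin: "(\<Sum>i. ennreal \<bar>?p (Suc i) t k - ?p i t k\<bar>) \<noteq> \<infinity>" by (simp add: S_def del: picard.simps)
      note tl = telescoping_limit[of "\<lambda>n. ?p n t k", OF fin]
      have "0 \<le> lim (\<lambda>n. ?p n t k)" by (rule LIMSEQ_le_const[OF tl(1)]) (use p0 in blast)
      then have "?l t k = lim (\<lambda>n. ?p n t k)" by (simp add: picard_limit_def)
      then show ?case using tl unfolding S_def by simp
    qed
  qed
  have gapl: "gap ?\<kappa> ?l (?p n) \<le> ennreal (2 * (1 / 2) ^ n) * G" for n
  proof -
    have "gap ?\<kappa> ?l (?p n) \<le> (\<integral>\<^sup>+k. \<integral>\<^sup>+t. S n t k \<partial>laplace ?\<kappa> \<partial>lborel)"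
      unfolding gap_def
      by (rule nn_integral_mono_AE, use lim in eventually_elim, rule nn_integral_mono_AE, erule eventually_mono) blast
    then show ?thesis using Sint order_trans by blast
  qed
  have le: "energy ?\<kappa> W ?l \<le> 2 * (\<integral>\<^sup>+k. ennreal (W k * u k) \<partial>lborel)" if W: "doubling C W" for W
  proof -
    note [measurable] = doubling_measurable[OF W]
    have W0: "0 \<le> W k" for k by (rule doubling_nonneg[OF W])
    have wm: "case_prod (\<lambda>t k. ennreal (W k * (damp k + ?\<kappa>) * ?p n t k)) \<in> borel_measurable (lborel \<Otimes>\<^sub>M lborel)" for n
      using pm[of n] by measurable
    have "energy ?\<kappa> W ?l = (\<integral>\<^sup>+k. \<integral>\<^sup>+t. ennreal (W k * (damp k + ?\<kappa>) * ?l t k) \<partial>laplace ?\<kappa> \<partial>lborel)"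
      by (rule energy_alt[OF lm W0 l0 k])
    also have "\<dots> \<le> (\<integral>\<^sup>+k. liminf (\<lambda>n. \<integral>\<^sup>+t. ennreal (W k * (damp k + ?\<kappa>) * ?p n t k) \<partial>laplace ?\<kappa>) \<partial>lborel)"
    proof (rule nn_integral_mono_AE, use lim in eventually_elim)
      case (elim k)
      have "(\<integral>\<^sup>+t. ennreal (W k * (damp k + ?\<kappa>) * ?l t k) \<partial>laplace ?\<kappa>) = (\<integral>\<^sup>+t. liminf (\<lambda>n. ennreal (W k * (damp k + ?\<kappa>) * ?p n t k)) \<partial>laplace ?\<kappa>)"
      proof (rule nn_integral_cong_AE, use elim in eventually_elim)
        case (elim t)
        then have "(\<lambda>n. ennreal (W k * (damp k + ?\<kappa>) * ?p n t k)) \<longlonglongrightarrow> ennreal (W k * (damp k + ?\<kappa>) * ?l t k)"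
          by (intro tendsto_ennrealI tendsto_intros) auto
        then show ?case using lim_imp_Liminf[of sequentially] by (metis sequentially_bot)
      qed
      also have "\<dots> \<le> liminf (\<lambda>n. \<integral>\<^sup>+t. ennreal (W k * (damp k + ?\<kappa>) * ?p n t k) \<partial>laplace ?\<kappa>)"
        using measurable_slices(2)[OF wm] by (intro nn_integral_liminf) simp
      finally show ?case .
    qed
    also have "\<dots> \<le> liminf (\<lambda>n. \<integral>\<^sup>+k. \<integral>\<^sup>+t. ennreal (W k * (damp k + ?\<kappa>) * ?p n t k) \<partial>laplace ?\<kappa> \<partial>lborel)"
      using measurable_laplace_integral(1)[OF k wm] by (intro nn_integral_liminf) simp
    also have "\<dots> = liminf (\<lambda>n. energy ?\<kappa> W (?p n))"
      using energy_alt[OF pm W0 p0 k] by simp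
    also have "\<dots> \<le> liminf (\<lambda>n. 2 * (\<integral>\<^sup>+k. ennreal (W k * u k) \<partial>lborel))"
      by (intro Liminf_mono always_eventually allI pe W)
    also have "\<dots> = 2 * (\<integral>\<^sup>+k. ennreal (W k * u k) \<partial>lborel)" by (simp add: Liminf_const)
    finally show ?thesis .
  qed
  have lfin: "energy ?\<kappa> (\<lambda>_. 1) ?l < \<infinity>"
    using le_less_trans[OF le[OF doubling_one[OF C]]] Ufin by (simp add: ennreal_mult_less_top)
  have fm: "case_prod f \<in> borel_measurable (lborel \<Otimes>\<^sub>M lborel)" unfolding f_def by (rule step_measurable[OF um lm])
  have f0: "0 \<le> f t k" for t k unfolding f_def by (rule step_nonneg[OF u0 l0])
  \<comment> \<open>Both \<open>f\<close> and the limit are close to the iterate of order \<open>n + 1\<close>.\<close>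
  have "gap ?\<kappa> f ?l \<le> ennreal (2 * (1 / 2) ^ n) * G" for n
  proof -
    have "gap ?\<kappa> f ?l \<le> gap ?\<kappa> f (?p (Suc n)) + gap ?\<kappa> (?p (Suc n)) ?l"
      by (rule gap_triangle[OF k fm pm lm])
    also have "gap ?\<kappa> (?p (Suc n)) ?l = gap ?\<kappa> ?l (?p (Suc n))" by (simp add: gap_def abs_minus_commute del: picard.simps)
    also have "gap ?\<kappa> f (?p (Suc n)) \<le> ennreal (1 / 2) * gap ?\<kappa> ?l (?p n)"
      unfolding f_def picard.simps(2) by (rule gap_step_le[OF C lm l0 lfin pm p0 pfin])
    also have "\<dots> \<le> ennreal (1 / 2) * (ennreal (2 * (1 / 2) ^ n) * G)" by (intro mult_left_mono gapl) auto
    also have "\<dots> = ennreal ((1 / 2) ^ n) * G"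
      by (subst mult.assoc[symmetric], subst ennreal_mult[symmetric]) auto
    also have "gap ?\<kappa> ?l (?p (Suc n)) \<le> ennreal ((1 / 2) ^ n) * G" using gapl[of "Suc n"] by simp
    also have "ennreal ((1 / 2) ^ n) * G + ennreal ((1 / 2) ^ n) * G = ennreal (2 * (1 / 2) ^ n) * G"
      by (subst distrib_right[symmetric], subst ennreal_plus[symmetric]) auto
    finally show ?thesis by (simp add: add_mono)
  qed
  moreover have "(\<lambda>n. ennreal (2 * (1 / 2) ^ n) * G) \<longlonglongrightarrow> 0"
  proof -
    obtain g where g: "G = ennreal g" "0 \<le> g" using Gfin by (cases G) auto
    have "(\<lambda>n. ennreal (2 * (1 / 2) ^ n * g)) \<longlonglongrightarrow> ennreal (2 * 0 * g)"
      by (intro tendsto_ennrealI tendsto_intros LIMSEQ_realpow_zero) auto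
    then show ?thesis using g by (simp add: ennreal_mult)
  qed
  ultimately have gap0: "gap ?\<kappa> f ?l = 0"
    using LIMSEQ_le_const[of "\<lambda>n. ennreal (2 * (1 / 2) ^ n) * G" 0 "gap ?\<kappa> f ?l"] by auto
  have ae_src: "AE k in lborel. AE t in laplace ?\<kappa>. source (f t) k = source (?l t) k"
  proof -
    have dm: "case_prod (\<lambda>t k. ennreal \<bar>f t k - ?l t k\<bar>) \<in> borel_measurable (lborel \<Otimes>\<^sub>M lborel)" using fm lm by measurable
    have "(\<integral>\<^sup>+t. \<integral>\<^sup>+k. ennreal \<bar>f t k - ?l t k\<bar> \<partial>lborel \<partial>laplace ?\<kappa>) = 0"
      using gap0 laplace_swap[OF k dm] by (simp add: gap_def)
    then have "AE t in laplace ?\<kappa>. (\<integral>\<^sup>+k. ennreal \<bar>f t k - ?l t k\<bar> \<partial>lborel) = 0"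
      using measurable_laplace_integral(2)[OF k dm] by (subst (asm) nn_integral_0_iff_AE) auto
    then have "AE t in laplace ?\<kappa>. AE k in lborel. source (f t) k = source (?l t) k"
    proof eventually_elim
      case (elim t)
      note [measurable] = measurable_slices(1)[OF fm] measurable_slices(1)[OF lm]
      have ae: "AE k in lborel. f t k = ?l t k" using elim by (subst (asm) nn_integral_0_iff_AE) auto
      have "AE k in lborel. collision lam1 lam2 \<CC> (f t) k = collision lam1 lam2 \<CC> (?l t) k"
        by (rule collision_cong_AE[OF _ _ ae]) measurable
      with ae show ?case by eventually_elim (simp add: source_def)
    qed
    have sf: "case_prod (\<lambda>s k. source (f s) k) \<in> borel_measurable (lborel \<Otimes>\<^sub>M lborel)" using source_measurable_pair[OF fm] by simp
    have sl: "case_prod (\<lambda>s k. source (?l s) k) \<in> borel_measurable (lborel \<Otimes>\<^sub>M lborel)" using source_measurable_pair[OF lm] by simp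
    have sd: "case_prod (\<lambda>t k. ennreal \<bar>source (f t) k - source (?l t) k\<bar>) \<in> borel_measurable (lborel \<Otimes>\<^sub>M lborel)" using sf sl by measurable
    note [measurable] = measurable_slices[OF sf] measurable_slices[OF sl] measurable_slices[OF sd]
    have "(\<integral>\<^sup>+k. ennreal \<bar>source (f t) k - source (?l t) k\<bar> \<partial>lborel) = 0"
      if "AE k in lborel. source (f t) k = source (?l t) k" for t
      using that by (subst nn_integral_0_iff_AE) auto
    with \<open>AE t in laplace ?\<kappa>. AE k in lborel. source (f t) k = source (?l t) k\<close>
    have "(\<integral>\<^sup>+t. \<integral>\<^sup>+k. ennreal \<bar>source (f t) k - source (?l t) k\<bar> \<partial>lborel \<partial>laplace ?\<kappa>) = 0"
      using measurable_laplace_integral(2)[OF k sd] by (subst nn_integral_0_iff_AE) (auto elim: eventually_mono)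
    then have "(\<integral>\<^sup>+k. \<integral>\<^sup>+t. ennreal \<bar>source (f t) k - source (?l t) k\<bar> \<partial>laplace ?\<kappa> \<partial>lborel) = 0"
      using laplace_swap[OF k sd] by simp
    then have "AE k in lborel. (\<integral>\<^sup>+t. ennreal \<bar>source (f t) k - source (?l t) k\<bar> \<partial>laplace ?\<kappa>) = 0"
      using measurable_laplace_integral(1)[OF k sd] by (subst (asm) nn_integral_0_iff_AE) auto
    then show ?thesis
      by eventually_elim (subst (asm) nn_integral_0_iff_AE, auto)
  qed
  show "case_prod f \<in> borel_measurable (lborel \<Otimes>\<^sub>M lborel)" by (rule fm)
  show "0 \<le> f t k" for t k by (rule f0)
  have sf: "case_prod (\<lambda>s k. source (f s) k) \<in> borel_measurable (lborel \<Otimes>\<^sub>M lborel)" using source_measurable_pair[OF fm] by simp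
  have sl: "case_prod (\<lambda>s k. source (?l s) k) \<in> borel_measurable (lborel \<Otimes>\<^sub>M lborel)" using source_measurable_pair[OF lm] by simp
  show "AE k in lborel. (\<integral>\<^sup>+t. ennreal (source (f t) k) \<partial>laplace ?\<kappa>) < \<infinity> \<and> (\<forall>t. f t k = duhamel (damp k) (u k) (\<lambda>s. source (f s) k) t)"
    using ae_src source_finite_AE[OF C lm l0 lfin]
  proof eventually_elim
    case (elim k)
    note [measurable] = measurable_slices(2)[OF sf, of k] measurable_slices(2)[OF sl, of k]
    have "(\<integral>\<^sup>+t. ennreal (source (f t) k) \<partial>laplace ?\<kappa>) = (\<integral>\<^sup>+t. ennreal (source (?l t) k) \<partial>laplace ?\<kappa>)"
      using elim(1) by (intro nn_integral_cong_AE) (auto elim: eventually_mono)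
    moreover have "f t k = duhamel (damp k) (u k) (\<lambda>s. source (f s) k) t" for t
    proof -
      have "(\<integral>s. indicator {0..t} s * exp (- (damp k * (t - s))) * source (?l s) k \<partial>lborel)
         = (\<integral>s. indicator {0..t} s * exp (- (damp k * (t - s))) * source (f s) k \<partial>lborel)"
        using elim(1) unfolding AE_laplace by (intro integral_cong_AE) (auto simp: indicator_def elim: eventually_mono)
      then show ?thesis unfolding f_def step_def duhamel_def by simp
    qed
    ultimately show ?case using elim by simp
  qed
  fix W :: "real^'n \<Rightarrow> real" and t :: real assume W: "doubling C W" and t: "0 \<le> t"
  note [measurable] = doubling_measurable[OF W]
  have W0: "0 \<le> W k" for k by (rule doubling_nonneg[OF W])
  let ?U = "\<integral>\<^sup>+k. ennreal (W k * u k) \<partial>lborel"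
  let ?E = "ennreal (exp (?\<kappa> * t))"
  have slm: "case_prod (\<lambda>s k. ennreal (source (?l s) k)) \<in> borel_measurable (lborel \<Otimes>\<^sub>M lborel)" using sl by measurable
  note [measurable] = measurable_laplace_integral(1)[OF k slm]
  have "(\<integral>\<^sup>+k. ennreal (W k * f t k) \<partial>lborel) \<le> (\<integral>\<^sup>+k. ennreal (W k * u k) + ?E * (ennreal (W k) * (\<integral>\<^sup>+s. ennreal (source (?l s) k) \<partial>laplace ?\<kappa>)) \<partial>lborel)"
  proof (rule nn_integral_mono)
    fix k
    note [measurable] = measurable_slices(2)[OF sl, of k]
    have "ennreal (f t k) \<le> ennreal (exp (- (damp k * t)) * u k)
      + (\<integral>\<^sup>+s. ennreal (indicator {0..t} s * exp (- (damp k * (t - s)))) * ennreal (source (?l s) k) \<partial>lborel)"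
      unfolding f_def step_def by (intro duhamel_le u0 source_nonneg l0)
    also have "\<dots> \<le> ennreal (u k) + (\<integral>\<^sup>+s. indicator {0..t} s * ennreal (source (?l s) k) \<partial>lborel)"
    proof (intro add_mono ennreal_leI nn_integral_mono mult_right_mono)
      show "exp (- (damp k * t)) * u k \<le> u k" using t damp_nonneg[of k] u0[of k] by (simp add: mult_left_le_one_le)
      show "ennreal (indicator {0..t} s * exp (- (damp k * (t - s)))) \<le> indicator {0..t} s" for s
        using damp_nonneg[of k] by (auto simp: indicator_def)
    qed auto
    also have "\<dots> \<le> ennreal (u k) + ?E * (\<integral>\<^sup>+s. ennreal (source (?l s) k) \<partial>laplace ?\<kappa>)"
      by (intro add_left_mono nn_integral_laplace_window k) measurable
    finally have "ennreal (W k) * ennreal (f t k) \<le> ennreal (W k) * (ennreal (u k) + ?E * (\<integral>\<^sup>+s. ennreal (source (?l s) k) \<partial>laplace ?\<kappa>))"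
      by (rule mult_left_mono) simp
    then show "ennreal (W k * f t k) \<le> ennreal (W k * u k) + ?E * (ennreal (W k) * (\<integral>\<^sup>+s. ennreal (source (?l s) k) \<partial>laplace ?\<kappa>))"
      using W0 u0 f0 by (simp add: ennreal_mult distrib_left mult.left_commute)
  qed
  also have "\<dots> = ?U + ?E * (\<integral>\<^sup>+k. ennreal (W k) * (\<integral>\<^sup>+s. ennreal (source (?l s) k) \<partial>laplace ?\<kappa>) \<partial>lborel)"
    by (simp add: nn_integral_add nn_integral_cmult)
  also have "\<dots> \<le> ?U + ?E * (ennreal (1 / 2) * (2 * ?U))"
    using source_spacetime_le[OF C W lm l0] mult_left_mono[OF le[OF W], of "ennreal (1 / 2)"]
    by (intro add_left_mono mult_left_mono) (auto intro: order_trans)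
  also have "ennreal (1 / 2) * (2 * ?U) = ?U"
  proof -
    have "ennreal (1 / 2) * (2 * ?U) = (ennreal (1 / 2) * ennreal 2) * ?U" by (simp only: mult.assoc ennreal_numeral)
    also have "ennreal (1 / 2) * ennreal 2 = 1" by (subst ennreal_mult[symmetric]) auto
    finally show ?thesis by simp
  qed
  also have "?U + ?E * ?U \<le> ?E * ?U + ?E * ?U"
  proof (rule add_right_mono)
    have "ennreal 1 * ?U \<le> ?E * ?U" using t k by (intro mult_right_mono ennreal_leI) auto
    then show "?U \<le> ?E * ?U" by simp
  qed
  also have "?E * ?U + ?E * ?U = ennreal (2 * exp (?\<kappa> * t)) * ?U"
    by (subst distrib_right[symmetric], subst ennreal_plus[symmetric]) auto
  finally show "(\<integral>\<^sup>+k. ennreal (W k * f t k) \<partial>lborel) \<le> ennreal (2 * exp (?\<kappa> * t)) * ?U" .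
qed

end

section \<open>Regularity of the mild solution\<close>

lemma doubling_add: "doubling D W \<Longrightarrow> doubling D W' \<Longrightarrow> doubling D (\<lambda>x. W x + W' x)"
  unfolding doubling_def
proof (intro conjI allI impI)
  fix x y z :: 'a
  assume "W \<in> borel_measurable borel \<and> (\<forall>x. 0 \<le> W x) \<and> (\<forall>x y z. norm x \<le> norm y + norm z \<longrightarrow> W x \<le> D * (W y + W z))"
    "W' \<in> borel_measurable borel \<and> (\<forall>x. 0 \<le> W' x) \<and> (\<forall>x y z. norm x \<le> norm y + norm z \<longrightarrow> W' x \<le> D * (W' y + W' z))"
    "norm x \<le> norm y + norm z"
  then have "W x \<le> D * (W y + W z)" "W' x \<le> D * (W' y + W' z)" by blast+
  then show "W x + W' x \<le> D * (W y + W' y + (W z + W' z))" by (simp add: algebra_simps)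
qed (auto intro: add_nonneg_nonneg)

lemma powr_le_one_plus:
  fixes x p q :: real
  assumes "0 \<le> x" "0 \<le> p" "p \<le> q"
  shows "x powr p \<le> 1 + x powr q"
proof (cases "x \<le> 1")
  case True
  then have "x powr p \<le> 1 powr p" using assms by (intro powr_mono2) auto
  then show ?thesis by (simp add: add_increasing2)
next
  case False
  then have "x powr p \<le> x powr q" using assms by (intro powr_mono) auto
  then show ?thesis by simp
qed

text \<open>
  Interpolation between the order \<open>0\<close> and the order \<open>q\<close>, at the cost of a constant.
\<close>

lemma powr_interpolate:
  fixes p q e :: real
  assumes "0 \<le> p" "p + 1 \<le> q" "0 < e"
  shows "\<exists>c\<ge>0. \<forall>x\<ge>0. x powr p \<le> e * x powr q + c"
proof (intro exI[of _ "(max 1 (1 / e)) powr p"] conjI allI impI)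
  define R where "R = max 1 (1 / e)"
  have R: "1 \<le> R" "1 / e \<le> R" by (auto simp: R_def)
  fix x :: real assume x: "0 \<le> x"
  have "x powr p \<le> e * x powr q + R powr p"
  proof (cases "x \<le> R")
    case True
    then have "x powr p \<le> R powr p" using x assms by (intro powr_mono2) auto
    then show ?thesis using assms by (simp add: add_increasing)
  next
    case False
    have "1 \<le> e * R" using R(2) assms by (simp add: field_simps)
    also have "e * R \<le> e * x" using False assms by (intro mult_left_mono) auto
    finally have "1 \<le> e * x" .
    moreover have "1 \<le> x" using False R by simp
    ultimately have "1 \<le> x" "1 \<le> e * x" by auto
    then have "1 * x powr p \<le> (e * x) * x powr p" by (intro mult_right_mono) auto
    also have "\<dots> = e * x powr (1 + p)" using \<open>1 \<le> x\<close> by (simp add: powr_add)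
    also have "\<dots> \<le> e * x powr q" using \<open>1 \<le> x\<close> assms by (intro mult_left_mono powr_mono) auto
    finally show ?thesis by (simp add: add_increasing2)
  qed
  then show "x powr p \<le> e * x powr q + (max 1 (1 / e)) powr p" by (simp add: R_def)
qed auto

text \<open>
  The properties of the solution that \<open>mild_solution_exists\<close> provides. The doubling constant
  \<open>2\<^sup>N\<^sup>+\<^sup>3\<close> is the one of \<open>\<omega>\<^sup>N\<^sup>+\<^sup>3\<close>.
\<close>

locale mild_flow = kinetic +
  fixes N :: real and u :: "real^'n \<Rightarrow> real" and f :: "real \<Rightarrow> real^'n \<Rightarrow> real"
  assumes N: "0 < N" and ui: "integrable lborel u" and u0: "\<And>k. 0 \<le> u k"
    and uw: "integrable lborel (\<lambda>k. omega lam1 lam2 k powr (N + 3) * u k)"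
    and upos: "0 < (\<integral>k. u k \<partial>lborel)"
    and fm: "case_prod f \<in> borel_measurable (lborel \<Otimes>\<^sub>M lborel)" and f0: "\<And>t k. 0 \<le> f t k"
    and mild: "AE k in lborel. (\<integral>\<^sup>+t. ennreal (source (f t) k) \<partial>laplace (rate (2 powr (N + 3)))) < \<infinity> \<and>
        (\<forall>t. f t k = duhamel (damp k) (u k) (\<lambda>s. source (f s) k) t)"
    and moment: "\<And>W t. doubling (2 powr (N + 3)) W \<Longrightarrow> 0 \<le> t \<Longrightarrow>
        (\<integral>\<^sup>+k. ennreal (W k * f t k) \<partial>lborel)
          \<le> ennreal (2 * exp (rate (2 powr (N + 3)) * t)) * (\<integral>\<^sup>+k. ennreal (W k * u k) \<partial>lborel)"
begin

abbreviation \<kappa> :: real where "\<kappa> \<equiv> rate (2 powr (N + 3))"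
abbreviation w :: "real^'n \<Rightarrow> real" where "w \<equiv> omega lam1 lam2"

definition moment_weight :: "real^'n \<Rightarrow> real" where "moment_weight k = 1 + w k powr (N + 3)"
definition norm_const :: real where "norm_const = 1 + 1 / sqrt lam2 + (1 / sqrt lam2)\<^sup>2"
definition moment_bound :: "real \<Rightarrow> real" where "moment_bound T = 2 * exp (\<kappa> * T) * (\<integral>k. moment_weight k * u k \<partial>lborel)"
definition velocity :: "real \<Rightarrow> real^'n \<Rightarrow> real" where
  "velocity t k = collision lam1 lam2 \<CC> (f t) k - 2 * \<nu> * (norm k)\<^sup>2 * f t k"

lemma moment_const_ge_1: "1 \<le> 2 powr (N + 3)" using N by (intro ge_one_powr_ge_zero) auto
lemma moment_rate_pos: "0 < \<kappa>" by (rule rate_pos[OF moment_const_ge_1])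
lemma weight_nonneg: "0 \<le> w k" using lam1 lam2 by (intro omega_nonneg) auto
lemma u_measurable [measurable]: "u \<in> borel_measurable borel" using ui by auto
lemma f_measurable [measurable]: "f t \<in> borel_measurable borel" by (rule measurable_slices(1)[OF fm])
lemma f_time_measurable: "(\<lambda>t. f t k) \<in> borel_measurable borel" by (rule measurable_slices(2)[OF fm])
lemma moment_weight_measurable [measurable]: "moment_weight \<in> borel_measurable borel" unfolding moment_weight_def[abs_def] by measurable
lemma moment_weight_ge_1: "1 \<le> moment_weight k" by (simp add: moment_weight_def)
lemma norm_const_ge_1: "1 \<le> norm_const" using lam2 by (simp add: norm_const_def)

lemma velocity_measurable_pair: "case_prod velocity \<in> borel_measurable (lborel \<Otimes>\<^sub>M lborel)"
proof -
  note [measurable] = collision_measurable_pair[OF fm, of lam1 lam2 \<CC>] fm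
  have "(\<lambda>x. collision lam1 lam2 \<CC> (f (fst x)) (snd x)) \<in> borel_measurable (lborel \<Otimes>\<^sub>M lborel)"
    "(\<lambda>x. f (fst x) (snd x)) \<in> borel_measurable (lborel \<Otimes>\<^sub>M lborel)"
    using collision_measurable_pair[OF fm, of lam1 lam2 \<CC>] fm by (simp_all add: case_prod_beta)
  then show ?thesis unfolding velocity_def case_prod_beta by measurable
qed

lemma velocity_measurable [measurable]: "velocity t \<in> borel_measurable borel" by (rule measurable_slices(1)[OF velocity_measurable_pair])

lemma norm_le_w: "norm k \<le> 1 / sqrt lam2 * w k"
  using omega_ge_norm[of lam1 lam2 k] lam1 lam2 by (simp add: field_simps)

text \<open>
  The factors \<open>|k|\<close> and \<open>|k|\<^sup>2\<close> produced by the equation each cost one power of \<open>\<omega>\<close>.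
\<close>

lemma norm_power_omega_le:
  assumes "i \<le> 2"
  shows "norm k ^ i * w k powr N \<le> norm_const * w k powr (N + real i)" "norm k ^ i * w k powr N \<le> norm_const * moment_weight k" "norm k ^ i \<le> norm_const * moment_weight k"
proof -
  have mu: "(1 / sqrt lam2) ^ i \<le> norm_const" using assms lam2 by (auto simp: norm_const_def numeral_2_eq_2 le_Suc_eq)
  have ki: "norm k ^ i \<le> norm_const * w k ^ i"
  proof -
    have "norm k ^ i \<le> (1 / sqrt lam2 * w k) ^ i" by (intro power_mono norm_le_w) auto
    also have "\<dots> = (1 / sqrt lam2) ^ i * w k ^ i" by (rule power_mult_distrib)
    also have "\<dots> \<le> norm_const * w k ^ i" using mu weight_nonneg by (intro mult_right_mono) auto
    finally show ?thesis .
  qed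
  have wi: "w k ^ i * w k powr N = w k powr (N + real i)"
  proof (cases "w k = 0")
    case False
    then have "0 < w k" using weight_nonneg[of k] by simp
    then show ?thesis by (simp add: powr_add powr_realpow)
  qed simp
  show 1: "norm k ^ i * w k powr N \<le> norm_const * w k powr (N + real i)"
    using mult_right_mono[OF ki, of "w k powr N"] wi by (simp add: mult.assoc)
  have "w k powr (N + real i) \<le> moment_weight k" unfolding moment_weight_def using weight_nonneg N assms by (intro powr_le_one_plus) auto
  then have "norm_const * w k powr (N + real i) \<le> norm_const * moment_weight k" using norm_const_ge_1 by (intro mult_left_mono) auto
  then show "norm k ^ i * w k powr N \<le> norm_const * moment_weight k" using 1 by simp
  have "w k ^ i \<le> moment_weight k"
  proof (cases "w k \<le> 1")
    case True
    then show ?thesis using power_le_one[OF weight_nonneg[of k]] moment_weight_ge_1[of k] by (meson order_trans)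
  next
    case False
    then have "w k ^ i = w k powr real i" by (simp add: powr_realpow)
    also have "\<dots> \<le> moment_weight k" unfolding moment_weight_def using weight_nonneg N assms by (intro powr_le_one_plus) auto
    finally show ?thesis .
  qed
  then have "norm_const * w k ^ i \<le> norm_const * moment_weight k" using norm_const_ge_1 by (intro mult_left_mono) auto
  then show "norm k ^ i \<le> norm_const * moment_weight k" using ki by simp
qed

lemma doubling_omega_powr: "0 \<le> p \<Longrightarrow> doubling (2 powr p) (\<lambda>k. w k powr p)"
  using lam1 lam2 by (intro doubling_powr weight_nonneg omega_subadditive) auto

lemma doubling_moment_weight: "doubling (2 powr (N + 3)) moment_weight"
  unfolding moment_weight_def[abs_def] using N by (intro doubling_add doubling_omega_powr doubling_one moment_const_ge_1) auto

lemma moment_weight_u_integrable: "integrable lborel (\<lambda>k. moment_weight k * u k)"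
  unfolding moment_weight_def distrib_right using ui uw by simp

lemma moment_weight_u_nonneg: "0 \<le> (\<integral>k. moment_weight k * u k \<partial>lborel)"
  using u0 moment_weight_ge_1 by (intro integral_nonneg_AE AE_I2 mult_nonneg_nonneg) (auto intro: order_trans[OF zero_le_one])

lemma moment_bound_nonneg: "0 \<le> moment_bound T" unfolding moment_bound_def using moment_weight_u_nonneg by simp

lemma moment_f_le: 
  assumes "0 \<le> t" "t \<le> T"
  shows "(\<integral>\<^sup>+k. ennreal (moment_weight k * f t k) \<partial>lborel) \<le> ennreal (moment_bound T)"
proof -
  have Z0: "0 \<le> moment_weight k" for k using moment_weight_ge_1[of k] by simp
  have "(\<integral>\<^sup>+k. ennreal (moment_weight k * f t k) \<partial>lborel) \<le> ennreal (2 * exp (\<kappa> * t)) * (\<integral>\<^sup>+k. ennreal (moment_weight k * u k) \<partial>lborel)"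
    by (rule moment[OF doubling_moment_weight assms(1)])
  also have "\<dots> = ennreal (2 * exp (\<kappa> * t) * (\<integral>k. moment_weight k * u k \<partial>lborel))"
    using nn_integral_eq_integral[OF moment_weight_u_integrable] Z0 u0 moment_weight_u_nonneg by (simp add: ennreal_mult)
  also have "\<dots> \<le> ennreal (moment_bound T)"
    unfolding moment_bound_def using assms moment_rate_pos moment_weight_u_nonneg by (intro ennreal_leI mult_right_mono) auto
  finally show ?thesis .
qed

lemma f_weighted_integrable:
  assumes V [measurable]: "V \<in> borel_measurable borel" and V0: "\<And>k. 0 \<le> V k" and le: "\<And>k. V k \<le> c * moment_weight k" and t: "0 \<le> t" "t \<le> T"
  shows "integrable lborel (\<lambda>k. V k * f t k)" "(\<integral>k. V k * f t k \<partial>lborel) \<le> c * moment_bound T"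
proof -
  have Z0: "0 \<le> moment_weight k" for k using moment_weight_ge_1[of k] by simp
  have c: "0 \<le> c" using order_trans[OF V0 le, of 0] moment_weight_ge_1[of 0] by (auto simp: zero_le_mult_iff)
  have "(\<integral>\<^sup>+k. ennreal (V k * f t k) \<partial>lborel) \<le> (\<integral>\<^sup>+k. ennreal c * ennreal (moment_weight k * f t k) \<partial>lborel)"
  proof (rule nn_integral_mono)
    fix k
    have "V k * f t k \<le> c * (moment_weight k * f t k)" using mult_right_mono[OF le f0, of k t k] by (simp add: mult.assoc)
    then show "ennreal (V k * f t k) \<le> ennreal c * ennreal (moment_weight k * f t k)" using c Z0 f0 by (simp add: ennreal_leI flip: ennreal_mult)
  qed
  also have "\<dots> = ennreal c * (\<integral>\<^sup>+k. ennreal (moment_weight k * f t k) \<partial>lborel)" by (rule nn_integral_cmult) measurable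
  also have "\<dots> \<le> ennreal c * ennreal (moment_bound T)" by (intro mult_left_mono moment_f_le t) auto
  also have "\<dots> = ennreal (c * moment_bound T)" using c moment_bound_nonneg by (simp add: ennreal_mult)
  finally have le: "(\<integral>\<^sup>+k. ennreal (V k * f t k) \<partial>lborel) \<le> ennreal (c * moment_bound T)" .
  then show int: "integrable lborel (\<lambda>k. V k * f t k)"
    using V0 f0 by (intro integrableI_bounded) (auto intro: le_less_trans)
  have "ennreal (\<integral>k. V k * f t k \<partial>lborel) \<le> ennreal (c * moment_bound T)"
    using le nn_integral_eq_integral[OF int] V0 f0 by simp
  then show "(\<integral>k. V k * f t k \<partial>lborel) \<le> c * moment_bound T" using c moment_bound_nonneg by (simp add: ennreal_le_iff)
qed

lemma f_integrable: "0 \<le> t \<Longrightarrow> integrable lborel (f t)"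
  using f_weighted_integrable(1)[of "\<lambda>_. 1" 1 t t] moment_weight_ge_1 by simp

lemma integral_equation:
  "AE k in lborel. \<forall>s t. 0 \<le> s \<longrightarrow> s \<le> t \<longrightarrow> integrable lborel (\<lambda>r. indicator {s..t} r * velocity r k) \<and>
      f t k - f s k = (\<integral>r. indicator {s..t} r * velocity r k \<partial>lborel)"
  using mild
proof eventually_elim
  case (elim k)
  have sm: "case_prod (\<lambda>s k. source (f s) k) \<in> borel_measurable (lborel \<Otimes>\<^sub>M lborel)" using source_measurable_pair[OF fm] by simp
  note [measurable] = measurable_slices(2)[OF sm, of k] f_time_measurable[of k]
  have p0: "0 \<le> source (f s) k" for s by (rule source_nonneg[OF f0])
  have pint: "integrable lborel (\<lambda>s. indicator {0..t} s * source (f s) k)" for t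
    using elim p0 moment_rate_pos damp_nonneg[of k] by (intro duhamel_integrable(1)[where a = "damp k"]) auto
  have dh: "f t k = duhamel (damp k) (u k) (\<lambda>s. source (f s) k) t" for t using elim by blast
  have sk: "(\<lambda>s. source (f s) k) \<in> borel_measurable borel" by (rule measurable_slices(2)[OF sm])
  note D = duhamel_integral_equation[OF u0[of k] p0 sk damp_nonneg[of k] pint _ f_time_measurable dh]
  have FD: "velocity r k = source (f r) k - damp k * f r k" for r
    by (simp add: velocity_def source_def damp_def algebra_simps)
  have iF: "integrable lborel (\<lambda>r. indicator {0..t} r * velocity r k)"
    and eF: "f t k = u k + (\<integral>r. indicator {0..t} r * velocity r k \<partial>lborel)" if "0 \<le> t" for t
  proof -
    have iD: "integrable lborel (\<lambda>s. indicator {0..t} s * (damp k * f s k))"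
      using integrable_mult_right[OF D(1)[OF that], of "damp k"] by (simp add: mult.left_commute)
    show "integrable lborel (\<lambda>r. indicator {0..t} r * velocity r k)"
      unfolding FD right_diff_distrib using pint[of t] iD by (intro Bochner_Integration.integrable_diff)
    have "(\<integral>r. indicator {0..t} r * velocity r k \<partial>lborel) = (\<integral>r. indicator {0..t} r * source (f r) k \<partial>lborel) - (\<integral>s. indicator {0..t} s * (damp k * f s k) \<partial>lborel)"
      unfolding FD right_diff_distrib using pint[of t] iD by (intro Bochner_Integration.integral_diff)
    then show "f t k = u k + (\<integral>r. indicator {0..t} r * velocity r k \<partial>lborel)" using D(2)[OF that] by simp
  qed
  show ?case
  proof (intro allI impI)
    fix s t :: real assume st: "0 \<le> s" "s \<le> t"
    then have t: "0 \<le> t" by simp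
    have ae: "AE r in lborel. indicator {s..t} r * velocity r k = indicator {0..t} r * velocity r k - indicator {0..s} r * velocity r k"
      using AE_lborel_singleton[of s] by eventually_elim (use st in \<open>auto simp: indicator_def\<close>)
    have Fk: "(\<lambda>r. velocity r k) \<in> borel_measurable borel" by (rule measurable_slices(2)[OF velocity_measurable_pair])
    note [measurable] = Fk
    have "integrable lborel (\<lambda>r. indicator {0..t} r * velocity r k - indicator {0..s} r * velocity r k)"
      using iF[OF t] iF[OF st(1)] by simp
    then show "integrable lborel (\<lambda>r. indicator {s..t} r * velocity r k) \<and> f t k - f s k = (\<integral>r. indicator {s..t} r * velocity r k \<partial>lborel)"
      using ae eF[OF t] eF[OF st(1)] iF[OF t] iF[OF st(1)] integrable_cong_AE[OF _ _ ae] integral_cong_AE[OF _ _ ae] by simp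
  qed
qed

text \<open>
  The viscous term needs two powers of \<open>|k|\<close> and the collision term one, so moments of order
  \<open>N + 2\<close> suffice.
\<close>

lemma velocity_bound:
  "\<exists>K\<ge>0. \<forall>t. 0 \<le> t \<longrightarrow> t \<le> T \<longrightarrow> (\<integral>\<^sup>+k. ennreal ((1 + w k powr N) * \<bar>velocity t k\<bar>) \<partial>lborel) \<le> ennreal K"
proof (intro exI[of _ "9 * \<CC>\<^sup>2 * (4 * 2 powr (N + 3)) * (2 * norm_const * moment_bound T) + 2 * \<nu> * (2 * norm_const * moment_bound T)"] conjI allI impI)
  show "0 \<le> 9 * \<CC>\<^sup>2 * (4 * 2 powr (N + 3)) * (2 * norm_const * moment_bound T) + 2 * \<nu> * (2 * norm_const * moment_bound T)"
    using norm_const_ge_1 moment_bound_nonneg[of T] nu by (intro add_nonneg_nonneg mult_nonneg_nonneg) auto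
  fix t assume t: "0 \<le> t" "t \<le> T"
  define W where "W k = 1 + w k powr N" for k
  have "2 powr N \<le> 2 powr (N + 3)" by (intro powr_mono) auto
  then have W: "doubling (2 powr (N + 3)) W" unfolding W_def using N by (intro doubling_add doubling_one moment_const_ge_1 doubling_mono[OF doubling_omega_powr]) auto
  note [measurable] = doubling_measurable[OF W] collision_measurable[OF f_measurable[of t], of lam1 lam2 \<CC>]
  have nWi: "norm k ^ i * W k \<le> 2 * norm_const * moment_weight k" if "i \<le> 2" for i k
    using norm_power_omega_le(2,3)[OF that, of k] by (simp add: W_def distrib_left)
  have nW: "norm k * W k \<le> 2 * norm_const * moment_weight k" for k using nWi[of 1 k] by simp
  have "(\<integral>\<^sup>+k. ennreal (W k * \<bar>velocity t k\<bar>) \<partial>lborel)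
     \<le> (\<integral>\<^sup>+k. ennreal (W k * \<bar>collision lam1 lam2 \<CC> (f t) k\<bar>) + ennreal (2 * \<nu> * ((norm k ^ 2 * W k) * f t k)) \<partial>lborel)"
  proof (rule nn_integral_mono)
    fix k
    have W0: "0 \<le> W k" by (rule doubling_nonneg[OF W])
    have "\<bar>velocity t k\<bar> \<le> \<bar>collision lam1 lam2 \<CC> (f t) k\<bar> + 2 * \<nu> * (norm k)\<^sup>2 * f t k"
      unfolding velocity_def using f0[of t k] nu abs_triangle_ineq4[of "collision lam1 lam2 \<CC> (f t) k" "2 * \<nu> * (norm k)\<^sup>2 * f t k"]
      by (simp add: abs_mult)
    then have "W k * \<bar>velocity t k\<bar> \<le> W k * (\<bar>collision lam1 lam2 \<CC> (f t) k\<bar> + 2 * \<nu> * (norm k)\<^sup>2 * f t k)" by (rule mult_left_mono[OF _ W0])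
    also have "\<dots> = W k * \<bar>collision lam1 lam2 \<CC> (f t) k\<bar> + 2 * \<nu> * ((norm k ^ 2 * W k) * f t k)"
      by (simp add: algebra_simps)
    finally have "ennreal (W k * \<bar>velocity t k\<bar>) \<le> ennreal (W k * \<bar>collision lam1 lam2 \<CC> (f t) k\<bar> + 2 * \<nu> * ((norm k ^ 2 * W k) * f t k))"
      by (rule ennreal_leI)
    also have "\<dots> = ennreal (W k * \<bar>collision lam1 lam2 \<CC> (f t) k\<bar>) + ennreal (2 * \<nu> * ((norm k ^ 2 * W k) * f t k))"
      using nu f0 W0 by (intro ennreal_plus) auto
    finally show "ennreal (W k * \<bar>velocity t k\<bar>) \<le> ennreal (W k * \<bar>collision lam1 lam2 \<CC> (f t) k\<bar>) + ennreal (2 * \<nu> * ((norm k ^ 2 * W k) * f t k))" .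
  qed
  also have "\<dots> = (\<integral>\<^sup>+k. ennreal (W k * \<bar>collision lam1 lam2 \<CC> (f t) k\<bar>) \<partial>lborel) + (\<integral>\<^sup>+k. ennreal (2 * \<nu> * ((norm k ^ 2 * W k) * f t k)) \<partial>lborel)"
    by (rule nn_integral_add) measurable
  also have "\<dots> \<le> ennreal (9 * \<CC>\<^sup>2 * (4 * 2 powr (N + 3)) * (2 * norm_const * moment_bound T)) + ennreal (2 * \<nu> * (2 * norm_const * moment_bound T))"
  proof (rule add_mono)
    have "(\<integral>\<^sup>+k. ennreal (W k * \<bar>collision lam1 lam2 \<CC> (f t) k\<bar>) \<partial>lborel) \<le> ennreal (9 * \<CC>\<^sup>2 * (4 * 2 powr (N + 3)) * (\<integral>k. norm k * W k * f t k \<partial>lborel))"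
      using f_integrable[OF t(1)] f0 nW t doubling_nonneg[OF W] by (intro collision_le doubling_norm_mult W f_weighted_integrable(1)[where c = "2 * norm_const" and T = T]) auto
    also have "\<dots> \<le> ennreal (9 * \<CC>\<^sup>2 * (4 * 2 powr (N + 3)) * (2 * norm_const * moment_bound T))"
      using nW t doubling_nonneg[OF W] by (intro ennreal_leI mult_left_mono f_weighted_integrable(2)) auto
    finally show "(\<integral>\<^sup>+k. ennreal (W k * \<bar>collision lam1 lam2 \<CC> (f t) k\<bar>) \<partial>lborel) \<le> ennreal (9 * \<CC>\<^sup>2 * (4 * 2 powr (N + 3)) * (2 * norm_const * moment_bound T))" .
    have i: "integrable lborel (\<lambda>k. (norm k ^ 2 * W k) * f t k)" and le: "(\<integral>k. (norm k ^ 2 * W k) * f t k \<partial>lborel) \<le> 2 * norm_const * moment_bound T"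
      using nWi[of 2] t doubling_nonneg[OF W] by (auto intro!: f_weighted_integrable[where c = "2 * norm_const" and T = T] simp del: One_nat_def)
    have "(\<integral>\<^sup>+k. ennreal (2 * \<nu> * ((norm k ^ 2 * W k) * f t k)) \<partial>lborel) = ennreal (\<integral>k. 2 * \<nu> * ((norm k ^ 2 * W k) * f t k) \<partial>lborel)"
      using i nu f0 doubling_nonneg[OF W] by (intro nn_integral_eq_integral integrable_mult_right) auto
    also have "(\<integral>k. 2 * \<nu> * ((norm k ^ 2 * W k) * f t k) \<partial>lborel) = 2 * \<nu> * (\<integral>k. (norm k ^ 2 * W k) * f t k \<partial>lborel)"
      by (rule integral_mult_right_zero)
    also have "ennreal \<dots> \<le> ennreal (2 * \<nu> * (2 * norm_const * moment_bound T))"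
      using le nu by (intro ennreal_leI mult_left_mono) auto
    finally show "(\<integral>\<^sup>+k. ennreal (2 * \<nu> * ((norm k ^ 2 * W k) * f t k)) \<partial>lborel) \<le> ennreal (2 * \<nu> * (2 * norm_const * moment_bound T))" .
  qed
  also have "\<dots> = ennreal (9 * \<CC>\<^sup>2 * (4 * 2 powr (N + 3)) * (2 * norm_const * moment_bound T) + 2 * \<nu> * (2 * norm_const * moment_bound T))"
    using norm_const_ge_1 moment_bound_nonneg[of T] nu by (intro ennreal_plus[symmetric] mult_nonneg_nonneg) auto
  finally have "(\<integral>\<^sup>+k. ennreal (W k * \<bar>velocity t k\<bar>) \<partial>lborel) \<le> ennreal (9 * \<CC>\<^sup>2 * (4 * 2 powr (N + 3)) * (2 * norm_const * moment_bound T) + 2 * \<nu> * (2 * norm_const * moment_bound T))" .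
  then show "(\<integral>\<^sup>+k. ennreal ((1 + w k powr N) * \<bar>velocity t k\<bar>) \<partial>lborel) \<le> ennreal (9 * \<CC>\<^sup>2 * (4 * 2 powr (N + 3)) * (2 * norm_const * moment_bound T) + 2 * \<nu> * (2 * norm_const * moment_bound T))"
    by (simp only: W_def)
qed

text \<open>
  With \<open>g = 0\<close> this gives Lipschitz continuity in time, and with \<open>g\<close> the velocity at one of the end
  points it gives differentiability.
\<close>

lemma increment_le:
  assumes V [measurable]: "V \<in> borel_measurable borel" and V0: "\<And>k. 0 \<le> V k" and g [measurable]: "g \<in> borel_measurable borel"
    and st: "0 \<le> s" "s \<le> t" and K: "\<And>r. s \<le> r \<Longrightarrow> r \<le> t \<Longrightarrow> (\<integral>\<^sup>+k. ennreal (V k * \<bar>velocity r k - g k\<bar>) \<partial>lborel) \<le> ennreal K" and K0: "0 \<le> K"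
  shows "(\<integral>\<^sup>+k. ennreal (V k * \<bar>f t k - f s k - (t - s) * g k\<bar>) \<partial>lborel) \<le> ennreal (K * (t - s))"
proof -
  have "case_prod velocity \<in> borel_measurable (lborel \<Otimes>\<^sub>M lborel)" by (rule velocity_measurable_pair)
  then have Fc [measurable]: "(\<lambda>x. velocity (fst x) (snd x)) \<in> borel_measurable (lborel \<Otimes>\<^sub>M lborel)" by (simp add: case_prod_beta)
  have dm: "case_prod (\<lambda>r k. indicator {s..t} r * ennreal (V k * \<bar>velocity r k - g k\<bar>)) \<in> borel_measurable (lborel \<Otimes>\<^sub>M lborel)"
    unfolding case_prod_beta by measurable
  have "(\<integral>\<^sup>+k. ennreal (V k * \<bar>f t k - f s k - (t - s) * g k\<bar>) \<partial>lborel)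
      \<le> (\<integral>\<^sup>+k. \<integral>\<^sup>+r. indicator {s..t} r * ennreal (V k * \<bar>velocity r k - g k\<bar>) \<partial>lborel \<partial>lborel)"
  proof (rule nn_integral_mono_AE, use integral_equation in eventually_elim)
    case (elim k)
    have [measurable]: "(\<lambda>r. velocity r k) \<in> borel_measurable borel" by (rule measurable_slices(2)[OF velocity_measurable_pair])
    have i: "integrable lborel (\<lambda>r. indicator {s..t} r * velocity r k)" and e: "f t k - f s k = (\<integral>r. indicator {s..t} r * velocity r k \<partial>lborel)"
      using elim st by auto
    have ig: "integrable lborel (\<lambda>r. indicator {s..t} r * g k)"
      by (intro integrable_mult_left integrable_real_indicator) (auto simp: emeasure_lborel_Icc_eq)
    have eg: "(t - s) * g k = (\<integral>r. indicator {s..t} r * g k \<partial>lborel)" using st by simp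
    have "ennreal \<bar>f t k - f s k - (t - s) * g k\<bar> \<le> (\<integral>\<^sup>+r. ennreal (indicator {s..t} r * \<bar>velocity r k - g k\<bar>) \<partial>lborel)"
      unfolding e eg using i ig by (intro ennreal_abs_integral_diff_le) (auto simp: indicator_def)
    then have "ennreal (V k) * ennreal \<bar>f t k - f s k - (t - s) * g k\<bar> \<le> ennreal (V k) * (\<integral>\<^sup>+r. ennreal (indicator {s..t} r * \<bar>velocity r k - g k\<bar>) \<partial>lborel)"
      by (rule mult_left_mono) simp
    also have "\<dots> = (\<integral>\<^sup>+r. indicator {s..t} r * ennreal (V k * \<bar>velocity r k - g k\<bar>) \<partial>lborel)"
      using V0 by (subst nn_integral_cmult[symmetric]) (auto intro!: nn_integral_cong simp: ennreal_mult indicator_def)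
    finally show ?case using V0 by (simp add: ennreal_mult)
  qed
  also have "\<dots> = (\<integral>\<^sup>+r. \<integral>\<^sup>+k. indicator {s..t} r * ennreal (V k * \<bar>velocity r k - g k\<bar>) \<partial>lborel \<partial>lborel)"
    by (rule lborel_swap[OF dm])
  also have "\<dots> \<le> (\<integral>\<^sup>+r. ennreal K * indicator {s..t} r \<partial>lborel)"
  proof (rule nn_integral_mono)
    fix r :: real
    show "(\<integral>\<^sup>+k. indicator {s..t} r * ennreal (V k * \<bar>velocity r k - g k\<bar>) \<partial>lborel) \<le> ennreal K * indicator {s..t} r"
      using K[of r] by (cases "r \<in> {s..t}") auto
  qed
  also have "\<dots> = ennreal (K * (t - s))" using st K0 by (simp add: nn_integral_cmult_indicator ennreal_mult)
  finally show ?thesis .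
qed

end

lemma L1w_norm_le:
  assumes "(\<integral>\<^sup>+k. ennreal (omega lam1 lam2 k powr p * \<bar>h k\<bar>) \<partial>lborel) \<le> ennreal e" "0 \<le> e"
  shows "L1w_norm lam1 lam2 p h \<le> e"
proof -
  have "ennreal (L1w_norm lam1 lam2 p h) \<le> ennreal e"
    unfolding L1w_norm_def using assms by (intro order_trans[OF ennreal_integral_le_nn_integral]) auto
  then show ?thesis using assms by (simp add: ennreal_le_iff)
qed

lemma L1w_norm_nonneg: "0 \<le> L1w_norm lam1 lam2 p h"
  unfolding L1w_norm_def by simp

context mild_flow begin

text \<open>
  All weights that occur in the continuity of the velocity; its order \<open>N + 2\<close> is below that of
  \<open>moment_weight\<close>.
\<close>

definition velocity_weight :: "real^'n \<Rightarrow> real" where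
  "velocity_weight k = 1 + w k powr N + norm k * w k powr N + (norm k)\<^sup>2 * w k powr N"

lemma velocity_weight_measurable [measurable]: "velocity_weight \<in> borel_measurable borel" unfolding velocity_weight_def[abs_def] by measurable

lemma velocity_weight_ge: "1 \<le> velocity_weight k" "w k powr N \<le> velocity_weight k" "norm k * w k powr N \<le> velocity_weight k" "(norm k)\<^sup>2 * w k powr N \<le> velocity_weight k"
  unfolding velocity_weight_def by auto

lemma velocity_weight_le: "velocity_weight k \<le> (4 * norm_const) * moment_weight k"
  using norm_power_omega_le(2)[of 0 k] norm_power_omega_le(2)[of 1 k] norm_power_omega_le(2)[of 2 k] norm_power_omega_le(3)[of 0 k]
  by (simp add: velocity_weight_def)

lemma velocity_weight_interpolate:
  assumes e: "0 < e"
  shows "\<exists>c\<ge>0. \<forall>k. velocity_weight k \<le> e * moment_weight k + c"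
proof -
  define e' where "e' = e / (3 * norm_const)"
  have e': "0 < e'" "3 * (norm_const * e') = e" using e norm_const_ge_1 by (auto simp: e'_def)
  obtain a1 a2 a3 where a: "0 \<le> a1" "0 \<le> a2" "0 \<le> a3"
    and le: "\<And>x::real. 0 \<le> x \<Longrightarrow> x powr (N + real 0) \<le> e' * x powr (N + 3) + a1"
      "\<And>x::real. 0 \<le> x \<Longrightarrow> x powr (N + real 1) \<le> e' * x powr (N + 3) + a2"
      "\<And>x::real. 0 \<le> x \<Longrightarrow> x powr (N + real 2) \<le> e' * x powr (N + 3) + a3"
    using powr_interpolate[of "N + real 0" "N + 3" e'] powr_interpolate[of "N + real 1" "N + 3" e'] powr_interpolate[of "N + real 2" "N + 3" e'] N e'
    by auto
  have "velocity_weight k \<le> e * moment_weight k + (1 + norm_const * (a1 + a2 + a3))" for k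
  proof -
    have "norm k ^ 0 * w k powr N \<le> norm_const * (e' * w k powr (N + 3) + a1)" "norm k ^ 1 * w k powr N \<le> norm_const * (e' * w k powr (N + 3) + a2)"
      "norm k ^ 2 * w k powr N \<le> norm_const * (e' * w k powr (N + 3) + a3)"
      using norm_const_ge_1 weight_nonneg[of k] by (auto intro!: order_trans[OF norm_power_omega_le(1)] mult_left_mono le simp del: power_0 power_one_right of_nat_0 of_nat_1 One_nat_def)
    then have "velocity_weight k \<le> 1 + 3 * (norm_const * e') * w k powr (N + 3) + norm_const * (a1 + a2 + a3)"
      by (simp add: velocity_weight_def algebra_simps)
    also have "\<dots> \<le> e * moment_weight k + (1 + norm_const * (a1 + a2 + a3))" unfolding e' moment_weight_def using e by (simp add: distrib_left)
    finally show ?thesis .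
  qed
  moreover have "0 \<le> 1 + norm_const * (a1 + a2 + a3)" using a norm_const_ge_1 by simp
  ultimately show ?thesis by blast
qed

lemma L1_Lipschitz:
  "\<exists>K\<ge>0. \<forall>s t. 0 \<le> s \<longrightarrow> s \<le> T \<longrightarrow> 0 \<le> t \<longrightarrow> t \<le> T \<longrightarrow> (\<integral>k. \<bar>f s k - f t k\<bar> \<partial>lborel) \<le> K * \<bar>s - t\<bar>"
proof -
  obtain K where K: "0 \<le> K" "\<And>t. 0 \<le> t \<Longrightarrow> t \<le> T \<Longrightarrow> (\<integral>\<^sup>+k. ennreal ((1 + w k powr N) * \<bar>velocity t k\<bar>) \<partial>lborel) \<le> ennreal K"
    using velocity_bound by blast
  have FK: "(\<integral>\<^sup>+k. ennreal (1 * \<bar>velocity t k - 0\<bar>) \<partial>lborel) \<le> ennreal K" if "0 \<le> t" "t \<le> T" for t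
    by (rule order_trans[OF _ K(2)[OF that]]) (auto intro!: nn_integral_mono ennreal_leI simp: distrib_right)
  have 1: "(\<integral>k. \<bar>f t k - f s k\<bar> \<partial>lborel) \<le> K * (t - s)" if "0 \<le> s" "s \<le> t" "t \<le> T" for s t
  proof -
    have "(\<integral>\<^sup>+k. ennreal (1 * \<bar>f t k - f s k - (t - s) * 0\<bar>) \<partial>lborel) \<le> ennreal (K * (t - s))"
      by (rule increment_le) (use that K(1) FK in auto)
    moreover have "integrable lborel (\<lambda>k. \<bar>f t k - f s k\<bar>)" using f_integrable that by simp
    ultimately show ?thesis using K(1) that by (simp add: nn_integral_eq_integral ennreal_le_iff)
  qed
  have "(\<integral>k. \<bar>f s k - f t k\<bar> \<partial>lborel) \<le> K * \<bar>s - t\<bar>" if "0 \<le> s" "s \<le> T" "0 \<le> t" "t \<le> T" for s t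
  proof (cases "s \<le> t")
    case True then show ?thesis using 1[of s t] that by (simp add: abs_minus_commute)
  next
    case False then show ?thesis using 1[of t s] that by simp
  qed
  then show ?thesis using K(1) by blast
qed

lemma f_diff_weighted_integrable:
  assumes V [measurable]: "V \<in> borel_measurable borel" and V0: "\<And>k. 0 \<le> V k" and le: "\<And>k. V k \<le> c * moment_weight k" and s: "0 \<le> s" "s \<le> T" and t: "0 \<le> t" "t \<le> T"
  shows "integrable lborel (\<lambda>k. V k * \<bar>f s k - f t k\<bar>)" "(\<integral>k. V k * \<bar>f s k - f t k\<bar> \<partial>lborel) \<le> 2 * c * moment_bound T"
proof -
  note i = f_weighted_integrable[OF V V0 le s] f_weighted_integrable[OF V V0 le t]
  have p: "V k * \<bar>f s k - f t k\<bar> \<le> V k * f s k + V k * f t k" for k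
  proof -
    have "V k * \<bar>f s k - f t k\<bar> \<le> V k * (f s k + f t k)" using f0[of s k] f0[of t k] by (intro mult_left_mono V0) auto
    then show ?thesis by (simp add: distrib_left)
  qed
  show int: "integrable lborel (\<lambda>k. V k * \<bar>f s k - f t k\<bar>)"
  proof (rule Bochner_Integration.integrable_bound[OF Bochner_Integration.integrable_add[OF i(1) i(3)]])
    show "AE k in lborel. norm (V k * \<bar>f s k - f t k\<bar>) \<le> norm (V k * f s k + V k * f t k)"
      using p V0 f0 by (auto simp: abs_mult)
  qed measurable
  have "(\<integral>k. V k * \<bar>f s k - f t k\<bar> \<partial>lborel) \<le> (\<integral>k. V k * f s k + V k * f t k \<partial>lborel)"
    using int i p by (intro integral_mono) auto
  also have "\<dots> = (\<integral>k. V k * f s k \<partial>lborel) + (\<integral>k. V k * f t k \<partial>lborel)" using i by simp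
  finally show "(\<integral>k. V k * \<bar>f s k - f t k\<bar> \<partial>lborel) \<le> 2 * c * moment_bound T" using i(2,4) by simp
qed

text \<open>
  Interpolation: the highest moments are bounded and the \<open>L\<^sup>1\<close> norm of the increment is small.
\<close>

lemma flow_weighted_continuous:
  assumes t: "0 \<le> t" and e: "0 < e"
  shows "\<exists>d>0. d \<le> 1 \<and> (\<forall>s\<ge>0. \<bar>s - t\<bar> < d \<longrightarrow> (\<integral>k. velocity_weight k * \<bar>f s k - f t k\<bar> \<partial>lborel) < e)"
proof -
  define T where "T = t + 1"
  \<comment> \<open>The share of the highest moments is made at most \<open>e / 2\<close>; the summand \<open>1\<close> avoids a vanishing denominator.\<close>
  define e1 where "e1 = e / (4 * moment_bound T + 1)"
  have e1: "0 < e1" unfolding e1_def using e moment_bound_nonneg[of T] by (intro divide_pos_pos add_nonneg_pos) auto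
  have e1M: "2 * (e1 * moment_bound T) \<le> e / 2"
  proof -
    have "e1 * (4 * moment_bound T + 1) = e" unfolding e1_def using moment_bound_nonneg[of T] by simp
    then show ?thesis using e1 by (simp add: algebra_simps)
  qed
  obtain c where c: "0 \<le> c" "\<And>k. velocity_weight k \<le> e1 * moment_weight k + c" using velocity_weight_interpolate[OF e1] by blast
  obtain K where K: "0 \<le> K" "\<And>s t. 0 \<le> s \<Longrightarrow> s \<le> T \<Longrightarrow> 0 \<le> t \<Longrightarrow> t \<le> T \<Longrightarrow> (\<integral>k. \<bar>f s k - f t k\<bar> \<partial>lborel) \<le> K * \<bar>s - t\<bar>"
    using L1_Lipschitz by blast
  define d where "d = min 1 (e / (2 * (c * K + 1)))"
  have cK: "0 < c * K + 1" using c K by (simp add: add_nonneg_pos)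
  have "0 < d" unfolding d_def using e cK by simp
  moreover have "(\<integral>k. velocity_weight k * \<bar>f s k - f t k\<bar> \<partial>lborel) < e" if s: "0 \<le> s" "\<bar>s - t\<bar> < d" for s
  proof -
    have sT: "s \<le> T" "t \<le> T" using s unfolding d_def T_def by auto
    have Z0: "0 \<le> moment_weight k" for k using moment_weight_ge_1[of k] by simp
    note wz = f_diff_weighted_integrable[of moment_weight 1 s T t, OF moment_weight_measurable Z0 _ s(1) sT(1) t sT(2)]
    have fi: "integrable lborel (\<lambda>k. \<bar>f s k - f t k\<bar>)" using f_integrable s t by simp
    have "(\<integral>k. velocity_weight k * \<bar>f s k - f t k\<bar> \<partial>lborel) \<le> (\<integral>k. e1 * (moment_weight k * \<bar>f s k - f t k\<bar>) + c * \<bar>f s k - f t k\<bar> \<partial>lborel)"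
    proof (rule integral_mono)
      show "integrable lborel (\<lambda>k. velocity_weight k * \<bar>f s k - f t k\<bar>)"
        using velocity_weight_ge(1) velocity_weight_le s t sT by (intro f_diff_weighted_integrable(1)[where c = "4 * norm_const"]) (auto intro: order_trans[OF zero_le_one])
      show "integrable lborel (\<lambda>k. e1 * (moment_weight k * \<bar>f s k - f t k\<bar>) + c * \<bar>f s k - f t k\<bar>)"
        using wz(1) fi by simp
      show "velocity_weight k * \<bar>f s k - f t k\<bar> \<le> e1 * (moment_weight k * \<bar>f s k - f t k\<bar>) + c * \<bar>f s k - f t k\<bar>" for k
        using mult_right_mono[OF c(2), of "\<bar>f s k - f t k\<bar>" k] by (simp add: distrib_right mult.assoc)
    qed
    also have "\<dots> = e1 * (\<integral>k. moment_weight k * \<bar>f s k - f t k\<bar> \<partial>lborel) + c * (\<integral>k. \<bar>f s k - f t k\<bar> \<partial>lborel)"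
      using wz(1) fi by simp
    also have "\<dots> \<le> e1 * (2 * moment_bound T) + c * (K * \<bar>s - t\<bar>)"
      using wz(2) K(2)[of s t] s t sT e1 c by (intro add_mono mult_left_mono) auto
    also have "\<dots> < e"
    proof -
      have "c * (K * \<bar>s - t\<bar>) \<le> (c * K + 1) * \<bar>s - t\<bar>" by (simp add: algebra_simps)
      also have "\<dots> < (c * K + 1) * (e / (2 * (c * K + 1)))"
        using s cK by (intro mult_strict_left_mono) (auto simp: d_def)
      also have "\<dots> = e / 2"
      proof -
        have "X * (e / (2 * X)) = e / 2" if "0 < X" for X :: real using that by simp
        then show ?thesis using cK by blast
      qed
      finally show ?thesis using e1M by simp
    qed
    finally show ?thesis .
  qed
  ultimately show ?thesis by (intro exI[of _ d]) (auto simp: d_def)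
qed

lemma u_weighted_integrable:
  assumes V [measurable]: "V \<in> borel_measurable borel" and V0: "\<And>k. 0 \<le> V k" and le: "\<And>k. V k \<le> c * moment_weight k"
  shows "integrable lborel (\<lambda>k. V k * u k)"
proof (rule Bochner_Integration.integrable_bound[OF integrable_mult_right[OF moment_weight_u_integrable, of c]])
  have "V k * u k \<le> c * (moment_weight k * u k)" for k using mult_right_mono[OF le u0, of k k] by (simp add: mult.assoc)
  then show "AE k in lborel. norm (V k * u k) \<le> norm (c * (moment_weight k * u k))" 
  proof (intro AE_I2)
    fix k assume "\<And>k. V k * u k \<le> c * (moment_weight k * u k)"
    then have "V k * u k \<le> \<bar>c * (moment_weight k * u k)\<bar>" by (rule order_trans) simp
    then show "norm (V k * u k) \<le> norm (c * (moment_weight k * u k))" using V0[of k] u0[of k] by simp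
  qed
qed measurable

text \<open>
  The mean of the damping with respect to the initial datum, which is the decay rate in Jensen's
  inequality.
\<close>

definition decay :: real where "decay = (\<integral>k. damp k * u k \<partial>lborel) / (\<integral>k. u k \<partial>lborel)"

lemma damp_u_integrable: "integrable lborel (\<lambda>k. damp k * u k)"
proof (rule u_weighted_integrable)
  show "damp k \<le> (2 * \<nu> * norm_const + 2 * \<CC>\<^sup>2 * norm_const) * moment_weight k" for k :: "real^'n"
  proof -
    have "2 * \<nu> * (norm k)\<^sup>2 \<le> 2 * \<nu> * (norm_const * moment_weight k)" using norm_power_omega_le(3)[of 2 k] nu by (intro mult_left_mono) auto
    moreover have "2 * \<CC>\<^sup>2 * norm k \<le> 2 * \<CC>\<^sup>2 * (norm_const * moment_weight k)" using norm_power_omega_le(3)[of 1 k] by (intro mult_left_mono) auto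
    ultimately show ?thesis by (simp add: damp_def distrib_right mult.assoc)
  qed
qed (auto simp: damp_nonneg)

text \<open>
  Jensen's inequality for \<open>\<integral> e\<^sup>-\<^sup>a\<^sup>t u\<close>, in the form of the tangent of the exponential function at the
  mean of \<open>a\<close>.
\<close>

lemma mass_ge:
  assumes t: "0 \<le> t"
  shows "(\<integral>k. u k \<partial>lborel) * exp (- decay * t) \<le> (\<integral>k. f t k \<partial>lborel)"
proof -
  let ?g = "\<lambda>k. exp (- decay * t) * (u k - t * (damp k * u k) + t * decay * u k)"
  have "(\<integral>k. ?g k \<partial>lborel) = exp (- decay * t) * ((\<integral>k. u k \<partial>lborel) - t * (\<integral>k. damp k * u k \<partial>lborel) + t * decay * (\<integral>k. u k \<partial>lborel))"
    using ui damp_u_integrable by simp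
  also have "\<dots> = (\<integral>k. u k \<partial>lborel) * exp (- decay * t)" using upos by (simp add: decay_def)
  finally have 1: "(\<integral>k. ?g k \<partial>lborel) = (\<integral>k. u k \<partial>lborel) * exp (- decay * t)" .
  have "(\<integral>k. ?g k \<partial>lborel) \<le> (\<integral>k. f t k \<partial>lborel)"
  proof (rule integral_mono_AE)
    show "integrable lborel ?g" using ui damp_u_integrable by simp
    show "integrable lborel (f t)" by (rule f_integrable[OF t])
    show "AE k in lborel. ?g k \<le> f t k"
      using mild
    proof eventually_elim
      case (elim k)
      have "1 + (decay * t - damp k * t) \<le> exp (decay * t - damp k * t)" by (rule exp_ge_add_one_self)
      then have "exp (- decay * t) * u k * (1 + (decay * t - damp k * t)) \<le> exp (- decay * t) * u k * exp (decay * t - damp k * t)"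
        using u0 by (intro mult_left_mono) auto
      also have "\<dots> = exp (- (damp k * t)) * u k" by (simp add: exp_minus exp_diff field_simps)
      also have "\<dots> \<le> f t k" 
      proof -
        have "0 \<le> source (f s) k" for s by (rule source_nonneg[OF f0])
        then show ?thesis using elim duhamel_ge[of "\<lambda>s. source (f s) k" "damp k" t "u k"] by simp
      qed
      finally show ?case by (simp add: algebra_simps)
    qed
  qed
  then show ?thesis unfolding 1 .
qed

text \<open>
  The collision operator with weight \<open>\<omega>\<^sup>N\<close> is Lipschitz only as long as the mass is bounded below,
  which \<open>mass_ge\<close> guarantees on bounded time intervals.
\<close>

lemma velocity_continuous:
  assumes t: "0 \<le> t" and e: "0 < e"
  shows "\<exists>d>0. \<forall>s\<ge>0. \<bar>s - t\<bar> < d \<longrightarrow> (\<integral>\<^sup>+k. ennreal (w k powr N * \<bar>velocity s k - velocity t k\<bar>) \<partial>lborel) \<le> ennreal e"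
proof -
  define T where "T = t + 1"
  \<comment> \<open>A lower bound for the mass that is uniform up to time \<open>T\<close>.\<close>
  define m where "m = (\<integral>k. u k \<partial>lborel) * exp (- \<bar>decay\<bar> * T)"
  have m: "0 < m" using upos by (simp add: m_def)
  have mass: "m \<le> (\<integral>k. f s k \<partial>lborel)" if "0 \<le> s" "s \<le> T" for s
  proof -
    have "decay * s \<le> \<bar>decay\<bar> * T" using that by (intro mult_mono) auto
    then have "m \<le> (\<integral>k. u k \<partial>lborel) * exp (- decay * s)" unfolding m_def using upos by (intro mult_left_mono) auto
    then show ?thesis using mass_ge[OF that(1)] by simp
  qed
  define D :: real where "D = 4 * 2 powr N"
  define B where "B = 9 * \<CC>\<^sup>2 * D * (1 + 2 * (norm_const * moment_bound T / m)) + 2 * \<nu>"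
  have D0: "0 \<le> D" by (simp add: D_def)
  have B0: "0 < B" unfolding B_def using D0 norm_const_ge_1 moment_bound_nonneg[of T] m nu by (intro add_nonneg_pos mult_nonneg_nonneg add_nonneg_nonneg) auto
  obtain d where d: "0 < d" "d \<le> 1" "\<And>s. 0 \<le> s \<Longrightarrow> \<bar>s - t\<bar> < d \<Longrightarrow> (\<integral>k. velocity_weight k * \<bar>f s k - f t k\<bar> \<partial>lborel) < e / B"
    using flow_weighted_continuous[OF t, of "e / B"] e B0 by auto
  have "(\<integral>\<^sup>+k. ennreal (w k powr N * \<bar>velocity s k - velocity t k\<bar>) \<partial>lborel) \<le> ennreal e" if s: "0 \<le> s" "\<bar>s - t\<bar> < d" for s
  proof -
    have sT: "s \<le> T" "t \<le> T" using s d unfolding T_def by auto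
    define h where "h k = \<bar>f s k - f t k\<bar>" for k
    define g where "g = (\<integral>k. velocity_weight k * h k \<partial>lborel)"
    have g: "g < e / B" unfolding g_def h_def by (rule d(3)[OF s])
    have V20: "0 \<le> velocity_weight k" for k using velocity_weight_ge(1)[of k] by simp
    note [measurable] = collision_measurable[OF f_measurable[of t], of lam1 lam2 \<CC>] collision_measurable[OF f_measurable[of s], of lam1 lam2 \<CC>]
    have iV2: "integrable lborel (\<lambda>k. velocity_weight k * h k)"
      unfolding h_def using V20 velocity_weight_le s t sT by (intro f_diff_weighted_integrable(1)[where c = "4 * norm_const"]) auto
    have leg: "(\<integral>k. V k * h k \<partial>lborel) \<le> g" if "V \<in> borel_measurable borel" "\<And>k. 0 \<le> V k" "\<And>k. V k \<le> velocity_weight k" for V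
      unfolding g_def
    proof (rule integral_mono[OF _ iV2])
      show "integrable lborel (\<lambda>k. V k * h k)"
        unfolding h_def using that velocity_weight_le s t sT by (intro f_diff_weighted_integrable(1)[where c = "4 * norm_const"]) (auto intro: order_trans)
      show "V k * h k \<le> velocity_weight k * h k" for k by (intro mult_right_mono that) (simp add: h_def)
    qed
    let ?Q = "collision lam1 lam2 \<CC>" and ?V = "\<lambda>k. norm k * w k powr N"
    have V: "doubling D ?V" unfolding D_def using N by (intro doubling_norm_mult doubling_omega_powr) auto
    note [measurable] = doubling_measurable[OF V]
    have Vc: "?V k \<le> norm_const * moment_weight k" for k using norm_power_omega_le(2)[of 1 k] by simp
    have g0: "0 \<le> g" unfolding g_def h_def using V20 by simp
    have ms: "0 < (\<integral>k. f s k \<partial>lborel)" "0 < (\<integral>k. f t k \<partial>lborel)"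
      using mass[of s] mass[of t] s t sT m by auto
    have "(\<integral>\<^sup>+k. ennreal (w k powr N * \<bar>?Q (f s) k - ?Q (f t) k\<bar>) \<partial>lborel)
      \<le> ennreal (9 * \<CC>\<^sup>2 * D * ((\<integral>k. ?V k * \<bar>f s k - f t k\<bar> \<partial>lborel) + (\<integral>k. \<bar>f s k - f t k\<bar> \<partial>lborel) *
          ((\<integral>k. ?V k * f s k \<partial>lborel) / (\<integral>k. f s k \<partial>lborel) + (\<integral>k. ?V k * f t k \<partial>lborel) / (\<integral>k. f t k \<partial>lborel))))"
      using s t sT f_integrable f0 V Vc D0 ms by (intro collision_diff_le f_weighted_integrable(1)[where c = norm_const and T = T]) auto
    also have "\<dots> \<le> ennreal (9 * \<CC>\<^sup>2 * D * (1 + 2 * (norm_const * moment_bound T / m)) * g)"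
    proof (rule ennreal_leI)
      have 1: "(\<integral>k. ?V k * \<bar>f s k - f t k\<bar> \<partial>lborel) \<le> g" using leg[of ?V] velocity_weight_ge(3) by (simp add: h_def)
      have 2: "(\<integral>k. \<bar>f s k - f t k\<bar> \<partial>lborel) \<le> g" using leg[of "\<lambda>_. 1"] velocity_weight_ge(1) by (simp add: h_def)
      have 3: "(\<integral>k. ?V k * f r k \<partial>lborel) / (\<integral>k. f r k \<partial>lborel) \<le> norm_const * moment_bound T / m" if "0 \<le> r" "r \<le> T" for r
        using mass[OF that] m norm_const_ge_1 moment_bound_nonneg[of T] Vc that by (intro frac_le f_weighted_integrable(2)) auto
      have "(\<integral>k. \<bar>f s k - f t k\<bar> \<partial>lborel) * ((\<integral>k. ?V k * f s k \<partial>lborel) / (\<integral>k. f s k \<partial>lborel) + (\<integral>k. ?V k * f t k \<partial>lborel) / (\<integral>k. f t k \<partial>lborel))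
         \<le> g * (norm_const * moment_bound T / m + norm_const * moment_bound T / m)"
        using 2 3[of s] 3[of t] s t sT g0 f0 ms by (intro mult_mono add_mono) (auto intro!: add_nonneg_nonneg divide_nonneg_nonneg)
      then have "(\<integral>k. ?V k * \<bar>f s k - f t k\<bar> \<partial>lborel) + (\<integral>k. \<bar>f s k - f t k\<bar> \<partial>lborel) *
          ((\<integral>k. ?V k * f s k \<partial>lborel) / (\<integral>k. f s k \<partial>lborel) + (\<integral>k. ?V k * f t k \<partial>lborel) / (\<integral>k. f t k \<partial>lborel)) \<le> (1 + 2 * (norm_const * moment_bound T / m)) * g"
        using 1 by (simp add: algebra_simps)
      from mult_left_mono[OF this, of "9 * \<CC>\<^sup>2 * D"] D0
      show "9 * \<CC>\<^sup>2 * D * ((\<integral>k. ?V k * \<bar>f s k - f t k\<bar> \<partial>lborel) + (\<integral>k. \<bar>f s k - f t k\<bar> \<partial>lborel) *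
          ((\<integral>k. ?V k * f s k \<partial>lborel) / (\<integral>k. f s k \<partial>lborel) + (\<integral>k. ?V k * f t k \<partial>lborel) / (\<integral>k. f t k \<partial>lborel)))
        \<le> 9 * \<CC>\<^sup>2 * D * (1 + 2 * (norm_const * moment_bound T / m)) * g" by (simp add: mult.assoc)
    qed
    finally have Qle: "(\<integral>\<^sup>+k. ennreal (w k powr N * \<bar>?Q (f s) k - ?Q (f t) k\<bar>) \<partial>lborel) \<le> ennreal (9 * \<CC>\<^sup>2 * D * (1 + 2 * (norm_const * moment_bound T / m)) * g)" .
    have "(\<integral>\<^sup>+k. ennreal (w k powr N * \<bar>velocity s k - velocity t k\<bar>) \<partial>lborel)
       \<le> (\<integral>\<^sup>+k. ennreal (w k powr N * \<bar>?Q (f s) k - ?Q (f t) k\<bar>) + ennreal (2 * \<nu> * (velocity_weight k * h k)) \<partial>lborel)"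
    proof (rule nn_integral_mono)
      fix k
      have eq: "velocity s k - velocity t k = (?Q (f s) k - ?Q (f t) k) - 2 * \<nu> * (norm k)\<^sup>2 * (f s k - f t k)" by (simp add: velocity_def algebra_simps)
      have "w k powr N * \<bar>velocity s k - velocity t k\<bar> \<le> w k powr N * (\<bar>?Q (f s) k - ?Q (f t) k\<bar> + \<bar>2 * \<nu> * (norm k)\<^sup>2 * (f s k - f t k)\<bar>)"
        unfolding eq by (intro mult_left_mono abs_triangle_ineq4) auto
      also have "\<bar>2 * \<nu> * (norm k)\<^sup>2 * (f s k - f t k)\<bar> = 2 * \<nu> * (norm k)\<^sup>2 * h k" using nu by (simp add: abs_mult h_def)
      also have "w k powr N * (\<bar>?Q (f s) k - ?Q (f t) k\<bar> + 2 * \<nu> * (norm k)\<^sup>2 * h k)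
          = w k powr N * \<bar>?Q (f s) k - ?Q (f t) k\<bar> + 2 * \<nu> * (((norm k)\<^sup>2 * w k powr N) * h k)" by (simp add: algebra_simps)
      also have "\<dots> \<le> w k powr N * \<bar>?Q (f s) k - ?Q (f t) k\<bar> + 2 * \<nu> * (velocity_weight k * h k)"
        using velocity_weight_ge(4)[of k] nu by (intro add_left_mono mult_left_mono mult_right_mono) (auto simp: h_def)
      finally have "ennreal (w k powr N * \<bar>velocity s k - velocity t k\<bar>) \<le> ennreal (w k powr N * \<bar>?Q (f s) k - ?Q (f t) k\<bar> + 2 * \<nu> * (velocity_weight k * h k))" by (rule ennreal_leI)
      also have "\<dots> = ennreal (w k powr N * \<bar>?Q (f s) k - ?Q (f t) k\<bar>) + ennreal (2 * \<nu> * (velocity_weight k * h k))"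
        using V20 nu by (intro ennreal_plus) (auto simp: h_def)
      finally show "ennreal (w k powr N * \<bar>velocity s k - velocity t k\<bar>) \<le> ennreal (w k powr N * \<bar>?Q (f s) k - ?Q (f t) k\<bar>) + ennreal (2 * \<nu> * (velocity_weight k * h k))" .
    qed
    also have "\<dots> = (\<integral>\<^sup>+k. ennreal (w k powr N * \<bar>?Q (f s) k - ?Q (f t) k\<bar>) \<partial>lborel) + (\<integral>\<^sup>+k. ennreal (2 * \<nu> * (velocity_weight k * h k)) \<partial>lborel)"
      unfolding h_def by (rule nn_integral_add) measurable
    also have "(\<integral>\<^sup>+k. ennreal (2 * \<nu> * (velocity_weight k * h k)) \<partial>lborel) = ennreal (\<integral>k. 2 * \<nu> * (velocity_weight k * h k) \<partial>lborel)"
      using nu V20 iV2 by (intro nn_integral_eq_integral integrable_mult_right) (auto simp: h_def)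
    also have "(\<integral>k. 2 * \<nu> * (velocity_weight k * h k) \<partial>lborel) = 2 * \<nu> * g" by (simp add: g_def)
    also have "(\<integral>\<^sup>+k. ennreal (w k powr N * \<bar>?Q (f s) k - ?Q (f t) k\<bar>) \<partial>lborel) + ennreal (2 * \<nu> * g)
        \<le> ennreal (9 * \<CC>\<^sup>2 * D * (1 + 2 * (norm_const * moment_bound T / m)) * g) + ennreal (2 * \<nu> * g)" by (rule add_right_mono[OF Qle])
    also have "\<dots> = ennreal (9 * \<CC>\<^sup>2 * D * (1 + 2 * (norm_const * moment_bound T / m)) * g + 2 * \<nu> * g)"
      using D0 norm_const_ge_1 moment_bound_nonneg[of T] m nu g0 by (intro ennreal_plus[symmetric] mult_nonneg_nonneg add_nonneg_nonneg) auto
    also have "9 * \<CC>\<^sup>2 * D * (1 + 2 * (norm_const * moment_bound T / m)) * g + 2 * \<nu> * g = B * g" by (simp add: B_def distrib_right)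
    also have "ennreal (B * g) \<le> ennreal e"
      using g B0 by (intro ennreal_leI) (simp add: field_simps)
    finally show ?thesis .
  qed
  then show ?thesis using d(1) by blast
qed

lemma velocity_space:
  assumes t: "0 \<le> t"
  shows "velocity t \<in> L1w_space lam1 lam2 N"
proof -
  obtain K where K: "(\<integral>\<^sup>+k. ennreal ((1 + w k powr N) * \<bar>velocity t k\<bar>) \<partial>lborel) \<le> ennreal K"
    using velocity_bound[of t] t by blast
  have "(\<integral>\<^sup>+k. ennreal (norm (velocity t k)) \<partial>lborel) \<le> ennreal K"
    by (rule order_trans[OF _ K]) (auto intro!: nn_integral_mono ennreal_leI simp: distrib_right)
  moreover have "(\<integral>\<^sup>+k. ennreal (norm (w k powr N * \<bar>velocity t k\<bar>)) \<partial>lborel) \<le> ennreal K"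
    by (rule order_trans[OF _ K]) (auto intro!: nn_integral_mono ennreal_leI simp: distrib_right abs_mult)
  ultimately show ?thesis
    unfolding L1w_space_def by (auto intro!: integrableI_bounded intro: le_less_trans[OF _ ennreal_less_top])
qed

lemma f_space: 
  assumes t: "0 \<le> t"
  shows "f t \<in> L1w_space lam1 lam2 N" "f t \<in> L1w_space lam1 lam2 (N + 3)"
proof -
  have a: "\<bar>f t k\<bar> = f t k" for k using f0[of t k] by simp
  have "w k powr N \<le> norm_const * moment_weight k" for k using norm_power_omega_le(2)[of 0 k] by simp
  moreover have "w k powr (N + 3) \<le> 1 * moment_weight k" for k by (simp add: moment_weight_def)
  ultimately have "integrable lborel (\<lambda>k. w k powr N * f t k)" "integrable lborel (\<lambda>k. w k powr (N + 3) * f t k)"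
    using t by (auto intro!: f_weighted_integrable(1)[where T = t and c = norm_const] f_weighted_integrable(1)[where T = t and c = 1 and V = "\<lambda>k. w k powr (N + 3)"])
  then show "f t \<in> L1w_space lam1 lam2 N" "f t \<in> L1w_space lam1 lam2 (N + 3)"
    unfolding L1w_space_def using f_integrable[OF t] by (simp_all add: a)
qed

lemma flow_continuous: "L1w_continuous_on lam1 lam2 N {0..} f"
  unfolding L1w_continuous_on_def
proof (intro ballI conjI)
  fix t :: real assume "t \<in> {0..}"
  then have t: "0 \<le> t" by simp
  show "f t \<in> L1w_space lam1 lam2 N" by (rule f_space[OF t])
  show "((\<lambda>s. L1w_norm lam1 lam2 N (\<lambda>k. f s k - f t k)) \<longlongrightarrow> 0) (at t within {0..})"
  proof (rule tendstoI)
    fix e :: real assume e: "0 < e"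
    obtain d where d: "0 < d" "d \<le> 1" "\<And>s. 0 \<le> s \<Longrightarrow> \<bar>s - t\<bar> < d \<Longrightarrow> (\<integral>k. velocity_weight k * \<bar>f s k - f t k\<bar> \<partial>lborel) < e"
      using flow_weighted_continuous[OF t e] by auto
    have "L1w_norm lam1 lam2 N (\<lambda>k. f s k - f t k) < e" if s: "0 \<le> s" "\<bar>s - t\<bar> < d" for s
    proof -
      have sT: "s \<le> t + 1" "t \<le> t + 1" using s d by auto
      have V20: "0 \<le> velocity_weight k" for k using velocity_weight_ge(1)[of k] by simp
      have "L1w_norm lam1 lam2 N (\<lambda>k. f s k - f t k) \<le> (\<integral>k. velocity_weight k * \<bar>f s k - f t k\<bar> \<partial>lborel)"
        unfolding L1w_norm_def
      proof (rule integral_mono)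
        show "integrable lborel (\<lambda>k. velocity_weight k * \<bar>f s k - f t k\<bar>)"
          using V20 velocity_weight_le s t sT by (intro f_diff_weighted_integrable(1)[where c = "4 * norm_const" and T = "t + 1"]) auto
        show "integrable lborel (\<lambda>k. w k powr N * \<bar>f s k - f t k\<bar>)"
          using norm_power_omega_le(2)[of 0] s t sT by (intro f_diff_weighted_integrable(1)[where c = norm_const and T = "t + 1"]) auto
        show "w k powr N * \<bar>f s k - f t k\<bar> \<le> velocity_weight k * \<bar>f s k - f t k\<bar>" for k
          by (intro mult_right_mono velocity_weight_ge) auto
      qed
      then show ?thesis using d(3)[OF s] by simp
    qed
    then show "\<forall>\<^sub>F s in at t within {0..}. dist (L1w_norm lam1 lam2 N (\<lambda>k. f s k - f t k)) 0 < e"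
      unfolding eventually_at using d(1) by (intro exI[of _ d]) (auto simp: dist_real_def abs_of_nonneg[OF L1w_norm_nonneg])
  qed
qed

lemma velocity_L1w_continuous: "L1w_continuous_on lam1 lam2 N {0<..} velocity"
  unfolding L1w_continuous_on_def
proof (intro ballI conjI)
  fix t :: real assume "t \<in> {0<..}"
  then have t: "0 \<le> t" by simp
  show "velocity t \<in> L1w_space lam1 lam2 N" by (rule velocity_space[OF t])
  show "((\<lambda>s. L1w_norm lam1 lam2 N (\<lambda>k. velocity s k - velocity t k)) \<longlongrightarrow> 0) (at t within {0<..})"
  proof (rule tendstoI)
    fix e :: real assume e: "0 < e"
    obtain d where d: "0 < d" "\<And>s. 0 \<le> s \<Longrightarrow> \<bar>s - t\<bar> < d \<Longrightarrow> (\<integral>\<^sup>+k. ennreal (w k powr N * \<bar>velocity s k - velocity t k\<bar>) \<partial>lborel) \<le> ennreal (e / 2)"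
      using velocity_continuous[OF t, of "e / 2"] e by auto
    have "L1w_norm lam1 lam2 N (\<lambda>k. velocity s k - velocity t k) < e" if "0 \<le> s" "\<bar>s - t\<bar> < d" for s
      using L1w_norm_le[OF d(2)[OF that]] e by simp
    then show "\<forall>\<^sub>F s in at t within {0<..}. dist (L1w_norm lam1 lam2 N (\<lambda>k. velocity s k - velocity t k)) 0 < e"
      unfolding eventually_at using d(1) by (intro exI[of _ d]) (auto simp: dist_real_def abs_of_nonneg[OF L1w_norm_nonneg])
  qed
qed

lemma flow_derivative:
  assumes t: "0 < t"
  shows "L1w_has_derivative lam1 lam2 N f (velocity t) t"
  unfolding L1w_has_derivative_def
proof
  show "velocity t \<in> L1w_space lam1 lam2 N" using t by (intro velocity_space) simp
  show "((\<lambda>s. L1w_norm lam1 lam2 N (\<lambda>k. (f s k - f t k) / (s - t) - velocity t k)) \<longlongrightarrow> 0) (at t)"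
  proof (rule tendstoI)
    fix e :: real assume e: "0 < e"
    obtain d0 where d0: "0 < d0" "\<And>s. 0 \<le> s \<Longrightarrow> \<bar>s - t\<bar> < d0 \<Longrightarrow> (\<integral>\<^sup>+k. ennreal (w k powr N * \<bar>velocity s k - velocity t k\<bar>) \<partial>lborel) \<le> ennreal (e / 2)"
      using velocity_continuous[of t "e / 2"] e t by auto
    define d where "d = min d0 t"
    have "L1w_norm lam1 lam2 N (\<lambda>k. (f s k - f t k) / (s - t) - velocity t k) < e" if s: "s \<noteq> t" "\<bar>s - t\<bar> < d" for s
    proof -
      define a b where "a = min s t" and "b = max s t"
      have ab: "0 \<le> a" "a < b" using s t by (auto simp: a_def b_def d_def)
      have eq: "\<bar>(f s k - f t k) / (s - t) - velocity t k\<bar> = 1 / (b - a) * \<bar>f b k - f a k - (b - a) * velocity t k\<bar>" for k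
      proof -
        have q: "(f s k - f t k) / (s - t) = (f b k - f a k) / (b - a)"
          unfolding a_def b_def min_def max_def using s(1) minus_divide_divide[of "f s k - f t k" "s - t"] by auto
        have "(f b k - f a k) / (b - a) - velocity t k = 1 / (b - a) * (f b k - f a k - (b - a) * velocity t k)" using ab by (simp add: field_simps)
        then show ?thesis unfolding q using ab by (simp add: abs_mult)
      qed
      have "(\<integral>\<^sup>+k. ennreal (w k powr N * \<bar>(f s k - f t k) / (s - t) - velocity t k\<bar>) \<partial>lborel)
          = (\<integral>\<^sup>+k. ennreal (1 / (b - a)) * ennreal (w k powr N * \<bar>f b k - f a k - (b - a) * velocity t k\<bar>) \<partial>lborel)"
        unfolding eq using ab by (intro nn_integral_cong) (subst ennreal_mult[symmetric], auto simp: mult_ac)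
      also have "\<dots> = ennreal (1 / (b - a)) * (\<integral>\<^sup>+k. ennreal (w k powr N * \<bar>f b k - f a k - (b - a) * velocity t k\<bar>) \<partial>lborel)"
        by (rule nn_integral_cmult) measurable
      also have "\<dots> \<le> ennreal (1 / (b - a)) * ennreal (e / 2 * (b - a))"
      proof (intro mult_left_mono increment_le)
        fix r assume r: "a \<le> r" "r \<le> b"
        show "(\<integral>\<^sup>+k. ennreal (w k powr N * \<bar>velocity r k - velocity t k\<bar>) \<partial>lborel) \<le> ennreal (e / 2)"
          using r ab s by (intro d0(2)) (auto simp: a_def b_def d_def)
      qed (use ab e in auto)
      also have "\<dots> = ennreal (e / 2)" using ab e by (subst ennreal_mult[symmetric]) auto
      finally show ?thesis using L1w_norm_le[of lam1 lam2 N "\<lambda>k. (f s k - f t k) / (s - t) - velocity t k" "e / 2"] e by simp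
    qed
    then show "\<forall>\<^sub>F s in at t. dist (L1w_norm lam1 lam2 N (\<lambda>k. (f s k - f t k) / (s - t) - velocity t k)) 0 < e"
      unfolding eventually_at using d0(1) t by (intro exI[of _ d]) (auto simp: dist_real_def abs_of_nonneg[OF L1w_norm_nonneg] d_def)
  qed
qed

theorem flow_strong_solution: "nonneg_strong_solution lam1 lam2 \<CC> \<nu> N {0..} u f"
proof -
  have "AE k in lborel. f 0 k = u k"
    using mild
  proof eventually_elim
    case (elim k)
    have "(\<integral>s. indicator {0..0} s * exp (- (damp k * (0 - s))) * source (f s) k \<partial>lborel) = 0"
      by (rule integral_eq_zero_AE) (use AE_lborel_singleton[of "0::real"] in \<open>eventually_elim, auto simp: indicator_def\<close>)
    then show ?case using elim by (simp add: duhamel_def)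
  qed
  moreover have "interior {0..} = ({0<..} :: real set)" by simp
  ultimately show ?thesis
    unfolding nonneg_strong_solution_def strong_solution_def
    using flow_continuous velocity_L1w_continuous flow_derivative f0 by (auto simp: velocity_def intro!: exI[of _ velocity])
qed

lemma flow_norm_le:
  assumes t: "0 \<le> t"
  shows "L1w_norm lam1 lam2 (N + 3) (f t) \<le> 2 * exp (\<kappa> * t) * L1w_norm lam1 lam2 (N + 3) u"
proof -
  have U: "L1w_norm lam1 lam2 (N + 3) u = (\<integral>k. w k powr (N + 3) * u k \<partial>lborel)" using u0 by (simp add: L1w_norm_def)
  have U0: "0 \<le> L1w_norm lam1 lam2 (N + 3) u" by (rule L1w_norm_nonneg)
  have "(\<integral>\<^sup>+k. ennreal (w k powr (N + 3) * f t k) \<partial>lborel) \<le> ennreal (2 * exp (\<kappa> * t)) * (\<integral>\<^sup>+k. ennreal (w k powr (N + 3) * u k) \<partial>lborel)"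
    using N t by (intro moment doubling_omega_powr) auto
  also have "\<dots> = ennreal (2 * exp (\<kappa> * t) * L1w_norm lam1 lam2 (N + 3) u)"
  proof -
    have "(\<integral>\<^sup>+k. ennreal (w k powr (N + 3) * u k) \<partial>lborel) = ennreal (L1w_norm lam1 lam2 (N + 3) u)"
      unfolding U using u0 by (intro nn_integral_eq_integral uw) auto
    then show ?thesis using U0 by (subst ennreal_mult) auto
  qed
  finally show ?thesis using f0 U0 by (intro L1w_norm_le) auto
qed

end

section \<open>A differential inequality for weighted norms\<close>

text \<open>
  The last time at which the bound holds cannot lie before \<open>t\<close>.
\<close>

lemma upper_bound_from_right_increments:
  fixes v :: "real \<Rightarrow> real"
  assumes st: "s \<le> t" and c: "continuous_on {s..t} v"
    and inc: "\<And>r. s \<le> r \<Longrightarrow> r < t \<Longrightarrow> \<forall>\<^sub>F x in at_right r. v x \<le> v r + e * (x - r)"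
  shows "v t \<le> v s + e * (t - s)"
proof (rule ccontr)
  assume no: "\<not> ?thesis"
  define S where "S = {r \<in> {s..t}. v r - e * (r - s) \<le> v s}"
  have "closed S" unfolding S_def
    by (rule continuous_on_closed_Collect_le) (intro continuous_intros c closed_atLeastAtMost)+
  moreover have S: "s \<in> S" "S \<subseteq> {s..t}" using st by (auto simp: S_def)
  moreover have bdd: "bdd_above S" using S(2) by (meson bdd_above_Icc bdd_above_mono)
  ultimately have c: "Sup S \<in> S" using closed_contains_Sup by blast
  define r where "r = Sup S"
  have r: "s \<le> r" "r \<le> t" "v r - e * (r - s) \<le> v s" using c by (auto simp: S_def r_def)
  have "r \<noteq> t" using no r by auto
  then have "r < t" using r by simp
  have "\<forall>\<^sub>F x in at_right r. v x \<le> v r + e * (x - r) \<and> x \<in> {r<..<t}"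
    using inc[OF r(1) \<open>r < t\<close>] eventually_at_right_real[OF \<open>r < t\<close>] by eventually_elim auto
  then obtain x where x: "v x \<le> v r + e * (x - r)" "r < x" "x < t"
    using eventually_happens'[of "at_right r"] by (auto simp: trivial_limit_at_right_real)
  have "x \<in> S" using x r by (auto simp: S_def algebra_simps)
  then have "x \<le> r" unfolding r_def by (rule cSup_upper[OF _ bdd])
  then show False using x by simp
qed

text \<open>
  A comparison principle: the norm of a differentiable curve in \<open>L\<^sup>1\<close> is only one-sidedly
  differentiable, and an upper bound for the right Dini derivative is all that is available.
\<close>

lemma dini_integral_bound:
  fixes y \<rho> :: "real \<Rightarrow> real"
  assumes st: "s \<le> t" and y: "continuous_on {s..t} y" and \<rho>: "continuous_on {s..t} \<rho>"
    and dini: "\<And>r e. s \<le> r \<Longrightarrow> r < t \<Longrightarrow> 0 < e \<Longrightarrow> \<forall>\<^sub>F x in at_right r. y x \<le> y r + (x - r) * (\<rho> r + e)"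
  shows "y t \<le> y s + integral {s..t} \<rho>"
proof -
  define P where "P r = integral {s..r} \<rho>" for r
  have P: "(P has_real_derivative \<rho> r) (at r within {s..t})" if "r \<in> {s..t}" for r
    unfolding P_def by (rule integral_has_real_derivative[OF \<rho> that])
  have Pc: "continuous_on {s..t} P" using P by (intro DERIV_continuous_on)
  have slope: "y t - P t \<le> (y s - P s) + e * (t - s)" if e: "0 < e" for e
  proof (rule upper_bound_from_right_increments[OF st])
    show "continuous_on {s..t} (\<lambda>r. y r - P r)" by (intro continuous_intros y Pc)
    fix r assume r: "s \<le> r" "r < t"
    have "((\<lambda>x. (P x - P r) / (x - r)) \<longlongrightarrow> \<rho> r) (at r within {s..t})"
      using P[of r] r by (simp add: has_field_derivative_iff)
    then have "((\<lambda>x. (P x - P r) / (x - r)) \<longlongrightarrow> \<rho> r) (at r within {r<..<t})"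
      by (rule tendsto_within_subset) (use r in auto)
    moreover have "at r within {r<..<t} = at_right r" using r by (intro at_within_nhd[of r "{..<t}"]) auto
    ultimately have "((\<lambda>x. (P x - P r) / (x - r)) \<longlongrightarrow> \<rho> r) (at_right r)" by simp
    then have "\<forall>\<^sub>F x in at_right r. \<rho> r - e / 2 < (P x - P r) / (x - r)"
      using e by (intro order_tendstoD) auto
    moreover have "\<forall>\<^sub>F x in at_right r. y x \<le> y r + (x - r) * (\<rho> r + e / 2)" using dini[OF r, of "e / 2"] e by simp
    moreover have "\<forall>\<^sub>F x in at_right r. x \<in> {r<..<t}" by (rule eventually_at_right_real[OF r(2)])
    ultimately show "\<forall>\<^sub>F x in at_right r. y x - P x \<le> (y r - P r) + e * (x - r)"
    proof eventually_elim
      case (elim x)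
      then have "(\<rho> r - e / 2) * (x - r) \<le> P x - P r" by (simp add: pos_less_divide_eq less_imp_le)
      moreover have "y x \<le> y r + (x - r) * (\<rho> r + e / 2)" using elim by simp
      moreover have "(x - r) * (\<rho> r + e / 2) = (\<rho> r - e / 2) * (x - r) + e * (x - r)" by (simp add: field_simps)
      ultimately show ?case by linarith
    qed
  qed
  have "y t - P t \<le> y s - P s"
  proof (rule field_le_epsilon)
    fix e :: real assume e: "0 < e"
    define x where "x = t - s"
    have x: "0 \<le> x" using st by (simp add: x_def)
    have "y t - P t \<le> (y s - P s) + (e / (x + 1)) * x" unfolding x_def using e st by (intro slope) auto
    moreover have "(e / (x + 1)) * x \<le> e" using e x by (simp add: field_simps)
    ultimately show "y t - P t \<le> y s - P s + e" by linarith
  qed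
  then show ?thesis by (simp add: P_def)
qed

lemma L1w_space_lin:
  assumes u: "u \<in> L1w_space lam1 lam2 N" and v: "v \<in> L1w_space lam1 lam2 N"
  shows "(\<lambda>k. a * u k + b * v k) \<in> L1w_space lam1 lam2 N"
proof -
  have i: "integrable lborel u" "integrable lborel v" "integrable lborel (\<lambda>k. omega lam1 lam2 k powr N * \<bar>u k\<bar>)" "integrable lborel (\<lambda>k. omega lam1 lam2 k powr N * \<bar>v k\<bar>)"
    using u v by (auto simp: L1w_space_def)
  note [measurable] = borel_measurable_integrable[OF i(1)] borel_measurable_integrable[OF i(2)]
  have "integrable lborel (\<lambda>k. omega lam1 lam2 k powr N * \<bar>a * u k + b * v k\<bar>)"
  proof (rule Bochner_Integration.integrable_bound)
    show "integrable lborel (\<lambda>k. \<bar>a\<bar> * (omega lam1 lam2 k powr N * \<bar>u k\<bar>) + \<bar>b\<bar> * (omega lam1 lam2 k powr N * \<bar>v k\<bar>))"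
      using i by simp
    show "AE k in lborel. norm (omega lam1 lam2 k powr N * \<bar>a * u k + b * v k\<bar>)
       \<le> norm (\<bar>a\<bar> * (omega lam1 lam2 k powr N * \<bar>u k\<bar>) + \<bar>b\<bar> * (omega lam1 lam2 k powr N * \<bar>v k\<bar>))"
    proof (intro AE_I2)
      fix k
      have "omega lam1 lam2 k powr N * \<bar>a * u k + b * v k\<bar> \<le> omega lam1 lam2 k powr N * (\<bar>a * u k\<bar> + \<bar>b * v k\<bar>)"
        by (intro mult_left_mono abs_triangle_ineq) auto
      also have "\<dots> = \<bar>a\<bar> * (omega lam1 lam2 k powr N * \<bar>u k\<bar>) + \<bar>b\<bar> * (omega lam1 lam2 k powr N * \<bar>v k\<bar>)"
        by (simp add: abs_mult algebra_simps)
      finally show "norm (omega lam1 lam2 k powr N * \<bar>a * u k + b * v k\<bar>)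
       \<le> norm (\<bar>a\<bar> * (omega lam1 lam2 k powr N * \<bar>u k\<bar>) + \<bar>b\<bar> * (omega lam1 lam2 k powr N * \<bar>v k\<bar>))"
        by (simp add: abs_mult)
    qed
  qed measurable
  then show ?thesis using i by (simp add: L1w_space_def)
qed

lemma L1w_space_diff: "u \<in> L1w_space lam1 lam2 N \<Longrightarrow> v \<in> L1w_space lam1 lam2 N \<Longrightarrow> (\<lambda>k. u k - v k) \<in> L1w_space lam1 lam2 N"
  using L1w_space_lin[of u lam1 lam2 N v 1 "-1"] by simp

lemma dominated_weight:
  assumes u: "u \<in> L1w_space lam1 lam2 N" and V [measurable]: "V \<in> borel_measurable borel" and V0: "\<And>k. 0 \<le> V k"
    and le: "\<And>k. V k \<le> c * omega lam1 lam2 k powr N"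
  shows "integrable lborel (\<lambda>k. V k * \<bar>u k\<bar>)" "(\<integral>k. V k * \<bar>u k\<bar> \<partial>lborel) \<le> c * L1w_norm lam1 lam2 N u"
proof -
  have i: "integrable lborel u" "integrable lborel (\<lambda>k. c * (omega lam1 lam2 k powr N * \<bar>u k\<bar>))"
    using u by (auto simp: L1w_space_def)
  note [measurable] = borel_measurable_integrable[OF i(1)]
  have p: "V k * \<bar>u k\<bar> \<le> c * (omega lam1 lam2 k powr N * \<bar>u k\<bar>)" for k
    using mult_right_mono[OF le, of "\<bar>u k\<bar>" k] by (simp add: mult.assoc)
  show int: "integrable lborel (\<lambda>k. V k * \<bar>u k\<bar>)"
  proof (rule Bochner_Integration.integrable_bound[OF i(2)])
    show "AE k in lborel. norm (V k * \<bar>u k\<bar>) \<le> norm (c * (omega lam1 lam2 k powr N * \<bar>u k\<bar>))"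
    proof (intro AE_I2)
      fix k
      have "V k * \<bar>u k\<bar> \<le> \<bar>c * (omega lam1 lam2 k powr N * \<bar>u k\<bar>)\<bar>" using p[of k] by linarith
      then show "norm (V k * \<bar>u k\<bar>) \<le> norm (c * (omega lam1 lam2 k powr N * \<bar>u k\<bar>))" using V0[of k] by (simp add: abs_mult)
    qed
  qed measurable
  have "(\<integral>k. V k * \<bar>u k\<bar> \<partial>lborel) \<le> (\<integral>k. c * (omega lam1 lam2 k powr N * \<bar>u k\<bar>) \<partial>lborel)"
    by (intro integral_mono int i p)
  then show "(\<integral>k. V k * \<bar>u k\<bar> \<partial>lborel) \<le> c * L1w_norm lam1 lam2 N u" by (simp add: L1w_norm_def)
qed

lemma weighted_norm_diff_le:
  assumes u: "u \<in> L1w_space lam1 lam2 N" and v: "v \<in> L1w_space lam1 lam2 N" and V [measurable]: "V \<in> borel_measurable borel" and V0: "\<And>k. 0 \<le> V k"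
    and le: "\<And>k. V k \<le> c * omega lam1 lam2 k powr N"
  shows "\<bar>(\<integral>k. V k * \<bar>u k\<bar> \<partial>lborel) - (\<integral>k. V k * \<bar>v k\<bar> \<partial>lborel)\<bar> \<le> c * L1w_norm lam1 lam2 N (\<lambda>k. u k - v k)"
proof -
  note i = dominated_weight(1)[OF u V V0 le] dominated_weight(1)[OF v V V0 le] dominated_weight[OF L1w_space_diff[OF u v] V V0 le]
  have "(\<integral>k. V k * \<bar>u k\<bar> \<partial>lborel) - (\<integral>k. V k * \<bar>v k\<bar> \<partial>lborel) = (\<integral>k. V k * \<bar>u k\<bar> - V k * \<bar>v k\<bar> \<partial>lborel)"
    using i by simp
  also have "\<bar>\<dots>\<bar> \<le> (\<integral>k. \<bar>V k * \<bar>u k\<bar> - V k * \<bar>v k\<bar>\<bar> \<partial>lborel)" using integral_norm_bound[of lborel "\<lambda>k. V k * \<bar>u k\<bar> - V k * \<bar>v k\<bar>"] by simp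
  also have "\<dots> \<le> (\<integral>k. V k * \<bar>u k - v k\<bar> \<partial>lborel)"
  proof (rule integral_mono)
    fix k
    have "V k * \<bar>\<bar>u k\<bar> - \<bar>v k\<bar>\<bar> \<le> V k * \<bar>u k - v k\<bar>" by (intro mult_left_mono abs_triangle_ineq3 V0)
    then show "\<bar>V k * \<bar>u k\<bar> - V k * \<bar>v k\<bar>\<bar> \<le> V k * \<bar>u k - v k\<bar>"
      using V0[of k] by (simp add: abs_mult flip: right_diff_distrib)
  qed (use i in auto)
  also have "\<dots> \<le> c * L1w_norm lam1 lam2 N (\<lambda>k. u k - v k)" by (rule i(4))
  finally show ?thesis .
qed

lemma weighted_norm_continuous:
  assumes h: "L1w_continuous_on lam1 lam2 N J h" and V: "V \<in> borel_measurable borel" "\<And>k. 0 \<le> V k"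
    and le: "\<And>k. V k \<le> c * omega lam1 lam2 k powr N"
  shows "continuous_on J (\<lambda>t. \<integral>k. V k * \<bar>h t k\<bar> \<partial>lborel)"
  unfolding continuous_on_def
proof
  fix t assume t: "t \<in> J"
  have h_space: "h s \<in> L1w_space lam1 lam2 N" if "s \<in> J" for s using h that by (simp add: L1w_continuous_on_def)
  have "((\<lambda>s. c * L1w_norm lam1 lam2 N (\<lambda>k. h s k - h t k)) \<longlongrightarrow> c * 0) (at t within J)"
    using h t by (intro tendsto_mult_left) (simp add: L1w_continuous_on_def)
  then have lim: "((\<lambda>s. c * L1w_norm lam1 lam2 N (\<lambda>k. h s k - h t k)) \<longlongrightarrow> 0) (at t within J)" by simp
  have "\<forall>\<^sub>F s in at t within J. norm ((\<integral>k. V k * \<bar>h s k\<bar> \<partial>lborel) - (\<integral>k. V k * \<bar>h t k\<bar> \<partial>lborel)) \<le> c * L1w_norm lam1 lam2 N (\<lambda>k. h s k - h t k)"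
    unfolding eventually_at_filter using weighted_norm_diff_le[OF h_space h_space[OF t] V le] by (intro always_eventually) auto
  from LIM_zero_cancel[OF Lim_null_comparison[OF this lim]]
  show "((\<lambda>t. \<integral>k. V k * \<bar>h t k\<bar> \<partial>lborel) \<longlongrightarrow> (\<integral>k. V k * \<bar>h t k\<bar> \<partial>lborel)) (at t within J)" .
qed

text \<open>
  A curve with \<open>h' + a h = z\<close>, observed through a weight \<open>\<eta>\<close> on whose support the damping is bounded
  and which \<open>\<omega>\<^sup>N\<close> dominates. The support stays away from the origin and from infinity in the
  applications.
\<close>

locale damped_curve =
  fixes lam1 lam2 N T :: real and a :: "real^'n \<Rightarrow> real" and h h' :: "real \<Rightarrow> real^'n \<Rightarrow> real"
    and \<eta> :: "real^'n \<Rightarrow> real" and c A :: real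
  assumes hc: "L1w_continuous_on lam1 lam2 N {0..<T} h" and h'c: "L1w_continuous_on lam1 lam2 N {0<..<T} h'"
    and deriv: "\<And>t. t \<in> {0<..<T} \<Longrightarrow> L1w_has_derivative lam1 lam2 N h (h' t) t"
    and \<eta>m: "\<eta> \<in> borel_measurable borel" and \<eta>0: "\<And>k. 0 \<le> \<eta> k" and \<eta>le: "\<And>k. \<eta> k \<le> c * omega lam1 lam2 k powr N"
    and am: "a \<in> borel_measurable borel" and a0: "\<And>k. 0 \<le> a k" and aA: "\<And>k. \<eta> k \<noteq> 0 \<Longrightarrow> a k \<le> A" and A0: "0 \<le> A"
begin

lemma h_space: "t \<in> {0..<T} \<Longrightarrow> h t \<in> L1w_space lam1 lam2 N" using hc by (simp add: L1w_continuous_on_def)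
lemma h'_space: "t \<in> {0<..<T} \<Longrightarrow> h' t \<in> L1w_space lam1 lam2 N" using h'c by (simp add: L1w_continuous_on_def)
lemma \<eta>a0: "0 \<le> \<eta> k * a k" using \<eta>0 a0 by simp
lemma \<eta>am: "(\<lambda>k. \<eta> k * a k) \<in> borel_measurable borel" using \<eta>m am by measurable
lemma \<eta>ale: "\<eta> k * a k \<le> (A * c) * omega lam1 lam2 k powr N"
proof -
  have "\<eta> k * a k \<le> A * \<eta> k" using aA[of k] \<eta>0[of k] by (cases "\<eta> k = 0") (auto simp: mult.commute)
  also have "\<dots> \<le> A * (c * omega lam1 lam2 k powr N)" by (intro mult_left_mono \<eta>le A0)
  finally show ?thesis by (simp add: mult.assoc)
qed

lemma h_measurable: "t \<in> {0..<T} \<Longrightarrow> h t \<in> borel_measurable borel" "t \<in> {0<..<T} \<Longrightarrow> h' t \<in> borel_measurable borel"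
  using h_space[of t] h'_space[of t] by (auto simp: L1w_space_def)

definition y where "y t = (\<integral>k. \<eta> k * \<bar>h t k\<bar> \<partial>lborel)"
definition ya where "ya t = (\<integral>k. \<eta> k * a k * \<bar>h t k\<bar> \<partial>lborel)"
definition yz where "yz t = (\<integral>k. \<eta> k * \<bar>h' t k + a k * h t k\<bar> \<partial>lborel)"

lemma y_continuous: "continuous_on {0..<T} y"
  unfolding y_def[abs_def] by (rule weighted_norm_continuous[OF hc \<eta>m \<eta>0 \<eta>le])

lemma ya_continuous: "continuous_on {0..<T} ya"
  unfolding ya_def[abs_def] by (rule weighted_norm_continuous[OF hc \<eta>am \<eta>a0 \<eta>ale])

lemma z_integrable:
  assumes t: "t \<in> {0<..<T}"
  shows "integrable lborel (\<lambda>k. \<eta> k * \<bar>h' t k + a k * h t k\<bar>)"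
proof (rule Bochner_Integration.integrable_bound)
  have t': "t \<in> {0..<T}" using t by auto
  note [measurable] = h_measurable(1)[OF t'] h_measurable(2)[OF t] \<eta>m am
  show "integrable lborel (\<lambda>k. \<eta> k * \<bar>h' t k\<bar> + \<eta> k * a k * \<bar>h t k\<bar>)"
    using dominated_weight(1)[OF h'_space[OF t] \<eta>m \<eta>0 \<eta>le] dominated_weight(1)[OF h_space[OF t'] \<eta>am \<eta>a0 \<eta>ale] by simp
  show "(\<lambda>k. \<eta> k * \<bar>h' t k + a k * h t k\<bar>) \<in> borel_measurable lborel" by measurable
  show "AE k in lborel. norm (\<eta> k * \<bar>h' t k + a k * h t k\<bar>) \<le> norm (\<eta> k * \<bar>h' t k\<bar> + \<eta> k * a k * \<bar>h t k\<bar>)"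
  proof (intro AE_I2)
    fix k
    have "\<eta> k * \<bar>h' t k + a k * h t k\<bar> \<le> \<eta> k * (\<bar>h' t k\<bar> + \<bar>a k * h t k\<bar>)" by (intro mult_left_mono abs_triangle_ineq \<eta>0)
    then show "norm (\<eta> k * \<bar>h' t k + a k * h t k\<bar>) \<le> norm (\<eta> k * \<bar>h' t k\<bar> + \<eta> k * a k * \<bar>h t k\<bar>)"
      using \<eta>0[of k] a0[of k] by (simp add: abs_mult distrib_left mult.assoc)
  qed
qed

lemma yz_continuous: "continuous_on {0<..<T} yz"
  unfolding continuous_on_def
proof
  fix t assume t: "t \<in> {0<..<T}"
  then have t': "t \<in> {0..<T}" by auto
  let ?b = "\<lambda>s. c * L1w_norm lam1 lam2 N (\<lambda>k. h' s k - h' t k) + A * c * L1w_norm lam1 lam2 N (\<lambda>k. h s k - h t k)"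
  have "((\<lambda>s. L1w_norm lam1 lam2 N (\<lambda>k. h s k - h t k)) \<longlongrightarrow> 0) (at t within {0..<T})"
    using hc t' by (simp add: L1w_continuous_on_def)
  then have "((\<lambda>s. L1w_norm lam1 lam2 N (\<lambda>k. h s k - h t k)) \<longlongrightarrow> 0) (at t within {0<..<T})"
    by (rule tendsto_within_subset) auto
  moreover have "((\<lambda>s. L1w_norm lam1 lam2 N (\<lambda>k. h' s k - h' t k)) \<longlongrightarrow> 0) (at t within {0<..<T})"
    using h'c t by (simp add: L1w_continuous_on_def)
  ultimately have "(?b \<longlongrightarrow> c * 0 + A * c * 0) (at t within {0<..<T})" by (intro tendsto_intros)
  then have lim: "(?b \<longlongrightarrow> 0) (at t within {0<..<T})" by simp
  have "norm (yz s - yz t) \<le> ?b s" if s: "s \<in> {0<..<T}" for s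
  proof -
    have s': "s \<in> {0..<T}" using s by auto
    note d1 = dominated_weight[OF L1w_space_diff[OF h'_space[OF s] h'_space[OF t]] \<eta>m \<eta>0 \<eta>le]
    note d2 = dominated_weight[OF L1w_space_diff[OF h_space[OF s'] h_space[OF t']] \<eta>am \<eta>a0 \<eta>ale]
    note zi = z_integrable[OF s] z_integrable[OF t]
    let ?z = "\<lambda>s k. h' s k + a k * h s k"
    have pt: "\<bar>\<eta> k * \<bar>?z s k\<bar> - \<eta> k * \<bar>?z t k\<bar>\<bar> \<le> \<eta> k * \<bar>h' s k - h' t k\<bar> + \<eta> k * a k * \<bar>h s k - h t k\<bar>" for k
    proof -
      have "?z s k - ?z t k = (h' s k - h' t k) + a k * (h s k - h t k)" by (simp add: right_diff_distrib)
      then have "\<bar>\<bar>?z s k\<bar> - \<bar>?z t k\<bar>\<bar> \<le> \<bar>(h' s k - h' t k) + a k * (h s k - h t k)\<bar>"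
        using abs_triangle_ineq3[of "?z s k" "?z t k"] by (simp only:)
      also have "\<dots> \<le> \<bar>h' s k - h' t k\<bar> + \<bar>a k * (h s k - h t k)\<bar>" by (rule abs_triangle_ineq)
      also have "\<bar>a k * (h s k - h t k)\<bar> = a k * \<bar>h s k - h t k\<bar>" using a0[of k] by (simp add: abs_mult)
      finally have "\<eta> k * \<bar>\<bar>?z s k\<bar> - \<bar>?z t k\<bar>\<bar> \<le> \<eta> k * (\<bar>h' s k - h' t k\<bar> + a k * \<bar>h s k - h t k\<bar>)" by (rule mult_left_mono[OF _ \<eta>0])
      moreover have "\<bar>\<eta> k * X - \<eta> k * Y\<bar> = \<eta> k * \<bar>X - Y\<bar>" for X Y
        using \<eta>0[of k] by (simp add: abs_mult flip: right_diff_distrib)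
      ultimately show ?thesis by (simp only: distrib_left mult.assoc)
    qed
    have "\<bar>yz s - yz t\<bar> = \<bar>\<integral>k. \<eta> k * \<bar>?z s k\<bar> - \<eta> k * \<bar>?z t k\<bar> \<partial>lborel\<bar>" unfolding yz_def using zi by simp
    also have "\<dots> \<le> (\<integral>k. \<bar>\<eta> k * \<bar>?z s k\<bar> - \<eta> k * \<bar>?z t k\<bar>\<bar> \<partial>lborel)"
      using integral_norm_bound[of lborel "\<lambda>k. \<eta> k * \<bar>?z s k\<bar> - \<eta> k * \<bar>?z t k\<bar>"] by simp
    also have "\<dots> \<le> (\<integral>k. \<eta> k * \<bar>h' s k - h' t k\<bar> + \<eta> k * a k * \<bar>h s k - h t k\<bar> \<partial>lborel)"
      by (rule integral_mono[OF _ _ pt]) (use zi d1 d2 in auto)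
    also have "\<dots> \<le> ?b s" using d1 d2 by simp
    finally show ?thesis by simp
  qed
  then have "\<forall>\<^sub>F s in at t within {0<..<T}. norm (yz s - yz t) \<le> ?b s"
    unfolding eventually_at_filter by (intro always_eventually) auto
  from LIM_zero_cancel[OF Lim_null_comparison[OF this lim]]
  show "(yz \<longlongrightarrow> yz t) (at t within {0<..<T})" .
qed

text \<open>
  For a short time step \<open>\<tau>\<close> the Euler step is \<open>(1 - \<tau> a) h + \<tau> z\<close>. Its first coefficient is
  nonnegative on the support of \<open>\<eta>\<close>, so that the damping survives the absolute value.
\<close>

lemma y_dini:
  assumes t: "t \<in> {0<..<T}" and e: "0 < e"
  shows "\<forall>\<^sub>F s in at_right t. y s \<le> y t + (s - t) * (yz t - ya t + e)"
proof -
  have t': "t \<in> {0..<T}" using t by auto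
  let ?q = "\<lambda>s k. (h s k - h t k) / (s - t) - h' t k"
  have "((\<lambda>s. c * L1w_norm lam1 lam2 N (?q s)) \<longlongrightarrow> c * 0) (at t)"
    using deriv[OF t] by (intro tendsto_mult_left) (simp add: L1w_has_derivative_def)
  then have "((\<lambda>s. c * L1w_norm lam1 lam2 N (?q s)) \<longlongrightarrow> 0) (at_right t)"
    by (simp add: filterlim_at_split)
  then have "\<forall>\<^sub>F s in at_right t. c * L1w_norm lam1 lam2 N (?q s) < e" using e by (rule order_tendstoD)
  moreover have "\<forall>\<^sub>F s in at_right t. s \<in> {t<..<min T (t + 1 / (A + 1))}"
    using t A0 by (intro eventually_at_right_real) auto
  ultimately show ?thesis
  proof eventually_elim
    case (elim s)
    then have s: "t < s" "s < T" "(s - t) * (A + 1) < 1" using A0 by (auto simp: field_simps)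
    have s': "s \<in> {0..<T}" using s t by auto
    have "?q s = (\<lambda>k. 1 * (1 / (s - t) * h s k + (- 1 / (s - t)) * h t k) + (-1) * h' t k)"
      by (simp add: fun_eq_iff diff_divide_distrib)
    also have "\<dots> \<in> L1w_space lam1 lam2 N" by (intro L1w_space_lin h_space s' t' h'_space t)
    finally have q: "?q s \<in> L1w_space lam1 lam2 N" .
    note dq = dominated_weight[OF q \<eta>m \<eta>0 \<eta>le]
    note dh = dominated_weight(1)[OF h_space[OF s'] \<eta>m \<eta>0 \<eta>le] dominated_weight(1)[OF h_space[OF t'] \<eta>m \<eta>0 \<eta>le] dominated_weight(1)[OF h_space[OF t'] \<eta>am \<eta>a0 \<eta>ale]
    note zi = z_integrable[OF t]
    have "y s \<le> (\<integral>k. \<eta> k * \<bar>h t k\<bar> - (s - t) * (\<eta> k * a k * \<bar>h t k\<bar>) + (s - t) * (\<eta> k * \<bar>h' t k + a k * h t k\<bar>) + (s - t) * (\<eta> k * \<bar>?q s k\<bar>) \<partial>lborel)"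
      unfolding y_def
    proof (rule integral_mono)
      fix k
      show "\<eta> k * \<bar>h s k\<bar> \<le> \<eta> k * \<bar>h t k\<bar> - (s - t) * (\<eta> k * a k * \<bar>h t k\<bar>) + (s - t) * (\<eta> k * \<bar>h' t k + a k * h t k\<bar>) + (s - t) * (\<eta> k * \<bar>?q s k\<bar>)"
      proof (cases "\<eta> k = 0")
        case False
        have "(s - t) * a k \<le> (s - t) * (A + 1)" using aA[OF False] s by (intro mult_left_mono) auto
        then have sa: "0 \<le> 1 - (s - t) * a k" using s(3) by linarith
        have q1: "(s - t) * ?q s k = (h s k - h t k) - (s - t) * h' t k" 
        proof -
          have "d * (X / d - Y) = X - d * Y" if "d \<noteq> 0" for d X Y :: real using that by (simp add: right_diff_distrib)
          then show ?thesis using s(1) by simp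
        qed
        have "h s k = (1 - (s - t) * a k) * h t k + (s - t) * (h' t k + a k * h t k) + (s - t) * ?q s k"
          unfolding q1 by (simp add: algebra_simps)
        then have "\<bar>h s k\<bar> \<le> \<bar>(1 - (s - t) * a k) * h t k\<bar> + \<bar>(s - t) * (h' t k + a k * h t k)\<bar> + \<bar>(s - t) * ?q s k\<bar>" by linarith
        also have "\<dots> = (1 - (s - t) * a k) * \<bar>h t k\<bar> + (s - t) * \<bar>h' t k + a k * h t k\<bar> + (s - t) * \<bar>?q s k\<bar>"
          using s sa by (simp only: abs_mult abs_of_nonneg)
        finally have "\<eta> k * \<bar>h s k\<bar> \<le> \<eta> k * ((1 - (s - t) * a k) * \<bar>h t k\<bar> + (s - t) * \<bar>h' t k + a k * h t k\<bar> + (s - t) * \<bar>?q s k\<bar>)"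
          by (rule mult_left_mono[OF _ \<eta>0])
        also have "\<dots> = \<eta> k * \<bar>h t k\<bar> - (s - t) * (\<eta> k * a k * \<bar>h t k\<bar>) + (s - t) * (\<eta> k * \<bar>h' t k + a k * h t k\<bar>) + (s - t) * (\<eta> k * \<bar>?q s k\<bar>)"
          by (simp only: distrib_left left_diff_distrib right_diff_distrib mult_1_left mult_ac)
        finally show ?thesis .
      qed simp
    qed (use dq dh zi in auto)
    also have "\<dots> = y t - (s - t) * ya t + (s - t) * yz t + (s - t) * (\<integral>k. \<eta> k * \<bar>?q s k\<bar> \<partial>lborel)"
      unfolding y_def ya_def yz_def using dq(1) dh zi by simp
    also have "\<dots> \<le> y t - (s - t) * ya t + (s - t) * yz t + (s - t) * e"
      using dq(2) elim s by (intro add_left_mono mult_left_mono) auto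
    finally show ?case by (simp add: algebra_simps)
  qed
qed

text \<open>
  The integrating factor \<open>e\<^sup>-\<^sup>\<kappa>\<^sup>t\<close> adds \<open>\<kappa>\<close> to the damping. The initial time is positive because the
  derivative need not be bounded as \<open>t\<close> tends to \<open>0\<close>.
\<close>

theorem energy_inequality:
  assumes st: "0 < s" "s \<le> t" "t < T"
  shows "exp (- \<kappa> * t) * y t \<le> exp (- \<kappa> * s) * y s + integral {s..t} (\<lambda>r. exp (- \<kappa> * r) * (yz r - ya r - \<kappa> * y r))"
proof (rule dini_integral_bound[OF st(2)])
  have c1: "continuous_on {s..t} y" "continuous_on {s..t} ya" "continuous_on {s..t} yz"
    using st by (auto intro: continuous_on_subset[OF y_continuous] continuous_on_subset[OF ya_continuous] continuous_on_subset[OF yz_continuous])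
  show "continuous_on {s..t} (\<lambda>t. exp (- \<kappa> * t) * y t)" by (intro continuous_intros c1)
  show "continuous_on {s..t} (\<lambda>r. exp (- \<kappa> * r) * (yz r - ya r - \<kappa> * y r))" by (intro continuous_intros c1)
  fix r e :: real assume r: "s \<le> r" "r < t" and e: "0 < e"
  have rT: "r \<in> {0<..<T}" using r st by auto
  define E where "E x = exp (- \<kappa> * x)" for x
  have E: "0 < E x" for x by (simp add: E_def)
  define e1 where "e1 = e / (2 * E r)"
  have e1: "0 < e1" using e E by (simp add: e1_def)
  define \<rho> where "\<rho> = yz r - ya r"
  define \<phi> where "\<phi> x = E x * (y r + (x - r) * (\<rho> + e1))" for x
  have "(\<phi> has_real_derivative (- \<kappa> * E r * y r + E r * (\<rho> + e1))) (at r)"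
    unfolding \<phi>_def E_def by (auto intro!: derivative_eq_intros simp: algebra_simps)
  then have "((\<lambda>x. (\<phi> x - \<phi> r) / (x - r)) \<longlongrightarrow> (- \<kappa> * E r * y r + E r * (\<rho> + e1))) (at_right r)"
    unfolding has_field_derivative_iff by (simp add: filterlim_at_split)
  then have "\<forall>\<^sub>F x in at_right r. (\<phi> x - \<phi> r) / (x - r) < (- \<kappa> * E r * y r + E r * (\<rho> + e1)) + e / 2"
    using e by (intro order_tendstoD) auto
  moreover have "\<forall>\<^sub>F x in at_right r. y x \<le> y r + (x - r) * (\<rho> + e1)"
    unfolding \<rho>_def by (rule y_dini[OF rT e1])
  moreover have "\<forall>\<^sub>F x in at_right r. x \<in> {r<..<t}" by (rule eventually_at_right_real[OF r(2)])
  ultimately show "\<forall>\<^sub>F x in at_right r. exp (- \<kappa> * x) * y x \<le> exp (- \<kappa> * r) * y r + (x - r) * (exp (- \<kappa> * r) * (yz r - ya r - \<kappa> * y r) + e)"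
  proof eventually_elim
    case (elim x)
    have "E x * y x \<le> \<phi> x" unfolding \<phi>_def using elim E[of x] by (intro mult_left_mono) auto
    also have "\<phi> x \<le> \<phi> r + (x - r) * ((- \<kappa> * E r * y r + E r * (\<rho> + e1)) + e / 2)"
      using elim by (simp add: pos_divide_less_eq mult.commute)
    also have "(- \<kappa> * E r * y r + E r * (\<rho> + e1)) + e / 2 = E r * (yz r - ya r - \<kappa> * y r) + e"
      unfolding \<rho>_def e1_def using E[of r] by (simp add: algebra_simps)
    also have "\<phi> r = E r * y r" by (simp add: \<phi>_def)
    finally show ?case by (simp add: E_def)
  qed
qed

end

section \<open>Uniqueness\<close>

lemma L1w_norm_diff_le:
  assumes u: "u \<in> L1w_space lam1 lam2 N" and v: "v \<in> L1w_space lam1 lam2 N"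
  shows "L1w_norm lam1 lam2 N (\<lambda>k. u k - v k) \<le> L1w_norm lam1 lam2 N u + L1w_norm lam1 lam2 N v"
proof -
  have i: "integrable lborel (\<lambda>k. omega lam1 lam2 k powr N * \<bar>u k\<bar>)" "integrable lborel (\<lambda>k. omega lam1 lam2 k powr N * \<bar>v k\<bar>)"
    "integrable lborel (\<lambda>k. omega lam1 lam2 k powr N * \<bar>u k - v k\<bar>)"
    using u v L1w_space_diff[OF u v] by (auto simp: L1w_space_def)
  have "L1w_norm lam1 lam2 N (\<lambda>k. u k - v k) \<le> (\<integral>k. omega lam1 lam2 k powr N * \<bar>u k\<bar> + omega lam1 lam2 k powr N * \<bar>v k\<bar> \<partial>lborel)"
    unfolding L1w_norm_def
    by (intro integral_mono i Bochner_Integration.integrable_add) (simp flip: distrib_left add: mult_left_mono abs_triangle_ineq4)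
  then show ?thesis using i by (simp add: L1w_norm_def)
qed

lemma L1w_continuous_diff:
  assumes g: "L1w_continuous_on lam1 lam2 N J g" and h: "L1w_continuous_on lam1 lam2 N J h"
  shows "L1w_continuous_on lam1 lam2 N J (\<lambda>t k. g t k - h t k)"
  unfolding L1w_continuous_on_def
proof (intro ballI conjI)
  fix t assume t: "t \<in> J"
  have sp: "g s \<in> L1w_space lam1 lam2 N" "h s \<in> L1w_space lam1 lam2 N" if "s \<in> J" for s
    using g h that by (auto simp: L1w_continuous_on_def)
  show "(\<lambda>k. g t k - h t k) \<in> L1w_space lam1 lam2 N" by (intro L1w_space_diff sp t)
  let ?b = "\<lambda>s. L1w_norm lam1 lam2 N (\<lambda>k. g s k - g t k) + L1w_norm lam1 lam2 N (\<lambda>k. h s k - h t k)"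
  have "(?b \<longlongrightarrow> 0 + 0) (at t within J)" using g h t by (intro tendsto_add) (auto simp: L1w_continuous_on_def)
  then have lim: "(?b \<longlongrightarrow> 0) (at t within J)" by simp
  have "L1w_norm lam1 lam2 N (\<lambda>k. (g s k - h s k) - (g t k - h t k)) \<le> ?b s" if s: "s \<in> J" for s
  proof -
    have "(\<lambda>k. (g s k - h s k) - (g t k - h t k)) = (\<lambda>k. (g s k - g t k) - (h s k - h t k))" by (simp add: fun_eq_iff)
    then show ?thesis using L1w_norm_diff_le[OF L1w_space_diff L1w_space_diff, OF sp(1)[OF s] sp(1)[OF t] sp(2)[OF s] sp(2)[OF t]] by simp
  qed
  then have "\<forall>\<^sub>F s in at t within J. norm (L1w_norm lam1 lam2 N (\<lambda>k. (g s k - h s k) - (g t k - h t k))) \<le> ?b s"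
    unfolding eventually_at_filter by (intro always_eventually) (auto simp: abs_of_nonneg[OF L1w_norm_nonneg])
  then show "((\<lambda>s. L1w_norm lam1 lam2 N (\<lambda>k. (g s k - h s k) - (g t k - h t k))) \<longlongrightarrow> 0) (at t within J)"
    by (rule Lim_null_comparison[OF _ lim])
qed

lemma L1w_derivative_diff:
  assumes g: "L1w_has_derivative lam1 lam2 N g g' t" and h: "L1w_has_derivative lam1 lam2 N h h' t"
    and sp: "\<And>s. s \<in> J \<Longrightarrow> g s \<in> L1w_space lam1 lam2 N" "\<And>s. s \<in> J \<Longrightarrow> h s \<in> L1w_space lam1 lam2 N" and J: "open J" "t \<in> J"
  shows "L1w_has_derivative lam1 lam2 N (\<lambda>t k. g t k - h t k) (\<lambda>k. g' k - h' k) t"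
  unfolding L1w_has_derivative_def
proof
  have d: "g' \<in> L1w_space lam1 lam2 N" "h' \<in> L1w_space lam1 lam2 N" using g h by (auto simp: L1w_has_derivative_def)
  then show "(\<lambda>k. g' k - h' k) \<in> L1w_space lam1 lam2 N" by (rule L1w_space_diff)
  let ?q = "\<lambda>f f' s k. (f s k - f t k) / (s - t) - f' k"
  let ?b = "\<lambda>s. L1w_norm lam1 lam2 N (?q g g' s) + L1w_norm lam1 lam2 N (?q h h' s)"
  have "(?b \<longlongrightarrow> 0 + 0) (at t)" using g h by (intro tendsto_add) (auto simp: L1w_has_derivative_def)
  then have lim: "(?b \<longlongrightarrow> 0) (at t)" by simp
  have qs: "?q f f' s \<in> L1w_space lam1 lam2 N"
    if "f s \<in> L1w_space lam1 lam2 N" "f t \<in> L1w_space lam1 lam2 N" "f' \<in> L1w_space lam1 lam2 N" for f f' s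
  proof -
    have "?q f f' s = (\<lambda>k. 1 * (1 / (s - t) * f s k + (- 1 / (s - t)) * f t k) + (-1) * f' k)"
      by (simp add: fun_eq_iff diff_divide_distrib)
    also have "\<dots> \<in> L1w_space lam1 lam2 N" by (intro L1w_space_lin that)
    finally show ?thesis .
  qed
  have "norm (L1w_norm lam1 lam2 N (\<lambda>k. ((g s k - h s k) - (g t k - h t k)) / (s - t) - (g' k - h' k))) \<le> ?b s" if s: "s \<in> J" for s
  proof -
    have "(\<lambda>k. ((g s k - h s k) - (g t k - h t k)) / (s - t) - (g' k - h' k)) = (\<lambda>k. ?q g g' s k - ?q h h' s k)"
      by (simp add: fun_eq_iff diff_divide_distrib)
    then show ?thesis
      using L1w_norm_diff_le[OF qs[OF sp(1)[OF s] sp(1)[OF J(2)] d(1)] qs[OF sp(2)[OF s] sp(2)[OF J(2)] d(2)]]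
      by (simp add: abs_of_nonneg[OF L1w_norm_nonneg])
  qed
  then have "\<forall>\<^sub>F s in at t. norm (L1w_norm lam1 lam2 N (\<lambda>k. ((g s k - h s k) - (g t k - h t k)) / (s - t) - (g' k - h' k))) \<le> ?b s"
    using J by (auto simp: eventually_at_topological)
  then show "((\<lambda>s. L1w_norm lam1 lam2 N (\<lambda>k. ((g s k - h s k) - (g t k - h t k)) / (s - t) - (g' k - h' k))) \<longlongrightarrow> 0) (at t)"
    by (rule Lim_null_comparison[OF _ lim])
qed

lemma nn_integral_continuous_Icc:
  fixes \<phi> :: "real \<Rightarrow> real"
  assumes c: "continuous_on {s..t} \<phi>" and nn: "\<And>r. r \<in> {s..t} \<Longrightarrow> 0 \<le> \<phi> r"
  shows "(\<integral>\<^sup>+r. ennreal (indicator {s..t} r * \<phi> r) \<partial>lborel) = ennreal (integral {s..t} \<phi>)"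
proof -
  have i: "set_integrable lborel {s..t} \<phi>" by (rule borel_integrable_atLeastAtMost'[OF c])
  have "(\<integral>\<^sup>+r. ennreal (indicator {s..t} r * \<phi> r) \<partial>lborel) = ennreal (\<integral>r. indicator {s..t} r * \<phi> r \<partial>lborel)"
    using i nn by (intro nn_integral_eq_integral) (auto simp: set_integrable_def indicator_def)
  also have "(\<integral>r. indicator {s..t} r * \<phi> r \<partial>lborel) = integral {s..t} \<phi>"
    using set_borel_integral_eq_integral(2)[OF i] by (simp add: set_lebesgue_integral_def)
  finally show ?thesis .
qed

lemma real_le_of_nn_integral:
  assumes "(\<integral>\<^sup>+k. ennreal (F k) \<partial>M) \<le> ennreal b" "0 \<le> b" "\<And>k. 0 \<le> F k"
  shows "(\<integral>k. F k \<partial>M) \<le> b"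
  using order_trans[OF ennreal_integral_le_nn_integral assms(1)] assms(2,3) by (simp add: ennreal_le_iff)

lemma omega_powr_ge:
  fixes k :: "real^'n"
  assumes "0 \<le> lam1" "0 < lam2" "0 < \<delta>" "\<delta> \<le> norm k" "0 \<le> N"
  shows "1 \<le> (1 / (sqrt lam2 * \<delta>) powr N) * omega lam1 lam2 k powr N"
proof -
  have "sqrt lam2 * \<delta> \<le> sqrt lam2 * norm k" using assms by (intro mult_left_mono) auto
  also have "\<dots> \<le> omega lam1 lam2 k" using assms by (intro omega_ge_norm) auto
  finally have "(sqrt lam2 * \<delta>) powr N \<le> omega lam1 lam2 k powr N" using assms by (intro powr_mono2) auto
  then show ?thesis using assms by simp
qed

context kinetic begin

text \<open>
  Replaces a solution, which is nonnegative only almost everywhere, by a function that is nonnegative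
  everywhere.
\<close>

lemma collision_max_AE:
  assumes "g \<in> borel_measurable borel" "AE k in lborel. 0 \<le> g k"
  shows "AE k in lborel. collision lam1 lam2 \<CC> g k = collision lam1 lam2 \<CC> (\<lambda>k. max 0 (g k)) k"
  using assms by (intro collision_cong_AE) (auto elim: eventually_mono)

definition shell :: "real \<Rightarrow> real \<Rightarrow> (real^'n) set" where
  "shell r R = {k. r \<le> norm k \<and> norm k \<le> R}"

lemma shell_measurable [measurable]: "shell r R \<in> sets borel"
  unfolding shell_def by measurable

lemma indicator_shell_le:
  assumes "0 < \<delta>" "0 < N"
  shows "indicator (shell \<delta> R) k \<le> (1 / (sqrt lam2 * \<delta>) powr N) * omega lam1 lam2 k powr N"
  using omega_powr_ge[OF lam1 lam2 assms(1), of k N] assms(2) by (auto simp: indicator_def shell_def)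

lemma solution_curve:
  assumes g: "nonneg_strong_solution lam1 lam2 \<CC> \<nu> N {0..<T} u g"
  obtains g' where "L1w_continuous_on lam1 lam2 N {0..<T} g" "L1w_continuous_on lam1 lam2 N {0<..<T} g'"
    "\<And>t. t \<in> {0<..<T} \<Longrightarrow> L1w_has_derivative lam1 lam2 N g (g' t) t"
    "\<And>t. t \<in> {0<..<T} \<Longrightarrow> AE k in lborel. g' t k + 2 * \<nu> * (norm k)\<^sup>2 * g t k = collision lam1 lam2 \<CC> (\<lambda>k. max 0 (g t k)) k"
    "\<And>t. t \<in> {0..<T} \<Longrightarrow> g t \<in> L1w_space lam1 lam2 N" "\<And>t. t \<in> {0..<T} \<Longrightarrow> AE k in lborel. 0 \<le> g t k"
    "AE k in lborel. g 0 k = u k"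
proof -
  have int: "interior {0..<T} = {0<..<T}" by (rule interior_atLeastLessThan)
  obtain g' where g': "L1w_continuous_on lam1 lam2 N {0<..<T} g'"
    "\<And>t. t \<in> {0<..<T} \<Longrightarrow> L1w_has_derivative lam1 lam2 N g (g' t) t"
    "\<And>t. t \<in> {0<..<T} \<Longrightarrow> AE k in lborel. g' t k + 2 * \<nu> * (norm k)\<^sup>2 * g t k = collision lam1 lam2 \<CC> (g t) k"
    using g unfolding nonneg_strong_solution_def strong_solution_def int by blast
  have gc: "L1w_continuous_on lam1 lam2 N {0..<T} g" and nn: "\<And>t. t \<in> {0..<T} \<Longrightarrow> AE k in lborel. 0 \<le> g t k" and ini: "AE k in lborel. g 0 k = u k"
    using g unfolding nonneg_strong_solution_def strong_solution_def by blast+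
  have sp: "g t \<in> L1w_space lam1 lam2 N" if "t \<in> {0..<T}" for t using gc that by (simp add: L1w_continuous_on_def)
  have "AE k in lborel. g' t k + 2 * \<nu> * (norm k)\<^sup>2 * g t k = collision lam1 lam2 \<CC> (\<lambda>k. max 0 (g t k)) k" if t: "t \<in> {0<..<T}" for t
  proof -
    have t': "t \<in> {0..<T}" using t by auto
    have "g t \<in> borel_measurable borel" using sp[OF t'] by (auto simp: L1w_space_def)
    from collision_max_AE[OF this nn[OF t']] g'(3)[OF t] show ?thesis by eventually_elim simp
  qed
  then show ?thesis using that gc g' sp nn ini by blast
qed

text \<open>
  Only the norm with weight \<open>\<omega>\<^sup>N\<close> is known to be bounded, and this says little near the origin. But
  the gain into low wave numbers carries a factor \<open>|k|\<close>: a bound for the moment of order \<open>p + 1\<close> of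
  \<open>min 1 |k|\<close> implies one for the moment of order \<open>p\<close>. Starting at an integer \<open>p \<ge> N\<close> one arrives
  at the mass itself.
\<close>

lemma mass_locally_bounded:
  fixes g :: "real \<Rightarrow> real^'n \<Rightarrow> real"
  assumes N: "0 < N" and g: "nonneg_strong_solution lam1 lam2 \<CC> \<nu> N {0..<T} u g" and T1: "0 \<le> T1" "T1 < T"
  shows "\<exists>B. \<forall>t\<in>{0..T1}. (\<integral>k. \<bar>g t k\<bar> \<partial>lborel) \<le> B"
proof -
  obtain g' where gc: "L1w_continuous_on lam1 lam2 N {0..<T} g" and g'c: "L1w_continuous_on lam1 lam2 N {0<..<T} g'"
    and gd: "\<And>t. t \<in> {0<..<T} \<Longrightarrow> L1w_has_derivative lam1 lam2 N g (g' t) t"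
    and eq: "\<And>t. t \<in> {0<..<T} \<Longrightarrow> AE k in lborel. g' t k + 2 * \<nu> * (norm k)\<^sup>2 * g t k = collision lam1 lam2 \<CC> (\<lambda>k. max 0 (g t k)) k"
    and sp: "\<And>t. t \<in> {0..<T} \<Longrightarrow> g t \<in> L1w_space lam1 lam2 N" and nn: "\<And>t. t \<in> {0..<T} \<Longrightarrow> AE k in lborel. 0 \<le> g t k"
    by (rule solution_curve[OF g]) blast
  have gi: "integrable lborel (g t)" if "t \<in> {0..<T}" for t using sp[OF that] by (simp add: L1w_space_def)
  have T1T: "t \<in> {0..<T}" if "t \<in> {0..T1}" for t using that T1 by auto
  have "continuous_on {0..T1} (\<lambda>t. \<integral>k. omega lam1 lam2 k powr N * \<bar>g t k\<bar> \<partial>lborel)"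
    by (rule continuous_on_subset[OF weighted_norm_continuous[OF gc, where c = 1]]) (use T1 in auto)
  then have "bounded ((\<lambda>t. \<integral>k. omega lam1 lam2 k powr N * \<bar>g t k\<bar> \<partial>lborel) ` {0..T1})"
    by (intro compact_imp_bounded compact_continuous_image) auto
  then obtain Nb where Nb': "\<forall>x \<in> (\<lambda>t. \<integral>k. omega lam1 lam2 k powr N * \<bar>g t k\<bar> \<partial>lborel) ` {0..T1}. norm x \<le> Nb"
    unfolding bounded_iff by blast
  have Nb: "L1w_norm lam1 lam2 N (g t) \<le> Nb" if "t \<in> {0..T1}" for t
    using bspec[OF Nb' imageI[OF that]] unfolding L1w_norm_def by simp
  define \<mu> where "\<mu> k = min 1 (norm k)" for k :: "real^'n"
  have \<mu>0: "0 \<le> \<mu> k" "\<mu> k \<le> 1" for k by (auto simp: \<mu>_def)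
  have \<mu>m [measurable]: "\<mu> \<in> borel_measurable borel" unfolding \<mu>_def[abs_def] by measurable
  have \<mu>w: "doubling (2 ^ p) (\<lambda>k. \<mu> k ^ p)" for p
  proof (rule doubling_power[OF \<mu>m \<mu>0(1)])
    have "min 1 a \<le> min 1 b + min 1 c" if "a \<le> b + c" "0 \<le> b" "0 \<le> c" for a b c :: real
      using that by (auto simp: min_def)
    then show "\<mu> x \<le> \<mu> y + \<mu> z" if "norm x \<le> norm y + norm z" for x y z using that by (simp add: \<mu>_def)
  qed
  have \<mu>i: "integrable lborel (\<lambda>k. \<mu> k ^ p * \<bar>g t k\<bar>)" if "t \<in> {0..<T}" for p t
  proof (rule Bochner_Integration.integrable_bound[OF gi[OF that]])
    show "AE k in lborel. norm (\<mu> k ^ p * \<bar>g t k\<bar>) \<le> norm (g t k)"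
      using \<mu>0 by (auto simp: abs_mult intro!: mult_left_le_one_le power_le_one)
  qed (use gi[OF that] in measurable)
  define P where "P p \<longleftrightarrow> (\<exists>B. \<forall>t\<in>{0..T1}. (\<integral>k. \<mu> k ^ p * \<bar>g t k\<bar> \<partial>lborel) \<le> B)" for p
  \<comment> \<open>Since \<open>\<mu> \<le> 1\<close>, a power of order at least \<open>N\<close> is at most \<open>|k|\<^sup>N\<close>, which \<open>\<omega>\<^sup>N\<close> dominates.\<close>
  have base: "P p" if "N \<le> real p" for p
  proof -
    have le: "\<mu> k ^ p \<le> (1 / (sqrt lam2 * 1) powr N) * omega lam1 lam2 k powr N" for k
    proof (cases "k = 0")
      case True
      moreover have "p \<noteq> 0" using that N by (intro notI) simp
      ultimately show ?thesis by (simp add: \<mu>_def power_0_left)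
    next
      case False
      then have pos: "0 < \<mu> k" "0 < norm k" by (auto simp: \<mu>_def)
      have "\<mu> k ^ p = \<mu> k powr real p" using pos by (simp add: powr_realpow)
      also have "\<dots> \<le> \<mu> k powr N" using pos \<mu>0 that by (intro powr_mono') auto
      also have "\<dots> \<le> norm k powr N" using pos N by (intro powr_mono2) (auto simp: \<mu>_def)
      also have "\<dots> = norm k powr N * 1" by simp
      also have "\<dots> \<le> norm k powr N * ((1 / (sqrt lam2 * norm k) powr N) * omega lam1 lam2 k powr N)"
        using omega_powr_ge[OF lam1 lam2 pos(2), of k N] N by (intro mult_left_mono) auto
      also have "\<dots> = (1 / (sqrt lam2 * 1) powr N) * omega lam1 lam2 k powr N"
        using pos lam2 by (simp add: powr_mult)
      finally show ?thesis .
    qed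
    have "(\<integral>k. \<mu> k ^ p * \<bar>g t k\<bar> \<partial>lborel) \<le> (1 / (sqrt lam2 * 1) powr N) * Nb" if t: "t \<in> {0..T1}" for t
    proof -
      have "(\<integral>k. \<mu> k ^ p * \<bar>g t k\<bar> \<partial>lborel) \<le> (1 / (sqrt lam2 * 1) powr N) * L1w_norm lam1 lam2 N (g t)"
        using \<mu>0 by (intro dominated_weight(2) sp T1T t le) auto
      also have "\<dots> \<le> (1 / (sqrt lam2 * 1) powr N) * Nb" by (intro mult_left_mono Nb t) auto
      finally show ?thesis .
    qed
    then show ?thesis unfolding P_def by blast
  qed
  have step: "P p" if PS: "P (Suc p)" for p
  proof -
    obtain B where B': "\<forall>t\<in>{0..T1}. (\<integral>k. \<mu> k ^ Suc p * \<bar>g t k\<bar> \<partial>lborel) \<le> B" using PS unfolding P_def by blast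
    note B = bspec[OF B']
    \<comment> \<open>The bound of \<open>collision_le\<close> for the weight \<open>\<mu>\<close> to the power \<open>p + 1\<close>, whose doubling constant is \<open>2\<close> to that power.\<close>
    define K where "K = 9 * \<CC>\<^sup>2 * 2 ^ Suc p * B"
    define m0 where "m0 = (\<integral>k. \<bar>g 0 k\<bar> \<partial>lborel)"
    define \<eta> where "\<eta> n k = indicator (shell (1 / real (Suc n)) 1) k * norm k ^ p" for n and k :: "real^'n"
    have \<eta>le1: "\<eta> n k \<le> indicator (shell (1 / real (Suc n)) 1) k" for n k
      by (auto simp: \<eta>_def indicator_def shell_def power_le_one)
    have \<eta>0: "0 \<le> \<eta> n k" for n k by (simp add: \<eta>_def)
    have \<eta>1: "\<eta> n k \<le> 1" for n k by (rule order_trans[OF \<eta>le1 indicator_le_1])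
    have \<eta>m [measurable]: "\<eta> n \<in> borel_measurable borel" for n unfolding \<eta>_def[abs_def] by measurable
    have inner: "(\<integral>k. \<eta> n k * \<bar>g t k\<bar> \<partial>lborel) \<le> m0 + \<bar>K\<bar> * T1" if t: "t \<in> {0..T1}" for n t
    proof (cases "t = 0")
      case True
      have "(\<integral>k. \<eta> n k * \<bar>g 0 k\<bar> \<partial>lborel) \<le> m0" unfolding m0_def
      proof (rule integral_mono_AE')
        show "integrable lborel (\<lambda>k. \<bar>g 0 k\<bar>)" using gi T1 by simp
        show "AE k in lborel. \<eta> n k * \<bar>g 0 k\<bar> \<le> \<bar>g 0 k\<bar>"
          using \<eta>1 \<eta>0 by (intro AE_I2 mult_left_le_one_le) auto
      qed (use \<eta>0 in auto)
      then show ?thesis using True T1 by (simp add: add_increasing2)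
    next
      case False
      then have t0: "0 < t" "t < T" using t T1 by auto
      interpret D: damped_curve lam1 lam2 N T "\<lambda>k. 2 * \<nu> * (norm k)\<^sup>2" g g' "\<eta> n" "1 / (sqrt lam2 * (1 / real (Suc n))) powr N" "2 * \<nu>"
      proof
        show "\<eta> n k \<le> 1 / (sqrt lam2 * (1 / real (Suc n))) powr N * omega lam1 lam2 k powr N" for k
          using order_trans[OF \<eta>le1 indicator_shell_le[OF _ N]] by simp
        show "2 * \<nu> * (norm k)\<^sup>2 \<le> 2 * \<nu>" if "\<eta> n k \<noteq> 0" for k
          using that nu by (auto simp: \<eta>_def indicator_def shell_def power_le_one split: if_splits)
      qed (use gc g'c gd \<eta>0 nu in auto)
      have yz: "D.yz r \<le> \<bar>K\<bar>" if r: "0 < r" "r \<le> t" for r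
      proof -
        have rT: "r \<in> {0<..<T}" "r \<in> {0..<T}" "r \<in> {0..T1}" using r t T1 by auto
        let ?G = "\<lambda>k. max 0 (g r k)"
        have Gi: "integrable lborel ?G" using gi[OF rT(2)] by auto
        have G: "AE k in lborel. \<bar>g r k\<bar> = ?G k" using nn[OF rT(2)] by eventually_elim simp
        have "D.yz r = (\<integral>k. \<eta> n k * \<bar>collision lam1 lam2 \<CC> ?G k\<bar> \<partial>lborel)"
          unfolding D.yz_def
        proof (rule integral_cong_AE)
          note [measurable] = D.h_measurable(1)[OF rT(2)] D.h_measurable(2)[OF rT(1)] collision_measurable[of ?G lam1 lam2 \<CC>]
          show "(\<lambda>k. \<eta> n k * \<bar>g' r k + 2 * \<nu> * (norm k)\<^sup>2 * g r k\<bar>) \<in> borel_measurable lborel" by measurable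
          show "(\<lambda>k. \<eta> n k * \<bar>collision lam1 lam2 \<CC> ?G k\<bar>) \<in> borel_measurable lborel" by measurable
          show "AE k in lborel. \<eta> n k * \<bar>g' r k + 2 * \<nu> * (norm k)\<^sup>2 * g r k\<bar> = \<eta> n k * \<bar>collision lam1 lam2 \<CC> ?G k\<bar>"
            using eq[OF rT(1)] by eventually_elim simp
        qed
        also have "\<dots> \<le> \<bar>K\<bar>"
        proof (rule real_le_of_nn_integral)
          have VG: "integrable lborel (\<lambda>k. \<mu> k ^ Suc p * ?G k)" "(\<integral>k. \<mu> k ^ Suc p * ?G k \<partial>lborel) = (\<integral>k. \<mu> k ^ Suc p * \<bar>g r k\<bar> \<partial>lborel)"
          proof -
            note [measurable] = D.h_measurable(1)[OF rT(2)]
            have ae: "AE k in lborel. \<mu> k ^ Suc p * \<bar>g r k\<bar> = \<mu> k ^ Suc p * ?G k" using G by eventually_elim simp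
            show "integrable lborel (\<lambda>k. \<mu> k ^ Suc p * ?G k)" using \<mu>i[OF rT(2), of "Suc p"] integrable_cong_AE[OF _ _ ae] by simp
            show "(\<integral>k. \<mu> k ^ Suc p * ?G k \<partial>lborel) = (\<integral>k. \<mu> k ^ Suc p * \<bar>g r k\<bar> \<partial>lborel)" using integral_cong_AE[OF _ _ ae] by simp
          qed
          have "(\<integral>\<^sup>+k. ennreal (\<eta> n k * \<bar>collision lam1 lam2 \<CC> ?G k\<bar>) \<partial>lborel) \<le> ennreal (9 * \<CC>\<^sup>2 * 2 ^ Suc p * (\<integral>k. \<mu> k ^ Suc p * ?G k \<partial>lborel))"
          proof (rule collision_le[OF Gi _ \<eta>m \<eta>0 \<mu>w _ _ VG(1)])
            show "norm k * \<eta> n k \<le> \<mu> k ^ Suc p" for k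
              by (auto simp: \<eta>_def indicator_def shell_def \<mu>_def min_def)
          qed auto
          also have "\<dots> \<le> ennreal \<bar>K\<bar>"
            unfolding VG(2) K_def by (rule ennreal_leI, rule order_trans[OF _ abs_ge_self]) (intro mult_left_mono B rT(3); simp)
          finally show "(\<integral>\<^sup>+k. ennreal (\<eta> n k * \<bar>collision lam1 lam2 \<CC> ?G k\<bar>) \<partial>lborel) \<le> ennreal \<bar>K\<bar>" .
        qed (use \<eta>0 in auto)
        finally show ?thesis .
      qed
      have sle: "D.y t \<le> D.y s + \<bar>K\<bar> * T1" if s: "0 < s" "s \<le> t" for s
      proof -
        have "D.y t \<le> D.y s + integral {s..t} (\<lambda>r. D.yz r - D.ya r)"
          using D.energy_inequality[OF s t0(2), of 0] by simp
        also have "integral {s..t} (\<lambda>r. D.yz r - D.ya r) \<le> integral {s..t} (\<lambda>r. \<bar>K\<bar>)"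
        proof (rule integral_le)
          have "continuous_on {s..t} (\<lambda>r. D.yz r - D.ya r)"
            using s t0 by (intro continuous_intros continuous_on_subset[OF D.yz_continuous] continuous_on_subset[OF D.ya_continuous]) auto
          then show "(\<lambda>r. D.yz r - D.ya r) integrable_on {s..t}" by (rule integrable_continuous_interval)
          fix r assume r: "r \<in> {s..t}"
          have "0 \<le> D.ya r" unfolding D.ya_def using \<eta>0 nu by simp
          then show "D.yz r - D.ya r \<le> \<bar>K\<bar>" using yz[of r] r s by simp
        qed (rule integrable_const_ivl)
        also have "integral {s..t} (\<lambda>r. \<bar>K\<bar>) \<le> \<bar>K\<bar> * T1"
        proof -
          have "\<bar>K\<bar> * (t - s) \<le> \<bar>K\<bar> * T1" using s t by (intro mult_left_mono) auto
          then show ?thesis using s by (simp add: mult.commute)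
        qed
        finally show ?thesis by simp
      qed
      have "(D.y \<longlongrightarrow> D.y 0) (at 0 within {0..<T})" using D.y_continuous t0 by (simp add: continuous_on_def)
      then have "(D.y \<longlongrightarrow> D.y 0) (at 0 within {0<..<T})" by (rule tendsto_within_subset) auto
      moreover have "at 0 within {0<..<T} = at_right 0" using t0 by (intro at_within_nhd[of 0 "{..<T}"]) auto
      ultimately have "((\<lambda>s. D.y s + \<bar>K\<bar> * T1) \<longlongrightarrow> D.y 0 + \<bar>K\<bar> * T1) (at_right 0)" by (intro tendsto_intros) auto
      moreover have "\<forall>\<^sub>F s in at_right 0. D.y t \<le> D.y s + \<bar>K\<bar> * T1"
        using eventually_at_right_real[OF t0(1)] by eventually_elim (use sle in auto)
      ultimately have "D.y t \<le> D.y 0 + \<bar>K\<bar> * T1" by (rule tendsto_lowerbound) simp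
      moreover have "D.y 0 \<le> m0" unfolding D.y_def m0_def
      proof (rule integral_mono_AE')
        show "integrable lborel (\<lambda>k. \<bar>g 0 k\<bar>)" using gi T1 by simp
        show "AE k in lborel. \<eta> n k * \<bar>g 0 k\<bar> \<le> \<bar>g 0 k\<bar>"
          using \<eta>1 \<eta>0 by (intro AE_I2 mult_left_le_one_le) auto
      qed (use \<eta>0 in auto)
      ultimately show ?thesis by (simp add: D.y_def)
    qed
    have outer: "(\<integral>k. \<mu> k ^ p * \<bar>g t k\<bar> \<partial>lborel) \<le> (m0 + \<bar>K\<bar> * T1) + (1 / (sqrt lam2 * 1) powr N) * Nb" if t: "t \<in> {0..T1}" for t
    proof -
      let ?in = "\<lambda>k. indicator {k. 0 < norm k \<and> norm k \<le> 1} k * norm k ^ p * \<bar>g t k\<bar>"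
      let ?out = "\<lambda>k. indicator {k. 1 < norm k} k * \<bar>g t k\<bar>"
      note tT = T1T[OF t]
      have gm [measurable]: "g t \<in> borel_measurable borel" using gi[OF tT] by auto
      have ag: "integrable lborel (\<lambda>k. \<bar>g t k\<bar>)" using gi[OF tT] by simp
      have lim: "(\<lambda>n. \<integral>k. \<eta> n k * \<bar>g t k\<bar> \<partial>lborel) \<longlonglongrightarrow> (\<integral>k. ?in k \<partial>lborel)" and iin: "integrable lborel ?in"
      proof -
        have conv: "(\<lambda>n. \<eta> n k * \<bar>g t k\<bar>) \<longlonglongrightarrow> ?in k" for k
        proof (rule tendsto_eventually)
          show "\<forall>\<^sub>F n in sequentially. \<eta> n k * \<bar>g t k\<bar> = ?in k"
          proof (cases "k = 0")
            case False
            then obtain n0 where n0: "1 / real (Suc n0) < norm k" using nat_approx_posE[of "norm k"] by auto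
            have "1 / real (Suc n) \<le> norm k" if "n0 \<le> n" for n
            proof -
              have "1 / real (Suc n) \<le> 1 / real (Suc n0)" using that by (intro divide_left_mono) auto
              then show ?thesis using n0 by simp
            qed
            then show ?thesis using False unfolding eventually_sequentially
              by (intro exI[of _ n0]) (auto simp: \<eta>_def indicator_def shell_def)
          qed (auto simp: \<eta>_def indicator_def shell_def)
        qed
        have bd: "norm (\<eta> n k * \<bar>g t k\<bar>) \<le> \<bar>g t k\<bar>" for n k
          using \<eta>1[of n k] \<eta>0[of n k] by (auto simp: abs_mult intro!: mult_left_le_one_le)
        show "(\<lambda>n. \<integral>k. \<eta> n k * \<bar>g t k\<bar> \<partial>lborel) \<longlonglongrightarrow> (\<integral>k. ?in k \<partial>lborel)"
          by (rule integral_dominated_convergence[where w = "\<lambda>k. \<bar>g t k\<bar>"]) (use ag conv bd in auto)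
        show "integrable lborel ?in"
          by (rule integrable_dominated_convergence[where w = "\<lambda>k. \<bar>g t k\<bar>" and s = "\<lambda>n k. \<eta> n k * \<bar>g t k\<bar>"]) (use ag conv bd in auto)
      qed
      have in_le: "(\<integral>k. ?in k \<partial>lborel) \<le> m0 + \<bar>K\<bar> * T1"
        by (rule LIMSEQ_le_const2[OF lim]) (use inner[OF t] in blast)
      have out: "integrable lborel ?out" "(\<integral>k. ?out k \<partial>lborel) \<le> (1 / (sqrt lam2 * 1) powr N) * L1w_norm lam1 lam2 N (g t)"
      proof -
        have "indicator {k. 1 < norm k} k \<le> (1 / (sqrt lam2 * 1) powr N) * omega lam1 lam2 k powr N" for k :: "real^'n"
          using omega_powr_ge[OF lam1 lam2, of 1 k N] N by (auto simp: indicator_def)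
        from dominated_weight[OF sp[OF tT] _ _ this] show "integrable lborel ?out" "(\<integral>k. ?out k \<partial>lborel) \<le> (1 / (sqrt lam2 * 1) powr N) * L1w_norm lam1 lam2 N (g t)"
          by auto
      qed
      have "(\<integral>k. \<mu> k ^ p * \<bar>g t k\<bar> \<partial>lborel) \<le> (\<integral>k. ?in k + ?out k \<partial>lborel)"
      proof (rule integral_mono_AE)
        show "AE k in lborel. \<mu> k ^ p * \<bar>g t k\<bar> \<le> ?in k + ?out k"
          using AE_lborel_singleton[of "0 :: real^'n"] by eventually_elim (auto simp: \<mu>_def indicator_def min_def)
      qed (use \<mu>i[OF tT] iin out(1) in auto)
      also have "\<dots> = (\<integral>k. ?in k \<partial>lborel) + (\<integral>k. ?out k \<partial>lborel)" using iin out(1) by simp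
      also have "\<dots> \<le> (m0 + \<bar>K\<bar> * T1) + (1 / (sqrt lam2 * 1) powr N) * Nb"
        using in_le out(2) mult_left_mono[OF Nb[OF t], of "1 / (sqrt lam2 * 1) powr N"] by simp
      finally show ?thesis .
    qed
    then show "P p" unfolding P_def by blast
  qed
  have "P n \<Longrightarrow> P 0" for n by (induction n) (auto intro: step)
  moreover have "P (nat \<lceil>N\<rceil>)" by (rule base) linarith
  ultimately have "P 0" by blast
  then show ?thesis by (simp add: P_def)
qed

text \<open>
  With \<open>\<eta> = 1 / (2 \<nu> |k|\<^sup>2 + \<kappa>)\<close> on a shell, the damping terms of the energy inequality add up to
  \<open>\<integral> |h|\<close> over the shell, whereas the collision term is at most \<open>1/2 \<integral> |h|\<close> over the whole space.
  The latter includes the part outside the shell; it is absorbed after the exhaustion because its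
  integral in time is finite.
\<close>

lemma solution_unique:
  fixes g1 g2 :: "real \<Rightarrow> real^'n \<Rightarrow> real"
  assumes N: "0 < N" and g1: "nonneg_strong_solution lam1 lam2 \<CC> \<nu> N {0..<T} u g1" and g2: "nonneg_strong_solution lam1 lam2 \<CC> \<nu> N {0..<T} u g2"
    and t: "t \<in> {0..<T}"
  shows "AE k in lborel. g1 t k = g2 t k"
proof -
  obtain g1' where gc1: "L1w_continuous_on lam1 lam2 N {0..<T} g1" and g'c1: "L1w_continuous_on lam1 lam2 N {0<..<T} g1'"
    and gd1: "\<And>t. t \<in> {0<..<T} \<Longrightarrow> L1w_has_derivative lam1 lam2 N g1 (g1' t) t"
    and eq1: "\<And>t. t \<in> {0<..<T} \<Longrightarrow> AE k in lborel. g1' t k + 2 * \<nu> * (norm k)\<^sup>2 * g1 t k = collision lam1 lam2 \<CC> (\<lambda>k. max 0 (g1 t k)) k"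
    and sp1: "\<And>t. t \<in> {0..<T} \<Longrightarrow> g1 t \<in> L1w_space lam1 lam2 N" and nn1: "\<And>t. t \<in> {0..<T} \<Longrightarrow> AE k in lborel. 0 \<le> g1 t k"
    and ini1: "AE k in lborel. g1 0 k = u k"
    by (rule solution_curve[OF g1]) blast
  obtain g2' where gc2: "L1w_continuous_on lam1 lam2 N {0..<T} g2" and g'c2: "L1w_continuous_on lam1 lam2 N {0<..<T} g2'"
    and gd2: "\<And>t. t \<in> {0<..<T} \<Longrightarrow> L1w_has_derivative lam1 lam2 N g2 (g2' t) t"
    and eq2: "\<And>t. t \<in> {0<..<T} \<Longrightarrow> AE k in lborel. g2' t k + 2 * \<nu> * (norm k)\<^sup>2 * g2 t k = collision lam1 lam2 \<CC> (\<lambda>k. max 0 (g2 t k)) k"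
    and sp2: "\<And>t. t \<in> {0..<T} \<Longrightarrow> g2 t \<in> L1w_space lam1 lam2 N" and nn2: "\<And>t. t \<in> {0..<T} \<Longrightarrow> AE k in lborel. 0 \<le> g2 t k"
    and ini2: "AE k in lborel. g2 0 k = u k"
    by (rule solution_curve[OF g2]) blast
  show ?thesis
  proof (cases "t = 0")
    case True
    show ?thesis unfolding True using ini1 ini2 by eventually_elim simp
  next
    case False
    then have t0: "0 < t" "t < T" using t by auto
    define h where "h s k = g1 s k - g2 s k" for s k
    define h' where "h' s k = g1' s k - g2' s k" for s k
    define H where "H s = (\<integral>k. \<bar>h s k\<bar> \<partial>lborel)" for s
    define \<kappa> where "\<kappa> = rate 1"
    define E where "E r = exp (- \<kappa> * r)" for r
    have \<kappa>: "0 < \<kappa>" unfolding \<kappa>_def by (rule rate_pos) simp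
    have E: "0 < E r" for r by (simp add: E_def)
    define \<eta> where "\<eta> n k = indicator (shell (1 / real (Suc n)) (real (Suc n))) k * (1 / (2 * \<nu> * (norm k)\<^sup>2 + \<kappa>))" for n and k :: "real^'n"
    have dpos: "0 < 2 * \<nu> * (norm k)\<^sup>2 + \<kappa>" for k :: "real^'n" using nu \<kappa> by (intro add_nonneg_pos) auto
    have \<eta>0: "0 \<le> \<eta> n k" for n k unfolding \<eta>_def using dpos[of k] by (intro mult_nonneg_nonneg) auto
    have \<eta>m [measurable]: "\<eta> n \<in> borel_measurable borel" for n unfolding \<eta>_def[abs_def] by measurable
    define cn where "cn n = 1 / \<kappa> * (1 / (sqrt lam2 * (1 / real (Suc n))) powr N)" for n
    have \<eta>le: "\<eta> n k \<le> cn n * omega lam1 lam2 k powr N" for n k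
    proof -
      have "1 / (2 * \<nu> * (norm k)\<^sup>2 + \<kappa>) \<le> 1 / \<kappa>" using \<kappa> nu by (intro divide_left_mono mult_pos_pos dpos) auto
      then have "\<eta> n k \<le> indicator (shell (1 / real (Suc n)) (real (Suc n))) k * (1 / \<kappa>)" unfolding \<eta>_def by (intro mult_left_mono) auto
      also have "\<dots> \<le> ((1 / (sqrt lam2 * (1 / real (Suc n))) powr N) * omega lam1 lam2 k powr N) * (1 / \<kappa>)"
        using \<kappa> by (intro mult_right_mono indicator_shell_le N) auto
      also have "\<dots> = cn n * omega lam1 lam2 k powr N" by (simp add: cn_def)
      finally show ?thesis .
    qed
    have hcont: "L1w_continuous_on lam1 lam2 N {0..<T} h" unfolding h_def[abs_def] by (rule L1w_continuous_diff[OF gc1 gc2])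
    have h'cont: "L1w_continuous_on lam1 lam2 N {0<..<T} h'" unfolding h'_def[abs_def] by (rule L1w_continuous_diff[OF g'c1 g'c2])
    have hder: "L1w_has_derivative lam1 lam2 N h (h' s) s" if "s \<in> {0<..<T}" for s
      unfolding h_def[abs_def] h'_def by (rule L1w_derivative_diff[OF gd1[OF that] gd2[OF that], of "{0<..<T}"]) (use sp1 sp2 that in auto)
    have damped: "damped_curve lam1 lam2 N T (\<lambda>k. 2 * \<nu> * (norm k)\<^sup>2) h h' (\<eta> n) (cn n) (2 * \<nu> * (real (Suc n))\<^sup>2)" for n
    proof
      show "2 * \<nu> * (norm k)\<^sup>2 \<le> 2 * \<nu> * (real (Suc n))\<^sup>2" if "\<eta> n k \<noteq> 0" for k
        using that nu by (intro mult_left_mono power_mono) (auto simp: \<eta>_def indicator_def shell_def split: if_splits)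
    qed (use hcont h'cont hder \<eta>0 \<eta>le nu in auto)
    define y where "y n = damped_curve.y h (\<eta> n)" for n
    define ya where "ya n = damped_curve.ya (\<lambda>k. 2 * \<nu> * (norm k)\<^sup>2) h (\<eta> n)" for n
    define yz where "yz n = damped_curve.yz (\<lambda>k. 2 * \<nu> * (norm k)\<^sup>2) h h' (\<eta> n)" for n
    have y_eq: "y n r = (\<integral>k. \<eta> n k * \<bar>h r k\<bar> \<partial>lborel)" for n r unfolding y_def damped_curve.y_def[OF damped] ..
    have ya_eq: "ya n r = (\<integral>k. \<eta> n k * (2 * \<nu> * (norm k)\<^sup>2) * \<bar>h r k\<bar> \<partial>lborel)" for n r unfolding ya_def damped_curve.ya_def[OF damped] ..
    have yz_eq: "yz n r = (\<integral>k. \<eta> n k * \<bar>h' r k + 2 * \<nu> * (norm k)\<^sup>2 * h r k\<bar> \<partial>lborel)" for n r unfolding yz_def damped_curve.yz_def[OF damped] ..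
    define Y where "Y n r = ya n r + \<kappa> * y n r" for n r
    have yc: "continuous_on {0..<T} (y n)" for n unfolding y_def by (rule damped_curve.y_continuous[OF damped])
    have yac: "continuous_on {0..<T} (ya n)" for n unfolding ya_def by (rule damped_curve.ya_continuous[OF damped])
    have yzc: "continuous_on {0<..<T} (yz n)" for n unfolding yz_def by (rule damped_curve.yz_continuous[OF damped])
    have Yc: "continuous_on {0..<T} (Y n)" for n unfolding Y_def[abs_def] by (intro continuous_intros yc yac)
    have hsp: "h r \<in> L1w_space lam1 lam2 N" if "r \<in> {0..<T}" for r using hcont that by (simp add: L1w_continuous_on_def)
    have hi: "integrable lborel (h r)" if "r \<in> {0..<T}" for r using hsp[OF that] by (simp add: L1w_space_def)
    have Y_eq: "Y n r = (\<integral>k. indicator (shell (1 / real (Suc n)) (real (Suc n))) k * \<bar>h r k\<bar> \<partial>lborel)" if r: "r \<in> {0..<T}" for n r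
    proof -
      have i1: "integrable lborel (\<lambda>k. \<eta> n k * \<bar>h r k\<bar>)" by (rule dominated_weight(1)[OF hsp[OF r] \<eta>m \<eta>0 \<eta>le])
      have i2: "integrable lborel (\<lambda>k. \<eta> n k * (2 * \<nu> * (norm k)\<^sup>2) * \<bar>h r k\<bar>)"
        by (rule dominated_weight(1)[OF hsp[OF r] damped_curve.\<eta>am[OF damped] damped_curve.\<eta>a0[OF damped] damped_curve.\<eta>ale[OF damped]])
      have "Y n r = (\<integral>k. \<eta> n k * (2 * \<nu> * (norm k)\<^sup>2) * \<bar>h r k\<bar> + \<kappa> * (\<eta> n k * \<bar>h r k\<bar>) \<partial>lborel)"
        unfolding Y_def y_eq ya_eq using i1 i2 by simp
      also have "\<dots> = (\<integral>k. indicator (shell (1 / real (Suc n)) (real (Suc n))) k * \<bar>h r k\<bar> \<partial>lborel)"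
      proof (rule Bochner_Integration.integral_cong[OF refl])
        fix k :: "real^'n"
        define d where "d = 2 * \<nu> * (norm k)\<^sup>2 + \<kappa>"
        have d: "d \<noteq> 0" using dpos[of k] by (simp add: d_def)
        have "\<eta> n k * (2 * \<nu> * (norm k)\<^sup>2) * \<bar>h r k\<bar> + \<kappa> * (\<eta> n k * \<bar>h r k\<bar>) = (\<eta> n k * d) * \<bar>h r k\<bar>"
          by (simp add: d_def algebra_simps)
        also have "\<eta> n k * d = indicator (shell (1 / real (Suc n)) (real (Suc n))) k" unfolding \<eta>_def d_def[symmetric] using d by simp
        finally show "\<eta> n k * (2 * \<nu> * (norm k)\<^sup>2) * \<bar>h r k\<bar> + \<kappa> * (\<eta> n k * \<bar>h r k\<bar>) = indicator (shell (1 / real (Suc n)) (real (Suc n))) k * \<bar>h r k\<bar>" .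
      qed
      finally show ?thesis .
    qed
    have Y0: "0 \<le> Y n r" for n r
      unfolding Y_def y_eq ya_eq using \<eta>0 nu \<kappa> by (intro add_nonneg_nonneg mult_nonneg_nonneg integral_nonneg_AE AE_I2) auto
    have yn0: "0 \<le> y n r" for n r unfolding y_eq using \<eta>0 by simp
    have yz0: "0 \<le> yz n r" for n r unfolding yz_eq using \<eta>0 by simp
    have H0: "0 \<le> H r" for r by (simp add: H_def)
    have YH: "(\<lambda>n. Y n r) \<longlonglongrightarrow> H r" if r: "r \<in> {0..<T}" for r
    proof -
      have hm [measurable]: "h r \<in> borel_measurable borel" using hi[OF r] by auto
      have "(\<lambda>n. \<integral>k. indicator (shell (1 / real (Suc n)) (real (Suc n))) k * \<bar>h r k\<bar> \<partial>lborel) \<longlonglongrightarrow> (\<integral>k. \<bar>h r k\<bar> \<partial>lborel)"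
      proof (rule integral_dominated_convergence[where w = "\<lambda>k. \<bar>h r k\<bar>"])
        show "integrable lborel (\<lambda>k. \<bar>h r k\<bar>)" using hi[OF r] by simp
        show "AE k in lborel. norm (indicator (shell (1 / real (Suc n)) (real (Suc n))) k * \<bar>h r k\<bar>) \<le> \<bar>h r k\<bar>" for n
          by (intro AE_I2) (auto simp: indicator_def)
        show "AE k in lborel. (\<lambda>n. indicator (shell (1 / real (Suc n)) (real (Suc n))) k * \<bar>h r k\<bar>) \<longlonglongrightarrow> \<bar>h r k\<bar>"
          using AE_lborel_singleton[of "0 :: real^'n"]
        proof eventually_elim
          case (elim k)
          then obtain n0 where n0: "1 / real (Suc n0) < norm k" using nat_approx_posE[of "norm k"] by auto
          obtain n1 where n1: "norm k \<le> real n1" using real_arch_simple by blast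
          have "indicator (shell (1 / real (Suc n)) (real (Suc n))) k = (1::real)" if "max n0 n1 \<le> n" for n
          proof -
            have "1 / real (Suc n) \<le> 1 / real (Suc n0)" using that by (intro divide_left_mono) auto
            then have "1 / real (Suc n) \<le> norm k" "norm k \<le> real (Suc n)" using n0 n1 that by auto
            then show ?thesis by (simp add: shell_def)
          qed
          then have "\<forall>\<^sub>F n in sequentially. indicator (shell (1 / real (Suc n)) (real (Suc n))) k * \<bar>h r k\<bar> = \<bar>h r k\<bar>"
            unfolding eventually_sequentially by (intro exI[of _ "max n0 n1"]) auto
          then show ?case by (rule tendsto_eventually)
        qed
      qed auto
      then show ?thesis using Y_eq[OF r] by (simp add: H_def)
    qed
    have yzH: "yz n r \<le> 1 / 2 * H r" if r: "r \<in> {0<..<T}" for n r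
    proof -
      have r': "r \<in> {0..<T}" using r by auto
      let ?G1 = "\<lambda>k. max 0 (g1 r k)" and ?G2 = "\<lambda>k. max 0 (g2 r k)" and ?Q = "collision lam1 lam2 \<CC>"
      have gi: "integrable lborel (g1 r)" "integrable lborel (g2 r)" using sp1[OF r'] sp2[OF r'] by (auto simp: L1w_space_def)
      then have Gi: "integrable lborel ?G1" "integrable lborel ?G2" by auto
      note [measurable] = borel_measurable_integrable[OF gi(1)] borel_measurable_integrable[OF gi(2)]
        collision_measurable[of ?G1 lam1 lam2 \<CC>] collision_measurable[of ?G2 lam1 lam2 \<CC>] damped_curve.h_measurable(1)[OF damped r'] damped_curve.h_measurable(2)[OF damped r]
      have GH: "(\<integral>k. \<bar>?G1 k - ?G2 k\<bar> \<partial>lborel) = H r"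
        unfolding H_def h_def using nn1[OF r'] nn2[OF r'] by (intro integral_cong_AE) (auto elim: eventually_elim2)
      have "yz n r = (\<integral>k. \<eta> n k * \<bar>?Q ?G1 k - ?Q ?G2 k\<bar> \<partial>lborel)"
        unfolding yz_eq
      proof (rule integral_cong_AE)
        show "AE k in lborel. \<eta> n k * \<bar>h' r k + 2 * \<nu> * (norm k)\<^sup>2 * h r k\<bar> = \<eta> n k * \<bar>?Q ?G1 k - ?Q ?G2 k\<bar>"
          using eq1[OF r] eq2[OF r]
        proof eventually_elim
          case (elim k)
          then have "h' r k + 2 * \<nu> * (norm k)\<^sup>2 * h r k = ?Q ?G1 k - ?Q ?G2 k" by (simp add: h_def h'_def algebra_simps)
          then show ?case by (simp only:)
        qed
      qed measurable
      also have "\<dots> \<le> 1 / 2 * H r"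
      proof (rule real_le_of_nn_integral)
        define e where "e = 1 / (2 * gain_const 1)"
        have gp: "0 < gain_const 1" "38 * \<CC>\<^sup>2 \<le> gain_const 1" using gain_const_pos[of 1] gain_const_ge[of 1] by auto
        have "(\<integral>\<^sup>+k. ennreal (\<eta> n k * \<bar>?Q ?G1 k - ?Q ?G2 k\<bar>) \<partial>lborel) \<le> ennreal (27 * \<CC>\<^sup>2 * e * (\<integral>k. \<bar>?G1 k - ?G2 k\<bar> \<partial>lborel))"
        proof (rule collision_Lipschitz[OF Gi(1) _ Gi(2) _ \<eta>m \<eta>0])
          show "norm k * \<eta> n k \<le> e" for k
          proof -
            have "norm k * \<eta> n k \<le> norm k * (1 / (2 * \<nu> * (norm k)\<^sup>2 + \<kappa>))"
              unfolding \<eta>_def using dpos[of k] by (intro mult_left_mono mult_left_le_one_le) (auto simp: indicator_def)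
            also have "\<dots> \<le> e" unfolding e_def using norm_le_damp[of 1 k] dpos[of k] gp by (simp add: \<kappa>_def field_simps)
            finally show ?thesis .
          qed
        qed (use gp in \<open>auto simp: e_def\<close>)
        also have "\<dots> \<le> ennreal (1 / 2 * H r)"
        proof (rule ennreal_leI)
          have "27 * \<CC>\<^sup>2 \<le> gain_const 1" using gp zero_le_power2[of \<CC>] by linarith
          then have "27 * \<CC>\<^sup>2 * e \<le> 1 / 2" unfolding e_def using gp by (simp add: field_simps)
          then show "27 * \<CC>\<^sup>2 * e * (\<integral>k. \<bar>?G1 k - ?G2 k\<bar> \<partial>lborel) \<le> 1 / 2 * H r" unfolding GH by (rule mult_right_mono[OF _ H0])
        qed
        finally show "(\<integral>\<^sup>+k. ennreal (\<eta> n k * \<bar>?Q ?G1 k - ?Q ?G2 k\<bar>) \<partial>lborel) \<le> ennreal (1 / 2 * H r)" .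
      qed (use \<eta>0 H0 in auto)
      finally show ?thesis .
    qed
    obtain B1 B2 where B: "\<forall>s\<in>{0..t}. (\<integral>k. \<bar>g1 s k\<bar> \<partial>lborel) \<le> B1" "\<forall>s\<in>{0..t}. (\<integral>k. \<bar>g2 s k\<bar> \<partial>lborel) \<le> B2"
      using mass_locally_bounded[OF N g1, of t] mass_locally_bounded[OF N g2, of t] t0 by auto
    have HB: "H s \<le> B1 + B2" if s: "s \<in> {0..t}" for s
    proof -
      have s': "s \<in> {0..<T}" using s t0 by auto
      have gi: "integrable lborel (g1 s)" "integrable lborel (g2 s)" using sp1[OF s'] sp2[OF s'] by (auto simp: L1w_space_def)
      have "H s \<le> (\<integral>k. \<bar>g1 s k\<bar> + \<bar>g2 s k\<bar> \<partial>lborel)"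
        unfolding H_def h_def using gi by (intro integral_mono) auto
      then show ?thesis using gi B s by fastforce
    qed
    \<comment> \<open>The quantity that is shown to be at most half of itself. It is finite by the local bound on the masses.\<close>
    define X where "X = (\<integral>\<^sup>+r. ennreal (indicator {0<..t} r * (E r * H r)) \<partial>lborel)"
    have XHm: "(\<lambda>r. indicator {0<..t} r * (E r * H r)) \<in> borel_measurable borel"
    proof (rule borel_measurable_LIMSEQ_real)
      show "(\<lambda>n. indicator {0<..t} r * (E r * Y n r)) \<longlonglongrightarrow> indicator {0<..t} r * (E r * H r)" for r
        using YH[of r] t0 by (cases "r \<in> {0<..t}") (auto intro!: tendsto_intros)
      have "continuous_on {0<..t} (\<lambda>r. E r * Y n r)" for n
        using t0 unfolding E_def by (intro continuous_intros continuous_on_subset[OF Yc]) auto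
      from borel_measurable_continuous_on_indicator[OF _ this]
      show "(\<lambda>r. indicator {0<..t} r * (E r * Y n r)) \<in> borel_measurable borel" for n by simp
    qed
    have Xfin: "X < \<infinity>"
    proof -
      have "X \<le> (\<integral>\<^sup>+r. ennreal (B1 + B2) * indicator {0..t} r \<partial>lborel)"
        unfolding X_def
      proof (rule nn_integral_mono)
        fix r :: real
        show "ennreal (indicator {0<..t} r * (E r * H r)) \<le> ennreal (B1 + B2) * indicator {0..t} r"
        proof (cases "r \<in> {0<..t}")
          case True
          have "E r \<le> 1" unfolding E_def using \<kappa> True by simp
          then have "E r * H r \<le> 1 * (B1 + B2)" using True H0 HB[of r] by (intro mult_mono) auto
          then show ?thesis using True by (auto intro: ennreal_leI)
        qed auto
      qed
      also have "\<dots> < \<infinity>" using t0 by (simp add: nn_integral_cmult_indicator ennreal_mult_less_top)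
      finally show ?thesis .
    qed
    have main: "ennreal (E t * y n t) + (\<integral>\<^sup>+r. ennreal (indicator {s..t} r * (E r * Y n r)) \<partial>lborel) \<le> ennreal (y n s) + ennreal (1 / 2) * X"
      if s: "0 < s" "s \<le> t" for n s
    proof -
      have sub: "{s..t} \<subseteq> {0..<T}" "{s..t} \<subseteq> {0<..<T}" using s t0 by auto
      have c: "continuous_on {s..t} (\<lambda>r. E r * Y n r)" "continuous_on {s..t} (\<lambda>r. E r * yz n r)"
        unfolding E_def by (intro continuous_intros continuous_on_subset[OF Yc sub(1)] continuous_on_subset[OF yzc sub(2)])+
      have "E t * y n t \<le> E s * y n s + integral {s..t} (\<lambda>r. E r * (yz n r - ya n r - \<kappa> * y n r))"
        unfolding E_def y_def ya_def yz_def by (rule damped_curve.energy_inequality[OF damped s t0(2)])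
      also have "(\<lambda>r. E r * (yz n r - ya n r - \<kappa> * y n r)) = (\<lambda>r. E r * yz n r - E r * Y n r)"
        by (simp add: Y_def fun_eq_iff algebra_simps)
      also have "integral {s..t} \<dots> = integral {s..t} (\<lambda>r. E r * yz n r) - integral {s..t} (\<lambda>r. E r * Y n r)"
        using c by (intro integral_diff integrable_continuous_interval)
      finally have le: "E t * y n t + integral {s..t} (\<lambda>r. E r * Y n r) \<le> E s * y n s + integral {s..t} (\<lambda>r. E r * yz n r)" by simp
      have EY0: "0 \<le> E r * Y n r" "0 \<le> E r * yz n r" for r using E[of r] Y0[of n r] yz0[of n r] by simp_all
      have pos: "0 \<le> integral {s..t} (\<lambda>r. E r * Y n r)" "0 \<le> integral {s..t} (\<lambda>r. E r * yz n r)"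
        using c EY0 by (intro integral_nonneg integrable_continuous_interval; blast)+
      have "ennreal (E t * y n t) + (\<integral>\<^sup>+r. ennreal (indicator {s..t} r * (E r * Y n r)) \<partial>lborel) = ennreal (E t * y n t + integral {s..t} (\<lambda>r. E r * Y n r))"
        using pos E[of t] yn0[of n t] by (subst nn_integral_continuous_Icc[OF c(1) EY0(1)]) simp
      also have "\<dots> \<le> ennreal (E s * y n s + integral {s..t} (\<lambda>r. E r * yz n r))" by (rule ennreal_leI[OF le])
      also have "\<dots> = ennreal (E s * y n s) + (\<integral>\<^sup>+r. ennreal (indicator {s..t} r * (E r * yz n r)) \<partial>lborel)"
        using pos E[of s] yn0[of n s] by (subst nn_integral_continuous_Icc[OF c(2) EY0(2)]) simp
      also have "\<dots> \<le> ennreal (y n s) + (\<integral>\<^sup>+r. ennreal (1 / 2) * ennreal (indicator {0<..t} r * (E r * H r)) \<partial>lborel)"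
      proof (intro add_mono nn_integral_mono)
        have "E s \<le> 1" unfolding E_def using \<kappa> s by simp
        then show "ennreal (E s * y n s) \<le> ennreal (y n s)" using E[of s] yn0[of n s] by (intro ennreal_leI mult_left_le_one_le) auto
        fix r :: real
        show "ennreal (indicator {s..t} r * (E r * yz n r)) \<le> ennreal (1 / 2) * ennreal (indicator {0<..t} r * (E r * H r))"
        proof (cases "r \<in> {s..t}")
          case True
          then have r: "r \<in> {0<..<T}" "r \<in> {0<..t}" using s t0 by auto
          have "E r * yz n r \<le> E r * (1 / 2 * H r)" using E[of r] yzH[OF r(1)] by (intro mult_left_mono) auto
          then have "E r * yz n r \<le> 1 / 2 * (E r * H r)" by simp
          then have "ennreal (E r * yz n r) \<le> ennreal (1 / 2) * ennreal (E r * H r)"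
            using E[of r] H0[of r] by (subst ennreal_mult[symmetric]) (auto intro: ennreal_leI)
          then show ?thesis using True r by simp
        qed simp
      qed
      also have "(\<integral>\<^sup>+r. ennreal (1 / 2) * ennreal (indicator {0<..t} r * (E r * H r)) \<partial>lborel) = ennreal (1 / 2) * X"
        unfolding X_def using XHm by (intro nn_integral_cmult) simp
      finally show ?thesis .
    qed
    have y00: "y n 0 = 0" for n
    proof -
      have "AE k in lborel. \<eta> n k * \<bar>h 0 k\<bar> = 0" using ini1 ini2 by eventually_elim (simp add: h_def)
      then show ?thesis unfolding y_eq by (rule integral_eq_zero_AE)
    qed
    have lim0: "((\<lambda>s. ennreal (y n s) + ennreal (1 / 2) * X) \<longlongrightarrow> 0 + ennreal (1 / 2) * X) (at_right 0)" for n
    proof -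
      have "(y n \<longlongrightarrow> y n 0) (at 0 within {0..<T})" using yc t0 by (simp add: continuous_on_def)
      then have "(y n \<longlongrightarrow> y n 0) (at 0 within {0<..<T})" by (rule tendsto_within_subset) auto
      moreover have "at 0 within {0<..<T} = at_right 0" using t0 by (intro at_within_nhd[of 0 "{..<T}"]) auto
      ultimately have "(y n \<longlongrightarrow> 0) (at_right 0)" using y00 by simp
      then have "((\<lambda>s. ennreal (y n s)) \<longlongrightarrow> ennreal 0) (at_right 0)" by (rule tendsto_ennrealI)
      then show ?thesis by (intro tendsto_add tendsto_const) simp
    qed
    \<comment> \<open>The weighted norm tends to \<open>0\<close> at the initial time, which removes the term at \<open>s\<close>.\<close>
    have limit: "ennreal (E t * y n t) + (\<integral>\<^sup>+r. ennreal (indicator {s0..t} r * (E r * Y n r)) \<partial>lborel) \<le> ennreal (1 / 2) * X"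
      if s0: "0 < s0" "s0 \<le> t" for n s0
    proof -
      have "\<forall>\<^sub>F s in at_right 0. ennreal (E t * y n t) + (\<integral>\<^sup>+r. ennreal (indicator {s0..t} r * (E r * Y n r)) \<partial>lborel) \<le> ennreal (y n s) + ennreal (1 / 2) * X"
        using eventually_at_right_real[OF s0(1)]
      proof eventually_elim
        case (elim s)
        have "(\<integral>\<^sup>+r. ennreal (indicator {s0..t} r * (E r * Y n r)) \<partial>lborel) \<le> (\<integral>\<^sup>+r. ennreal (indicator {s..t} r * (E r * Y n r)) \<partial>lborel)"
          using elim E Y0 by (intro nn_integral_mono ennreal_leI) (auto simp: indicator_def less_imp_le)
        then show ?case using main[of s n] elim s0 by (auto intro: order_trans add_left_mono)
      qed
      from tendsto_lowerbound[OF lim0 this] show ?thesis by simp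
    qed
    have "X = 0"
    proof -
      let ?Fn = "\<lambda>n r. ennreal (indicator {t / real (Suc n)..t} r * (E r * Y n r))"
      have tn: "0 < t / real (Suc n)" "t / real (Suc n) \<le> t" for n
      proof -
        show "0 < t / real (Suc n)" using t0 by simp
        show "t / real (Suc n) \<le> t" using divide_left_mono[of 1 "real (Suc n)" t] t0 by simp
      qed
      have "X \<le> (\<integral>\<^sup>+r. liminf (\<lambda>n. ?Fn n r) \<partial>lborel)"
        unfolding X_def
      proof (rule nn_integral_mono)
        fix r :: real
        show "ennreal (indicator {0<..t} r * (E r * H r)) \<le> liminf (\<lambda>n. ?Fn n r)"
        proof (cases "r \<in> {0<..t}")
          case True
          then have r: "r \<in> {0..<T}" using t0 by auto
          obtain n0 where n0: "1 / real (Suc n0) < r / t" using nat_approx_posE[of "r / t"] True t0 by auto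
          have ev: "\<forall>\<^sub>F n in sequentially. ?Fn n r = ennreal (E r * Y n r)"
            unfolding eventually_sequentially
          proof (intro exI[of _ n0] allI impI)
            fix n assume n: "n0 \<le> n"
            have "1 / real (Suc n) \<le> 1 / real (Suc n0)" using n by (intro divide_left_mono) auto
            then have "1 / real (Suc n) < r / t" using n0 by simp
            then have "t / real (Suc n) \<le> r" using t0 by (simp add: field_simps)
            then show "?Fn n r = ennreal (E r * Y n r)" using True by simp
          qed
          have "(\<lambda>n. ennreal (E r * Y n r)) \<longlonglongrightarrow> ennreal (E r * H r)"
            using YH[OF r] by (intro tendsto_ennrealI tendsto_intros)
          then have "(\<lambda>n. ?Fn n r) \<longlonglongrightarrow> ennreal (E r * H r)"
            by (rule Lim_transform_eventually) (rule eventually_mono[OF ev sym])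
          then have "liminf (\<lambda>n. ?Fn n r) = ennreal (E r * H r)" by (intro lim_imp_Liminf) auto
          then show ?thesis using True by simp
        qed simp
      qed
      also have "\<dots> \<le> liminf (\<lambda>n. \<integral>\<^sup>+r. ?Fn n r \<partial>lborel)"
      proof (rule nn_integral_liminf)
        fix n
        have sub: "{t / real (Suc n)..t} \<subseteq> {0..<T}"
        proof
          fix r assume r: "r \<in> {t / real (Suc n)..t}"
          then have "t / real (Suc n) \<le> r" by simp
          from less_le_trans[OF tn(1) this] show "r \<in> {0..<T}" using r t0 by simp
        qed
        have "continuous_on {t / real (Suc n)..t} (\<lambda>r. E r * Y n r)"
          unfolding E_def by (intro continuous_intros continuous_on_subset[OF Yc sub])
        from borel_measurable_continuous_on_indicator[OF _ this]
        have "(\<lambda>r. indicator {t / real (Suc n)..t} r * (E r * Y n r)) \<in> borel_measurable borel" by simp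
        then show "?Fn n \<in> borel_measurable lborel" by simp
      qed
      also have "\<dots> \<le> liminf (\<lambda>n::nat. ennreal (1 / 2) * X)"
      proof (intro Liminf_mono always_eventually allI)
        fix n
        show "(\<integral>\<^sup>+r. ?Fn n r \<partial>lborel) \<le> ennreal (1 / 2) * X"
          by (rule order_trans[OF _ limit[OF tn, of n n]]) (rule add_increasing, simp_all)
      qed
      also have "\<dots> = ennreal (1 / 2) * X" by (simp add: Liminf_const)
      finally have le: "X \<le> ennreal (1 / 2) * X" .
      obtain x where x: "X = ennreal x" "0 \<le> x" using Xfin by (cases X) auto
      have "ennreal (1 / 2 * x) = ennreal (1 / 2) * ennreal x" using x by (intro ennreal_mult) auto
      with le have "ennreal x \<le> ennreal (1 / 2 * x)" unfolding x(1) by (simp only:)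
      then have "x \<le> 1 / 2 * x" using x by (subst (asm) ennreal_le_iff) auto
      then show ?thesis using x by simp
    qed
    have "AE k in lborel. \<eta> n k * \<bar>h t k\<bar> = 0" for n
    proof -
      have "ennreal (E t * y n t) \<le> ennreal (1 / 2) * X"
        by (rule order_trans[OF _ limit[OF t0(1) order_refl, of n]]) (rule add_increasing2, simp_all)
      then have "E t * y n t \<le> 0" using \<open>X = 0\<close> by (simp add: ennreal_eq_0_iff)
      then have "y n t = 0" using E[of t] yn0[of n t] by (simp add: mult_le_0_iff)
      moreover have "integrable lborel (\<lambda>k. \<eta> n k * \<bar>h t k\<bar>)" by (rule dominated_weight(1)[OF hsp[OF t] \<eta>m \<eta>0 \<eta>le])
      ultimately show ?thesis unfolding y_eq using \<eta>0 by (subst (asm) integral_nonneg_eq_0_iff_AE) auto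
    qed
    then have "AE k in lborel. \<forall>n. \<eta> n k * \<bar>h t k\<bar> = 0" by (subst AE_all_countable) blast
    then show ?thesis
      using AE_lborel_singleton[of "0 :: real^'n"]
    proof eventually_elim
      case (elim k)
      then obtain n0 where n0: "1 / real (Suc n0) < norm k" using nat_approx_posE[of "norm k"] by auto
      obtain n1 where n1: "norm k \<le> real n1" using real_arch_simple by blast
      define n where "n = max n0 n1"
      have "1 / real (Suc n) \<le> 1 / real (Suc n0)" by (intro divide_left_mono) (auto simp: n_def)
      then have "1 / real (Suc n) \<le> norm k" "norm k \<le> real (Suc n)" using n0 n1 by (auto simp: n_def)
      then have "\<eta> n k \<noteq> 0" unfolding \<eta>_def using dpos[of k] by (simp add: shell_def)
      then show ?case using elim(1) by (auto simp: h_def)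
    qed
  qed
qed

end

lemma nonneg_strong_solution_restrict:
  assumes "nonneg_strong_solution lam1 lam2 \<CC> \<nu> N {0..} u f"
  shows "nonneg_strong_solution lam1 lam2 \<CC> \<nu> N {0..<T} u f"
proof -
  have int: "interior {0..} = ({0<..} :: real set)" "interior {0..<T} = {0<..<T}" by simp_all
  have sub: "L1w_continuous_on lam1 lam2 N J h" if "L1w_continuous_on lam1 lam2 N I h" "J \<subseteq> I" for I J :: "real set" and h
    using that unfolding L1w_continuous_on_def by (meson subsetD tendsto_within_subset)
  obtain f' where f': "L1w_continuous_on lam1 lam2 N {0<..} f'"
    "\<forall>t\<in>{0<..}. L1w_has_derivative lam1 lam2 N f (f' t) t \<and> (AE k in lborel. f' t k + 2 * \<nu> * (norm k)\<^sup>2 * f t k = collision lam1 lam2 \<CC> (f t) k)"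
    using assms unfolding nonneg_strong_solution_def strong_solution_def int by blast
  have "L1w_continuous_on lam1 lam2 N {0<..<T} f'" by (rule sub[OF f'(1)]) auto
  moreover have fc: "L1w_continuous_on lam1 lam2 N {0..} f" and ini: "AE k in lborel. f 0 k = u k"
    and nn: "\<forall>t\<in>{0..}. AE k in lborel. 0 \<le> f t k"
    using assms unfolding nonneg_strong_solution_def strong_solution_def by blast+
  moreover have "L1w_continuous_on lam1 lam2 N {0..<T} f" by (rule sub[OF fc]) auto
  moreover have "\<forall>t\<in>{0..<T}. AE k in lborel. 0 \<le> f t k" using nn by simp
  moreover have "\<forall>t\<in>{0<..<T}. L1w_has_derivative lam1 lam2 N f (f' t) t \<and> (AE k in lborel. f' t k + 2 * \<nu> * (norm k)\<^sup>2 * f t k = collision lam1 lam2 \<CC> (f t) k)"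
    using f'(2) by simp
  ultimately show ?thesis unfolding nonneg_strong_solution_def strong_solution_def int by blast
qed

lemma nonneg_strong_solution_initial_cong:
  assumes "nonneg_strong_solution lam1 lam2 \<CC> \<nu> N J u f" "AE k in lborel. u k = v k"
  shows "nonneg_strong_solution lam1 lam2 \<CC> \<nu> N J v f"
proof -
  have "AE k in lborel. f 0 k = v k"
    using assms unfolding nonneg_strong_solution_def strong_solution_def by (auto elim: eventually_elim2)
  then show ?thesis using assms unfolding nonneg_strong_solution_def strong_solution_def by blast
qed

text \<open>
  Ensures that a large ball carries mass, so that \<open>R\<^sub>0\<close> may be taken as large as needed.
\<close>

lemma truncated_mass_tendsto:
  fixes f :: "real^'n \<Rightarrow> real"
  assumes "integrable lborel f"
  shows "(\<lambda>n. L1_norm (\<lambda>k. f k * indicator (ball 0 (real n)) k)) \<longlonglongrightarrow> L1_norm f"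
  unfolding L1_norm_def
proof (rule integral_dominated_convergence[where w = "\<lambda>k. \<bar>f k\<bar>"])
  note [measurable] = borel_measurable_integrable[OF assms]
  show "(\<lambda>k. \<bar>f k\<bar>) \<in> borel_measurable lborel" by measurable
  show "(\<lambda>k. \<bar>f k * indicator (ball 0 (real n)) k\<bar>) \<in> borel_measurable lborel" for n
    by (intro borel_measurable_abs borel_measurable_times borel_measurable_indicator) auto
  show "integrable lborel (\<lambda>k. \<bar>f k\<bar>)" using assms by simp
  show "AE k in lborel. norm \<bar>f k * indicator (ball 0 (real n)) k\<bar> \<le> \<bar>f k\<bar>" for n
    by (intro AE_I2) (auto simp: indicator_def)
  show "AE k in lborel. (\<lambda>n. \<bar>f k * indicator (ball 0 (real n)) k\<bar>) \<longlonglongrightarrow> \<bar>f k\<bar>"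
  proof (intro AE_I2 tendsto_eventually)
    fix k :: "real^'n"
    obtain n0 where "norm k < real n0" using reals_Archimedean2 by blast
    then show "\<forall>\<^sub>F n in sequentially. \<bar>f k * indicator (ball 0 (real n)) k\<bar> = \<bar>f k\<bar>"
      unfolding eventually_sequentially by (intro exI[of _ n0]) (auto simp: indicator_def)
  qed
qed

lemma truncated_mass_le:
  fixes f :: "real^'n \<Rightarrow> real"
  assumes "integrable lborel f"
  shows "L1_norm (\<lambda>k. f k * indicator (ball 0 R) k) \<le> L1_norm f"
  unfolding L1_norm_def
proof (rule integral_mono_AE')
  show "integrable lborel (\<lambda>k. \<bar>f k\<bar>)" using assms by simp
qed (auto simp: indicator_def)

theorem theorem1p1:
  fixes lam1 lam2 :: real
  assumes "CARD('n::finite) \<ge> 2" and "lam1 \<ge> 0" and "lam2 > 0"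
  shows "\<exists>C0>0. \<forall>\<nu>>0. \<forall>\<CC>>0. \<forall>N>0. \<forall>R_upper>0. \<forall>R_lower>1. \<forall>f0 :: real^'n \<Rightarrow> real.
    R_upper < R_lower \<and>
    f0 \<in> L1w_space lam1 lam2 (N + 3) \<and>
    (AE k in lborel. 0 \<le> f0 k) \<and>
    R_upper < L1w_norm lam1 lam2 (N + 3) f0 \<and>
    L1w_norm lam1 lam2 (N + 3) f0 < R_lower \<and>
    L1_norm f0 \<ge> R_upper / 2
    \<longrightarrow>
    (\<exists>R0>0. L1_norm (\<lambda>k. f0 k * indicator (ball 0 R0) k) > 0 \<and>
       (\<forall>T>0. \<exists>f.
          nonneg_strong_solution lam1 lam2 \<CC> \<nu> N {0..<T} f0 f \<and>
          (\<forall>t\<in>{0..<T}. f t \<in> S_set lam1 lam2 \<nu> N R_upper R_lower C0 R0 f0 T T) \<and>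
          (\<forall>g. nonneg_strong_solution lam1 lam2 \<CC> \<nu> N {0..<T} f0 g \<longrightarrow>
             (\<forall>t\<in>{0..<T}. AE k in lborel. g t k = f t k)))) \<and>
    (\<exists>f. nonneg_strong_solution lam1 lam2 \<CC> \<nu> N {0..} f0 f \<and>
       (\<forall>g. nonneg_strong_solution lam1 lam2 \<CC> \<nu> N {0..} f0 g \<longrightarrow>
          (\<forall>t\<in>{0..}. AE k in lborel. g t k = f t k)))"
proof (rule exI[of _ 1], intro conjI allI impI)
  show "(0::real) < 1" by simp
next
  fix \<nu> \<CC> N R_upper R_lower :: real and f0 :: "real^'n \<Rightarrow> real"
  assume nu: "0 < \<nu>" and CC: "0 < \<CC>" and N: "0 < N" and Ru: "0 < R_upper" and Rl: "1 < R_lower"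
    and data: "R_upper < R_lower \<and> f0 \<in> L1w_space lam1 lam2 (N + 3) \<and> (AE k in lborel. 0 \<le> f0 k) \<and>
      R_upper < L1w_norm lam1 lam2 (N + 3) f0 \<and> L1w_norm lam1 lam2 (N + 3) f0 < R_lower \<and> L1_norm f0 \<ge> R_upper / 2"
  interpret K: kinetic lam1 lam2 \<CC> \<nu> by standard (use assms nu CC in auto)
  define u where "u k = max 0 (f0 k)" for k
  define C where "C = 2 powr (N + 3)"
  define m0 where "m0 = L1_norm f0"
  have f0i: "integrable lborel f0" and f0w: "integrable lborel (\<lambda>k. omega lam1 lam2 k powr (N + 3) * \<bar>f0 k\<bar>)"
    using data by (auto simp: L1w_space_def)
  note [measurable] = borel_measurable_integrable[OF f0i]
  have uf0: "AE k in lborel. u k = f0 k" using data unfolding u_def by (auto elim: eventually_mono)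
  have uabs: "AE k in lborel. u k = \<bar>f0 k\<bar>" using data unfolding u_def by (auto elim: eventually_mono)
  have ui: "integrable lborel u" unfolding u_def[abs_def] using f0i by simp
  have u0: "0 \<le> u k" for k by (simp add: u_def)
  note [measurable] = borel_measurable_integrable[OF ui]
  have uwae: "AE k in lborel. omega lam1 lam2 k powr (N + 3) * \<bar>f0 k\<bar> = omega lam1 lam2 k powr (N + 3) * u k"
    using uabs by eventually_elim simp
  have uw: "integrable lborel (\<lambda>k. omega lam1 lam2 k powr (N + 3) * u k)"
    using f0w integrable_cong_AE[OF _ _ uwae] by simp
  have unorm: "L1w_norm lam1 lam2 (N + 3) u = L1w_norm lam1 lam2 (N + 3) f0"
    unfolding L1w_norm_def using u0 integral_cong_AE[OF _ _ uwae] by simp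
  have um0: "(\<integral>k. u k \<partial>lborel) = m0" unfolding m0_def L1_norm_def using uabs by (intro integral_cong_AE) auto
  have m0: "0 < m0" "R_upper / 2 \<le> m0" using data Ru by (auto simp: m0_def)
  have C1: "1 \<le> C" unfolding C_def using N by (intro ge_one_powr_ge_zero) auto
  obtain f where f: "case_prod f \<in> borel_measurable (lborel \<Otimes>\<^sub>M lborel)" "\<And>t k. 0 \<le> f t k"
    "AE k in lborel. (\<integral>\<^sup>+t. ennreal (K.source (f t) k) \<partial>laplace (K.rate C)) < \<infinity> \<and> (\<forall>t. f t k = duhamel (K.damp k) (u k) (\<lambda>s. K.source (f s) k) t)"
    "\<And>W t. doubling C W \<Longrightarrow> 0 \<le> t \<Longrightarrow>
        (\<integral>\<^sup>+k. ennreal (W k * f t k) \<partial>lborel) \<le> ennreal (2 * exp (K.rate C * t)) * (\<integral>\<^sup>+k. ennreal (W k * u k) \<partial>lborel)"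
    using K.mild_solution_exists[OF C1 ui u0] by blast
  interpret F: mild_flow lam1 lam2 \<CC> \<nu> N u f
    by standard (use N ui u0 uw um0 m0 f in \<open>auto simp: C_def\<close>)
  define \<kappa> where "\<kappa> = K.rate C"
  have \<kappa>: "0 < \<kappa>" unfolding \<kappa>_def by (rule K.rate_pos[OF C1])
  have global: "nonneg_strong_solution lam1 lam2 \<CC> \<nu> N {0..} f0 f"
    by (rule nonneg_strong_solution_initial_cong[OF F.flow_strong_solution uf0])
  have loc: "nonneg_strong_solution lam1 lam2 \<CC> \<nu> N {0..<T} f0 f" for T
    by (rule nonneg_strong_solution_restrict[OF global])
  have unique: "AE k in lborel. g t k = f t k"
    if "nonneg_strong_solution lam1 lam2 \<CC> \<nu> N {0..<T} f0 g" "t \<in> {0..<T}" for g T t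
    by (rule K.solution_unique[OF N that(1) loc that(2)])
  have unique_global: "AE k in lborel. g t k = f t k"
    if "nonneg_strong_solution lam1 lam2 \<CC> \<nu> N {0..} f0 g" "0 \<le> t" for g t
    by (rule unique[OF nonneg_strong_solution_restrict[OF that(1), of "t + 1"]]) (use that in auto)
  have norm_le: "L1w_norm lam1 lam2 (N + 3) (f t) \<le> 2 * R_lower * exp (\<kappa> * t)" if "0 \<le> t" for t
  proof -
    have "L1w_norm lam1 lam2 (N + 3) (f t) \<le> 2 * exp (\<kappa> * t) * L1w_norm lam1 lam2 (N + 3) u"
      using F.flow_norm_le[OF that] by (simp add: \<kappa>_def C_def)
    also have "\<dots> \<le> 2 * exp (\<kappa> * t) * R_lower" using data unfolding unorm by (intro mult_left_mono) auto
    finally show ?thesis by (simp add: mult.commute mult.left_commute)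
  qed
  have mass_ge: "m0 * exp (- F.decay * t) \<le> L1_norm (f t)" if "0 \<le> t" for t
    using F.mass_ge[OF that] f(2) unfolding um0 L1_norm_def by simp
  \<comment> \<open>Up to time \<open>T0\<close> the factor \<open>2 R_lower\<close> grows by at most \<open>1\<close>, so the additive constant in \<open>S\<^sub>T\<close> suffices. After \<open>T0\<close> the exponent is large.\<close>
  define T0 where "T0 = ln ((2 * R_lower + 1) / (2 * R_lower)) / \<kappa>"
  have T0: "0 < T0" unfolding T0_def using \<kappa> Rl by (intro divide_pos_pos ln_gt_zero) auto
  have "\<forall>\<^sub>F n in sequentially. 0 < L1_norm (\<lambda>k. f0 k * indicator (ball 0 (real n)) k)"
    using truncated_mass_tendsto[OF f0i] m0(1) unfolding m0_def by (rule order_tendstoD)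
  moreover have "\<forall>\<^sub>F n in sequentially. max 1 (max \<bar>F.decay\<bar> (\<kappa> * m0 / (8 * T0))) \<le> real n"
    by (rule filterlim_real_sequentially[unfolded filterlim_at_top, rule_format])
  ultimately have "\<forall>\<^sub>F n in sequentially. 0 < L1_norm (\<lambda>k. f0 k * indicator (ball 0 (real n)) k) \<and> max 1 (max \<bar>F.decay\<bar> (\<kappa> * m0 / (8 * T0))) \<le> real n"
    by eventually_elim simp
  then obtain n where n: "0 < L1_norm (\<lambda>k. f0 k * indicator (ball 0 (real n)) k)" "max 1 (max \<bar>F.decay\<bar> (\<kappa> * m0 / (8 * T0))) \<le> real n"
    using eventually_happens' sequentially_bot by blast
  define R0 where "R0 = real n"
  have R0: "1 \<le> R0" "\<bar>F.decay\<bar> \<le> R0" "\<kappa> * m0 / (8 * T0) \<le> R0" using n(2) by (auto simp: R0_def)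
  define mR where "mR = L1_norm (\<lambda>k. f0 k * indicator (ball 0 R0) k)"
  have mR: "0 < mR" "mR \<le> m0" using n(1) truncated_mass_le[OF f0i] by (auto simp: mR_def R0_def m0_def)
  have S: "f t \<in> S_set lam1 lam2 \<nu> N R_upper R_lower 1 R0 f0 T T" if T: "0 < T" and t: "t \<in> {0..<T}" for t T
  proof -
    have t': "0 \<le> t" "t \<le> T" using t by auto
    define Cl where "Cl = C_lower 1 \<nu> R0 T f0"
    have Cl: "Cl = (1 + exp ((4 * \<nu> * R0\<^sup>2 + 8 * R0) * T)) / mR" by (simp add: Cl_def C_lower_def mR_def)
    have Cl0: "0 \<le> Cl" unfolding Cl using mR by (intro divide_nonneg_pos add_nonneg_nonneg) auto
    have exp_t: "2 * R_lower * exp (\<kappa> * t) \<le> 2 * R_lower * exp (\<kappa> * T)" using \<kappa> t' Rl by (intro mult_left_mono) auto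
    have upper: "2 * R_lower * exp (\<kappa> * T) \<le> (2 * R_lower + 1) * exp (Cl * T)"
    proof (cases "T \<le> T0")
      case True
      then have "\<kappa> * T \<le> \<kappa> * T0" using \<kappa> by (intro mult_left_mono) auto
      also have "\<kappa> * T0 = ln ((2 * R_lower + 1) / (2 * R_lower))" using \<kappa> by (simp add: T0_def)
      finally have "exp (\<kappa> * T) \<le> exp (ln ((2 * R_lower + 1) / (2 * R_lower)))" by simp
      also have "\<dots> = (2 * R_lower + 1) / (2 * R_lower)" using Rl by (intro exp_ln divide_pos_pos) auto
      finally have "2 * R_lower * exp (\<kappa> * T) \<le> (2 * R_lower + 1) * 1" using Rl by (simp add: field_simps)
      also have "\<dots> \<le> (2 * R_lower + 1) * exp (Cl * T)" using Cl0 T Rl by (intro mult_left_mono) auto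
      finally show ?thesis .
    next
      case False
      have "\<kappa> * m0 \<le> 8 * R0 * T0" using R0(3) T0 by (simp add: field_simps)
      also have "\<dots> \<le> 8 * R0 * T" using False R0 by (intro mult_left_mono) auto
      also have "\<dots> \<le> (4 * \<nu> * R0\<^sup>2 + 8 * R0) * T" using nu T by (intro mult_right_mono) auto
      also have "\<dots> \<le> 1 + exp ((4 * \<nu> * R0\<^sup>2 + 8 * R0) * T)"
        using exp_ge_add_one_self[of "(4 * \<nu> * R0\<^sup>2 + 8 * R0) * T"] by linarith
      finally have "\<kappa> * m0 \<le> 1 + exp ((4 * \<nu> * R0\<^sup>2 + 8 * R0) * T)" .
      moreover have "\<kappa> * mR \<le> \<kappa> * m0" using \<kappa> mR by (intro mult_left_mono) auto
      ultimately have "\<kappa> * mR \<le> 1 + exp ((4 * \<nu> * R0\<^sup>2 + 8 * R0) * T)" by linarith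
      then have "\<kappa> \<le> Cl" unfolding Cl by (subst pos_le_divide_eq[OF mR(1)])
      then have "exp (\<kappa> * T) \<le> exp (Cl * T)" using T by (simp add: mult_right_mono)
      then show ?thesis using Rl by (intro mult_mono) auto
    qed
    have lower: "1 / 2 * R_upper * exp (- C_upper \<nu> R0 * T) \<le> m0 * exp (- F.decay * t)"
    proof (rule mult_mono)
      have "F.decay * t \<le> R0 * T" using R0 t' by (intro mult_mono) auto
      also have "\<dots> \<le> C_upper \<nu> R0 * T" unfolding C_upper_def using R0 nu T by (intro mult_right_mono) (auto intro: add_increasing)
      finally show "exp (- C_upper \<nu> R0 * T) \<le> exp (- F.decay * t)" by simp
    qed (use m0 in auto)
    show ?thesis
      unfolding S_set_def Cl_def[symmetric]
      using F.f_space(2)[OF t'(1)] f(2) norm_le[OF t'(1)] mass_ge[OF t'(1)] exp_t upper lower by auto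
  qed
  show "\<exists>R0>0. L1_norm (\<lambda>k. f0 k * indicator (ball 0 R0) k) > 0 \<and>
       (\<forall>T>0. \<exists>f.
          nonneg_strong_solution lam1 lam2 \<CC> \<nu> N {0..<T} f0 f \<and>
          (\<forall>t\<in>{0..<T}. f t \<in> S_set lam1 lam2 \<nu> N R_upper R_lower 1 R0 f0 T T) \<and>
          (\<forall>g. nonneg_strong_solution lam1 lam2 \<CC> \<nu> N {0..<T} f0 g \<longrightarrow>
             (\<forall>t\<in>{0..<T}. AE k in lborel. g t k = f t k)))"
  proof (intro exI[of _ R0] conjI allI impI)
    show "0 < R0" using R0 by simp
    show "L1_norm (\<lambda>k. f0 k * indicator (ball 0 R0) k) > 0" using mR by (simp add: mR_def)
    fix T :: real assume T: "0 < T"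
    show "\<exists>f. nonneg_strong_solution lam1 lam2 \<CC> \<nu> N {0..<T} f0 f \<and>
          (\<forall>t\<in>{0..<T}. f t \<in> S_set lam1 lam2 \<nu> N R_upper R_lower 1 R0 f0 T T) \<and>
          (\<forall>g. nonneg_strong_solution lam1 lam2 \<CC> \<nu> N {0..<T} f0 g \<longrightarrow>
             (\<forall>t\<in>{0..<T}. AE k in lborel. g t k = f t k))"
      using loc S[OF T] unique by blast
  qed
  show "\<exists>f. nonneg_strong_solution lam1 lam2 \<CC> \<nu> N {0..} f0 f \<and>
       (\<forall>g. nonneg_strong_solution lam1 lam2 \<CC> \<nu> N {0..} f0 g \<longrightarrow>
          (\<forall>t\<in>{0..}. AE k in lborel. g t k = f t k))"
    using global unique_global by (intro exI[of _ f]) auto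
qed

end
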